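(* Let $\alpha\in\mathbb{R}$ and let $L_\alpha^{\min}$ be the Hermitian minimal operator on $L^2[0,\infty[$ given by $-\partial_x^2+\left(-\frac14+\alpha\right)\frac{1}{x^2}$. The set of self-adjoint extensions of $L_\alpha^{\min}$ is isomorphic either to a point or to a circle. The group of dilations $U_\tau$ (the "renormalization group"), acting by $H\mapsto \mathrm{e}^{2\tau}U_\tau HU_\tau^{-1}$, acts on this set by a continuous flow, which may have fixed points. Depending on $\alpha$ there are the following four "phases". (1) $1\le\alpha$ ("gas"): the set of self-adjoint extensions is a point. There is a unique fixed point: Friedrichs extension = Krein extension. (2) $0<\alpha<1$ ("liquid"): the set of self-adjoint extensions is a circle. There are two fixed points: the Friedrichs extension and the Krein extension. The renormalization group flows from the Krein extension to the Friedrichs extension. On one semicircle of non-fixed points all extensions have one bound state; on the other all have no bound states. (3) $\alpha=0$ ("liquid–solid phase transition"): the set of self-adjoint extensions is a circle. There is a unique fixed point: Friedrichs extension = Krein extension. The renormalization group flows from the Krein extension to the Friedrichs extension (that is, from the unique fixed point to itself). Non-fixed points have one bound state. (4) $\alpha<0$ ("solid"): the set of self-adjoint extensions is a circle. There are no fixed points. The renormalization group rotates the circle. All extensions have infinitely many bound states.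
   Context: $L_\alpha^{\min}$ is the closure in $L^2[0,\infty[$ of the differential expression $L_\alpha=-\partial_x^2+\left(-\frac14+\alpha\right)\frac1{x^2}$ on $C_{\mathrm c}^\infty(]0,\infty[)$, and $L_\alpha^{\max}$ is $L_\alpha$ on the domain of all $f\in L^2[0,\infty[$ with $L_\alpha f\in L^2[0,\infty[$. The dilations are $(U_\tau f)(x)=\mathrm{e}^{\tau/2}f(\mathrm{e}^{\tau}x)$, $\tau\in\mathbb{R}$; $L_\alpha^{\min}$ is homogeneous of degree $-2$, i.e. $U_\tau L_\alpha^{\min}U_\tau^{-1}=\mathrm{e}^{-2\tau}L_\alpha^{\min}$. A fixed point is a self-adjoint extension $H$ with $\mathrm{e}^{2\tau}U_\tau HU_\tau^{-1}=H$ for all $\tau$, i.e. one homogeneous of degree $-2$. A bound state means an eigenvalue. The flow is described as follows. For $\alpha<1$, $\alpha\ne0$, write $\alpha=m^2$. For $\kappa\in\mathbb{C}\cup\{\infty\}$ let $H_{m,\kappa}$ be the restriction of $L_{m^2}^{\max}$ to those $f$ in its domain for which there is $c\in\mathbb{C}$ such that $f(x)-c(x^{1/2-m}+\kappa x^{1/2+m})$ belongs to $\mathrm{Dom}(L_{m^2}^{\min})$ around $0$ (for $\kappa=\infty$: $f(x)-cx^{1/2+m}$). For $\alpha=0$ and $\nu\in\mathbb{C}\cup\{\infty\}$ let $H_0^\nu$ be defined in the same way from $L_0^{\max}$, with $f(x)-c(x^{1/2}\ln x+\nu x^{1/2})$ (for $\nu=\infty$: $f(x)-cx^{1/2}$).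 The self-adjoint extensions are: for $0<\alpha<1$, with $m=\sqrt\alpha$, the operators $H_{m,\kappa}$ with $\kappa\in\mathbb{R}\cup\{\infty\}$, where $\kappa=\infty$ is the Friedrichs and $\kappa=0$ the Krein extension; for $\alpha=0$, the operators $H_0^\nu$ with $\nu\in\mathbb{R}\cup\{\infty\}$; for $\alpha<0$, with $m\in\mathrm{i}\mathbb{R}$, the operators $H_{m,\kappa}$ with $|\kappa|=1$. The action of dilations is $U_\tau H_{m,\kappa}U_\tau^{-1}=\mathrm{e}^{-2\tau}H_{m,\mathrm{e}^{2\tau m}\kappa}$ and $U_\tau H_0^\nu U_\tau^{-1}=\mathrm{e}^{-2\tau}H_0^{\nu+\tau}$. *)

theory Defs
  imports "HOL-Analysis.Analysis"
begin

section \<open>The Hilbert space of square-integrable functions on the half-line\<close>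

text \<open>Elements of \<open>L\<^sup>2[0,\<infinity>[\<close> are represented by functions on the whole real line. Only their
  almost-everywhere class on \<open>{0..}\<close> matters, and the values on the negative axis are irrelevant.\<close>

abbreviation half_line :: "real measure" where
  "half_line \<equiv> lebesgue_on {0..}"

definition L2 :: "(real \<Rightarrow> complex) set" where
  "L2 = {f. f \<in> borel_measurable half_line \<and> integrable half_line (\<lambda>x. (norm (f x))\<^sup>2)}"

definition L2_inner :: "(real \<Rightarrow> complex) \<Rightarrow> (real \<Rightarrow> complex) \<Rightarrow> complex" where
  "L2_inner f g = (LINT x|half_line. cnj (f x) * g x)"

definition L2_norm :: "(real \<Rightarrow> complex) \<Rightarrow> real" where
  "L2_norm f = sqrt (LINT x|half_line. (norm (f x))\<^sup>2)"


section \<open>Unbounded operators\<close>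

text \<open>An operator is given by its graph, a set of pairs of representatives. Closures and adjoints
  below are saturated under almost-everywhere equality of both components, and hence so are
  self-adjoint operators; for these, equality of graphs as sets is equality of operators.\<close>

type_synonym operator = "((real \<Rightarrow> complex) \<times> (real \<Rightarrow> complex)) set"

definition op_closure :: "operator \<Rightarrow> operator" where
  "op_closure A = {(f, g). f \<in> L2 \<and> g \<in> L2 \<and>
     (\<exists>u v. (\<forall>n::nat. (u n, v n) \<in> A) \<and>
        (\<lambda>n. L2_norm (\<lambda>x. u n x - f x)) \<longlonglongrightarrow> 0 \<and>
        (\<lambda>n. L2_norm (\<lambda>x. v n x - g x)) \<longlonglongrightarrow> 0)}"

definition densely_defined :: "operator \<Rightarrow> bool" where
  "densely_defined A \<longleftrightarrow>
     (\<forall>f\<in>L2. \<forall>e>0. \<exists>(h, k)\<in>A. L2_norm (\<lambda>x. f x - h x) < e)"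

definition adjoint_op :: "operator \<Rightarrow> operator" where
  "adjoint_op A = {(f, g). f \<in> L2 \<and> g \<in> L2 \<and>
     (\<forall>(h, k)\<in>A. L2_inner k f = L2_inner h g)}"

text \<open>Density of the domain forces a relation equal to its adjoint to be linear and single-valued
  (up to almost-everywhere equality), so neither has to be required separately.\<close>

definition self_adjoint :: "operator \<Rightarrow> bool" where
  "self_adjoint A \<longleftrightarrow> densely_defined A \<and> adjoint_op A = A"

definition sa_extensions :: "operator \<Rightarrow> operator set" where
  "sa_extensions A = {H. A \<subseteq> H \<and> self_adjoint H}"

definition eigenvalues :: "operator \<Rightarrow> complex set" where
  "eigenvalues H = {z. \<exists>f. (f, \<lambda>x. z * f x) \<in> H \<and> \<not> (AE x in half_line. f x = 0)}"


section \<open>Friedrichs and Krein extensions\<close>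

definition nonneg_op :: "operator \<Rightarrow> bool" where
  "nonneg_op A \<longleftrightarrow> (\<forall>(f, g)\<in>A. L2_inner f g \<in> \<real> \<and> 0 \<le> Re (L2_inner f g))"

text \<open>\<open>closed_form A f q\<close>: the vector \<open>f\<close> lies in the domain of the closure of the quadratic form
  \<open>f \<mapsto> \<langle>f, A f\<rangle>\<close> (defined on the domain of a nonnegative \<open>A\<close>), and the closed form takes the
  value \<open>q\<close> at \<open>f\<close>.\<close>

definition closed_form :: "operator \<Rightarrow> (real \<Rightarrow> complex) \<Rightarrow> real \<Rightarrow> bool" where
  "closed_form A f q \<longleftrightarrow> f \<in> L2 \<and>
     (\<exists>u v. (\<forall>n::nat. (u n, v n) \<in> A) \<and>
        (\<lambda>n. L2_norm (\<lambda>x. u n x - f x)) \<longlonglongrightarrow> 0 \<and>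
        (\<forall>e>0. \<exists>N. \<forall>m\<ge>N. \<forall>n\<ge>N.
           norm (L2_inner (\<lambda>x. u m x - u n x) (\<lambda>x. v m x - v n x)) < e) \<and>
        (\<lambda>n. Re (L2_inner (u n) (v n))) \<longlonglongrightarrow> q)"

text \<open>The usual order \<open>A \<le> B\<close> of nonnegative self-adjoint operators: the form domain of \<open>B\<close> is
  contained in that of \<open>A\<close>, and there the form of \<open>A\<close> is below the form of \<open>B\<close>.\<close>

definition form_le :: "operator \<Rightarrow> operator \<Rightarrow> bool" where
  "form_le A B \<longleftrightarrow> (\<forall>f q. closed_form B f q \<longrightarrow> (\<exists>p\<le>q. closed_form A f p))"

text \<open>The operator associated with the closed form of a nonnegative \<open>A\<close>. For \<open>h\<close> in the domain of
  \<open>A\<close>, which is a form core, the sesquilinear closed form is \<open>(h, f) \<mapsto> \<langle>A h, f\<rangle>\<close>; hence this operator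
  is the restriction of the adjoint to the form domain.\<close>

definition friedrichs_extension :: "operator \<Rightarrow> operator" where
  "friedrichs_extension A = {(f, g) \<in> adjoint_op A. \<exists>q. closed_form A f q}"

text \<open>The Krein extension is the least nonnegative self-adjoint extension.\<close>

definition is_krein_extension :: "operator \<Rightarrow> operator \<Rightarrow> bool" where
  "is_krein_extension A K \<longleftrightarrow> K \<in> sa_extensions A \<and> nonneg_op K \<and>
     (\<forall>B\<in>sa_extensions A. nonneg_op B \<longrightarrow> form_le K B)"


section \<open>Topology on self-adjoint operators\<close>

text \<open>The norm-resolvent metric \<open>\<parallel>(A - i)\<^sup>-\<^sup>1 - (B - i)\<^sup>-\<^sup>1\<parallel>\<close>. For saturated \<open>A\<close>,
  \<open>(A - i)\<^sup>-\<^sup>1 g = f\<close> means that \<open>(f, g + i f)\<close> lies in the graph of \<open>A\<close>. The case distinction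
  only keeps the function nonnegative and symmetric for arbitrary arguments.\<close>

definition resolvent_dist :: "operator \<Rightarrow> operator \<Rightarrow> real" where
  "resolvent_dist A B =
     (if self_adjoint A \<and> self_adjoint B then
        Sup {L2_norm (\<lambda>x. f\<^sub>1 x - f\<^sub>2 x) | f\<^sub>1 f\<^sub>2 g. g \<in> L2 \<and> L2_norm g \<le> 1 \<and>
               (f\<^sub>1, \<lambda>x. g x + \<i> * f\<^sub>1 x) \<in> A \<and> (f\<^sub>2, \<lambda>x. g x + \<i> * f\<^sub>2 x) \<in> B}
      else 0)"

definition sa_topology :: "operator \<Rightarrow> operator topology" where
  "sa_topology A = Metric_space.mtopology (sa_extensions A) resolvent_dist"

abbreviation circle :: "complex topology" where
  "circle \<equiv> top_of_set (sphere 0 1)"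


section \<open>The Bessel operator and the renormalization group\<close>

definition test_functions :: "(real \<Rightarrow> complex) set" where
  "test_functions = {f.
     (\<exists>D :: nat \<Rightarrow> real \<Rightarrow> complex. D 0 = f \<and>
        (\<forall>n x. (D n has_vector_derivative D (Suc n) x) (at x))) \<and>
     (\<exists>a b. 0 < a \<and> (\<forall>x. x \<notin> {a..b} \<longrightarrow> f x = 0))}"

definition L_expr :: "real \<Rightarrow> (real \<Rightarrow> complex) \<Rightarrow> real \<Rightarrow> complex" where
  "L_expr \<alpha> f x =
     - vector_derivative (\<lambda>y. vector_derivative f (at y)) (at x)
     + complex_of_real ((- 1/4 + \<alpha>) * (1 / x\<^sup>2)) * f x"

definition L_min :: "real \<Rightarrow> operator" where
  "L_min \<alpha> = op_closure {(f, L_expr \<alpha> f) | f. f \<in> test_functions}"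

definition dilation :: "real \<Rightarrow> (real \<Rightarrow> complex) \<Rightarrow> real \<Rightarrow> complex" where
  "dilation \<tau> f x = complex_of_real (exp (\<tau> / 2)) * f (exp \<tau> * x)"

text \<open>The graph of \<open>e\<^sup>2\<^sup>\<tau> U\<^sub>\<tau> H U\<^sub>\<tau>\<^sup>-\<^sup>1\<close>.\<close>

definition rg :: "real \<Rightarrow> operator \<Rightarrow> operator" where
  "rg \<tau> H =
     {(dilation \<tau> f, \<lambda>x. complex_of_real (exp (2 * \<tau>)) * dilation \<tau> g x) | f g. (f, g) \<in> H}"

definition rg_fixed_points :: "real \<Rightarrow> operator set" where
  "rg_fixed_points \<alpha> = {H \<in> sa_extensions (L_min \<alpha>). \<forall>\<tau>. rg \<tau> H = H}"

definition continuous_flow_on :: "'a set \<Rightarrow> 'a topology \<Rightarrow> (real \<Rightarrow> 'a \<Rightarrow> 'a) \<Rightarrow> bool" where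
  "continuous_flow_on S X \<phi> \<longleftrightarrow>
     (\<forall>t. \<forall>x\<in>S. \<phi> t x \<in> S) \<and>
     (\<forall>x\<in>S. \<phi> 0 x = x) \<and>
     (\<forall>s t. \<forall>x\<in>S. \<phi> (s + t) x = \<phi> s (\<phi> t x)) \<and>
     continuous_map (prod_topology euclideanreal X) X (\<lambda>(t, x). \<phi> t x)"

definition rg_flows_from_to :: "real \<Rightarrow> operator \<Rightarrow> operator \<Rightarrow> bool" where
  "rg_flows_from_to \<alpha> K F \<longleftrightarrow>
     (\<forall>H \<in> sa_extensions (L_min \<alpha>) - rg_fixed_points \<alpha>.
        limitin (sa_topology (L_min \<alpha>)) (\<lambda>\<tau>. rg \<tau> H) K at_bot \<and>
        limitin (sa_topology (L_min \<alpha>)) (\<lambda>\<tau>. rg \<tau> H) F at_top)"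

end

theory Submission
  imports Defs
begin

text \<open>For \<open>\<alpha> < 1\<close> two real solutions \<open>u1\<close>, \<open>u2\<close> of \<open>L u = 0\<close> are square integrable near \<open>0\<close>, so the
  Wronskians of \<open>f\<close> with them have limits at \<open>0\<close> for every \<open>f\<close> in the maximal domain. By Green's formula these two
  boundary values carry a symplectic form whose real lines are the self-adjoint extensions. The line through
  \<open>z\<close> is coded by the point \<open>z / cnj z\<close> of the unit circle; resolvents depend on it Lipschitz continuously, so the
  space of extensions is a circle. Dilations act linearly on \<open>u1\<close> and \<open>u2\<close>, hence by Moebius maps on the
  circle. For \<open>\<alpha> \<ge> 1\<close> the boundary values vanish automatically.

  Every negative eigenfunction is a dilate of the solution at energy \<open>-1\<close>, a Macdonald function, so its boundary
  values decide which extensions have it; a virial identity excludes positive eigenvalues. For \<open>\<alpha> = m^2\<close> the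
  factorizations \<open>L = A\<^sup>* A\<close> attached to the solutions \<open>x powr (1/2 \<plusminus> m)\<close> identify the Friedrichs and the
  Krein extension.\<close>

subsection \<open>The space of square-integrable functions\<close>

text \<open>Operators are sets of pairs of representatives, so almost-everywhere classes must be
  turned into functions with derivatives: the adjoint of the expression on test functions is
  computed by distributional arguments, and its elements get C1 representatives
  (\<open>regular\<close>). The boundary values \<open>b1\<close>, \<open>b2\<close> are defined not
  as limits but as pairings with cut-off solutions. As pairings they are bounded in the graph norm,
  which makes the resolvent estimate quantitative; as limits of Wronskians they transform under
  dilations like \<open>u1\<close>, \<open>u2\<close>. The locale \<open>limit_circle\<close>
  records only a fundamental system at energy 0, its Wronskian \<open>w\<close> and the matrix of
  the dilations, so that circle, flow and eigenvalue criterion are proved once for the three phases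
  with \<alpha> < 1. Homogeneity takes the place of uniqueness theory: an eigenfunction is compared
  by Green's formula with the dilate of the solution at energy -1 that has the same energy, so a
  single boundary vector \<open>\<beta>\<close> and its orbit under \<open>G\<close> settle the
  negative spectrum.\<close>

type_synonym cfun = "real \<Rightarrow> complex"

lemma AE_lebesgue_nonzero: "AE x in lebesgue. x \<noteq> (0::real)" using AE_completion[OF AE_lborel_singleton[of "0::real"]] by simp

lemma AE_half_line_pos: "AE x in half_line. 0 < x" using AE_lebesgue_nonzero by (subst AE_restrict_space_iff) (auto elim: AE_mp)

text \<open>For B > 0 this is the discriminant, found at the minimizing t; for B <= 0 large
  multiples of - cnj p violate nonnegativity unless p = 0. With A = 0 the conclusion is p = 0, the
  first-order condition at a minimum.\<close>

lemma quadratic_nonneg_imp_bound: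
  fixes p :: complex and A B :: real
  assumes "\<And>t::complex. 0 \<le> A + 2 * Re (t * p) + (norm t)^2 * B"
  shows "(norm p)^2 \<le> A * B"
proof (cases "B > 0")
  case True
  have "0 \<le> A + 2 * Re ((- cnj p / of_real B) * p) + (norm (- cnj p / of_real B))^2 * B" by (rule assms)
  also have "(- cnj p / of_real B) * p = of_real (- (norm p)\<^sup>2 / B)" using complex_norm_square[of p] by (simp add: mult.commute)
  also have "(norm (- cnj p / of_real B))^2 * B = (norm p)^2 / B" using True by (simp add: norm_divide power2_eq_square)
  finally show ?thesis using True by (simp add: field_simps)
next
  case False
  have 1: "0 \<le> A - 2 * s * (norm p)^2" if "s \<ge> 0" for s
  proof -
    have "0 \<le> A + 2 * Re ((- of_real s * cnj p) * p) + (norm (- of_real s * cnj p))^2 * B" by (rule assms)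
    also have "(- of_real s * cnj p) * p = of_real (- s * (norm p)^2)" using complex_norm_square[of p] by (simp add: mult.commute)
    also have "(norm (- of_real s * cnj p))^2 * B \<le> 0" using False by (simp add: mult_nonneg_nonpos)
    finally show ?thesis by simp
  qed
  have p: "p = 0"
  proof (rule ccontr)
    assume "p \<noteq> 0"
    then have "0 < (norm p)^2" by simp
    moreover have "0 \<le> A" using 1[of 0] by simp
    ultimately have "0 \<le> A - 2 * ((A + 1) / (norm p)^2) * (norm p)^2" by (intro 1) simp
    with \<open>p \<noteq> 0\<close> \<open>0 \<le> A\<close> show False by simp
  qed
  have A: "0 \<le> A" using 1[of 0] by simp
  have "0 \<le> A * B"
  proof (cases "B = 0")
    case False
    with \<open>\<not> B > 0\<close> have B: "B < 0" by simp
    have "0 \<le> A + (norm (complex_of_real (sqrt ((A + 1) / - B))))^2 * B" using assms[of "complex_of_real (sqrt ((A + 1) / - B))"] p by simp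
    also have "(norm (complex_of_real (sqrt ((A + 1) / - B))))^2 = (A + 1) / - B" using B A by (simp add: divide_nonneg_neg)
    finally show ?thesis using B by simp
  qed simp
  with p show ?thesis by simp
qed

lemma L2_measurable: "f \<in> L2 \<Longrightarrow> f \<in> borel_measurable half_line" by (simp add: L2_def)

lemma L2_integrable_sq: "f \<in> L2 \<Longrightarrow> integrable half_line (\<lambda>x. (norm (f x))^2)" by (simp add: L2_def)

lemma L2_integrable_mult:
  assumes "f \<in> L2" "g \<in> L2"
  shows "integrable half_line (\<lambda>x. f x * g x)"
proof (rule Bochner_Integration.integrable_bound)
  show "integrable half_line (\<lambda>x. (norm (f x))^2 + (norm (g x))^2)" using assms by (intro Bochner_Integration.integrable_add L2_integrable_sq)
  show "(\<lambda>x. f x * g x) \<in> borel_measurable half_line" using assms[THEN L2_measurable] by measurable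
  have "norm (f x) * norm (g x) \<le> (norm (f x))^2 + (norm (g x))^2" for x using sum_squares_bound[of "norm (f x)" "norm (g x)"]
      mult_nonneg_nonneg[OF norm_ge_zero[of "f x"] norm_ge_zero[of "g x"]] by linarith
  then show "AE x in half_line. norm (f x * g x) \<le> norm ((norm (f x))^2 + (norm (g x))^2)" by (simp add: norm_mult)
qed

lemma borel_measurable_cnj [measurable]: "cnj \<in> borel_measurable borel" by (intro borel_measurable_continuous_onI continuous_intros)

lemma L2_cnj: "f \<in> L2 \<Longrightarrow> (\<lambda>x. cnj (f x)) \<in> L2" by (auto simp: L2_def)

lemma L2_integrable_inner:
  "f \<in> L2 \<Longrightarrow> g \<in> L2 \<Longrightarrow> integrable half_line (\<lambda>x. cnj (f x) * g x)"
  by (rule L2_integrable_mult[OF L2_cnj])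

lemma L2_add:
  assumes "f \<in> L2" "g \<in> L2"
  shows "(\<lambda>x. f x + g x) \<in> L2"
proof -
  have "integrable half_line (\<lambda>x. (norm (f x + g x))^2)"
  proof (rule Bochner_Integration.integrable_bound)
    show "integrable half_line (\<lambda>x. 2 * (norm (f x))^2 + 2 * (norm (g x))^2)"
      using assms by (intro Bochner_Integration.integrable_add integrable_mult_right L2_integrable_sq)
    show "(\<lambda>x. (norm (f x + g x))^2) \<in> borel_measurable half_line" using assms[THEN L2_measurable] by measurable
    have "(norm (f x + g x))^2 \<le> 2 * (norm (f x))^2 + 2 * (norm (g x))^2" for x
    proof -
      have "(norm (f x + g x))^2 \<le> (norm (f x) + norm (g x))^2" by (intro power_mono norm_triangle_ineq) auto
      also have "\<dots> \<le> 2 * (norm (f x))^2 + 2 * (norm (g x))^2" using sum_squares_bound[of "norm (f x)" "norm (g x)"] by (simp add: power2_sum)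
      finally show ?thesis .
    qed
    then show "AE x in half_line. norm ((norm (f x + g x))^2)
        \<le> norm (2 * (norm (f x))^2 + 2 * (norm (g x))^2)" by simp
  qed
  then show ?thesis using assms[THEN L2_measurable] by (simp add: L2_def)
qed

lemma L2_scale: "f \<in> L2 \<Longrightarrow> (\<lambda>x. c * f x) \<in> L2" by (auto simp: L2_def norm_mult power_mult_distrib)

lemma L2_uminus: "f \<in> L2 \<Longrightarrow> (\<lambda>x. - f x) \<in> L2" by (auto simp: L2_def)

lemma L2_diff: "f \<in> L2 \<Longrightarrow> g \<in> L2 \<Longrightarrow> (\<lambda>x. f x - g x) \<in> L2" using L2_add[OF _ L2_uminus, of f g] by simp

lemma L2_zero: "(\<lambda>x. 0) \<in> L2" by (simp add: L2_def)

lemmas L2_intros = L2_add L2_scale L2_uminus L2_diff L2_zero L2_cnj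

lemma L2_cong_AE:
  assumes "f \<in> L2" "AE x in half_line. f x = g x" "g \<in> borel_measurable half_line"
  shows "g \<in> L2"
proof -
  have "integrable half_line (\<lambda>x. (norm (g x))^2) \<longleftrightarrow> integrable half_line (\<lambda>x. (norm (f x))^2)"
  proof (rule integrable_cong_AE)
    show "AE x in half_line. (norm (g x))^2 = (norm (f x))^2" using assms(2) by eventually_elim simp
  qed (use assms in \<open>auto simp: L2_def\<close>)
  with assms show ?thesis by (simp add: L2_def)
qed

lemma inner_add_right:
  "\<lbrakk>f \<in> L2; g \<in> L2; h \<in> L2\<rbrakk> \<Longrightarrow> L2_inner f (\<lambda>x. g x + h x) = L2_inner f g + L2_inner f h"
  by (simp add: L2_inner_def distrib_left L2_integrable_inner)

lemma inner_add_left: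
  "\<lbrakk>f \<in> L2; g \<in> L2; h \<in> L2\<rbrakk> \<Longrightarrow> L2_inner (\<lambda>x. g x + h x) f = L2_inner g f + L2_inner h f"
  by (simp add: L2_inner_def distrib_right L2_integrable_inner)

lemma inner_diff_right:
  "\<lbrakk>f \<in> L2; g \<in> L2; h \<in> L2\<rbrakk> \<Longrightarrow> L2_inner f (\<lambda>x. g x - h x) = L2_inner f g - L2_inner f h"
  by (simp add: L2_inner_def right_diff_distrib L2_integrable_inner)

lemma inner_diff_left:
  "\<lbrakk>f \<in> L2; g \<in> L2; h \<in> L2\<rbrakk> \<Longrightarrow> L2_inner (\<lambda>x. g x - h x) f = L2_inner g f - L2_inner h f"
  by (simp add: L2_inner_def left_diff_distrib L2_integrable_inner)

lemma inner_scale_right: "L2_inner f (\<lambda>x. c * g x) = c * L2_inner f g"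
proof -
  have "L2_inner f (\<lambda>x. c * g x) = (LINT x|half_line. c * (cnj (f x) * g x))" unfolding L2_inner_def by (simp add: mult.left_commute)
  then show ?thesis by (simp add: L2_inner_def)
qed

lemma inner_scale_left: "L2_inner (\<lambda>x. c * f x) g = cnj c * L2_inner f g"
proof -
  have "L2_inner (\<lambda>x. c * f x) g = (LINT x|half_line. cnj c * (cnj (f x) * g x))" unfolding L2_inner_def by (simp add: mult.assoc)
  then show ?thesis by (simp add: L2_inner_def)
qed

lemma inner_uminus_right: "L2_inner f (\<lambda>x. - g x) = - L2_inner f g" using inner_scale_right[of f "-1" g] by simp

lemma inner_zero [simp]: "L2_inner (\<lambda>x. 0) g = 0" "L2_inner g (\<lambda>x. 0) = 0" by (simp_all add: L2_inner_def)

lemma inner_commute: "L2_inner g f = cnj (L2_inner f g)"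
proof -
  have "L2_inner g f = (LINT x|half_line. cnj (cnj (f x) * g x))" unfolding L2_inner_def by (simp add: mult.commute)
  also have "\<dots> = cnj (LINT x|half_line. cnj (f x) * g x)" by (rule Bochner_Integration.integral_cnj)
  finally show ?thesis by (simp add: L2_inner_def)
qed

lemma inner_cong_AE:
  assumes "AE x in half_line. f x = f' x" "AE x in half_line. g x = g' x"
    and "f \<in> L2" "f' \<in> L2" "g \<in> L2" "g' \<in> L2"
  shows "L2_inner f g = L2_inner f' g'" unfolding L2_inner_def
proof (rule integral_cong_AE)
  show "AE x in half_line. cnj (f x) * g x = cnj (f' x) * g' x" using assms(1,2) by eventually_elim simp
  note [measurable] = assms(3-)[THEN L2_measurable]
  show "(\<lambda>x. cnj (f x) * g x) \<in> borel_measurable half_line" by measurable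
  show "(\<lambda>x. cnj (f' x) * g' x) \<in> borel_measurable half_line" by measurable
qed

lemma L2_norm_sq: "(L2_norm f)^2 = (LINT x|half_line. (norm (f x))^2)" by (simp add: L2_norm_def)

lemma L2_norm_nonneg [simp]: "0 \<le> L2_norm f" by (simp add: L2_norm_def)

lemma inner_self: "L2_inner f f = complex_of_real ((L2_norm f)^2)"
proof -
  have "L2_inner f f = (LINT x|half_line. complex_of_real ((norm (f x))^2))" unfolding L2_inner_def complex_norm_square by (simp add: mult.commute)
  then show ?thesis by (simp only: L2_norm_sq integral_complex_of_real)
qed

lemma L2_norm_scale: "L2_norm (\<lambda>x. c * f x) = norm c * L2_norm f" by (simp add: L2_norm_def norm_mult power_mult_distrib real_sqrt_mult)

lemma L2_norm_uminus [simp]: "L2_norm (\<lambda>x. - f x) = L2_norm f" by (simp add: L2_norm_def)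

abbreviation L2_dist :: "cfun \<Rightarrow> cfun \<Rightarrow> real" where
  "L2_dist f g \<equiv> L2_norm (\<lambda>x. f x - g x)"

abbreviation L2_lim :: "(nat \<Rightarrow> cfun) \<Rightarrow> cfun \<Rightarrow> bool" where
  "L2_lim u f \<equiv> (\<lambda>n. L2_dist (u n) f) \<longlonglongrightarrow> 0"

lemma L2_norm_minus_commute: "L2_dist f g = L2_dist g f" by (simp add: L2_norm_def norm_minus_commute)

lemma L2_norm_zero [simp]: "L2_norm (\<lambda>x. 0) = 0" by (simp add: L2_norm_def)

lemma L2_norm_cong_AE:
  assumes "AE x in half_line. f x = g x"
    "f \<in> borel_measurable half_line" "g \<in> borel_measurable half_line"
  shows "L2_norm f = L2_norm g"
proof -
  have "(LINT x|half_line. (norm (f x))^2) = (LINT x|half_line. (norm (g x))^2)"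
  proof (rule integral_cong_AE)
    show "AE x in half_line. (norm (f x))^2 = (norm (g x))^2" using assms(1) by eventually_elim simp
  qed (use assms(2,3) in measurable)
  then show ?thesis by (simp add: L2_norm_def)
qed

lemma L2_norm_eq_0_iff: "f \<in> L2 \<Longrightarrow> L2_norm f = 0 \<longleftrightarrow> (AE x in half_line. f x = 0)"
  using integral_nonneg_eq_0_iff_AE[OF L2_integrable_sq, of f] by (simp add: L2_norm_def)

lemma L2_norm_add_sq:
  assumes "f \<in> L2" "g \<in> L2"
  shows "(L2_norm (\<lambda>x. f x + g x))^2 = (L2_norm f)^2 + 2 * Re (L2_inner f g) + (L2_norm g)^2"
proof -
  have "L2_inner (\<lambda>x. f x + g x) (\<lambda>x. f x + g x) =
      L2_inner f f + L2_inner g g + (L2_inner f g + cnj (L2_inner f g))"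
    using assms by (simp add: inner_add_left inner_add_right L2_intros inner_commute[of g f])
  then have "Re (L2_inner (\<lambda>x. f x + g x) (\<lambda>x. f x + g x)) =
     Re (L2_inner f f) + Re (L2_inner g g) + 2 * Re (L2_inner f g)" by simp
  then show ?thesis by (simp add: inner_self)
qed

lemma L2_norm_diff_sq:
  assumes "f \<in> L2" "g \<in> L2"
  shows "(L2_dist f g)^2 = (L2_norm f)^2 - 2 * Re (L2_inner f g) + (L2_norm g)^2"
  using L2_norm_add_sq[OF assms(1) L2_uminus[OF assms(2)]] by (simp add: inner_uminus_right)

lemma L2_Cauchy_Schwarz:
  assumes "f \<in> L2" "g \<in> L2"
  shows "norm (L2_inner f g) \<le> L2_norm f * L2_norm g"
proof -
  have "(norm (L2_inner f g))^2 \<le> (L2_norm f)^2 * (L2_norm g)^2"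
  proof (rule quadratic_nonneg_imp_bound)
    fix t
    have "0 \<le> (L2_norm (\<lambda>x. f x + t * g x))^2" by simp
    also have "\<dots> = (L2_norm f)^2 + 2 * Re (t * L2_inner f g) + (norm t)^2 * (L2_norm g)^2"
      using assms by (simp add: L2_norm_add_sq L2_scale inner_scale_right L2_norm_scale power_mult_distrib)
    finally show "0 \<le> \<dots>" .
  qed
  then show ?thesis by (metis power_mult_distrib power2_le_imp_le L2_norm_nonneg mult_nonneg_nonneg)
qed

lemma L2_triangle:
  assumes "f \<in> L2" "g \<in> L2"
  shows "L2_norm (\<lambda>x. f x + g x) \<le> L2_norm f + L2_norm g"
proof (rule power2_le_imp_le)
  have "Re (L2_inner f g) \<le> L2_norm f * L2_norm g" using L2_Cauchy_Schwarz[OF assms] complex_Re_le_cmod[of "L2_inner f g"] by linarith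
  then show "(L2_norm (\<lambda>x. f x + g x))^2 \<le> (L2_norm f + L2_norm g)^2" by (simp add: L2_norm_add_sq[OF assms] power2_sum)
qed simp

lemma L2_triangle_diff:
  assumes "f \<in> L2" "g \<in> L2"
  shows "L2_dist f g \<le> L2_norm f + L2_norm g" using L2_triangle[OF assms(1) L2_uminus[OF assms(2)]] by simp

lemma L2_triangle_dist:
  assumes "f \<in> L2" "g \<in> L2" "h \<in> L2"
  shows "L2_dist f h \<le> L2_dist f g + L2_dist g h" using L2_triangle[OF L2_diff[OF assms(1,2)] L2_diff[OF assms(2,3)]] by simp

lemma L2_norm_diff_ge:
  assumes "f \<in> L2" "g \<in> L2"
  shows "\<bar>L2_norm f - L2_norm g\<bar> \<le> L2_dist f g"
  using L2_triangle[OF L2_diff[OF assms] assms(2)] L2_triangle[OF L2_diff[OF assms(2,1)] assms(1)]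
    L2_norm_minus_commute[of f g] by simp

lemma L2_parallelogram:
  assumes "f \<in> L2" "g \<in> L2"
  shows "(L2_norm (\<lambda>x. f x + g x))^2 + (L2_dist f g)^2 = 2 * (L2_norm f)^2 + 2 * (L2_norm g)^2"
  using L2_norm_add_sq[OF assms] L2_norm_diff_sq[OF assms] by simp

lemma inner_tendsto:
  assumes f: "\<And>n::nat. u n \<in> L2" "f \<in> L2" "L2_lim u f"
    and g: "\<And>n. v n \<in> L2" "g \<in> L2" "L2_lim v g"
  shows "(\<lambda>n. L2_inner (u n) (v n)) \<longlonglongrightarrow> L2_inner f g"
proof -
  have "(\<lambda>n. L2_inner (u n) (v n) - L2_inner f g) \<longlonglongrightarrow> 0"
  proof (rule Lim_null_comparison)
    have "norm (L2_inner (u n) (v n) - L2_inner f g) \<le>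
        L2_dist (u n) f * (L2_dist (v n) g + L2_norm g)
        + L2_norm f * L2_dist (v n) g" for n
    proof -
      have "L2_inner (u n) (v n) - L2_inner f g =
         L2_inner (\<lambda>x. u n x - f x) (v n) + L2_inner f (\<lambda>x. v n x - g x)" using f g by (simp add: inner_diff_left inner_diff_right)
      also have "norm \<dots> \<le> L2_dist (u n) f * L2_norm (v n) + L2_norm f * L2_dist (v n) g"
        by (rule norm_triangle_mono; intro L2_Cauchy_Schwarz L2_diff f g)
      also have "\<dots> \<le> L2_dist (u n) f * (L2_dist (v n) g + L2_norm g)
         + L2_norm f * L2_dist (v n) g" using L2_triangle[OF L2_diff[OF g(1) g(2)] g(2), of n] by (intro add_mono mult_left_mono) auto
      finally show ?thesis .
    qed
    then show "\<forall>\<^sub>F n in sequentially. norm (L2_inner (u n) (v n) - L2_inner f g) \<le>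
        L2_dist (u n) f * (L2_dist (v n) g + L2_norm g)
        + L2_norm f * L2_dist (v n) g" by simp
    have "(\<lambda>n. L2_dist (u n) f * (L2_dist (v n) g + L2_norm g)
        + L2_norm f * L2_dist (v n) g) \<longlonglongrightarrow> 0 * (0 + L2_norm g) + L2_norm f * 0" by (intro tendsto_intros f g)
    then show "(\<lambda>n. L2_dist (u n) f * (L2_dist (v n) g + L2_norm g)
        + L2_norm f * L2_dist (v n) g) \<longlonglongrightarrow> 0" by simp
  qed
  then show ?thesis by (rule LIM_zero_cancel)
qed

lemma inner_tendsto_right:
  assumes "h \<in> L2" "\<And>n::nat. u n \<in> L2" "f \<in> L2" "L2_lim u f"
  shows "(\<lambda>n. L2_inner h (u n)) \<longlonglongrightarrow> L2_inner h f" using inner_tendsto[of "\<lambda>_. h" h u f] assms by simp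

lemma L2_norm_tendsto:
  assumes "\<And>n::nat. u n \<in> L2" "f \<in> L2" "L2_lim u f"
  shows "(\<lambda>n. L2_norm (u n)) \<longlonglongrightarrow> L2_norm f"
proof -
  have "(\<lambda>n. L2_norm (u n) - L2_norm f) \<longlonglongrightarrow> 0"
    by (rule Lim_null_comparison[OF _ assms(3)]) (use L2_norm_diff_ge[OF assms(1,2)] in simp)
  then show ?thesis by (rule LIM_zero_cancel)
qed

text \<open>Puts a pointwise limit into L2 from a norm bound alone, without a dominating function.
  The bound is asked from \<open>n0\<close> on, so that it applies to tails of a Cauchy
  sequence.\<close>

lemma L2_Fatou:
  assumes F: "\<And>n::nat. F n \<in> L2" and f: "f \<in> borel_measurable half_line"
    and ae: "AE x in half_line. (\<lambda>n. F n x) \<longlonglongrightarrow> f x"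
    and bd: "\<And>n. n \<ge> n0 \<Longrightarrow> L2_norm (F n) \<le> C"
  shows "f \<in> L2 \<and> L2_norm f \<le> C"
proof -
  have C: "0 \<le> C" using bd[of n0] L2_norm_nonneg[of "F n0"] by linarith
  have "(\<integral>\<^sup>+x. ennreal ((norm (f x))^2) \<partial>half_line) = (\<integral>\<^sup>+x. liminf (\<lambda>n. ennreal ((norm (F n x))^2)) \<partial>half_line)"
  proof (rule nn_integral_cong_AE)
    show "AE x in half_line. ennreal ((norm (f x))^2) = liminf (\<lambda>n. ennreal ((norm (F n x))^2))" using ae
    proof eventually_elim
      case (elim x)
      have "(\<lambda>n. ennreal ((norm (F n x))^2)) \<longlonglongrightarrow> ennreal ((norm (f x))^2)" by (intro tendsto_ennrealI tendsto_intros elim)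
      from lim_imp_Liminf[OF _ this] show ?case by simp
    qed
  qed
  also have "\<dots> \<le> liminf (\<lambda>n. \<integral>\<^sup>+x. ennreal ((norm (F n x))^2) \<partial>half_line)"
    using F[THEN L2_measurable] by (intro nn_integral_liminf) measurable
  also have "\<dots> \<le> liminf (\<lambda>n. ennreal (C^2))"
  proof (rule Liminf_mono)
    show "\<forall>\<^sub>F n in sequentially. (\<integral>\<^sup>+x. ennreal ((norm (F n x))^2) \<partial>half_line) \<le> ennreal (C^2)"
    proof (rule eventually_sequentiallyI)
      fix n assume "n \<ge> n0"
      have "(\<integral>\<^sup>+x. ennreal ((norm (F n x))^2) \<partial>half_line) = ennreal ((L2_norm (F n))^2)"
        using L2_integrable_sq[OF F] unfolding L2_norm_sq by (intro nn_integral_eq_integral) auto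
      also have "\<dots> \<le> ennreal (C^2)" using bd[OF \<open>n \<ge> n0\<close>] by (intro ennreal_leI power_mono) auto
      finally show "(\<integral>\<^sup>+x. ennreal ((norm (F n x))^2) \<partial>half_line) \<le> ennreal (C^2)" .
    qed
  qed
  also have "\<dots> = ennreal (C^2)" by (simp add: Liminf_const)
  finally have le: "(\<integral>\<^sup>+x. ennreal ((norm (f x))^2) \<partial>half_line) \<le> ennreal (C^2)" .
  have int: "integrable half_line (\<lambda>x. (norm (f x))^2)"
  proof (rule integrableI_bounded)
    show "(\<integral>\<^sup>+ x. ennreal (norm ((norm (f x))^2)) \<partial>half_line) < \<infinity>" using le by (simp add: le_less_trans)
  qed (use f in measurable)
  then have "ennreal ((L2_norm f)^2) \<le> ennreal (C^2)" using le unfolding L2_norm_sq by (subst (asm) nn_integral_eq_integral) auto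
  then have "(L2_norm f)^2 \<le> C^2" by simp
  then have "L2_norm f \<le> C" using C by (rule power2_le_imp_le)
  with int f show ?thesis by (simp add: L2_def)
qed

text \<open>Along a subsequence with increments below \<open>(1/2)^k\<close> the sum of
  \<open>2^k * (norm (d k x))^2\<close> has a finite integral, so the increments are summable almost
  everywhere. Fatou's lemma then carries the Cauchy bound over to the pointwise limit.\<close>

theorem L2_complete:
  assumes u: "\<And>n::nat. u n \<in> L2"
    and cauchy: "\<And>e. e > 0 \<Longrightarrow> \<exists>N. \<forall>m\<ge>N. \<forall>n\<ge>N. L2_dist (u m) (u n) < e"
  shows "\<exists>f\<in>L2. L2_lim u f"
proof -
  have "\<exists>N. \<forall>m\<ge>N. \<forall>n\<ge>N. L2_dist (u m) (u n) < (1/2)^k" for k :: nat by (rule cauchy) simp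
  then obtain N where N: "\<And>k m n. m \<ge> N k \<Longrightarrow> n \<ge> N k \<Longrightarrow> L2_dist (u m) (u n) < (1/2)^k" by metis
  \<comment> \<open>Partial sums make the indices nondecreasing and keep each one above
    \<open>N k\<close>.\<close>
  define r where "r k = (\<Sum>j\<le>k. N j)" for k
  have rN: "r k \<ge> N k" and rmono: "r (Suc k) \<ge> r k" for k by (auto simp: r_def member_le_sum)
  define F where "F k = u (r k)" for k
  define d where "d k x = F (Suc k) x - F k x" for k x
  have FL: "F k \<in> L2" and dL: "d k \<in> L2" for k unfolding F_def d_def by (auto intro!: L2_diff u)
  note [measurable] = FL[THEN L2_measurable] dL[THEN L2_measurable]
  have dn: "L2_norm (d k) \<le> (1/2)^k" for k unfolding d_def F_def using N[OF order_trans[OF rN rmono] rN, of k] by simp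
  have "(\<integral>\<^sup>+x. (\<Sum>k. ennreal (2^k * (norm (d k x))^2)) \<partial>half_line) =
      (\<Sum>k. \<integral>\<^sup>+x. ennreal (2^k * (norm (d k x))^2) \<partial>half_line)" by (intro nn_integral_suminf) measurable
  also have "\<dots> \<le> (\<Sum>k. ennreal ((1/2)^k))"
  proof (rule suminf_le)
    fix k
    have "(\<integral>\<^sup>+x. ennreal (2^k * (norm (d k x))^2) \<partial>half_line) = ennreal (2^k * (L2_norm (d k))^2)"
      unfolding L2_norm_sq integral_mult_right_zero[symmetric] using L2_integrable_sq[OF dL] by (intro nn_integral_eq_integral) auto
    also have "\<dots> \<le> ennreal (2^k * ((1/2)^k)^2)" using dn by (intro ennreal_leI mult_left_mono power_mono) auto
    also have "2^k * ((1/2)^k)^2 = ((1/2)^k :: real)" by (simp add: power2_eq_square power_one_over)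
    finally show "(\<integral>\<^sup>+x. ennreal (2^k * (norm (d k x))^2) \<partial>half_line) \<le> ennreal ((1/2)^k)" .
  qed auto
  also have "\<dots> < \<infinity>" by (subst suminf_ennreal2) (auto intro!: summable_geometric)
  finally have "AE x in half_line. (\<Sum>k. ennreal (2^k * (norm (d k x))^2)) \<noteq> \<infinity>" by (intro nn_integral_PInf_AE) auto
  then have conv: "AE x in half_line. convergent (\<lambda>k. F k x)"
  proof eventually_elim
    case (elim x)
    then have sm: "summable (\<lambda>k. 2^k * (norm (d k x))^2)" by (intro summable_suminf_not_top) (auto simp: top_ennreal_def)
    \<comment> \<open>The norm is the geometric mean of the two summands; one is a geometric series,
      the other is summable by \<open>sm\<close>.\<close>
    have bd: "norm (d k x) \<le> (1/2)^k + 2^k * (norm (d k x))^2" for k using arith_geo_mean_sqrt[of "(1/2)^k" "2^k * (norm (d k x))^2"]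
      by (simp add: real_sqrt_mult mult.assoc[symmetric] power_mult_distrib[symmetric], use norm_ge_zero[of "d k x"] in linarith)
    have "summable (\<lambda>k. d k x)" by (rule summable_comparison_test[OF _ summable_add[OF summable_geometric sm], of _ "1/2"]) (use bd in auto)
    then have "convergent (\<lambda>n. \<Sum>k<n. d k x)" by (simp add: summable_iff_convergent)
    moreover have "(\<Sum>k<n. d k x) = F n x - F 0 x" for n unfolding d_def by (rule sum_lessThan_telescope)
    ultimately show ?case by (simp add: convergent_diff_const_right_iff)
  qed
  define f where "f x = lim (\<lambda>k. F k x)" for x
  have fm [measurable]: "f \<in> borel_measurable half_line" unfolding f_def by measurable
  have lim: "AE x in half_line. (\<lambda>k. F k x) \<longlonglongrightarrow> f x" using conv by eventually_elim (simp add: f_def convergent_LIMSEQ_iff)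
  have key: "(\<lambda>x. u n x - f x) \<in> L2 \<and> L2_dist (u n) f \<le> (1/2)^k" if "n \<ge> N k" for n k
  proof (rule L2_Fatou[where F = "\<lambda>j x. u n x - F j x" and ?n0.0 = k])
    show "(\<lambda>x. u n x - F j x) \<in> L2" for j by (intro L2_diff u FL)
    show "(\<lambda>x. u n x - f x) \<in> borel_measurable half_line" using L2_measurable[OF u[of n]] by measurable
    show "AE x in half_line. (\<lambda>j. u n x - F j x) \<longlonglongrightarrow> u n x - f x" using lim by eventually_elim (intro tendsto_intros)
    fix j assume "k \<le> j"
    then have "r j \<ge> r k" using lift_Suc_mono_le[of r k j] rmono by blast
    then have "r j \<ge> N k" using rN[of k] by simp
    from N[OF that this] show "L2_dist (u n) (F j) \<le> (1/2)^k" by (simp add: F_def)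
  qed
  have "f \<in> L2" using L2_diff[OF u[of "N 0"] conjunct1[OF key[of 0 "N 0"]]] by simp
  moreover have "L2_lim u f"
  proof (rule LIMSEQ_I)
    fix e :: real assume "e > 0"
    then obtain k where "(1/2)^k < e" using real_arch_pow_inv[of e "1/2"] by auto
    then have "\<forall>n\<ge>N k. norm (L2_dist (u n) f - 0) < e" using key by (auto intro: le_less_trans)
    then show "\<exists>no. \<forall>n\<ge>no. norm (L2_dist (u n) f - 0) < e" ..
  qed
  ultimately show ?thesis by blast
qed

text \<open>The variational core of the projection theorem: the midpoint hypothesis is what the
  parallelogram law gives for squared distances \<open>q\<close> and \<open>D\<close>. As the
  midpoint is no better than the infimum, near-minimal elements are close to each other.\<close>

lemma minimizing_sequence:
  fixes q :: "'a \<Rightarrow> real" and D :: "'a \<Rightarrow> 'a \<Rightarrow> real"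
  assumes ne: "S \<noteq> {}" and q: "\<And>x. x \<in> S \<Longrightarrow> 0 \<le> q x"
    and mid: "\<And>x y. x \<in> S \<Longrightarrow> y \<in> S \<Longrightarrow> \<exists>z\<in>S. 4 * q z + D x y \<le> 2 * q x + 2 * q y"
  obtains x :: "nat \<Rightarrow> 'a" and c where "\<And>n. x n \<in> S" "\<And>y. y \<in> S \<Longrightarrow> c \<le> q y"
    "(\<lambda>n. q (x n)) \<longlonglongrightarrow> c" "\<And>e. e > 0 \<Longrightarrow> \<exists>N. \<forall>m\<ge>N. \<forall>n\<ge>N. D (x m) (x n) < e"
proof -
  define c where "c = Inf (q ` S)"
  have bdd: "bdd_below (q ` S)" using q by (intro bdd_belowI[of _ 0]) auto
  have c: "c \<le> q y" if "y \<in> S" for y unfolding c_def using bdd that by (intro cInf_lower) auto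
  have "\<exists>y\<in>S. q y < c + 1 / real (Suc n)" for n
  proof -
    have "Inf (q ` S) < c + 1 / real (Suc n)" by (simp add: c_def)
    then show ?thesis using cInf_lessD[of "q ` S"] ne by auto
  qed
  then obtain x where x: "\<And>n. x n \<in> S" "\<And>n. q (x n) < c + 1 / real (Suc n)" by metis
  have "(\<lambda>n. q (x n)) \<longlonglongrightarrow> c"
  proof (rule tendsto_sandwich)
    show "\<forall>\<^sub>F n in sequentially. c \<le> q (x n)" using c x by simp
    show "\<forall>\<^sub>F n in sequentially. q (x n) \<le> c + 1 / real (Suc n)" using x(2) by (intro always_eventually allI less_imp_le)
    show "(\<lambda>n. c + 1 / real (Suc n)) \<longlonglongrightarrow> c"
      using tendsto_add[OF tendsto_const[of c] LIMSEQ_inverse_real_of_nat] by (simp add: inverse_eq_divide)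
  qed simp
  moreover have "\<exists>N. \<forall>m\<ge>N. \<forall>n\<ge>N. D (x m) (x n) < e" if e: "e > 0" for e
  proof -
    \<comment> \<open>In \<open>2 * q + 2 * q - 4 * q\<close> the infimum \<open>c\<close> cancels
      and at most 4 / Suc N remains.\<close>
    obtain N where N: "4 / real (Suc N) < e"
    proof -
      obtain N where "inverse (real (Suc N)) < e / 4" using reals_Archimedean[of "e/4"] e by auto
      then show ?thesis by (intro that[of N]) (simp add: field_simps)
    qed
    have "D (x m) (x n) < e" if "m \<ge> N" "n \<ge> N" for m n
    proof -
      obtain z where z: "z \<in> S" "4 * q z + D (x m) (x n) \<le> 2 * q (x m) + 2 * q (x n)" using mid x by blast
      have "1 / real (Suc m) \<le> 1 / real (Suc N)" "1 / real (Suc n) \<le> 1 / real (Suc N)" using that by (auto intro!: divide_left_mono)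
      then show ?thesis using z c[OF z(1)] x(2)[of m] x(2)[of n] N by simp
    qed
    then show ?thesis by blast
  qed
  ultimately show ?thesis using that c x by blast
qed

subsection \<open>Self-adjoint operators and their resolvents\<close>

lemma adjoint_opI:
  assumes "f \<in> L2" "g \<in> L2" "\<And>h k. (h, k) \<in> A \<Longrightarrow> L2_inner k f = L2_inner h g"
  shows "(f, g) \<in> adjoint_op A" using assms by (auto simp: adjoint_op_def)

lemma adjoint_opD:
  assumes "(f, g) \<in> adjoint_op A"
  shows "f \<in> L2" "g \<in> L2" "(h, k) \<in> A \<Longrightarrow> L2_inner k f = L2_inner h g" using assms by (auto simp: adjoint_op_def)

lemma adjoint_op_antimono: "A \<subseteq> B \<Longrightarrow> adjoint_op B \<subseteq> adjoint_op A" by (auto simp: adjoint_op_def)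

lemma adjoint_op_closed:
  assumes "\<And>n::nat. (u n, v n) \<in> adjoint_op A" "f \<in> L2" "g \<in> L2" "\<And>h k. (h, k) \<in> A \<Longrightarrow> h \<in> L2 \<and> k \<in> L2"
    and "L2_lim u f" "L2_lim v g"
  shows "(f, g) \<in> adjoint_op A"
proof (rule adjoint_opI)
  fix h k assume hk: "(h, k) \<in> A"
  have "(\<lambda>n. L2_inner k (u n)) \<longlonglongrightarrow> L2_inner k f" "(\<lambda>n. L2_inner h (v n)) \<longlonglongrightarrow> L2_inner h g"
    using assms(4)[OF hk] adjoint_opD[OF assms(1)] assms by (auto intro!: inner_tendsto_right)
  moreover have "L2_inner k (u n) = L2_inner h (v n)" for n using adjoint_opD(3)[OF assms(1) hk] .
  ultimately show "L2_inner k f = L2_inner h g" using LIMSEQ_unique by fastforce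
qed fact+

lemma adjoint_op_cong_AE:
  assumes "(f, g) \<in> adjoint_op A" "\<And>h k. (h, k) \<in> A \<Longrightarrow> h \<in> L2 \<and> k \<in> L2" "f' \<in> L2" "g' \<in> L2"
    "AE x in half_line. f x = f' x" "AE x in half_line. g x = g' x"
  shows "(f', g') \<in> adjoint_op A"
proof (rule adjoint_opI)
  fix h k assume hk: "(h, k) \<in> A"
  have "L2_inner k f' = L2_inner k f" "L2_inner h g' = L2_inner h g" using assms(2)[OF hk] assms adjoint_opD[OF assms(1)]
    by (auto intro!: inner_cong_AE elim!: AE_mp)
  with adjoint_opD(3)[OF assms(1) hk] show "L2_inner k f' = L2_inner h g'" by simp
qed fact+

lemma self_adjointD:
  assumes "self_adjoint H" "(f, g) \<in> H"
  shows "f \<in> L2" "g \<in> L2" "(h, k) \<in> H \<Longrightarrow> L2_inner k f = L2_inner h g"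
  using assms adjoint_opD[of f g H] by (auto simp: self_adjoint_def)

lemma self_adjointI:
  assumes "self_adjoint H" "f \<in> L2" "g \<in> L2" "\<And>h k. (h, k) \<in> H \<Longrightarrow> L2_inner k f = L2_inner h g"
  shows "(f, g) \<in> H" using assms adjoint_opI[of f g H] by (auto simp: self_adjoint_def)

lemma self_adjoint_add:
  assumes H: "self_adjoint H" and "(f, g) \<in> H" "(h, k) \<in> H"
  shows "(\<lambda>x. f x + h x, \<lambda>x. g x + k x) \<in> H"
proof (rule self_adjointI[OF H])
  fix p r assume pr: "(p, r) \<in> H"
  note D = self_adjointD[OF H]
  show "L2_inner r (\<lambda>x. f x + h x) = L2_inner p (\<lambda>x. g x + k x)"
    using D[OF pr] D[OF assms(2)] D[OF assms(3)] pr by (simp add: inner_add_right)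
qed (use self_adjointD[OF H assms(2)] self_adjointD[OF H assms(3)] in \<open>auto intro: L2_intros\<close>)

lemma self_adjoint_scale:
  assumes H: "self_adjoint H" and "(f, g) \<in> H"
  shows "(\<lambda>x. c * f x, \<lambda>x. c * g x) \<in> H"
proof (rule self_adjointI[OF H])
  fix p r assume pr: "(p, r) \<in> H"
  show "L2_inner r (\<lambda>x. c * f x) = L2_inner p (\<lambda>x. c * g x)" using self_adjointD(3)[OF H assms(2) pr] by (simp add: inner_scale_right)
qed (use self_adjointD[OF H assms(2)] in \<open>auto intro: L2_intros\<close>)

lemma self_adjoint_diff:
  assumes H: "self_adjoint H" and "(f, g) \<in> H" "(h, k) \<in> H"
  shows "(\<lambda>x. f x - h x, \<lambda>x. g x - k x) \<in> H" using self_adjoint_add[OF H assms(2) self_adjoint_scale[OF H assms(3), of "-1"]] by simp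

lemma self_adjoint_closed:
  assumes H: "self_adjoint H" and "\<And>n::nat. (u n, v n) \<in> H" "f \<in> L2" "g \<in> L2"
    and "L2_lim u f" "L2_lim v g"
  shows "(f, g) \<in> H" using adjoint_op_closed[of u v H f g] assms self_adjointD[OF H] by (auto simp: self_adjoint_def)

lemma self_adjoint_cong_AE:
  assumes H: "self_adjoint H" and "(f, g) \<in> H" "f' \<in> L2" "g' \<in> L2"
    "AE x in half_line. f x = f' x" "AE x in half_line. g x = g' x"
  shows "(f', g') \<in> H" using adjoint_op_cong_AE[of f g H f' g'] assms self_adjointD[OF H] by (auto simp: self_adjoint_def)

lemma self_adjoint_op_closure_subset:
  assumes "self_adjoint H" "A \<subseteq> H"
  shows "op_closure A \<subseteq> H"
proof
  fix p assume "p \<in> op_closure A"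
  then obtain f g u v where "p = (f, g)" "f \<in> L2" "g \<in> L2" "\<And>n::nat. (u n, v n) \<in> A"
    "L2_lim u f" "L2_lim v g"
    by (auto simp: op_closure_def)
  with assms show "p \<in> H" using self_adjoint_closed[OF assms(1), of u v f g] by blast
qed

lemma self_adjoint_inner_real:
  assumes H: "self_adjoint H" and fg: "(f, g) \<in> H"
  shows "L2_inner f g \<in> \<real>" using self_adjointD(3)[OF H fg fg] inner_commute[of f g] by (simp add: Reals_cnj_iff)

text \<open>The cross term is the real part of \<i> times a real number. This identity makes the
  resolvent at \<i> a contraction.\<close>

lemma self_adjoint_norm_shift_sq:
  assumes H: "self_adjoint H" and fg: "(f, g) \<in> H"
  shows "(L2_norm (\<lambda>x. g x - \<i> * f x))^2 = (L2_norm g)^2 + (L2_norm f)^2"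
proof -
  note D = self_adjointD[OF H fg]
  have "Im (L2_inner g f) = 0" using self_adjoint_inner_real[OF H fg] inner_commute[of g f] by (simp add: complex_is_Real_iff)
  then show ?thesis using L2_norm_diff_sq[OF D(2) L2_scale[OF D(1)]] by (simp add: inner_scale_right L2_norm_scale)
qed

text \<open>\<open>E\<close> will be the value of a quadratic form on differences: the form bounds
  squares of distances, so a form-Cauchy sequence can be fed to completeness.\<close>

lemma L2_complete_sq:
  assumes u: "\<And>n::nat. u n \<in> L2" and le: "\<And>i j. (L2_dist (u i) (u j))^2 \<le> E i j"
    and cauchy: "\<And>e. e > 0 \<Longrightarrow> \<exists>N. \<forall>i\<ge>N. \<forall>j\<ge>N. E i j < e"
  shows "\<exists>f\<in>L2. L2_lim u f"
proof (rule L2_complete[OF u])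
  fix e :: real assume e: "e > 0"
  then show "\<exists>N. \<forall>i\<ge>N. \<forall>j\<ge>N. L2_dist (u i) (u j) < e"
    using cauchy[of "e^2"] le by (meson le_less_trans less_imp_le power2_less_imp_less zero_less_power)
qed

text \<open>Orthogonal projection in the direct sum of two copies of L2. \<open>S\<close> is an
  arbitrary subspace, so the projection may leave it; the approximating sequence in \<open>S\<close>
  and the residual are returned instead. Pairs are used because the subspaces in question are
  graphs, of an operator or of a first-order factor of it.\<close>

lemma L2_pair_orthogonal_residual:
  assumes S: "S \<subseteq> L2 \<times> L2" "(\<lambda>x. 0, \<lambda>x. 0) \<in> S"
    and add: "\<And>u u' v v'. (u, u') \<in> S \<Longrightarrow> (v, v') \<in> S \<Longrightarrow> (\<lambda>x. u x + v x, \<lambda>x. u' x + v' x) \<in> S"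
    and scale: "\<And>u u' c. (u, u') \<in> S \<Longrightarrow> (\<lambda>x. c * u x, \<lambda>x. c * u' x) \<in> S" and g: "g \<in> L2" "g' \<in> L2"
  shows "\<exists>s s' r r'. (\<forall>n::nat. (s n, s' n) \<in> S) \<and> r \<in> L2 \<and> r' \<in> L2 \<and> L2_lim (\<lambda>n x. g x - s n x) r
    \<and> L2_lim (\<lambda>n x. g' x - s' n x) r' \<and> (\<forall>(y, y')\<in>S. L2_inner r y + L2_inner r' y' = 0)"
proof -
  have SL: "fst u \<in> L2" "snd u \<in> L2" if "u \<in> S" for u using S that by auto
  define q where "q u = (L2_dist g (fst u))^2 + (L2_dist g' (snd u))^2" for u
  define E where "E u v = (L2_dist (fst u) (fst v))^2 + (L2_dist (snd u) (snd v))^2" for u v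
  \<comment> \<open>Parallelogram law for k - a and k - b, whose half sum is k minus the
    midpoint.\<close>
  have par: "4 * (L2_norm (\<lambda>x. k x - (1/2) * (a x + b x)))^2 + (L2_dist a b)^2 =
      2 * (L2_dist k a)^2 + 2 * (L2_dist k b)^2"
    if "k \<in> L2" "a \<in> L2" "b \<in> L2" for k a b
  proof -
    have "(\<lambda>x. k x - a x + (k x - b x)) = (\<lambda>x. 2 * (k x - (1/2) * (a x + b x)))" by (auto simp: field_simps)
    moreover have "L2_norm (\<lambda>x. k x - a x - (k x - b x)) = L2_dist a b" using L2_norm_minus_commute[of b a] by simp
    ultimately show ?thesis using L2_parallelogram[OF L2_diff[OF that(1,2)] L2_diff[OF that(1,3)]] by (simp only: L2_norm_scale power_mult_distrib) simp
  qed
  have comb: "4 * A + D = 2 * P + 2 * Q \<Longrightarrow> 4 * A' + D' = 2 * P' + 2 * Q' \<Longrightarrow>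
      4 * (A + A') + (D + D') \<le> 2 * (P + P') + 2 * (Q + Q')" for A A' D D' P P' Q Q' :: real by (simp add: distrib_left)
  obtain sp c where sp: "\<And>n. sp n \<in> S" and c: "\<And>y. y \<in> S \<Longrightarrow> c \<le> q y"
    and lim: "(\<lambda>n. q (sp n)) \<longlonglongrightarrow> c" and cau: "\<And>e. e > 0 \<Longrightarrow> \<exists>N. \<forall>m\<ge>N. \<forall>n\<ge>N. E (sp m) (sp n) < e"
  proof (rule minimizing_sequence[of S q E])
    fix a b assume ab: "a \<in> S" "b \<in> S"
    obtain a1 a2 b1 b2 where eq: "a = (a1, a2)" "b = (b1, b2)" by (cases a, cases b) auto
    define z where "z = (\<lambda>x. (1/2) * (a1 x + b1 x), \<lambda>x. (1/2) * (a2 x + b2 x))"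
    have z: "z \<in> S" unfolding z_def using ab unfolding eq by (intro scale add)
    have "4 * q z + E a b \<le> 2 * q a + 2 * q b" using par[OF g(1) SL(1)[OF ab(1)] SL(1)[OF ab(2)]] par[OF g(2) SL(2)[OF ab(1)] SL(2)[OF ab(2)]]
      unfolding q_def E_def z_def eq fst_conv snd_conv by (rule comb)
    with z show "\<exists>z\<in>S. 4 * q z + E a b \<le> 2 * q a + 2 * q b" by blast
  qed (use S(2) in \<open>auto simp: q_def\<close>)
  have conv: "\<exists>p\<in>L2. L2_lim (\<lambda>n x. \<pi> (sp n) x) p"
    if \<pi>: "\<And>u v. (L2_dist (\<pi> u) (\<pi> v))^2 \<le> E u v" "\<And>u. u \<in> S \<Longrightarrow> \<pi> u \<in> L2" for \<pi>
    by (rule L2_complete_sq[OF \<pi>(2)[OF sp] \<pi>(1) cau])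
  obtain p where p: "p \<in> L2" "L2_lim (\<lambda>n x. fst (sp n) x) p" using conv[of fst] SL by (auto simp: E_def)
  obtain p' where p': "p' \<in> L2" "L2_lim (\<lambda>n x. snd (sp n) x) p'" using conv[of snd] SL by (auto simp: E_def)
  define r where "r x = g x - p x" for x
  define r' where "r' x = g' x - p' x" for x
  have rL: "r \<in> L2" "r' \<in> L2" unfolding r_def r'_def by (intro L2_diff g p p')+
  have "L2_norm (\<lambda>x. (g x - fst (sp n) x) - r x) = L2_norm (\<lambda>x. fst (sp n) x - p x)"
    "L2_norm (\<lambda>x. (g' x - snd (sp n) x) - r' x) = L2_norm (\<lambda>x. snd (sp n) x - p' x)" for n
    using L2_norm_minus_commute[of p "fst (sp n)"] L2_norm_minus_commute[of p' "snd (sp n)"] by (simp_all add: r_def r'_def)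
  with p p' have lim_r: "L2_lim (\<lambda>n x. g x - fst (sp n) x) r"
    "L2_lim (\<lambda>n x. g' x - snd (sp n) x) r'" by simp_all
  have shift: "(\<lambda>n. L2_norm (\<lambda>x. k x - \<pi> (sp n) x - t * y x)) \<longlonglongrightarrow> L2_norm (\<lambda>x. \<rho> x - t * y x)"
    if "L2_lim (\<lambda>n x. k x - \<pi> (sp n) x) \<rho>" "k \<in> L2" "\<And>n. \<pi> (sp n) \<in> L2" "\<rho> \<in> L2" "y \<in> L2" for k \<pi> \<rho> y t
  proof (rule L2_norm_tendsto)
    show "(\<lambda>x. k x - \<pi> (sp n) x - t * y x) \<in> L2" for n by (rule L2_diff[OF L2_diff[OF that(2,3)] L2_scale[OF that(5)]])
    show "(\<lambda>x. \<rho> x - t * y x) \<in> L2" by (rule L2_diff[OF that(4) L2_scale[OF that(5)]])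
    show "(\<lambda>n. L2_norm (\<lambda>x. k x - \<pi> (sp n) x - t * y x - (\<rho> x - t * y x))) \<longlonglongrightarrow> 0"
    proof -
      have "(\<lambda>x. k x - \<pi> (sp n) x - t * y x - (\<rho> x - t * y x)) = (\<lambda>x. k x - \<pi> (sp n) x - \<rho> x)" for n
        by (auto simp: algebra_simps)
      then show ?thesis using that(1) by (simp only:)
    qed
  qed
  have sq: "(L2_norm (\<lambda>x. k x - t * y x))^2 = (L2_norm k)^2 - 2 * Re (t * L2_inner k y) + (norm t)^2 * (L2_norm y)^2"
    if "k \<in> L2" "y \<in> L2" for k y t
    using L2_norm_diff_sq[OF that(1) L2_scale[OF that(2), of t]] by (simp add: inner_scale_right L2_norm_scale power_mult_distrib)
  have c_le: "c \<le> (L2_norm (\<lambda>x. r x - t * y x))^2 + (L2_norm (\<lambda>x. r' x - t * y' x))^2" if y: "(y, y') \<in> S" for y y' t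
  proof (rule LIMSEQ_le_const)
    have yL: "y \<in> L2" "y' \<in> L2" using SL[OF y] by auto
    show "(\<lambda>n. (L2_norm (\<lambda>x. g x - fst (sp n) x - t * y x))^2 + (L2_norm (\<lambda>x. g' x - snd (sp n) x - t * y' x))^2)
        \<longlonglongrightarrow> (L2_norm (\<lambda>x. r x - t * y x))^2 + (L2_norm (\<lambda>x. r' x - t * y' x))^2"
      by (intro tendsto_add tendsto_power shift lim_r SL sp g rL yL)
    have "(\<lambda>x. fst (sp n) x + t * y x, \<lambda>x. snd (sp n) x + t * y' x) \<in> S" for n
      using add[OF _ scale[OF y, of t], of "fst (sp n)" "snd (sp n)"] sp by simp
    from c[OF this]
    show "\<exists>N. \<forall>n\<ge>N. c \<le> (L2_norm (\<lambda>x. g x - fst (sp n) x - t * y x))^2 + (L2_norm (\<lambda>x. g' x - snd (sp n) x - t * y' x))^2"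
      by (auto simp: q_def algebra_simps)
  qed
  have "(\<lambda>n. q (sp n)) \<longlonglongrightarrow> (L2_norm r)^2 + (L2_norm r')^2"
    unfolding q_def by (intro tendsto_add tendsto_power L2_norm_tendsto L2_diff g SL sp rL lim_r)
  with lim have cr: "c = (L2_norm r)^2 + (L2_norm r')^2" by (rule LIMSEQ_unique)
  have "L2_inner r y + L2_inner r' y' = 0" if y: "(y, y') \<in> S" for y y'
  proof -
    \<comment> \<open>The constant term is 0 because the minimum \<open>c\<close> equals the squared
      norm of the residual; hence the first variation vanishes.\<close>
    have "(norm (L2_inner r y + L2_inner r' y'))^2 \<le> 0 * ((L2_norm y)^2 + (L2_norm y')^2)"
    proof (rule quadratic_nonneg_imp_bound)
      fix t :: complex
      show "0 \<le> 0 + 2 * Re (t * (L2_inner r y + L2_inner r' y')) + (norm t)^2 * ((L2_norm y)^2 + (L2_norm y')^2)"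
        using c_le[OF y, of "- t"] SL[OF y] unfolding cr fst_conv snd_conv
        by (simp only: sq[OF rL(1)] sq[OF rL(2)] norm_minus_cancel) (simp add: algebra_simps)
    qed
    then show ?thesis by simp
  qed
  with sp rL lim_r show ?thesis by (intro exI[of _ "\<lambda>n. fst (sp n)"] exI[of _ "\<lambda>n. snd (sp n)"] exI[of _ r] exI[of _ r']) auto
qed

corollary L2_orthogonal_residual:
  assumes S: "S \<subseteq> L2" "(\<lambda>x. 0) \<in> S" and add: "\<And>u v. u \<in> S \<Longrightarrow> v \<in> S \<Longrightarrow> (\<lambda>x. u x + v x) \<in> S"
    and scale: "\<And>u c. u \<in> S \<Longrightarrow> (\<lambda>x. c * u x) \<in> S" and g: "g \<in> L2"
  shows "\<exists>s r. (\<forall>n::nat. s n \<in> S) \<and> r \<in> L2 \<and> L2_lim (\<lambda>n x. g x - s n x) r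
    \<and> (\<forall>y\<in>S. L2_inner r y = 0)" using L2_pair_orthogonal_residual[of "S \<times> {\<lambda>x. 0}" g "\<lambda>x. 0"] assms
  by (simp add: subset_eq) blast

text \<open>Split \<open>(0, g)\<close> orthogonally along the graph of \<open>H\<close>: the residual \<open>(r, r')\<close> satisfies \<open>(- r, g - r') \<in> H\<close> because
  the graph is closed and \<open>(r', - r) \<in> H\<close> by self-adjointness.\<close>

lemma self_adjoint_resolvent_exists:
  assumes H: "self_adjoint H" and g: "g \<in> L2"
  shows "\<exists>f. (f, \<lambda>x. g x + \<i> * f x) \<in> H"
proof -
  note D = self_adjointD[OF H]
  have "H \<subseteq> L2 \<times> L2" "(\<lambda>x. 0, \<lambda>x. 0) \<in> H" using D self_adjointI[OF H L2_zero L2_zero] by auto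
  then obtain s s' r r' where s: "\<And>n::nat. (s n, s' n) \<in> H" and rL: "r \<in> L2" "r' \<in> L2"
    and lim: "L2_lim (\<lambda>n x. 0 - s n x) r" "L2_lim (\<lambda>n x. g x - s' n x) r'"
    and orth: "\<And>y y'. (y, y') \<in> H \<Longrightarrow> L2_inner r y + L2_inner r' y' = 0"
    using L2_pair_orthogonal_residual[OF _ _ self_adjoint_add[OF H] self_adjoint_scale[OF H] L2_zero g] by blast
  have eq: "(\<lambda>x. 0 - s n x - r x) = (\<lambda>x. - r x - s n x)" "(\<lambda>x. g x - s' n x - r' x) = (\<lambda>x. (g x - r' x) - s' n x)" for n
    by (auto simp: algebra_simps)
  have rL': "(\<lambda>x. - r x) \<in> L2" by (rule L2_uminus[OF rL(1)])
  have 1: "(\<lambda>x. - r x, \<lambda>x. g x - r' x) \<in> H"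
    by (rule self_adjoint_closed[OF H s]) (use lim L2_norm_minus_commute[of "\<lambda>x. - r x"] L2_norm_minus_commute[of "\<lambda>x. g x - r' x"] in
      \<open>auto simp only: eq intro: rL' L2_diff g rL\<close>)
  have 2: "(r', \<lambda>x. - r x) \<in> H"
  proof (rule self_adjointI[OF H rL(2) rL'])
    fix h k assume "(h, k) \<in> H"
    from orth[OF this] have "L2_inner r' k = L2_inner (\<lambda>x. - r x) h" using inner_scale_left[of "- 1" r h] by (simp add: add_eq_0_iff)
    then show "L2_inner k r' = L2_inner h (\<lambda>x. - r x)" by (simp add: inner_commute[of k] inner_commute[of h])
  qed
  show ?thesis using self_adjoint_add[OF H 1 self_adjoint_scale[OF H 2, of \<i>]]
    by (intro exI[of _ "\<lambda>x. - r x + \<i> * r' x"]) (simp add: algebra_simps)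
qed

lemma self_adjoint_resolvent_norm_le:
  assumes H: "self_adjoint H" and g: "g \<in> L2" and fg: "(f, \<lambda>x. g x + \<i> * f x) \<in> H"
  shows "L2_norm f \<le> L2_norm g"
proof (rule power2_le_imp_le)
  show "(L2_norm f)^2 \<le> (L2_norm g)^2" using self_adjoint_norm_shift_sq[OF H fg] by simp
qed simp

lemma self_adjoint_maximal:
  assumes "self_adjoint A" "self_adjoint B" "A \<subseteq> B"
  shows "A = B" using adjoint_op_antimono[OF assms(3)] assms by (auto simp: self_adjoint_def)

section \<open>The norm-resolvent metric\<close>

definition resolvent_diffs :: "operator \<Rightarrow> operator \<Rightarrow> real set" where
  "resolvent_diffs A B = {L2_norm (\<lambda>x. f\<^sub>1 x - f\<^sub>2 x) | f\<^sub>1 f\<^sub>2 g. g \<in> L2 \<and> L2_norm g \<le> 1 \<and>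
      (f\<^sub>1, \<lambda>x. g x + \<i> * f\<^sub>1 x) \<in> A \<and> (f\<^sub>2, \<lambda>x. g x + \<i> * f\<^sub>2 x) \<in> B}"

lemma resolvent_dist_eq:
  "self_adjoint A \<Longrightarrow> self_adjoint B \<Longrightarrow> resolvent_dist A B = Sup (resolvent_diffs A B)"
  by (simp add: resolvent_dist_def resolvent_diffs_def)

lemma resolvent_diffs_bounded:
  assumes A: "self_adjoint A" and B: "self_adjoint B" and y: "y \<in> resolvent_diffs A B"
  shows "0 \<le> y" "y \<le> 2"
proof -
  obtain f1 f2 g where *: "y = L2_dist f1 f2" "g \<in> L2" "L2_norm g \<le> 1"
    "(f1, \<lambda>x. g x + \<i> * f1 x) \<in> A" "(f2, \<lambda>x. g x + \<i> * f2 x) \<in> B"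
    using y by (auto simp: resolvent_diffs_def)
  show "0 \<le> y" using * by simp
  have "y \<le> L2_norm f1 + L2_norm f2" unfolding * using self_adjointD(1)[OF A *(4)] self_adjointD(1)[OF B *(5)] by (rule L2_triangle_diff)
  also have "\<dots> \<le> 2" using self_adjoint_resolvent_norm_le[OF A *(2,4)] self_adjoint_resolvent_norm_le[OF B *(2,5)] *(3) by simp
  finally show "y \<le> 2" .
qed

lemma bdd_above_resolvent_diffs:
  "self_adjoint A \<Longrightarrow> self_adjoint B \<Longrightarrow> bdd_above (resolvent_diffs A B)"
  using resolvent_diffs_bounded(2) by (meson bdd_aboveI)

lemma resolvent_diffs_nonempty:
  assumes "self_adjoint A" "self_adjoint B"
  shows "0 \<in> resolvent_diffs A B"
proof -
  have "(\<lambda>x. 0, \<lambda>x. 0 + \<i> * 0) \<in> H" if "self_adjoint H" for H using self_adjointI[OF that L2_zero L2_zero] by simp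
  with assms show ?thesis unfolding resolvent_diffs_def by (intro CollectI exI[of _ "\<lambda>x. 0"]) (auto simp: L2_zero)
qed

lemma resolvent_dist_nonneg: "0 \<le> resolvent_dist A B"
proof (cases "self_adjoint A \<and> self_adjoint B")
  case True
  then show ?thesis using cSup_upper[OF resolvent_diffs_nonempty bdd_above_resolvent_diffs] by (simp add: resolvent_dist_eq)
qed (auto simp: resolvent_dist_def)

lemma resolvent_dist_le:
  assumes "self_adjoint A" "self_adjoint B"
    and "\<And>f\<^sub>1 f\<^sub>2 g. \<lbrakk>g \<in> L2; L2_norm g \<le> 1; (f\<^sub>1, \<lambda>x. g x + \<i> * f\<^sub>1 x) \<in> A; (f\<^sub>2, \<lambda>x. g x + \<i> * f\<^sub>2 x) \<in> B\<rbrakk>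
      \<Longrightarrow> L2_norm (\<lambda>x. f\<^sub>1 x - f\<^sub>2 x) \<le> C"
  shows "resolvent_dist A B \<le> C" unfolding resolvent_dist_eq[OF assms(1,2)]
proof (rule cSup_least)
  show "resolvent_diffs A B \<noteq> {}" using resolvent_diffs_nonempty[OF assms(1,2)] by auto
qed (use assms(3) in \<open>auto simp: resolvent_diffs_def\<close>)

lemma resolvent_dist_ge:
  assumes "self_adjoint A" "self_adjoint B" "g \<in> L2" "L2_norm g \<le> 1"
    "(f\<^sub>1, \<lambda>x. g x + \<i> * f\<^sub>1 x) \<in> A" "(f\<^sub>2, \<lambda>x. g x + \<i> * f\<^sub>2 x) \<in> B"
  shows "L2_norm (\<lambda>x. f\<^sub>1 x - f\<^sub>2 x) \<le> resolvent_dist A B" unfolding resolvent_dist_eq[OF assms(1,2)]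
  using assms by (intro cSup_upper bdd_above_resolvent_diffs) (auto simp: resolvent_diffs_def)

lemma resolvent_dist_commute: "resolvent_dist A B = resolvent_dist B A"
proof -
  have "resolvent_diffs A B = resolvent_diffs B A" unfolding resolvent_diffs_def using L2_norm_minus_commute by blast
  then show ?thesis by (cases "self_adjoint A \<and> self_adjoint B") (auto simp: resolvent_dist_eq, simp_all add: resolvent_dist_def)
qed

lemma resolvent_dist_self:
  assumes "self_adjoint A"
  shows "resolvent_dist A A = 0"
proof (rule antisym)
  show "resolvent_dist A A \<le> 0"
  proof (rule resolvent_dist_le[OF assms assms])
    fix f1 f2 g assume "(f1, \<lambda>x. g x + \<i> * f1 x) \<in> A" "(f2, \<lambda>x. g x + \<i> * f2 x) \<in> A"
    from self_adjoint_diff[OF assms this]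
    have "(\<lambda>x. f1 x - f2 x, \<lambda>x. 0 + \<i> * (f1 x - f2 x)) \<in> A" by (simp add: algebra_simps)
    from self_adjoint_resolvent_norm_le[OF assms L2_zero this]
    show "L2_dist f1 f2 \<le> 0" by simp
  qed
qed (rule resolvent_dist_nonneg)

text \<open>A graph point (f, k) of \<open>A\<close> says that the resolvent of \<open>A\<close>
  sends k - \<i> f to f. Distance 0 gives the same for \<open>B\<close> up to a null set, and one
  inclusion suffices by maximality.\<close>

lemma resolvent_dist_eq_0:
  assumes A: "self_adjoint A" and B: "self_adjoint B" and d: "resolvent_dist A B = 0"
  shows "A = B"
proof (rule self_adjoint_maximal[OF A B], rule subrelI)
  fix f k assume fk: "(f, k) \<in> A"
  note D = self_adjointD[OF A fk]
  define g where "g x = k x - \<i> * f x" for x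
  have g: "g \<in> L2" unfolding g_def using D by (intro L2_intros) auto
  \<comment> \<open>Scales g into the unit ball over which the supremum runs; the added 1 covers g
    of norm 0.\<close>
  define c where "c = complex_of_real (1 / (1 + L2_norm g))"
  have nz: "1 + L2_norm g \<noteq> 0" using L2_norm_nonneg[of g] by linarith
  then have c: "c \<noteq> 0" unfolding c_def of_real_eq_0_iff by simp
  have cn: "L2_norm (\<lambda>x. c * g x) \<le> 1"
  proof -
    have "norm c = 1 / (1 + L2_norm g)" unfolding c_def norm_of_real using L2_norm_nonneg[of g] by simp
    then show ?thesis using L2_norm_nonneg[of g] add_pos_nonneg[of 1 "L2_norm g"] by (simp add: L2_norm_scale divide_le_eq)
  qed
  obtain f2 where f2: "(f2, \<lambda>x. c * g x + \<i> * f2 x) \<in> B"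
    using self_adjoint_resolvent_exists[OF B, of "\<lambda>x. c * g x"] L2_scale[OF g] by blast
  have "(\<lambda>x. c * f x, \<lambda>x. c * g x + \<i> * (c * f x)) \<in> A" using self_adjoint_scale[OF A fk, of c] by (simp add: g_def algebra_simps)
  from resolvent_dist_ge[OF A B L2_scale[OF g] cn this f2] d
  have z: "L2_norm (\<lambda>x. c * f x - f2 x) = 0" using L2_norm_nonneg by (simp add: antisym)
  have f2L: "f2 \<in> L2" using self_adjointD[OF B f2] by simp
  have ae: "AE x in half_line. c * f x - f2 x = 0" using z L2_norm_eq_0_iff[OF L2_diff[OF L2_scale[OF D(1), of c] f2L]] by simp
  have "(\<lambda>x. c * f x, \<lambda>x. c * k x) \<in> B"
  proof (rule self_adjoint_cong_AE[OF B f2])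
    show "AE x in half_line. f2 x = c * f x" using ae by eventually_elim simp
    show "AE x in half_line. c * g x + \<i> * f2 x = c * k x" using ae by eventually_elim (simp add: g_def algebra_simps)
  qed (use D in \<open>auto intro: L2_intros\<close>)
  from self_adjoint_scale[OF B this, of "inverse c"] c show "(f, k) \<in> B" by (simp flip: mult.assoc)
qed

lemma resolvent_dist_triangle:
  assumes A: "self_adjoint A" and B: "self_adjoint B" and C: "self_adjoint C"
  shows "resolvent_dist A C \<le> resolvent_dist A B + resolvent_dist B C"
proof (rule resolvent_dist_le[OF A C])
  fix f1 f3 g assume g: "g \<in> L2" "L2_norm g \<le> 1"
    and f: "(f1, \<lambda>x. g x + \<i> * f1 x) \<in> A" "(f3, \<lambda>x. g x + \<i> * f3 x) \<in> C"
  obtain f2 where f2: "(f2, \<lambda>x. g x + \<i> * f2 x) \<in> B" using self_adjoint_resolvent_exists[OF B g(1)] by blast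
  have "L2_dist f1 f3 \<le> L2_dist f1 f2 + L2_dist f2 f3"
    using self_adjointD(1)[OF A f(1)] self_adjointD(1)[OF B f2] self_adjointD(1)[OF C f(2)] by (rule L2_triangle_dist)
  also have "\<dots> \<le> resolvent_dist A B + resolvent_dist B C"
    using resolvent_dist_ge[OF A B g f(1) f2] resolvent_dist_ge[OF B C g f2 f(2)] by linarith
  finally show "L2_dist f1 f3 \<le> resolvent_dist A B + resolvent_dist B C" .
qed

lemma Metric_space_sa_extensions: "Metric_space (sa_extensions A) resolvent_dist"
proof
  show "0 \<le> resolvent_dist x y" for x y by (rule resolvent_dist_nonneg)
  show "resolvent_dist x y = resolvent_dist y x" for x y by (rule resolvent_dist_commute)
  show "resolvent_dist x y = 0 \<longleftrightarrow> x = y" if "x \<in> sa_extensions A" "y \<in> sa_extensions A" for x y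
    using that resolvent_dist_eq_0 resolvent_dist_self by (auto simp: sa_extensions_def)
  show "resolvent_dist x z \<le> resolvent_dist x y + resolvent_dist y z"
    if "x \<in> sa_extensions A" "y \<in> sa_extensions A" "z \<in> sa_extensions A" for x y z
    using that resolvent_dist_triangle by (auto simp: sa_extensions_def)
qed

subsection \<open>Integrals over subintervals of the half-line\<close>

lemma half_line_integrable_iff:
  fixes h :: "real \<Rightarrow> 'b::euclidean_space"
  shows "integrable half_line h \<longleftrightarrow> h absolutely_integrable_on {0..}"
  unfolding set_integrable_def by (rule integrable_restrict_space) simp

lemma half_line_integral_eq:
  fixes h :: "real \<Rightarrow> 'b::euclidean_space"
  shows "integrable half_line h \<Longrightarrow> integral\<^sup>L half_line h = integral {0..} h" by (rule lebesgue_integral_eq_integral) auto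

lemma absolutely_integrable_Icc_half_line:
  fixes h :: "real \<Rightarrow> 'b::euclidean_space"
  assumes "integrable half_line h" "0 \<le> a"
  shows "h absolutely_integrable_on {a..b}" using assms(1) unfolding half_line_integrable_iff by (rule set_integrable_subset) (use assms(2) in auto)

text \<open>Dominated convergence for the indicators of the sets. Membership has to stabilize only
  almost everywhere, since intervals with positive left ends tending to 0 never contain 0.\<close>

lemma integral_tendsto_sets:
  fixes h :: "real \<Rightarrow> 'b::euclidean_space"
  assumes h: "h absolutely_integrable_on U" and S: "\<And>n::nat. S n \<in> sets lebesgue" "\<And>n. S n \<subseteq> U" "T \<in> sets lebesgue" "T \<subseteq> U"
    and ev: "AE x in lebesgue. \<forall>\<^sub>F n in sequentially. x \<in> S n \<longleftrightarrow> x \<in> T"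
  shows "(\<lambda>n. integral (S n) h) \<longlonglongrightarrow> integral T h"
proof -
  have si: "h absolutely_integrable_on S n" "h absolutely_integrable_on T" for n using set_integrable_subset[OF h] S by auto
  have "(\<lambda>n. integral\<^sup>L lebesgue (\<lambda>x. indicator (S n) x *\<^sub>R h x)) \<longlonglongrightarrow> integral\<^sup>L lebesgue (\<lambda>x. indicator T x *\<^sub>R h x)"
  proof (rule integral_dominated_convergence)
    show "integrable lebesgue (\<lambda>x. norm (indicat_real U x *\<^sub>R h x))" using h unfolding set_integrable_def by (rule integrable_norm)
    show "(\<lambda>x. indicat_real T x *\<^sub>R h x) \<in> borel_measurable lebesgue"
      "(\<lambda>x. indicat_real (S n) x *\<^sub>R h x) \<in> borel_measurable lebesgue" for n
      using si unfolding set_integrable_def by auto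
    show "AE x in lebesgue. (\<lambda>n. indicat_real (S n) x *\<^sub>R h x) \<longlonglongrightarrow> indicat_real T x *\<^sub>R h x" using ev
    proof eventually_elim
      case (elim x)
      then have "\<forall>\<^sub>F n in sequentially. indicat_real (S n) x *\<^sub>R h x = indicat_real T x *\<^sub>R h x"
        by eventually_elim (auto simp: indicator_def)
      then show ?case by (rule tendsto_eventually)
    qed
    show "AE x in lebesgue. norm (indicat_real (S n) x *\<^sub>R h x) \<le> norm (indicat_real U x *\<^sub>R h x)" for n
      using S(2) by (auto simp: indicator_def)
  qed
  then show ?thesis using si set_lebesgue_integral_eq_integral(2)[OF si(1)] set_lebesgue_integral_eq_integral(2)[OF si(2)]
    by (simp add: set_lebesgue_integral_def)
qed

lemma integral_Icc_tendsto_at_top: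
  fixes h :: "real \<Rightarrow> 'b::euclidean_space"
  assumes "h absolutely_integrable_on {a..}"
  shows "((\<lambda>b. integral {a..b} h) \<longlongrightarrow> integral {a..} h) at_top"
proof (rule tendsto_at_topI_sequentially)
  fix X :: "nat \<Rightarrow> real" assume X: "filterlim X at_top sequentially"
  show "(\<lambda>n. integral {a..X n} h) \<longlonglongrightarrow> integral {a..} h"
  proof (rule integral_tendsto_sets[OF assms])
    show "AE x in lebesgue. \<forall>\<^sub>F n in sequentially. (x \<in> {a..X n}) = (x \<in> {a..})"
    proof (rule AE_I2)
      fix x
      have "\<forall>\<^sub>F n in sequentially. x \<le> X n" using X by (simp add: filterlim_at_top)
      then show "\<forall>\<^sub>F n in sequentially. (x \<in> {a..X n}) = (x \<in> {a..})" by eventually_elim auto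
    qed
  qed auto
qed

lemma half_line_integral_tendsto:
  fixes h :: "real \<Rightarrow> 'b::euclidean_space"
  assumes h: "integrable half_line h" and a: "\<And>n. 0 < a n" "a \<longlonglongrightarrow> 0" and b: "filterlim b at_top sequentially"
  shows "(\<lambda>n. integral {a n..b n} h) \<longlonglongrightarrow> integral\<^sup>L half_line h" unfolding half_line_integral_eq[OF h]
proof (rule integral_tendsto_sets)
  show "h absolutely_integrable_on {0..}" using h by (simp add: half_line_integrable_iff)
  show "{a n..b n} \<subseteq> {0..}" for n using a(1)[of n] by auto
  have "\<forall>\<^sub>F n in sequentially. (x \<in> {a n..b n}) = (x \<in> {0..})" if "x \<noteq> 0" for x
  proof (cases "x < 0")
    case True
    then show ?thesis using a(1) by (intro always_eventually) (auto simp: not_le intro: less_trans)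
  next
    case False
    with that have "x > 0" by simp
    then have "\<forall>\<^sub>F n in sequentially. a n < x" using order_tendstoD(2)[OF a(2)] by auto
    moreover have "\<forall>\<^sub>F n in sequentially. x \<le> b n" using b by (simp add: filterlim_at_top)
    ultimately show ?thesis by eventually_elim (use \<open>x > 0\<close> in auto)
  qed
  with AE_lebesgue_nonzero show "AE x in lebesgue. \<forall>\<^sub>F n in sequentially. (x \<in> {a n..b n}) = (x \<in> {0..})" by (auto elim: AE_mp)
qed auto

lemma integral_Icc_tendsto_at_right_0:
  fixes h :: "real \<Rightarrow> 'b::euclidean_space"
  assumes "h integrable_on {0..b}" "0 < b"
  shows "((\<lambda>a. integral {a..b} h) \<longlongrightarrow> integral {0..b} h) (at_right 0)"
proof -
  have "continuous_on {0..b} (\<lambda>x. integral {x..b} h)" using indefinite_integral_continuous_1'[OF assms(1)] .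
  then have "((\<lambda>a. integral {a..b} h) \<longlongrightarrow> integral {0..b} h) (at 0 within {0..b})"
    using assms(2) by (auto simp: continuous_on_def)
  then have "((\<lambda>a. integral {a..b} h) \<longlongrightarrow> integral {0..b} h) (at 0 within {0<..<b})" by (rule tendsto_within_subset) auto
  moreover have "at 0 within {0<..<b} = at_right 0" using assms(2) by (intro at_within_nhd[of 0 "{..<b}"]) auto
  ultimately show ?thesis by simp
qed

lemma half_line_integral_support:
  fixes h :: "real \<Rightarrow> 'b::euclidean_space"
  assumes h: "h absolutely_integrable_on {a..b}" and "0 \<le> a" and z: "\<And>x. x \<notin> {a..b} \<Longrightarrow> h x = 0"
  shows "integrable half_line h" "integral\<^sup>L half_line h = integral {a..b} h"
proof -
  have "(\<lambda>x. indicat_real {0..} x *\<^sub>R h x) = (\<lambda>x. indicat_real {a..b} x *\<^sub>R h x)"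
    using z \<open>0 \<le> a\<close> by (auto simp: indicator_def fun_eq_iff)
  then show i: "integrable half_line h" using h unfolding half_line_integrable_iff set_integrable_def by simp
  show "integral\<^sup>L half_line h = integral {a..b} h" unfolding half_line_integral_eq[OF i]
  proof (rule integral_spike_set)
    have e: "{x \<in> {0..} - {a..b}. h x \<noteq> 0} = {}" "{x \<in> {a..b} - {0..}. h x \<noteq> 0} = {}" using z \<open>0 \<le> a\<close> by auto
    show "negligible {x \<in> {0..} - {a..b}. h x \<noteq> 0}" unfolding e by (rule negligible_empty)
    show "negligible {x \<in> {a..b} - {0..}. h x \<noteq> 0}" unfolding e by (rule negligible_empty)
  qed
qed

text \<open>Almost everywhere, a function is the derivative of its indefinite integral.\<close>
lemma zero_Icc_integrals_imp_AE_zero: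
  fixes h :: cfun
  assumes h: "\<And>a b. 0 < a \<Longrightarrow> a < b \<Longrightarrow> h absolutely_integrable_on {a..b}"
    and z: "\<And>a b. 0 < a \<Longrightarrow> a < b \<Longrightarrow> integral {a..b} h = 0"
  shows "AE x in half_line. h x = 0"
proof -
  have 1: "AE x in lebesgue. x > 1 / Suc n \<longrightarrow> h x = 0" for n :: nat
  proof -
    \<comment> \<open>Cutting off at 1 / Suc n gives a function integrable on every interval, also
      on those that reach 0, where h need not be integrable; only then does the differentiation
      theorem apply.\<close>
    define k where "k x = (if x \<in> {1 / Suc n..} then h x else 0)" for x
    have r: "{1 / Suc n..} \<inter> {a..b} = {max (1 / Suc n) a..b}" for a b by auto
    have ki: "k integrable_on cbox a b" for a b unfolding k_def cbox_interval integrable_restrict_Int r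
      using h[of "max (1 / Suc n) a" b] integrable_on_refl[of h b] by (cases "max (1 / Suc n) a" b rule: linorder_cases)
        (auto simp: absolutely_integrable_on_def less_max_iff_disj simp del: of_nat_Suc)
    obtain N where N: "negligible N"
      "\<forall>x e. x \<notin> N \<longrightarrow> 0 < e \<longrightarrow> (\<exists>d>0. \<forall>t. 0 < t \<and> t < d \<longrightarrow>
        norm (integral (cbox x (x + t *\<^sub>R One)) k /\<^sub>R t ^ DIM(real) - k x) < e)"
      by (rule integrable_ccontinuous_explicit[OF ki], rule that, assumption, simp)
    have "h x = 0" if x: "x \<notin> N" "x > 1 / Suc n" for x
    proof (rule ccontr)
      assume "h x \<noteq> 0"
      then obtain d where d: "d > 0" "\<And>t. 0 < t \<and> t < d \<Longrightarrow> norm (integral {x..x + t} k /\<^sub>R t - k x) < norm (h x)"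
        using N(2)[rule_format, OF x(1), of "norm (h x)"] by (auto simp: cbox_interval)
      have "{1 / Suc n..} \<inter> {x..x + d/2} = {x..x + d/2}" "0 < x" using x by (auto intro: less_trans[rotated])
      then have "integral {x..x + d/2} k = 0" unfolding k_def integral_restrict_Int using z[of x] d(1) by simp
      with d(2)[of "d/2"] d(1) x show False by (simp add: k_def)
    qed
    with N(1) show ?thesis by (intro AE_I'[of N]) (auto simp: negligible_iff_null_sets)
  qed
  have "AE x in lebesgue. \<forall>n::nat. x > 1 / Suc n \<longrightarrow> h x = 0" unfolding AE_all_countable using 1 by blast
  with AE_lebesgue_nonzero have "AE x in lebesgue. x \<in> {0..} \<longrightarrow> h x = 0"
    by eventually_elim (metis atLeast_iff inverse_eq_divide order_le_imp_less_or_eq reals_Archimedean)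
  then show ?thesis by (subst AE_restrict_space_iff) auto
qed

subsection \<open>Smooth functions and test functions\<close>

definition smooth :: "cfun \<Rightarrow> bool" where
  "smooth f \<longleftrightarrow> (\<exists>D :: nat \<Rightarrow> real \<Rightarrow> complex. D 0 = f \<and>
        (\<forall>n x. (D n has_vector_derivative D (Suc n) x) (at x)))"

text \<open>Choosing a derivative inside the class and iterating the choice yields the tower of
  derivatives. Proving smoothness thus amounts to exhibiting a class closed under
  differentiation.\<close>

lemma smooth_coinduct:
  assumes "P f" and step: "\<And>g. P g \<Longrightarrow> \<exists>g'. P g' \<and> (\<forall>x. (g has_vector_derivative g' x) (at x))"
  shows "smooth f"
proof -
  obtain F where F: "\<And>g. P g \<Longrightarrow> P (F g) \<and> (\<forall>x. (g has_vector_derivative F g x) (at x))" using step by metis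
  have "P ((F ^^ n) f)" for n by (induction n) (use assms(1) F in auto)
  with F show ?thesis unfolding smooth_def by (intro exI[of _ "\<lambda>n. (F ^^ n) f"]) simp
qed

lemma smooth_derivE:
  assumes "smooth f"
  obtains f' where "smooth f'" "\<And>x. (f has_vector_derivative f' x) (at x)"
proof -
  obtain D where D: "D 0 = f" "\<And>n x. (D n has_vector_derivative D (Suc n) x) (at x)" using assms by (auto simp: smooth_def)
  have "smooth (D 1)" unfolding smooth_def by (intro exI[of _ "\<lambda>n. D (Suc n)"]) (use D(2) in auto)
  with D(1) D(2)[of 0] show ?thesis by (intro that[of "D 1"]) auto
qed

lemma smooth_if_deriv:
  assumes "smooth f'" "\<And>x. (f has_vector_derivative f' x) (at x)"
  shows "smooth f" by (rule smooth_coinduct[of "\<lambda>g. g = f \<or> smooth g"]) (use assms in \<open>auto elim: smooth_derivE\<close>)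

text \<open>The derivative of a product is a sum of products, so the algebra generated by the smooth
  functions is the invariant from which closure under sums and products follows by
  coinduction.\<close>

inductive_set smooth_span :: "cfun set" where
  base: "smooth f \<Longrightarrow> f \<in> smooth_span"
| add: "f \<in> smooth_span \<Longrightarrow> g \<in> smooth_span \<Longrightarrow> (\<lambda>x. f x + g x) \<in> smooth_span"
| mult: "f \<in> smooth_span \<Longrightarrow> g \<in> smooth_span \<Longrightarrow> (\<lambda>x. f x * g x) \<in> smooth_span"

lemma smooth_span_smooth:
  assumes "f \<in> smooth_span"
  shows "smooth f"
proof (rule smooth_coinduct[of "\<lambda>g. g \<in> smooth_span"])
  fix g assume "g \<in> smooth_span"
  then show "\<exists>g'. g' \<in> smooth_span \<and> (\<forall>x. (g has_vector_derivative g' x) (at x))"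
  proof induction
    case (base f)
    then show ?case by (meson smooth_derivE smooth_span.base)
  next
    case (add f g)
    then obtain f' g' where *: "f' \<in> smooth_span" "g' \<in> smooth_span"
      "\<And>x. (f has_vector_derivative f' x) (at x)" "\<And>x. (g has_vector_derivative g' x) (at x)" by blast
    then have "(\<lambda>x. f' x + g' x) \<in> smooth_span" by (intro smooth_span.add)
    moreover have "((\<lambda>x. f x + g x) has_vector_derivative f' x + g' x) (at x)" for x by (intro has_vector_derivative_add *)
    ultimately show ?case by blast
  next
    case (mult f g)
    then obtain f' g' where *: "f' \<in> smooth_span" "g' \<in> smooth_span"
      "\<And>x. (f has_vector_derivative f' x) (at x)" "\<And>x. (g has_vector_derivative g' x) (at x)" by blast
    then have "(\<lambda>x. f x * g' x + f' x * g x) \<in> smooth_span" using mult by (intro smooth_span.add smooth_span.mult) auto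
    moreover have "((\<lambda>x. f x * g x) has_vector_derivative f x * g' x + f' x * g x) (at x)" for x by (intro has_vector_derivative_mult *)
    ultimately show ?case by blast
  qed
qed (rule assms)

lemma smooth_add: "smooth f \<Longrightarrow> smooth g \<Longrightarrow> smooth (\<lambda>x. f x + g x)"
  by (rule smooth_span_smooth, rule smooth_span.add; rule smooth_span.base)

lemma smooth_mult: "smooth f \<Longrightarrow> smooth g \<Longrightarrow> smooth (\<lambda>x. f x * g x)"
  by (rule smooth_span_smooth, rule smooth_span.mult; rule smooth_span.base)

lemma smooth_const: "smooth (\<lambda>x. c)"
  by (rule smooth_coinduct[of "\<lambda>g. \<exists>c. g = (\<lambda>x. c)"]) (auto intro: has_vector_derivative_const)

lemma smooth_scale: "smooth f \<Longrightarrow> smooth (\<lambda>x. c * f x)" by (intro smooth_mult smooth_const)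

lemma smooth_affine:
  assumes "smooth f"
  shows "smooth (\<lambda>x. f (a * x + b))"
proof (rule smooth_coinduct[of "\<lambda>g. \<exists>f c. smooth f \<and> g = (\<lambda>x. c * f (a * x + b))"])
  show "\<exists>h c. smooth h \<and> (\<lambda>x. f (a * x + b)) = (\<lambda>x. c * h (a * x + b))" using assms by (intro exI[of _ f] exI[of _ 1]) auto
  fix g assume "\<exists>f c. smooth f \<and> g = (\<lambda>x. c * f (a * x + b))"
  then obtain f c where f: "smooth f" and g: "g = (\<lambda>x. c * f (a * x + b))" by blast
  obtain f' where f': "smooth f'" "\<And>x. (f has_vector_derivative f' x) (at x)" using smooth_derivE[OF f] by blast
  have "(g has_vector_derivative (c * of_real a) * f' (a * x + b)) (at x)" for x
  proof -
    have "((\<lambda>x. a * x + b) has_vector_derivative a) (at x)"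
      by (auto intro!: derivative_eq_intros simp flip: has_real_derivative_iff_has_vector_derivative)
    from vector_diff_chain_at[OF this f'(2)]
    have "((\<lambda>x. f (a * x + b)) has_vector_derivative a *\<^sub>R f' (a * x + b)) (at x)" by (simp add: o_def)
    then show ?thesis unfolding g by (auto intro!: derivative_eq_intros simp: scaleR_conv_of_real)
  qed
  then show "\<exists>g'. (\<exists>f c. smooth f \<and> g' = (\<lambda>x. c * f (a * x + b))) \<and> (\<forall>x. (g has_vector_derivative g' x) (at x))"
    using f'(1) by (intro exI[of _ "\<lambda>x. (c * of_real a) * f' (a * x + b)"]) blast
qed

lemma smooth_cnj:
  assumes "smooth f"
  shows "smooth (\<lambda>x. cnj (f x))"
proof (rule smooth_coinduct[of "\<lambda>g. \<exists>f. smooth f \<and> g = (\<lambda>x. cnj (f x))"])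
  fix g assume "\<exists>f. smooth f \<and> g = (\<lambda>x. cnj (f x))"
  then obtain f where f: "smooth f" and g: "g = (\<lambda>x. cnj (f x))" by blast
  obtain f' where "smooth f'" "\<And>x. (f has_vector_derivative f' x) (at x)" using smooth_derivE[OF f] by blast
  then show "\<exists>g'. (\<exists>f. smooth f \<and> g' = (\<lambda>x. cnj (f x))) \<and> (\<forall>x. (g has_vector_derivative g' x) (at x))"
    unfolding g by (intro exI[of _ "\<lambda>x. cnj (f' x)"]) (auto intro: has_vector_derivative_cnj)
qed (use assms in blast)

lemma smooth_continuous_on: "smooth f \<Longrightarrow> continuous_on S f"
  by (meson smooth_derivE has_vector_derivative_continuous continuous_at_imp_continuous_on)

text \<open>All derivatives of \<open>exp (- 1 / x)\<close> have the form \<open>p (1 / x) exp (- 1 / x)\<close> with a polynomial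
  \<open>p\<close>, so extension by \<open>0\<close> to the left stays differentiable at every stage.\<close>

definition flat_exp :: "real poly \<Rightarrow> real \<Rightarrow> complex" where
  "flat_exp p x = of_real (if x > 0 then poly p (1 / x) * exp (- (1 / x)) else 0)"

lemma poly_times_exp_minus_tendsto_0: "((\<lambda>u::real. poly p u * exp (- u)) \<longlongrightarrow> 0) at_top"
proof (induction p)
  case 0 show ?case by simp
next
  case (pCons a p)
  have e: "((\<lambda>u::real. exp (- u)) \<longlongrightarrow> 0) at_top" using tendsto_power_div_exp_0[of 0] by (simp add: exp_minus divide_inverse)
  have "((\<lambda>u::real. u * poly p u * exp (- u)) \<longlongrightarrow> 0) at_top"
  proof -
    have "((\<lambda>u::real. poly (monom 1 1 * p) u / exp u) \<longlongrightarrow> 0) at_top"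
    proof -
      have "((\<lambda>u::real. (\<Sum>i\<le>degree (monom 1 1 * p). coeff (monom 1 1 * p) i * (u ^ i / exp u))) \<longlongrightarrow>
         (\<Sum>i\<le>degree (monom 1 1 * p). coeff (monom 1 1 * p) i * 0)) at_top"
        by (intro tendsto_sum tendsto_mult tendsto_const tendsto_power_div_exp_0)
      then show ?thesis by (simp add: poly_altdef sum_divide_distrib)
    qed
    then show ?thesis by (simp add: poly_monom exp_minus divide_inverse mult.assoc)
  qed
  from tendsto_add[OF tendsto_mult[OF tendsto_const[of a] e] this]
  show ?case by (simp add: algebra_simps)
qed

text \<open>With u = 1 / x, differentiation sends p(u) exp(-u) to u^2 (p - p')(u) exp(-u). At 0 the
  difference quotients tend to 0, because exp(-u) beats every polynomial.\<close>

lemma flat_exp_deriv: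
  "(flat_exp p has_vector_derivative flat_exp (monom 1 2 * (p - pderiv p)) x) (at x)"
proof -
  define h where "h x = (if x > 0 then poly p (1 / x) * exp (- (1 / x)) else 0)" for x :: real
  define h' where "h' x = (if x > 0 then poly (monom 1 2 * (p - pderiv p)) (1 / x) * exp (- (1 / x)) else 0)" for x :: real
  have "(h has_real_derivative h' x) (at x)"
  proof -
    consider "x > 0" | "x < 0" | "x = 0" by linarith
    then show ?thesis
    proof cases
      case 1
      have "((\<lambda>x. poly p (1 / x) * exp (- (1 / x))) has_real_derivative h' x) (at x)" using 1 unfolding h'_def
        by (auto intro!: derivative_eq_intros simp: poly_monom power2_eq_square field_simps)
      then show ?thesis
      proof (rule DERIV_cong_ev[THEN iffD1, OF refl _ refl, rotated])
        show "\<forall>\<^sub>F y in nhds x. poly p (1 / y) * exp (- (1 / y)) = h y"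
          using eventually_nhds_in_open[of "{0<..}" x] 1 by (auto elim!: eventually_mono simp: h_def)
      qed
    next
      case 2
      have "((\<lambda>x. 0) has_real_derivative h' x) (at x)" using 2 by (simp add: h'_def)
      then show ?thesis
      proof (rule DERIV_cong_ev[THEN iffD1, OF refl _ refl, rotated])
        show "\<forall>\<^sub>F y in nhds x. 0 = h y" using eventually_nhds_in_open[of "{..<0}" x] 2 by (auto elim!: eventually_mono simp: h_def)
      qed
    next
      case 3
      have "((\<lambda>y. h y / y) \<longlongrightarrow> 0) (at 0)"
      proof (rule filterlim_split_at)
        show "((\<lambda>y. h y / y) \<longlongrightarrow> 0) (at_left 0)"
        proof (rule tendsto_eventually)
          show "\<forall>\<^sub>F y in at_left 0. h y / y = 0" unfolding eventually_at_left_field by (intro exI[of _ "-1"]) (auto simp: h_def)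
        qed
        \<comment> \<open>\<open>pCons 0 p\<close> is the polynomial u p(u): division by y = 1 / u
          costs one factor u.\<close>
        have "((\<lambda>y. poly (pCons 0 p) (inverse y) * exp (- inverse y)) \<longlongrightarrow> 0) (at_right (0::real))"
          by (rule filterlim_compose[OF poly_times_exp_minus_tendsto_0 filterlim_inverse_at_top_right])
        moreover have "\<forall>\<^sub>F y in at_right 0. poly (pCons 0 p) (inverse y) * exp (- inverse y) = h y / y"
          unfolding eventually_at_right_field by (intro exI[of _ 1]) (auto simp: h_def field_simps)
        ultimately show "((\<lambda>y. h y / y) \<longlongrightarrow> 0) (at_right 0)" by (rule Lim_transform_eventually)
      qed
      then show ?thesis unfolding has_field_derivative_iff 3 by (simp add: h_def h'_def)
    qed
  qed
  then have "((\<lambda>x. complex_of_real (h x)) has_vector_derivative complex_of_real (h' x)) (at x)"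
    by (intro has_vector_derivative_of_real) (simp add: has_real_derivative_iff_has_vector_derivative)
  then show ?thesis unfolding flat_exp_def[abs_def] h_def h'_def .
qed

lemma smooth_flat_exp: "smooth (flat_exp p)" by (rule smooth_coinduct[of "\<lambda>g. \<exists>p. g = flat_exp p"]) (use flat_exp_deriv in blast)+

text \<open>A product of two reflected copies of exp (- 1 / x), flat at a and b. As \<open>c\<close>
  decreases to 0 the bumps increase to the indicator of the open interval.\<close>

definition bump :: "real \<Rightarrow> real \<Rightarrow> real \<Rightarrow> real \<Rightarrow> complex" where
  "bump c a b x = of_real (if x \<in> {a<..<b} then exp (- (c / (x - a))) * exp (- (c / (b - x))) else 0)"

lemma test_functions_iff:
  "f \<in> test_functions \<longleftrightarrow> smooth f \<and> (\<exists>a b. 0 < a \<and> (\<forall>x. x \<notin> {a..b} \<longrightarrow> f x = 0))"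
  unfolding test_functions_def smooth_def by blast

lemma bump_test_function:
  assumes "c > 0" "0 < a"
  shows "bump c a b \<in> test_functions"
proof -
  have "bump c a b = (\<lambda>x. flat_exp 1 ((1 / c) * x + (- a / c)) * flat_exp 1 ((- 1 / c) * x + b / c))"
  proof
    fix x
    have 1: "(1 / c) * x + (- a / c) = (x - a) / c" "(- 1 / c) * x + b / c = (b - x) / c" by (simp_all add: diff_divide_distrib)
    have 2: "(x - a) / c > 0 \<longleftrightarrow> a < x" "(b - x) / c > 0 \<longleftrightarrow> x < b"
      using assms(1) by (simp_all add: zero_less_divide_iff)
    show "bump c a b x = flat_exp 1 ((1 / c) * x + (- a / c)) * flat_exp 1 ((- 1 / c) * x + b / c)"
      unfolding 1 bump_def flat_exp_def 2 using assms(1) by simp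
  qed
  then have "smooth (bump c a b)" by (simp only: smooth_mult smooth_affine smooth_flat_exp)
  moreover have "\<forall>x. x \<notin> {a..b} \<longrightarrow> bump c a b x = 0" by (auto simp: bump_def)
  ultimately show ?thesis using assms(2) by (auto simp: test_functions_iff)
qed

lemma test_function_derivs:
  assumes "f \<in> test_functions"
  shows "\<exists>f' f'' a b. 0 < a \<and> a < b \<and> f' \<in> test_functions \<and> f'' \<in> test_functions \<and>
    (\<forall>x. (f has_vector_derivative f' x) (at x)) \<and> (\<forall>x. (f' has_vector_derivative f'' x) (at x)) \<and>
    (\<forall>x. x \<notin> {a<..<b} \<longrightarrow> f x = 0 \<and> f' x = 0 \<and> f'' x = 0)"
proof -
  obtain a0 b0 where ab0: "0 < a0" "\<And>x. x \<notin> {a0..b0} \<Longrightarrow> f x = 0" and sm: "smooth f"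
    using assms by (auto simp: test_functions_iff)
  \<comment> \<open>The interval is widened so that f and its derivatives vanish at the endpoints
    themselves and integration by parts has no boundary terms. The maximum ensures a < b even when
    the given interval is empty.\<close>
  define a b where "a = a0 / 2" and "b = max (b0 + 1) a0"
  have ab: "0 < a" "a < b" using ab0(1) by (auto simp: a_def b_def max_def)
  have out: "open (- {a0..b0})" "x \<in> - {a0..b0}" if "x \<notin> {a<..<b}" for x using that ab0(1) by (auto simp: a_def b_def max_def split: if_splits)
  obtain f' where f': "smooth f'" "\<And>x. (f has_vector_derivative f' x) (at x)" using smooth_derivE[OF sm] by blast
  obtain f'' where f'': "smooth f''" "\<And>x. (f' has_vector_derivative f'' x) (at x)" using smooth_derivE[OF f'(1)] by blast
  have zd: "g' x = 0" if "\<And>x. (g has_vector_derivative g' x) (at x)" "\<And>x. x \<notin> {a0..b0} \<Longrightarrow> g x = 0"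
    "x \<notin> {a0..b0}" for g g' :: cfun and x
  proof -
    have "(g has_vector_derivative 0) (at x)"
    proof (rule has_vector_derivative_transform_within_open[of "\<lambda>x. 0" 0 x "- {a0..b0}"])
      show "open (- {a0..b0})" by (simp add: open_Compl)
    qed (use that in auto)
    with that(1) show ?thesis using vector_derivative_unique_at by blast
  qed
  have z1: "x \<notin> {a0..b0} \<Longrightarrow> f' x = 0" for x using zd[OF f'(2) ab0(2)] .
  have z2: "x \<notin> {a0..b0} \<Longrightarrow> f'' x = 0" for x using zd[OF f''(2) z1] .
  have "f' \<in> test_functions" "f'' \<in> test_functions" using f'(1) f''(1) z1 z2 ab0(1) by (auto simp: test_functions_iff)
  moreover have "f x = 0 \<and> f' x = 0 \<and> f'' x = 0" if "x \<notin> {a<..<b}" for x using out(2)[OF that] ab0(2) z1 z2 by auto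
  ultimately show ?thesis using ab f'(2) f''(2) by blast
qed

lemma test_function_add:
  assumes "f \<in> test_functions" "g \<in> test_functions"
  shows "(\<lambda>x. f x + g x) \<in> test_functions"
proof -
  obtain a b c d where "0 < a" "0 < c" "\<And>x. x \<notin> {a..b} \<Longrightarrow> f x = 0" "\<And>x. x \<notin> {c..d} \<Longrightarrow> g x = 0"
    using assms by (auto simp: test_functions_iff)
  then have "0 < min a c" "\<And>x. x \<notin> {min a c..max b d} \<Longrightarrow> f x = 0 \<and> g x = 0"
    by (auto simp: min_def max_def split: if_splits)
  then have "0 < min a c" "\<forall>x. x \<notin> {min a c..max b d} \<longrightarrow> f x + g x = 0" by simp_all
  then show ?thesis using assms smooth_add[of f g] unfolding test_functions_iff by blast
qed

lemma test_function_scale: "f \<in> test_functions \<Longrightarrow> (\<lambda>x. c * f x) \<in> test_functions"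
  using smooth_scale[of f c] unfolding test_functions_iff by fastforce

lemma test_function_cnj: "f \<in> test_functions \<Longrightarrow> (\<lambda>x. cnj (f x)) \<in> test_functions"
  using smooth_cnj[of f] unfolding test_functions_iff by fastforce

lemma test_function_diff:
  "f \<in> test_functions \<Longrightarrow> g \<in> test_functions \<Longrightarrow> (\<lambda>x. f x - g x) \<in> test_functions"
  using test_function_add[OF _ test_function_scale[of g "-1"], of f] by simp

lemma test_function_zero: "(\<lambda>x. 0) \<in> test_functions" unfolding test_functions_iff using smooth_const[of 0] zero_less_one by blast

lemma test_function_continuous_on: "f \<in> test_functions \<Longrightarrow> continuous_on S f" by (auto simp: test_functions_iff smooth_continuous_on)

lemma continuous_compact_support_L2:
  fixes f :: cfun
  assumes c: "continuous_on {a..b} f" and "0 \<le> a" and z: "\<And>x. x \<notin> {a..b} \<Longrightarrow> f x = 0"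
  shows "f \<in> L2"
proof -
  have ac: "g absolutely_integrable_on {a..b}" if "continuous_on {a..b} g" for g :: "real \<Rightarrow> 'b::euclidean_space"
    using absolutely_integrable_continuous[of a b g] that by simp
  have "integrable half_line f" by (rule half_line_integral_support[OF ac[OF c] assms(2)]) (use z in auto)
  moreover have "integrable half_line (\<lambda>x. (norm (f x))^2)"
    by (rule half_line_integral_support[OF ac assms(2)]) (use z in \<open>auto intro!: continuous_intros c\<close>)
  ultimately show ?thesis by (simp add: L2_def)
qed

lemma test_function_L2:
  assumes "f \<in> test_functions"
  shows "f \<in> L2"
proof -
  obtain a b where "0 < a" "\<And>x. x \<notin> {a..b} \<Longrightarrow> f x = 0" using assms by (auto simp: test_functions_iff)
  then show ?thesis by (intro continuous_compact_support_L2[of a b]) (auto intro: test_function_continuous_on assms)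
qed

subsection \<open>Local integrability and the fundamental lemma\<close>

lemma absolutely_integrable_mult_continuous:
  fixes h k :: cfun
  assumes h: "continuous_on {a..b} h" and k: "k absolutely_integrable_on {a..b}"
  shows "(\<lambda>x. h x * k x) absolutely_integrable_on {a..b}"
proof -
  have ki: "integrable (lebesgue_on {a..b}) k" using k by (intro absolutely_integrable_imp_integrable) auto
  have hm: "h \<in> borel_measurable (lebesgue_on {a..b})" using h by (intro continuous_imp_measurable_on_sets_lebesgue) auto
  have "bounded (h ` {a..b})" using h by (intro compact_imp_bounded compact_continuous_image) auto
  then obtain B where B: "\<And>x. x \<in> {a..b} \<Longrightarrow> norm (h x) \<le> B" unfolding bounded_iff by blast
  have "integrable (lebesgue_on {a..b}) (\<lambda>x. h x * k x)"
  proof (rule Bochner_Integration.integrable_bound)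
    show "integrable (lebesgue_on {a..b}) (\<lambda>x. of_real B * k x)" using ki by simp
    show "(\<lambda>x. h x * k x) \<in> borel_measurable (lebesgue_on {a..b})" using hm borel_measurable_integrable[OF ki] by measurable
    show "AE x in lebesgue_on {a..b}. norm (h x * k x) \<le> norm (of_real B * k x)"
    proof (rule AE_I2)
      fix x assume "x \<in> space (lebesgue_on {a..b})"
      then have "norm (h x) \<le> B" using B by simp
      then show "norm (h x * k x) \<le> norm (of_real B * k x)" by (auto simp: norm_mult intro!: mult_right_mono)
    qed
  qed
  then show ?thesis unfolding set_integrable_def by (subst integrable_restrict_space[symmetric]) auto
qed

text \<open>On the interval, g is its product with the indicator, and a product of two
  square-integrable functions is integrable.\<close>

lemma L2_absolutely_integrable_Icc:
  assumes g: "g \<in> L2" and a: "0 \<le> a"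
  shows "g absolutely_integrable_on {a..b}"
proof -
  define u :: cfun where "u x = (if x \<in> {a..b} then 1 else 0)" for x
  have "(\<lambda>x. 1::complex) absolutely_integrable_on {a..b}" "(\<lambda>x. 1::real) absolutely_integrable_on {a..b}"
    by (rule absolutely_integrable_continuous_real, rule continuous_on_const)+
  note one = this
  have "u absolutely_integrable_on {a..b}" by (rule set_integrable_cong[THEN iffD2, OF refl refl _ one(1)]) (simp add: u_def)
  moreover have "(\<lambda>x. (norm (u x))^2) absolutely_integrable_on {a..b}"
    by (rule set_integrable_cong[THEN iffD2, OF refl refl _ one(2)]) (simp add: u_def)
  ultimately have "u \<in> L2" using half_line_integral_support(1)[of a b u] half_line_integral_support(1)[of a b "\<lambda>x. (norm (u x))^2"] a
    by (auto simp: L2_def u_def)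
  from absolutely_integrable_Icc_half_line[OF L2_integrable_mult[OF this g] a, of b]
  show ?thesis by (rule set_integrable_cong[THEN iffD1, OF refl refl, rotated]) (auto simp: u_def)
qed

text \<open>Only intervals that stay away from 0 are tested, because the potential is singular
  there.\<close>

definition locally_integrable :: "cfun \<Rightarrow> bool" where
  "locally_integrable h \<longleftrightarrow> (\<forall>a b. 0 < a \<longrightarrow> h absolutely_integrable_on {a..b})"

lemma L2_locally_integrable: "g \<in> L2 \<Longrightarrow> locally_integrable g"
  unfolding locally_integrable_def using L2_absolutely_integrable_Icc less_imp_le by blast

lemma continuous_locally_integrable: "continuous_on {0<..} h \<Longrightarrow> locally_integrable h" unfolding locally_integrable_def
  by (auto intro!: absolutely_integrable_continuous_real elim!: continuous_on_subset)

lemma locally_integrable_mult: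
  assumes "continuous_on {0<..} h" "locally_integrable k"
  shows "locally_integrable (\<lambda>x. h x * k x)" using assms unfolding locally_integrable_def
  by (auto intro!: absolutely_integrable_mult_continuous elim!: continuous_on_subset)

lemma locally_integrable_diff:
  "locally_integrable h \<Longrightarrow> locally_integrable k \<Longrightarrow> locally_integrable (\<lambda>x. h x - k x)"
  unfolding locally_integrable_def by auto

lemma locally_integrable_const: "locally_integrable (\<lambda>x. c)" by (intro continuous_locally_integrable continuous_intros)

lemma test_function_mult_integral:
  assumes f: "f \<in> test_functions" and h: "locally_integrable h"
  shows "integrable half_line (\<lambda>x. f x * h x)"
    and "0 < a \<Longrightarrow> (\<And>x. x \<notin> {a..b} \<Longrightarrow> f x = 0) \<Longrightarrow>
      (LINT x|half_line. f x * h x) = integral {a..b} (\<lambda>x. f x * h x)"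
proof -
  have *: "(\<lambda>x. f x * h x) absolutely_integrable_on {a..b}" if "0 < a" for a b using h that unfolding locally_integrable_def
    by (intro absolutely_integrable_mult_continuous test_function_continuous_on f) auto
  obtain a b where ab: "0 < a" "\<And>x. x \<notin> {a..b} \<Longrightarrow> f x = 0" using f by (auto simp: test_functions_iff)
  show "integrable half_line (\<lambda>x. f x * h x)" using half_line_integral_support(1)[OF *[OF ab(1), of b]] ab by simp
  show "(LINT x|half_line. f x * h x) = integral {a..b} (\<lambda>x. f x * h x)"
    if "0 < a" "\<And>x. x \<notin> {a..b} \<Longrightarrow> f x = 0" for a b using half_line_integral_support(2)[OF *[OF that(1), of b]] that by simp
qed

text \<open>Bumps converging to the indicator of an open interval show, by dominated convergence,
  that every integral of h over an interval vanishes.\<close>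

lemma fundamental_lemma:
  assumes h: "locally_integrable h" and z: "\<And>f. f \<in> test_functions \<Longrightarrow> (LINT x|half_line. f x * h x) = 0"
  shows "AE x in half_line. h x = 0"
proof (rule zero_Icc_integrals_imp_AE_zero)
  fix a b :: real assume ab: "0 < a" "a < b"
  show hi: "h absolutely_integrable_on {a..b}" using h ab by (simp add: locally_integrable_def)
  define \<phi> where "\<phi> n = bump (1 / real (Suc n)) a b" for n
  have \<phi>: "\<phi> n \<in> test_functions" for n unfolding \<phi>_def using ab by (intro bump_test_function) auto
  define k where "k x = indicator {a<..<b} x *\<^sub>R h x" for x
  have hio: "h absolutely_integrable_on {a<..<b}" by (rule set_integrable_subset[OF hi]) auto
  have ki: "integrable half_line k" unfolding half_line_integrable_iff set_integrable_def
    by (rule Bochner_Integration.integrable_cong[THEN iffD1, OF refl _ hio[unfolded set_integrable_def]])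
      (use ab in \<open>auto simp: k_def indicator_def\<close>)
  have "(\<lambda>n. LINT x|half_line. \<phi> n x * h x) \<longlonglongrightarrow> (LINT x|half_line. k x)"
  proof (rule integral_dominated_convergence)
    show "integrable half_line (\<lambda>x. norm (k x))" using ki by (rule integrable_norm)
    show "k \<in> borel_measurable half_line" using ki by auto
    show "(\<lambda>x. \<phi> n x * h x) \<in> borel_measurable half_line" for n using test_function_mult_integral(1)[OF \<phi> h] by auto
    show "AE x in half_line. (\<lambda>n. \<phi> n x * h x) \<longlonglongrightarrow> k x"
    proof (rule AE_I2)
      fix x
      show "(\<lambda>n. \<phi> n x * h x) \<longlonglongrightarrow> k x"
      proof (cases "x \<in> {a<..<b}")
        case True
        have l: "(\<lambda>n. exp (- (1 / real (Suc n) / c))) \<longlonglongrightarrow> exp (- (0 / c))" if "c \<noteq> 0" for c :: real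
          by (intro tendsto_intros LIMSEQ_inverse_real_of_nat[unfolded inverse_eq_divide] that)
        have "(\<lambda>n. \<phi> n x) \<longlonglongrightarrow> of_real (exp (- (0 / (x - a))) * exp (- (0 / (b - x))))"
          unfolding \<phi>_def bump_def using True by (simp only: if_True) (intro tendsto_of_real tendsto_mult l, auto)
        then have "(\<lambda>n. \<phi> n x * h x) \<longlonglongrightarrow> 1 * h x" by (intro tendsto_mult tendsto_const) simp
        then show ?thesis using True by (simp add: k_def)
      next
        case False
        then have "\<phi> n x = 0" for n unfolding \<phi>_def bump_def by (simp only: if_False of_real_0)
        with False show ?thesis by (simp add: k_def)
      qed
    qed
    show "AE x in half_line. norm (\<phi> n x * h x) \<le> norm (k x)" for n
    proof (rule AE_I2)
      fix x
      have "norm (\<phi> n x) \<le> indicator {a<..<b} x"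
      proof (cases "x \<in> {a<..<b}")
        case True
        then have "exp (- (1 / real (Suc n) / (x - a))) * exp (- (1 / real (Suc n) / (b - x))) \<le> 1 * (1::real)" by (intro mult_mono) auto
        then show ?thesis using True by (simp add: \<phi>_def bump_def norm_mult)
      next
        case False
        then show ?thesis unfolding \<phi>_def bump_def by (simp only: if_False of_real_0 norm_zero) simp
      qed
      from mult_right_mono[OF this norm_ge_zero[of "h x"]]
      show "norm (\<phi> n x * h x) \<le> norm (k x)" by (simp add: norm_mult k_def)
    qed
  qed
  then have "(LINT x|half_line. k x) = 0" using z[OF \<phi>] by (simp add: LIMSEQ_const_iff)
  also have "(LINT x|half_line. k x) = set_lebesgue_integral lebesgue {a<..<b} h" unfolding set_lebesgue_integral_def
    by (subst integral_restrict_space) (use ab in \<open>auto simp: k_def indicator_def intro!: Bochner_Integration.integral_cong\<close>)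
  also have "\<dots> = integral {a<..<b} h" by (rule set_lebesgue_integral_eq_integral(2)[OF hio])
  finally show "integral {a..b} h = 0" by (simp add: integral_open_interval_real)
qed

text \<open>The residual left by projecting f onto the test functions is orthogonal to all of them,
  hence 0 by the fundamental lemma.\<close>

lemma test_functions_dense:
  assumes f: "f \<in> L2" and e: "e > 0"
  shows "\<exists>h\<in>test_functions. L2_dist f h < e"
proof -
  obtain s r where s: "\<And>n::nat. s n \<in> test_functions" and r: "r \<in> L2"
    and lim: "L2_lim (\<lambda>n x. f x - s n x) r" and orth: "\<And>y. y \<in> test_functions \<Longrightarrow> L2_inner r y = 0"
    using L2_orthogonal_residual[OF _ test_function_zero test_function_add test_function_scale f] test_function_L2 by blast
  have "AE x in half_line. cnj (r x) = 0"
  proof (rule fundamental_lemma)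
    show "locally_integrable (\<lambda>x. cnj (r x))" by (intro L2_locally_integrable L2_cnj r)
    fix y assume "y \<in> test_functions"
    from orth[OF this] show "(LINT x|half_line. y x * cnj (r x)) = 0" by (simp add: L2_inner_def mult.commute)
  qed
  then have "L2_norm r = 0" using L2_norm_eq_0_iff[OF r] by simp
  obtain n where n: "L2_norm (\<lambda>x. (f x - s n x) - r x) < e" using order_tendstoD(2)[OF lim e] by (auto simp: eventually_sequentially)
  have "L2_dist f (s n) \<le> L2_norm (\<lambda>x. (f x - s n x) - r x) + L2_norm r"
    using L2_triangle[OF L2_diff[OF L2_diff[OF f test_function_L2[OF s]] r] r, of n] by simp
  with n \<open>L2_norm r = 0\<close> s show ?thesis by (intro bexI[of _ "s n"]) auto
qed

subsection \<open>Integration by parts and weak derivatives\<close>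

text \<open>The increment of \<open>f h - \<integral> (f' h + f k)\<close> over \<open>[x, y]\<close> is
  \<open>\<integral> f' (h y - h) + (f x - f) k\<close>, hence bounded by \<open>2 C (y - x)\<close> times the integral of \<open>|k|\<close> over
  \<open>[x, y]\<close>, so that this function has derivative \<open>0\<close> everywhere.\<close>

lemma integration_by_parts_C1_AC:
  fixes f f' h k :: cfun
  assumes ab: "a \<le> b"
    and f: "\<And>x. x \<in> {a..b} \<Longrightarrow> (f has_vector_derivative f' x) (at x within {a..b})"
    and f': "continuous_on {a..b} f'" and k: "k absolutely_integrable_on {a..b}"
    and h: "\<And>x y. a \<le> x \<Longrightarrow> x \<le> y \<Longrightarrow> y \<le> b \<Longrightarrow> (k has_integral (h y - h x)) {x..y}"
  shows "((\<lambda>x. f' x * h x + f x * k x) has_integral (f b * h b - f a * h a)) {a..b}"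
proof -
  define N where "N x = integral {a..x} (\<lambda>t. norm (k t))" for x
  have kn: "(\<lambda>t. norm (k t)) integrable_on {a..b}" using k by (simp add: absolutely_integrable_on_def)
  have Ni: "integral {x..y} (\<lambda>t. norm (k t)) = N y - N x" if "a \<le> x" "x \<le> y" "y \<le> b" for x y unfolding N_def using that kn
    by (subst Henstock_Kurzweil_Integration.integral_combine[symmetric, of a x y]) (auto intro: integrable_on_subinterval)
  have Nc: "continuous_on {a..b} N" unfolding N_def by (rule indefinite_integral_continuous_1[OF kn])
  have hN: "norm (h y - h x) \<le> N y - N x" if "a \<le> x" "x \<le> y" "y \<le> b" for x y
  proof -
    have "norm (integral {x..y} k) \<le> integral {x..y} (\<lambda>t. norm (k t))"
      using h[OF that] that kn by (intro integral_norm_bound_integral) (auto intro: integrable_on_subinterval)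
    then show ?thesis using Ni[OF that] integral_unique[OF h[OF that]] by simp
  qed
  have fc: "continuous_on {a..b} f" unfolding continuous_on_eq_continuous_within using f has_vector_derivative_continuous by blast
  have hc: "continuous_on {a..b} h"
  proof -
    have "continuous_on {a..b} (\<lambda>x. h a + integral {a..x} k)"
      using k by (intro continuous_intros indefinite_integral_continuous_1) (simp add: absolutely_integrable_on_def)
    then show ?thesis by (rule continuous_on_eq) (use integral_unique[OF h[of a]] in auto)
  qed
  have "bounded (f' ` {a..b})" using f' by (intro compact_imp_bounded compact_continuous_image) auto
  then obtain C where C: "\<And>x. x \<in> {a..b} \<Longrightarrow> norm (f' x) \<le> C" unfolding bounded_iff by blast
  have C0: "0 \<le> C" using C[of a] ab norm_ge_zero[of "f' a"] by (simp del: norm_ge_zero)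
  define I where "I x = f' x * h x + f x * k x" for x
  have fk: "(\<lambda>x. f x * k x) integrable_on {a..b}" using absolutely_integrable_mult_continuous[OF fc k] by (simp add: absolutely_integrable_on_def)
  have f'h: "(\<lambda>x. f' x * h x) integrable_on {a..b}" by (intro integrable_continuous_interval continuous_intros f' hc)
  have Ii: "I integrable_on {a..b}" unfolding I_def by (intro integrable_add f'h fk)
  define P where "P x = f x * h x - integral {a..x} I" for x
  have FTC: "(f' has_integral (f y - f x)) {x..y}" if "a \<le> x" "x \<le> y" "y \<le> b" for x y
    using that by (intro fundamental_theorem_of_calculus) (auto intro!: has_vector_derivative_within_subset[OF f])
  have fL: "norm (f y - f x) \<le> C * (y - x)" if "a \<le> x" "x \<le> y" "y \<le> b" for x y
  proof -
    have "norm (integral {x..y} f') \<le> integral {x..y} (\<lambda>_. C)" using FTC[OF that] that C by (intro integral_norm_bound_integral) auto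
    then show ?thesis using integral_unique[OF FTC[OF that]] that by (simp add: mult.commute)
  qed
  have key: "norm (P y - P x) \<le> 2 * C * (y - x) * (N y - N x)" if xy: "a \<le> x" "x \<le> y" "y \<le> b" for x y
  proof -
    define J where "J s = f' s * (h y - h s) + (f x - f s) * k s" for s
    have "((\<lambda>s. f' s * h y + f x * k s) has_integral ((f y - f x) * h y + f x * (h y - h x))) {x..y}"
      by (intro has_integral_add has_integral_mult_left has_integral_mult_right FTC h xy)
    moreover have "(I has_integral integral {x..y} I) {x..y}" using Ii xy by (intro integrable_integral) (auto intro: integrable_on_subinterval)
    ultimately have "((\<lambda>s. f' s * h y + f x * k s - I s) has_integral
        ((f y - f x) * h y + f x * (h y - h x) - integral {x..y} I)) {x..y}" by (rule has_integral_diff)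
    moreover have "(\<lambda>s. f' s * h y + f x * k s - I s) = J" by (auto simp: J_def I_def algebra_simps)
    moreover have "integral {x..y} I = integral {a..y} I - integral {a..x} I"
      using Ii xy by (subst Henstock_Kurzweil_Integration.integral_combine[symmetric, of a x y])
        (auto intro: integrable_on_subinterval)
    ultimately have J: "(J has_integral (P y - P x)) {x..y}" by (simp add: P_def algebra_simps)
    have bound: "((\<lambda>s. C * (N y - N x) + C * (y - x) * norm (k s)) has_integral
          (y - x) *\<^sub>R (C * (N y - N x)) + C * (y - x) * (N y - N x)) {x..y}"
      proof (intro has_integral_add has_integral_mult_right)
        show "((\<lambda>s. norm (k s)) has_integral (N y - N x)) {x..y}"
          unfolding Ni[OF xy, symmetric] using kn xy by (intro integrable_integral) (auto intro: integrable_on_subinterval)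
        show "((\<lambda>s. C * (N y - N x)) has_integral (y - x) *\<^sub>R (C * (N y - N x))) {x..y}"
          using has_integral_const_real[of "C * (N y - N x)" x y] xy by simp
      qed
    have "norm (integral {x..y} J) \<le> integral {x..y} (\<lambda>s. C * (N y - N x) + C * (y - x) * norm (k s))"
    proof (rule integral_norm_bound_integral)
      show "J integrable_on {x..y}" using J by auto
      show "(\<lambda>s. C * (N y - N x) + C * (y - x) * norm (k s)) integrable_on {x..y}" using bound by auto
      fix s assume s: "s \<in> {x..y}"
      have Nxs: "0 \<le> N s - N x" using hN[of x s] s xy norm_ge_zero[of "h s - h x"] by (simp del: norm_ge_zero)
      have "norm (J s) \<le> norm (f' s) * norm (h y - h s) + norm (f x - f s) * norm (k s)"
        unfolding J_def by (intro order_trans[OF norm_triangle_ineq]) (simp add: norm_mult)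
      also have "\<dots> \<le> C * (N y - N x) + C * (y - x) * norm (k s)"
      proof (intro add_mono mult_mono)
        show "norm (h y - h s) \<le> N y - N x" using hN[of s y] s xy Nxs by auto
        show "norm (f x - f s) \<le> C * (y - x)" using fL[of x s] s xy C0 mult_left_mono[of "s - x" "y - x" C] by (auto simp: norm_minus_commute)
      qed (use C[of s] s xy C0 in auto)
      finally show "norm (J s) \<le> C * (N y - N x) + C * (y - x) * norm (k s)" .
    qed
    also have "\<dots> = 2 * C * (y - x) * (N y - N x)"
    proof -
      from bound show ?thesis by (simp add: integral_unique algebra_simps)
    qed
    finally show ?thesis using integral_unique[OF J] by simp
  qed
  have "\<exists>c. \<forall>x\<in>{a..b}. P x = c"
  proof (rule has_derivative_zero_constant)
    fix x assume x: "x \<in> {a..b}"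
    show "(P has_derivative (\<lambda>h. 0)) (at x within {a..b})" unfolding has_derivative_within_alt
    proof (intro conjI allI impI)
      fix e :: real assume e: "e > 0"
      \<comment> \<open>Continuity of \<open>N\<close> makes the bound \<open>key\<close> of smaller
        order than y - x. The denominator 2 C + 1 absorbs the factor 2 C and stays positive for C =
        0.\<close>
      obtain d where d: "d > 0" "\<And>y. y \<in> {a..b} \<Longrightarrow> norm (y - x) < d \<Longrightarrow> \<bar>N y - N x\<bar> < e / (2 * C + 1)"
        using Nc x e C0 unfolding continuous_on_iff dist_norm
        by (metis add_pos_nonneg divide_pos_pos mult_nonneg_nonneg real_norm_def zero_le_numeral zero_less_one add.commute)
      have "norm (P y - P x - 0) \<le> e * norm (y - x)" if y: "y \<in> {a..b}" "norm (y - x) < d" for y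
      proof -
        have "norm (P y - P x) \<le> 2 * C * \<bar>y - x\<bar> * \<bar>N y - N x\<bar>"
        proof (cases "x \<le> y")
          case True
          then show ?thesis using key[of x y] x y hN[of x y] norm_ge_zero[of "h y - h x"] by (simp del: norm_ge_zero)
        next
          case False
          then show ?thesis using key[of y x] x y hN[of y x] norm_ge_zero[of "h x - h y"] by (simp del: norm_ge_zero add: norm_minus_commute)
        qed
        also have "\<dots> \<le> 2 * C * \<bar>y - x\<bar> * (e / (2 * C + 1))" using d(2)[OF y] C0 by (intro mult_left_mono) auto
        also have "\<dots> \<le> e * norm (y - x)"
        proof -
          have "2 * C / (2 * C + 1) \<le> 1" using C0 by simp
          then have "(2 * C / (2 * C + 1)) * (e * \<bar>y - x\<bar>) \<le> 1 * (e * \<bar>y - x\<bar>)" using e by (intro mult_right_mono) auto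
          then show ?thesis by (simp add: field_simps)
        qed
        finally show ?thesis by simp
      qed
      with d(1) show "\<exists>d>0. \<forall>y\<in>{a..b}. norm (y - x) < d \<longrightarrow> norm (P y - P x - 0) \<le> e * norm (y - x)" by blast
    qed (rule bounded_linear_zero)
  qed auto
  then have "P a = P b" using ab by auto
  then have "integral {a..b} I = f b * h b - f a * h a" by (simp add: P_def)
  with Ii show ?thesis unfolding I_def by (metis integrable_integral)
qed

lemma half_line_not_AE_False: "\<not> (AE x in half_line. False)"
proof
  assume "AE x in half_line. False"
  then have "emeasure half_line (space half_line) = 0" unfolding ae_filter_eq_bot_iff[symmetric] trivial_limit_def .
  moreover have "emeasure half_line (space half_line) \<ge> emeasure half_line {0..1}" by (intro emeasure_mono) (auto simp: sets_restrict_space)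
  moreover have "emeasure half_line {0..1} = 1" by (subst emeasure_restrict_space) auto
  ultimately show False by simp
qed

text \<open>If all test functions had integral 0, the fundamental lemma would make the constant 1
  vanish almost everywhere.\<close>

lemma test_function_with_unit_integral:
  obtains \<rho> where "\<rho> \<in> test_functions" "(LINT x|half_line. \<rho> x) = 1"
proof -
  have "\<not> (\<forall>f\<in>test_functions. (LINT x|half_line. f x * 1) = 0)"
    using fundamental_lemma[OF locally_integrable_const[of 1]] half_line_not_AE_False by fastforce
  then obtain f where f: "f \<in> test_functions" "(LINT x|half_line. f x) \<noteq> 0" by auto
  show ?thesis
  proof (rule that)
    show "(\<lambda>x. inverse (LINT x|half_line. f x) * f x) \<in> test_functions" by (intro test_function_scale f)
    show "(LINT x|half_line. inverse (LINT x|half_line. f x) * f x) = 1" using f(2) by simp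
  qed
qed

text \<open>The primitive from 0 vanishes left of the support, and the zero mean makes it vanish
  again to the right.\<close>

lemma test_function_antiderivative:
  assumes f: "f \<in> test_functions" and z: "(LINT x|half_line. f x) = 0"
  obtains F where "F \<in> test_functions" "\<And>x. (F has_vector_derivative f x) (at x)"
proof -
  obtain a b where ab: "0 < a" "\<And>x. x \<notin> {a..b} \<Longrightarrow> f x = 0" and sm: "smooth f" using f by (auto simp: test_functions_iff)
  define F where "F x = integral {0..x} f" for x
  have fi: "f integrable_on {c..d}" for c d by (intro integrable_continuous_interval test_function_continuous_on f)
  have F0: "F x = 0" if "x < a" for x
  proof -
    have "F x = integral {0..x} (\<lambda>_. 0)" unfolding F_def by (rule Henstock_Kurzweil_Integration.integral_cong) (use ab that in auto)
    then show ?thesis by simp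
  qed
  have F1: "F x = 0" if "x > max a b" for x
  proof -
    have "F x = integral {0..a} f + integral {a..x} f"
      unfolding F_def using ab(1) that fi by (intro Henstock_Kurzweil_Integration.integral_combine[symmetric]) auto
    also have "integral {0..a} f = integral {0<..<a} f" by (rule integral_open_interval_real)
    also have "\<dots> = integral {0<..<a} (\<lambda>_. 0)" by (rule Henstock_Kurzweil_Integration.integral_cong) (use ab(2) in auto)
    also have "\<dots> = 0" by simp
    also have "integral {a..x} f = 0"
    proof -
      have "f y = 0" if "y \<notin> {a..x}" for y using ab(2)[of y] that \<open>x > max a b\<close> by auto
      from test_function_mult_integral(2)[OF f locally_integrable_const[of 1] ab(1) this] z
      show ?thesis by simp
    qed
    finally show ?thesis by simp
  qed
  have d: "(F has_vector_derivative f x) (at x)" for x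
  proof (cases "x < a")
    case True
    show ?thesis
    proof (rule has_vector_derivative_transform_within_open[of "\<lambda>x. 0" _ _ "{..<a}"])
      show "((\<lambda>x. 0) has_vector_derivative f x) (at x)" using ab(2)[of x] True by (simp add: has_vector_derivative_const)
    qed (use True F0 in auto)
  next
    case False
    have "((\<lambda>u. integral {0..u} f) has_vector_derivative f x) (at x within {0..x + 1})"
      using False ab(1) by (intro integral_has_vector_derivative test_function_continuous_on f) auto
    moreover have "at x within {0..x + 1} = at x" using False ab(1) by (intro at_within_interior) auto
    ultimately show ?thesis by (simp add: F_def[abs_def])
  qed
  show ?thesis
  proof (rule that[OF _ d])
    have "\<forall>x. x \<notin> {a..max a b} \<longrightarrow> F x = 0" using F0 F1 by (auto simp: not_le)
    then show "F \<in> test_functions" unfolding test_functions_iff using smooth_if_deriv[OF sm d] ab(1) by blast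
  qed
qed

text \<open>The lemma of du Bois-Reymond: f minus its integral times \<rho> has mean 0, so it is the
  derivative of a test function and w annihilates it. Hence w acts on f like the constant obtained
  by testing it with \<rho>.\<close>

lemma weak_derivative_zero:
  assumes w: "locally_integrable w"
    and z: "\<And>f f'. \<lbrakk>f \<in> test_functions; f' \<in> test_functions; \<And>x. (f has_vector_derivative f' x) (at x)\<rbrakk>
      \<Longrightarrow> (LINT x|half_line. f' x * w x) = 0"
  shows "\<exists>c. AE x in half_line. w x = c"
proof -
  obtain \<rho> where \<rho>: "\<rho> \<in> test_functions" "(LINT x|half_line. \<rho> x) = 1" by (rule test_function_with_unit_integral)
  define c where "c = (LINT x|half_line. \<rho> x * w x)"
  have "AE x in half_line. w x - c = 0"
  proof (rule fundamental_lemma)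
    show "locally_integrable (\<lambda>x. w x - c)" by (intro locally_integrable_diff w locally_integrable_const)
    fix f assume f: "f \<in> test_functions"
    define p where "p = (LINT x|half_line. f x)"
    note int = test_function_mult_integral(1)
    note int1 = int[OF _ locally_integrable_const[of 1], simplified]
    have "(LINT x|half_line. f x - p * \<rho> x) = 0" using \<rho> f by (simp add: int1 p_def)
    then obtain F where F: "F \<in> test_functions" "\<And>x. (F has_vector_derivative (f x - p * \<rho> x)) (at x)"
      using test_function_antiderivative[OF test_function_diff[OF f test_function_scale[OF \<rho>(1)]]] by blast
    have "(LINT x|half_line. (f x - p * \<rho> x) * w x) = 0" using F f \<rho>(1) by (intro z[of F]) (auto intro: test_function_diff test_function_scale)
    also have "(\<lambda>x. (f x - p * \<rho> x) * w x) = (\<lambda>x. f x * w x - p * (\<rho> x * w x))" by (auto simp: algebra_simps)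
    also have "(LINT x|half_line. f x * w x - p * (\<rho> x * w x)) = (LINT x|half_line. f x * w x) - p * c" using f \<rho>(1) w by (simp add: int c_def)
    finally have "(LINT x|half_line. f x * w x) = p * c" by simp
    moreover have "(LINT x|half_line. f x * (w x - c)) = (LINT x|half_line. f x * w x) - p * c" using f w by (simp add: int int1 right_diff_distrib p_def)
    ultimately show "(LINT x|half_line. f x * (w x - c)) = 0" by simp
  qed
  then show ?thesis by (intro exI[of _ c]) (auto elim: AE_mp)
qed

lemma test_function_parts:
  assumes f: "f \<in> test_functions" "f' \<in> test_functions" "\<And>x. (f has_vector_derivative f' x) (at x)"
    and k: "locally_integrable k"
    and h: "\<And>x y. 0 < x \<Longrightarrow> x \<le> y \<Longrightarrow> (k has_integral (h y - h x)) {x..y}" and hl: "locally_integrable h"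
  shows "(LINT x|half_line. f' x * h x) = - (LINT x|half_line. f x * k x)"
proof -
  obtain f1 f2 a b where *: "0 < a \<and> a < b \<and> f1 \<in> test_functions \<and> f2 \<in> test_functions \<and>
    (\<forall>x. (f has_vector_derivative f1 x) (at x)) \<and> (\<forall>x. (f1 has_vector_derivative f2 x) (at x)) \<and>
    (\<forall>x. x \<notin> {a<..<b} \<longrightarrow> f x = 0 \<and> f1 x = 0 \<and> f2 x = 0)" using test_function_derivs[OF f(1)] by (elim exE)
  then have ab: "0 < a" "a < b" and f1: "\<And>x. (f has_vector_derivative f1 x) (at x)"
    and o: "\<And>x. x \<notin> {a<..<b} \<Longrightarrow> f x = 0 \<and> f1 x = 0 \<and> f2 x = 0" by simp_all
  have "f1 x = f' x" for x using vector_derivative_unique_at[OF f1 f(3)] .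
  with o have out: "f x = 0 \<and> f' x = 0" if "x \<notin> {a<..<b}" for x using that by auto
  have "((\<lambda>x. f' x * h x + f x * k x) has_integral (f b * h b - f a * h a)) {a..b}"
  proof (rule integration_by_parts_C1_AC)
    show "(f has_vector_derivative f' x) (at x within {a..b})" for x using f(3) by (rule has_vector_derivative_at_within)
    show "continuous_on {a..b} f'" by (rule test_function_continuous_on[OF f(2)])
    show "k absolutely_integrable_on {a..b}" using k ab by (simp add: locally_integrable_def)
  qed (use ab h in auto)
  then have "integral {a..b} (\<lambda>x. f' x * h x + f x * k x) = 0" using out[of a] out[of b] by (simp add: integral_unique)
  moreover have "(\<lambda>x. g x * w x) integrable_on {a..b}" if "g \<in> test_functions" "locally_integrable w" for g w
    using that ab(1) absolutely_integrable_mult_continuous[OF test_function_continuous_on[OF that(1)]]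
    by (simp add: absolutely_integrable_on_def locally_integrable_def)
  ultimately have "integral {a..b} (\<lambda>x. f' x * h x) + integral {a..b} (\<lambda>x. f x * k x) = 0"
    using f hl k by (subst Henstock_Kurzweil_Integration.integral_add[symmetric]) auto
  moreover have "x \<notin> {a..b} \<Longrightarrow> f x = 0 \<and> f' x = 0" for x using out[of x] by auto
  ultimately show ?thesis using test_function_mult_integral(2)[OF f(1) k ab(1), of b] test_function_mult_integral(2)[OF f(2) hl ab(1), of b]
    by (simp add: add_eq_0_iff)
qed

text \<open>After subtraction of a linear function of the right slope the weak first derivative
  vanishes: if p is the integral of f, then f' - p \<rho>' is the second derivative of a test
  function, so only the component of f along \<rho> has to be matched.\<close>

lemma weak_second_derivative_zero:
  assumes w: "locally_integrable w"
    and z: "\<And>f f' f''. \<lbrakk>f \<in> test_functions; f' \<in> test_functions; f'' \<in> test_functions; \<And>x. (f has_vector_derivative f' x) (at x);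
       \<And>x. (f' has_vector_derivative f'' x) (at x)\<rbrakk> \<Longrightarrow> (LINT x|half_line. f'' x * w x) = 0"
  shows "\<exists>c d. AE x in half_line. w x = c + d * of_real x"
proof -
  obtain \<rho> where \<rho>: "\<rho> \<in> test_functions" "(LINT x|half_line. \<rho> x) = 1" by (rule test_function_with_unit_integral)
  obtain \<rho>' where \<rho>': "\<rho>' \<in> test_functions" "\<And>x. (\<rho> has_vector_derivative \<rho>' x) (at x)"
    using test_function_derivs[OF \<rho>(1)] by blast
  \<comment> \<open>The weak derivative of w tested against \<rho>; since w' will be constant and
    \<rho> has integral 1, this is its value.\<close>
  define d where "d = - (LINT x|half_line. \<rho>' x * w x)"
  note int = test_function_mult_integral(1)
  note int1 = int[OF _ locally_integrable_const[of 1], simplified]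
  have lx: "locally_integrable (\<lambda>x. of_real x)" by (intro continuous_locally_integrable continuous_intros)
  have "\<exists>c. AE x in half_line. w x - d * of_real x = c"
  proof (rule weak_derivative_zero)
    show "locally_integrable (\<lambda>x. w x - d * of_real x)" by (intro locally_integrable_diff w continuous_locally_integrable continuous_intros)
    fix f f' assume f: "f \<in> test_functions" "f' \<in> test_functions" "\<And>x. (f has_vector_derivative f' x) (at x)"
    define p where "p = (LINT x|half_line. f x)"
    have "(LINT x|half_line. f x - p * \<rho> x) = 0" using \<rho> f by (simp add: int1 p_def)
    then obtain F where F: "F \<in> test_functions" "\<And>x. (F has_vector_derivative (f x - p * \<rho> x)) (at x)"
      using test_function_antiderivative[OF test_function_diff[OF f(1) test_function_scale[OF \<rho>(1)]]] by blast
    have "(LINT x|half_line. (f' x - p * \<rho>' x) * w x) = 0" using F f \<rho>(1) \<rho>' by (intro z[OF F(1) _ _ F(2)])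
        (auto intro!: test_function_diff test_function_scale has_vector_derivative_diff has_vector_derivative_mult_right)
    also have "(\<lambda>x. (f' x - p * \<rho>' x) * w x) = (\<lambda>x. f' x * w x - p * (\<rho>' x * w x))" by (auto simp: algebra_simps)
    also have "(LINT x|half_line. f' x * w x - p * (\<rho>' x * w x)) = (LINT x|half_line. f' x * w x) + p * d" using f \<rho>' w by (simp add: int d_def)
    finally have 1: "(LINT x|half_line. f' x * w x) = - p * d" by (simp add: add_eq_0_iff2)
    have "(LINT x|half_line. f' x * of_real x) = - (LINT x|half_line. f x * 1)"
    proof (rule test_function_parts[OF f locally_integrable_const _ lx])
      fix x y :: real assume "0 < x" "x \<le> y"
      then show "((\<lambda>x. 1::complex) has_integral of_real y - of_real x) {x..y}"
        using has_integral_const_real[of "1::complex" x y] by (simp add: scaleR_conv_of_real)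
    qed
    then have 2: "(LINT x|half_line. f' x * of_real x) = - p" by (simp add: p_def)
    have "(LINT x|half_line. f' x * (w x - d * of_real x)) = (LINT x|half_line. f' x * w x - d * (f' x * of_real x))" by (simp add: algebra_simps)
    also have "\<dots> = (LINT x|half_line. f' x * w x) - d * (LINT x|half_line. f' x * of_real x)" using int[OF f(2) w] int[OF f(2) lx] by simp
    finally show "(LINT x|half_line. f' x * (w x - d * of_real x)) = 0" using 1 2 by simp
  qed
  then obtain c where "AE x in half_line. w x - d * of_real x = c" by blast
  then have "AE x in half_line. w x = c + d * of_real x" by eventually_elim (simp add: algebra_simps)
  then show ?thesis by blast
qed

subsection \<open>The maximal operator\<close>

definition potential :: "real \<Rightarrow> real \<Rightarrow> complex" where
  "potential \<alpha> x = complex_of_real ((- 1/4 + \<alpha>) * (1 / x^2))"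

text \<open>The equation L f = g in integrated form: f is differentiable on the open half-line and
  f' is a primitive of V f - g. The derivative is carried along because all boundary terms are
  Wronskians.\<close>

definition regular :: "real \<Rightarrow> cfun \<Rightarrow> cfun \<Rightarrow> cfun \<Rightarrow> bool" where
  "regular \<alpha> f f' g \<longleftrightarrow> f \<in> L2 \<and> g \<in> L2 \<and> (\<forall>x>0. (f has_vector_derivative f' x) (at x)) \<and>
    (\<forall>a b. 0 < a \<longrightarrow> a \<le> b \<longrightarrow> ((\<lambda>x. potential \<alpha> x * f x - g x) has_integral (f' b - f' a)) {a..b})"

definition test_op :: "real \<Rightarrow> operator" where
  "test_op \<alpha> = {(f, L_expr \<alpha> f) | f. f \<in> test_functions}"

definition max_op :: "real \<Rightarrow> operator" where
  "max_op \<alpha> = {(f, g). f \<in> L2 \<and> (\<exists>F F'. regular \<alpha> F F' g \<and> (AE x in half_line. f x = F x))}"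

lemma L_min_eq: "L_min \<alpha> = op_closure (test_op \<alpha>)" by (simp add: L_min_def test_op_def)

lemma continuous_on_potential: "continuous_on {0<..} (potential \<alpha>)" unfolding potential_def by (intro continuous_intros) auto

lemma regularD:
  assumes "regular \<alpha> f f' g"
  shows "f \<in> L2" "g \<in> L2" "0 < x \<Longrightarrow> (f has_vector_derivative f' x) (at x)"
    "0 < a \<Longrightarrow> a \<le> b \<Longrightarrow> ((\<lambda>x. potential \<alpha> x * f x - g x) has_integral (f' b - f' a)) {a..b}"
  using assms by (auto simp: regular_def)

lemma continuous_on_pos_if_deriv:
  fixes f :: cfun
  assumes "\<And>x. 0 < x \<Longrightarrow> (f has_vector_derivative f' x) (at x)"
  shows "continuous_on {0<..} f"
proof (rule continuous_at_imp_continuous_on, rule ballI)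
  fix x :: real assume "x \<in> {0<..}"
  then show "isCont f x" using has_vector_derivative_continuous[OF assms[of x]] by simp
qed

lemma continuous_on_pos_measurable:
  fixes F :: cfun
  assumes "continuous_on {0<..} F"
  shows "F \<in> borel_measurable half_line"
proof -
  have "F \<in> borel_measurable (lebesgue_on {0<..})" using assms by (intro continuous_imp_measurable_on_sets_lebesgue) auto
  then have G: "(\<lambda>x. if x \<in> {0<..} then F x else 0) \<in> borel_measurable lebesgue" by (intro borel_measurable_if_I) auto
  have S: "{x \<in> space lebesgue. x \<in> {0<..}} \<in> sets (lebesgue :: real measure)" by (simp add: greaterThan_def[symmetric])
  have "(\<lambda>x. if x \<in> {0<..} then (if x \<in> {0<..} then F x else 0) else F 0) \<in> borel_measurable half_line"
    by (rule measurable_restrict_space1, rule measurable_If[OF G _ S]) simp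
  also have "?this \<longleftrightarrow> F \<in> borel_measurable half_line" by (rule measurable_cong) auto
  finally show ?thesis .
qed

lemma regular_continuous:
  assumes "regular \<alpha> f f' g"
  shows "continuous_on {0<..} f" by (rule continuous_on_pos_if_deriv[OF regularD(3)[OF assms]])

lemma regular_rhs_locally_integrable:
  assumes "regular \<alpha> f f' g"
  shows "locally_integrable (\<lambda>x. potential \<alpha> x * f x - g x)" using regularD[OF assms] regular_continuous[OF assms]
  by (intro locally_integrable_diff locally_integrable_mult continuous_on_potential L2_locally_integrable) auto

lemma continuous_on_pos_reals:
  fixes h :: cfun
  assumes "\<And>a b. 0 < a \<Longrightarrow> continuous_on {a..b} h"
  shows "continuous_on {0<..} h"
proof (rule continuous_at_imp_continuous_on, rule ballI)
  fix x :: real assume "x \<in> {0<..}"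
  then have "x \<in> interior {x / 2..x + 1}" "0 < x / 2" by auto
  with assms[of "x / 2" "x + 1"] show "isCont h x" by (simp add: continuous_on_interior)
qed

lemma regular_deriv_continuous:
  assumes "regular \<alpha> f f' g"
  shows "continuous_on {0<..} f'"
proof (rule continuous_on_pos_reals)
  fix a b :: real assume a: "0 < a"
  have i: "(\<lambda>x. potential \<alpha> x * f x - g x) integrable_on {a..b}"
    using regular_rhs_locally_integrable[OF assms] a by (simp add: locally_integrable_def absolutely_integrable_on_def)
  have "continuous_on {a..b} (\<lambda>x. f' a + integral {a..x} (\<lambda>x. potential \<alpha> x * f x - g x))"
    by (intro continuous_intros indefinite_integral_continuous_1 i)
  then show "continuous_on {a..b} f'" by (rule continuous_on_eq) (use integral_unique[OF regularD(4)[OF assms a]] in auto)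
qed

lemma regular_add:
  assumes "regular \<alpha> f f' g" "regular \<alpha> h h' k"
  shows "regular \<alpha> (\<lambda>x. f x + h x) (\<lambda>x. f' x + h' x) (\<lambda>x. g x + k x)"
proof -
  have "((\<lambda>x. potential \<alpha> x * (f x + h x) - (g x + k x)) has_integral ((f' b + h' b) - (f' a + h' a))) {a..b}"
    if "0 < a" "a \<le> b" for a b using has_integral_add[OF regularD(4)[OF assms(1) that] regularD(4)[OF assms(2) that]] by (simp add: algebra_simps)
  then show ?thesis using assms unfolding regular_def by (auto intro!: L2_add has_vector_derivative_add)
qed

lemma regular_scale:
  assumes "regular \<alpha> f f' g"
  shows "regular \<alpha> (\<lambda>x. c * f x) (\<lambda>x. c * f' x) (\<lambda>x. c * g x)"
proof -
  have "((\<lambda>x. potential \<alpha> x * (c * f x) - c * g x) has_integral (c * f' b - c * f' a)) {a..b}"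
    if "0 < a" "a \<le> b" for a b using has_integral_mult_right[OF regularD(4)[OF assms that], of c] by (simp add: algebra_simps)
  then show ?thesis using assms unfolding regular_def by (auto intro!: L2_scale has_vector_derivative_mult_right)
qed

lemma regular_diff:
  assumes "regular \<alpha> f f' g" "regular \<alpha> h h' k"
  shows "regular \<alpha> (\<lambda>x. f x - h x) (\<lambda>x. f' x - h' x) (\<lambda>x. g x - k x)"
  using regular_add[OF assms(1) regular_scale[OF assms(2), of "-1"]] by simp

lemma regular_cnj:
  assumes "regular \<alpha> f f' g"
  shows "regular \<alpha> (\<lambda>x. cnj (f x)) (\<lambda>x. cnj (f' x)) (\<lambda>x. cnj (g x))"
proof -
  have "((\<lambda>x. potential \<alpha> x * cnj (f x) - cnj (g x)) has_integral (cnj (f' b) - cnj (f' a))) {a..b}"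
    if "0 < a" "a \<le> b" for a b
  proof -
    have "((\<lambda>x. cnj (potential \<alpha> x * f x - g x)) has_integral cnj (f' b - f' a)) {a..b}"
      using has_integral_cnj[THEN iffD2, OF regularD(4)[OF assms that]] by (simp only: o_def)
    then show ?thesis by (simp add: potential_def)
  qed
  then show ?thesis using assms unfolding regular_def by (auto intro!: L2_cnj has_vector_derivative_cnj)
qed

lemma L_expr_test_function:
  assumes "\<And>x. (f has_vector_derivative f' x) (at x)" "\<And>x. (f' has_vector_derivative f'' x) (at x)"
  shows "L_expr \<alpha> f = (\<lambda>x. - f'' x + potential \<alpha> x * f x)"
proof -
  have "(\<lambda>y. vector_derivative f (at y)) = f'" using assms(1) by (auto intro: vector_derivative_at)
  with assms(2) show ?thesis by (auto simp: L_expr_def potential_def vector_derivative_at fun_eq_iff)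
qed

lemma regular_test_function:
  assumes f: "f \<in> test_functions"
  shows "\<exists>f'\<in>test_functions. regular \<alpha> f f' (L_expr \<alpha> f)"
proof -
  obtain f' f'' a b where ab: "0 < a" "a < b" and t: "f' \<in> test_functions" "f'' \<in> test_functions"
    and d: "\<And>x. (f has_vector_derivative f' x) (at x)" "\<And>x. (f' has_vector_derivative f'' x) (at x)"
    and o: "\<And>x. x \<notin> {a<..<b} \<Longrightarrow> f x = 0 \<and> f' x = 0 \<and> f'' x = 0"
    using test_function_derivs[OF f] by blast
  note L = L_expr_test_function[OF d]
  have "L_expr \<alpha> f \<in> L2"
  proof (rule continuous_compact_support_L2)
    have "continuous_on {a..b} (potential \<alpha>)" using ab by (intro continuous_on_subset[OF continuous_on_potential]) auto
    then show "continuous_on {a..b} (L_expr \<alpha> f)"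
      unfolding L using test_function_continuous_on[OF f] test_function_continuous_on[OF t(2)] by (intro continuous_intros)
    show "0 \<le> a" using ab by simp
    show "L_expr \<alpha> f x = 0" if "x \<notin> {a..b}" for x
    proof -
      have "x \<notin> {a<..<b}" using that by auto
      from o[OF this] show ?thesis by (simp add: L)
    qed
  qed
  moreover have "((\<lambda>x. potential \<alpha> x * f x - L_expr \<alpha> f x) has_integral (f' y - f' x)) {x..y}" if "x \<le> y" for x y
    unfolding L using d(2) that by (simp, intro fundamental_theorem_of_calculus) (auto intro: has_vector_derivative_at_within)
  ultimately show ?thesis using t d(1) f by (intro bexI[of _ f']) (auto simp: regular_def test_function_L2)
qed

lemma test_op_L2: "(h, k) \<in> test_op \<alpha> \<Longrightarrow> h \<in> L2 \<and> k \<in> L2"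
  using regular_test_function[of h \<alpha>] by (auto simp: test_op_def regular_def)

lemma AE_half_line_has_integral:
  fixes h k :: cfun
  assumes "AE x in half_line. h x = k x" "0 \<le> a" "(h has_integral I) {a..b}"
  shows "(k has_integral I) {a..b}"
proof -
  have "AE x in lebesgue. x \<in> {0..} \<longrightarrow> h x = k x" using assms(1) by (subst (asm) AE_restrict_space_iff) auto
  then obtain N where N: "N \<in> null_sets lebesgue" "{x. \<not> (x \<in> {0..} \<longrightarrow> h x = k x)} \<subseteq> N"
    by (auto simp: eventually_ae_filter)
  show ?thesis
  proof (rule has_integral_spike[OF _ _ assms(3)])
    show "negligible N" using N(1) by (simp add: negligible_iff_null_sets)
    show "k x = h x" if "x \<in> {a..b} - N" for x using subsetD[OF N(2), of x] that assms(2) by (cases "h x = k x") auto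
  qed
qed

text \<open>The signed integral from 1 to x: one of the two intervals always has at most one point.
  The base point is 1 because q need not be integrable at 0.\<close>

definition primitive :: "cfun \<Rightarrow> real \<Rightarrow> complex" where
  "primitive q x = integral {1..x} q - integral {x..1} q"

lemma has_integral_primitive:
  assumes q: "locally_integrable q" and ab: "0 < a" "a \<le> b"
  shows "(q has_integral (primitive q b - primitive q a)) {a..b}"
proof -
  have i: "q integrable_on {x..y}" if "0 < x" for x y using q that by (simp add: locally_integrable_def absolutely_integrable_on_def)
  have c: "integral {x..y} q + integral {y..z} q = integral {x..z} q" if "0 < x" "x \<le> y" "y \<le> z" for x y z
    using that i by (intro Henstock_Kurzweil_Integration.integral_combine) auto
  have e: "x > y \<Longrightarrow> integral {x..y} q = 0" for x y by simp
  have "primitive q b - primitive q a = integral {a..b} q"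
  proof -
    consider "1 \<le> a" | "b \<le> 1" | "a < 1" "1 < b" by linarith
    then show ?thesis
    proof cases
      case 1
      have "integral {a..1} q = 0" "integral {b..1} q = 0" using 1 ab by (cases "a = 1"; cases "b = 1"; simp)+
      with c[of 1 a b] 1 ab show ?thesis unfolding primitive_def by (auto simp: algebra_simps)
    next
      case 2
      have "integral {1..a} q = 0" "integral {1..b} q = 0" using 2 ab by (cases "a = 1"; cases "b = 1"; simp)+
      with c[of a b 1] 2 ab show ?thesis unfolding primitive_def by (auto simp: algebra_simps)
    next
      case 3
      then show ?thesis using c[of a 1 b] ab unfolding primitive_def by (simp add: e add.commute)
    qed
  qed
  with i[OF ab(1), of b] show ?thesis by (simp add: has_integral_integrable_integral)
qed

lemma primitive_continuous:
  assumes q: "locally_integrable q"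
  shows "continuous_on {0<..} (primitive q)"
proof (rule continuous_on_pos_reals)
  fix a b :: real assume a: "0 < a"
  have i: "q integrable_on {a..b}" using q a by (simp add: locally_integrable_def absolutely_integrable_on_def)
  have "continuous_on {a..b} (\<lambda>x. primitive q a + integral {a..x} q)" by (intro continuous_intros indefinite_integral_continuous_1 i)
  then show "continuous_on {a..b} (primitive q)" by (rule continuous_on_eq) (use integral_unique[OF has_integral_primitive[OF q a]] in auto)
qed

lemma primitive_deriv:
  assumes q: "continuous_on {0<..} q" and x: "0 < x"
  shows "(primitive q has_vector_derivative q x) (at x)"
proof -
  note l = continuous_locally_integrable[OF q]
  have "((\<lambda>u. primitive q (x/2) + integral {x/2..u} q) has_vector_derivative 0 + q x) (at x within {x/2..x+1})"
    using x by (intro has_vector_derivative_add has_vector_derivative_const integral_has_vector_derivative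
        continuous_on_subset[OF q]) auto
  then have "((\<lambda>u. primitive q (x/2) + integral {x/2..u} q) has_vector_derivative q x) (at x)"
    using at_within_interior[of x "{x/2..x+1}"] x by simp
  then show ?thesis
  proof (rule has_vector_derivative_transform_within_open[of _ _ _ "{x/2<..}"])
    show "primitive q (x/2) + integral {x/2..y} q = primitive q y" if "y \<in> {x/2<..}" for y
      using integral_unique[OF has_integral_primitive[OF l, of "x/2" y]] that x by simp
  qed (use x in auto)
qed

lemma C1_locally:
  fixes f :: cfun
  assumes "\<And>x. 0 < x \<Longrightarrow> (f has_vector_derivative f' x) (at x)" "continuous_on {0<..} f'" "0 < a" "a \<le> b"
  shows "(f' has_integral (f b - f a)) {a..b}"
  by (rule fundamental_theorem_of_calculus) (use assms in \<open>auto intro: has_vector_derivative_at_within\<close>)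

lemma test_function_parts2:
  assumes f: "f \<in> test_functions" "f' \<in> test_functions" "f'' \<in> test_functions"
    "\<And>x. (f has_vector_derivative f' x) (at x)" "\<And>x. (f' has_vector_derivative f'' x) (at x)"
    and q: "locally_integrable q" and h': "continuous_on {0<..} h'"
    and h: "\<And>x. 0 < x \<Longrightarrow> (h has_vector_derivative h' x) (at x)"
    and hq: "\<And>x y. 0 < x \<Longrightarrow> x \<le> y \<Longrightarrow> (q has_integral (h' y - h' x)) {x..y}"
  shows "(LINT x|half_line. f'' x * h x) = (LINT x|half_line. f x * q x)"
proof -
  have hc: "continuous_on {0<..} h" using h by (rule continuous_on_pos_if_deriv)
  have "(LINT x|half_line. f'' x * h x) = - (LINT x|half_line. f' x * h' x)"
    by (rule test_function_parts[OF f(2,3,5) continuous_locally_integrable[OF h'] _ continuous_locally_integrable[OF hc]])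
      (rule C1_locally[OF h h'])
  also have "(LINT x|half_line. f' x * h' x) = - (LINT x|half_line. f x * q x)"
    by (rule test_function_parts[OF f(1,2,4) q hq continuous_locally_integrable[OF h']])
  finally show ?thesis by simp
qed

lemma L2_inner_L_expr_test_function:
  assumes p: "p \<in> test_functions" "p'' \<in> test_functions"
    and d: "\<And>x. (p has_vector_derivative p' x) (at x)" "\<And>x. (p' has_vector_derivative p'' x) (at x)"
    and f: "locally_integrable f"
  shows "L2_inner (L_expr \<alpha> (\<lambda>x. cnj (p x))) f = (LINT x|half_line. p x * (potential \<alpha> x * f x)) - (LINT x|half_line. p'' x * f x)"
proof -
  note int = test_function_mult_integral(1)
  have kx: "cnj (L_expr \<alpha> (\<lambda>x. cnj (p x)) x) = - p'' x + potential \<alpha> x * p x" for x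
    unfolding L_expr_test_function[OF has_vector_derivative_cnj[OF d(1)] has_vector_derivative_cnj[OF d(2)]] by (simp add: potential_def)
  have "L2_inner (L_expr \<alpha> (\<lambda>x. cnj (p x))) f = (LINT x|half_line. p x * (potential \<alpha> x * f x) - p'' x * f x)"
    unfolding L2_inner_def kx by (simp add: algebra_simps)
  then show ?thesis using int[OF p(1) locally_integrable_mult[OF continuous_on_potential f]] int[OF p(2) f] by simp
qed

text \<open>One inclusion is integrating by parts twice. Conversely, two primitives solve Q'' = V f
  - g; then f - Q has vanishing weak second derivative, so it is affine almost everywhere, and Q
  plus that affine function is the differentiable representative.\<close>

theorem adjoint_test_op: "adjoint_op (test_op \<alpha>) = max_op \<alpha>"
proof (rule equalityI; rule subrelI)
  fix f g assume fg: "(f, g) \<in> max_op \<alpha>"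
  then obtain F F' where reg: "regular \<alpha> F F' g" and ae: "AE x in half_line. f x = F x" and f: "f \<in> L2" by (auto simp: max_op_def)
  note R = regularD[OF reg]
  have "(F, g) \<in> adjoint_op (test_op \<alpha>)"
  proof (rule adjoint_opI[OF R(1,2)])
    fix h k assume "(h, k) \<in> test_op \<alpha>"
    then have h: "h \<in> test_functions" and k: "k = L_expr \<alpha> h" by (auto simp: test_op_def)
    define p where "p x = cnj (h x)" for x
    have p: "p \<in> test_functions" unfolding p_def by (rule test_function_cnj[OF h])
    obtain p' p'' where t: "p' \<in> test_functions" "p'' \<in> test_functions"
      and d: "\<And>x. (p has_vector_derivative p' x) (at x)" "\<And>x. (p' has_vector_derivative p'' x) (at x)"
      using test_function_derivs[OF p] by blast
    note int = test_function_mult_integral(1)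
    note li = continuous_locally_integrable[OF regular_continuous[OF reg]]
      locally_integrable_mult[OF continuous_on_potential continuous_locally_integrable[OF regular_continuous[OF reg]]]
      L2_locally_integrable[OF R(2)]
    have "L2_inner k F = (LINT x|half_line. p x * (potential \<alpha> x * F x)) - (LINT x|half_line. p'' x * F x)"
      using L2_inner_L_expr_test_function[OF p t(2) d li(1)] by (simp add: k p_def)
    also have "(LINT x|half_line. p'' x * F x) = (LINT x|half_line. p x * (potential \<alpha> x * F x - g x))"
      by (rule test_function_parts2[OF p t d regular_rhs_locally_integrable[OF reg] regular_deriv_continuous[OF reg] R(3,4)])
    also have "\<dots> = (LINT x|half_line. p x * (potential \<alpha> x * F x)) - (LINT x|half_line. p x * g x)"
      using int[OF p li(2)] int[OF p li(3)] by (simp add: right_diff_distrib)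
    finally show "L2_inner k F = L2_inner h g" by (simp add: L2_inner_def p_def)
  qed
  then show "(f, g) \<in> adjoint_op (test_op \<alpha>)" by (rule adjoint_op_cong_AE) (use test_op_L2 f R(2) ae in \<open>auto elim: AE_mp\<close>)
next
  fix f g assume fg: "(f, g) \<in> adjoint_op (test_op \<alpha>)"
  note A = adjoint_opD[OF fg]
  define q where "q x = potential \<alpha> x * f x - g x" for x
  have q: "locally_integrable q" unfolding q_def by (intro locally_integrable_diff locally_integrable_mult continuous_on_potential L2_locally_integrable A)
  define Q' where "Q' = primitive q"
  define Q where "Q = primitive Q'"
  have Q'c: "continuous_on {0<..} Q'" unfolding Q'_def by (rule primitive_continuous[OF q])
  have Qd: "0 < x \<Longrightarrow> (Q has_vector_derivative Q' x) (at x)" for x unfolding Q_def by (rule primitive_deriv[OF Q'c])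
  have Qc: "continuous_on {0<..} Q" using Qd by (rule continuous_on_pos_if_deriv)
  have "\<exists>c d. AE x in half_line. f x - Q x = c + d * of_real x"
  proof (rule weak_second_derivative_zero)
    show "locally_integrable (\<lambda>x. f x - Q x)" by (intro locally_integrable_diff L2_locally_integrable A continuous_locally_integrable Qc)
    fix p p' p'' assume p: "p \<in> test_functions" "p' \<in> test_functions" "p'' \<in> test_functions"
      and d: "\<And>x. (p has_vector_derivative p' x) (at x)" "\<And>x. (p' has_vector_derivative p'' x) (at x)"
    define h where "h x = cnj (p x)" for x
    have h: "h \<in> test_functions" unfolding h_def by (rule test_function_cnj[OF p(1)])
    note int = test_function_mult_integral(1)
    note li = L2_locally_integrable[OF A(1)] L2_locally_integrable[OF A(2)]
      locally_integrable_mult[OF continuous_on_potential L2_locally_integrable[OF A(1)]]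
    have "L2_inner (L_expr \<alpha> h) f = L2_inner h g" by (rule A(3)) (auto simp: test_op_def h)
    moreover have "L2_inner (L_expr \<alpha> h) f = (LINT x|half_line. p x * (potential \<alpha> x * f x)) - (LINT x|half_line. p'' x * f x)"
      unfolding h_def[abs_def] by (rule L2_inner_L_expr_test_function[OF p(1,3) d li(1)])
    moreover have "L2_inner h g = (LINT x|half_line. p x * g x)" by (simp add: L2_inner_def h_def)
    moreover have "(LINT x|half_line. p'' x * Q x) = (LINT x|half_line. p x * q x)"
      by (rule test_function_parts2[OF p d q Q'c Qd]) (auto simp: Q'_def intro: has_integral_primitive[OF q])
    moreover have "(LINT x|half_line. p x * q x) = (LINT x|half_line. p x * (potential \<alpha> x * f x)) - (LINT x|half_line. p x * g x)"
      unfolding q_def using int[OF p(1) li(3)] int[OF p(1) li(2)] by (simp add: right_diff_distrib)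
    ultimately have "(LINT x|half_line. p x * (potential \<alpha> x * f x)) - (LINT x|half_line. p'' x * f x) =
        (LINT x|half_line. p x * (potential \<alpha> x * f x)) - (LINT x|half_line. p'' x * Q x)" by simp
    then have "(LINT x|half_line. p'' x * f x) = (LINT x|half_line. p'' x * Q x)" by simp
    then show "(LINT x|half_line. p'' x * (f x - Q x)) = 0"
      using int[OF p(3) li(1)] int[OF p(3) continuous_locally_integrable[OF Qc]] by (simp add: right_diff_distrib)
  qed
  then obtain c d where cd: "AE x in half_line. f x - Q x = c + d * of_real x" by blast
  define F where "F x = Q x + (c + d * of_real x)" for x
  define F' where "F' x = Q' x + d" for x
  have ae: "AE x in half_line. f x = F x" using cd by eventually_elim (simp add: F_def algebra_simps)
  have Fd: "0 < x \<Longrightarrow> (F has_vector_derivative F' x) (at x)" for x unfolding F_def F'_def by (auto intro!: derivative_eq_intros Qd)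
  have "F \<in> borel_measurable half_line" by (rule continuous_on_pos_measurable[OF continuous_on_pos_if_deriv[OF Fd]])
  then have FL: "F \<in> L2" using L2_cong_AE[OF A(1) ae] by simp
  have "((\<lambda>x. potential \<alpha> x * F x - g x) has_integral (F' b - F' a)) {a..b}" if "0 < a" "a \<le> b" for a b
  proof (rule AE_half_line_has_integral)
    show "AE x in half_line. q x = potential \<alpha> x * F x - g x" using ae by eventually_elim (simp add: q_def)
    show "(q has_integral F' b - F' a) {a..b}" using has_integral_primitive[OF q that] by (simp add: F'_def Q'_def)
  qed (use that in simp)
  with FL A(2) Fd have "regular \<alpha> F F' g" by (auto simp: regular_def)
  with A(1) ae show "(f, g) \<in> max_op \<alpha>" by (auto simp: max_op_def)
qed

subsection \<open>Lagrange's identity and boundary values\<close>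

abbreviation wronskian ::
  "cfun \<Rightarrow> cfun \<Rightarrow> cfun \<Rightarrow> cfun \<Rightarrow> real \<Rightarrow> complex" where
  "wronskian f f' h h' x \<equiv> f x * h' x - f' x * h x"

lemma regular_parts:
  assumes f: "\<And>x. 0 < x \<Longrightarrow> (f has_vector_derivative f' x) (at x)" "continuous_on {0<..} f'"
    and h: "regular \<alpha> h h' k" and ab: "0 < a" "a \<le> b"
  shows "((\<lambda>x. f' x * h' x + f x * (potential \<alpha> x * h x - k x)) has_integral (f b * h' b - f a * h' a)) {a..b}"
proof -
  have 1: "(f has_vector_derivative f' x) (at x within {a..b})" if "x \<in> {a..b}" for x
    by (rule has_vector_derivative_at_within[OF f(1)]) (use that ab in simp)
  have 2: "continuous_on {a..b} f'" by (rule continuous_on_subset[OF f(2)]) (use ab in auto)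
  have 3: "(\<lambda>x. potential \<alpha> x * h x - k x) absolutely_integrable_on {a..b}"
    using regular_rhs_locally_integrable[OF h] ab(1) unfolding locally_integrable_def by blast
  have 4: "((\<lambda>x. potential \<alpha> x * h x - k x) has_integral h' y - h' x) {x..y}" if "a \<le> x" "x \<le> y" "y \<le> b" for x y
    by (rule regularD(4)[OF h]) (use that ab in auto)
  show ?thesis by (rule integration_by_parts_C1_AC[OF ab(2) 1 2 3 4])
qed

text \<open>Integrating by parts with the roles of f and h exchanged and subtracting cancels f' h'
  and the potential.\<close>

lemma lagrange_Icc:
  assumes f: "regular \<alpha> f f' g" and h: "regular \<alpha> h h' k" and ab: "0 < a" "a \<le> b"
  shows "((\<lambda>x. f x * k x - g x * h x) has_integral (wronskian f f' h h' a - wronskian f f' h h' b)) {a..b}"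
proof -
  have "((\<lambda>x. (h' x * f' x + h x * (potential \<alpha> x * f x - g x)) - (f' x * h' x + f x * (potential \<alpha> x * h x - k x)))
     has_integral ((h b * f' b - h a * f' a) - (f b * h' b - f a * h' a))) {a..b}"
    by (intro has_integral_diff regular_parts ab f h regularD(3)[OF f] regularD(3)[OF h]
        regular_deriv_continuous[OF f] regular_deriv_continuous[OF h])
  then show ?thesis by (simp add: algebra_simps)
qed

lemma nonneg_integrable_exhaustion:
  fixes h :: "real \<Rightarrow> real"
  assumes i: "\<And>n. h integrable_on {a n..b n}" and inc: "\<And>n. {a n..b n} \<subseteq> {a (Suc n)..b (Suc n)}"
    and ex: "\<And>x. x \<in> S \<Longrightarrow> \<exists>n. x \<in> {a n..b n}" and sub: "\<And>n. {a n..b n} \<subseteq> S"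
    and nn: "\<And>x. x \<in> S \<Longrightarrow> 0 \<le> h x" and bd: "\<And>n. integral {a n..b n} h \<le> C"
  shows "h integrable_on S" "(\<lambda>n. integral {a n..b n} h) \<longlonglongrightarrow> integral S h"
proof -
  define F where "F n x = (if x \<in> {a n..b n} then h x else 0)" for n x
  have eq: "integral S (F n) = integral {a n..b n} h" for n
  proof -
    have "integral S (F n) = integral ({a n..b n} \<inter> S) h" unfolding F_def by (rule integral_restrict_Int)
    also have "{a n..b n} \<inter> S = {a n..b n}" using sub by auto
    finally show ?thesis .
  qed
  have "h integrable_on S \<and> (\<lambda>n. integral S (F n)) \<longlonglongrightarrow> integral S h"
  proof (rule monotone_convergence_increasing)
    show "F n integrable_on S" for n unfolding F_def using i[of n] sub[of n] by (subst integrable_restrict_Int) (simp add: Int_absorb2)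
    show "F n x \<le> F (Suc n) x" if "x \<in> S" for n x using inc[of n] nn[OF that] by (auto simp: F_def)
    show "(\<lambda>n. F n x) \<longlonglongrightarrow> h x" if "x \<in> S" for x
    proof -
      obtain n where n: "x \<in> {a n..b n}" using ex \<open>x \<in> S\<close> by blast
      have "x \<in> {a m..b m}" if "m \<ge> n" for m using lift_Suc_mono_le[of "\<lambda>n. {a n..b n}" n m] inc that n by blast
      then have "\<forall>\<^sub>F m in sequentially. F m x = h x" by (intro eventually_sequentiallyI[of n]) (simp add: F_def)
      then show ?thesis by (rule tendsto_eventually)
    qed
    have "\<bar>integral {a n..b n} h\<bar> \<le> C" for n
      using bd[of n] sub[of n] nn by (subst abs_of_nonneg) (auto intro!: Henstock_Kurzweil_Integration.integral_nonneg i)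
    then show "bounded (range (\<lambda>n. integral S (F n)))" unfolding eq by (auto simp: bounded_iff)
  qed
  then show "h integrable_on S" "(\<lambda>n. integral {a n..b n} h) \<longlonglongrightarrow> integral S h" by (simp_all add: eq)
qed

lemma integral_ge_log:
  fixes h :: "real \<Rightarrow> real"
  assumes h: "h integrable_on S" "\<And>x. x \<in> S \<Longrightarrow> 0 \<le> h x" and ab: "0 < a" "a \<le> b" "{a..b} \<subseteq> S"
    and ge: "\<And>x. x \<in> {a..b} \<Longrightarrow> e / x \<le> h x"
  shows "e * (ln b - ln a) \<le> integral S h"
proof -
  note hi = integrable_on_subinterval[OF h(1) ab(3)]
  have i: "((\<lambda>x. e / x) has_integral (e * ln b - e * ln a)) {a..b}" using ab by (intro fundamental_theorem_of_calculus)
      (auto intro!: derivative_eq_intros simp flip: has_real_derivative_iff_has_vector_derivative)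
  have "e * (ln b - ln a) = integral {a..b} (\<lambda>x. e / x)" using integral_unique[OF i] by (simp add: right_diff_distrib)
  also have "\<dots> \<le> integral {a..b} h" using i ge hi by (intro integral_le) auto
  also have "\<dots> \<le> integral S h" using h ab(3) hi by (intro integral_subset_le) auto
  finally show ?thesis .
qed

text \<open>Otherwise h would dominate e / x near infinity, whose integral diverges logarithmically.
  Integrability gives no pointwise decay, so boundary terms at infinity are controlled only along
  points found in this way.\<close>

lemma integrable_small_weighted_value_at_top:
  fixes h :: "real \<Rightarrow> real"
  assumes h: "h absolutely_integrable_on {c..}" and e: "e > 0"
  shows "\<exists>x\<ge>X. x * h x < e"
proof (rule ccontr)
  assume neg: "\<not> (\<exists>x\<ge>X. x * h x < e)"
  define Y where "Y = Max {1, c, X}"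
  have ge: "e / x \<le> \<bar>h x\<bar>" if "x \<ge> Y" for x
  proof -
    have "x > 0" "x \<ge> X" using that by (auto simp: Y_def)
    then have "e \<le> x * h x" using neg by (auto simp: not_less)
    also have "x * h x \<le> x * \<bar>h x\<bar>" using \<open>x > 0\<close> by (intro mult_left_mono) auto
    finally show ?thesis using \<open>x > 0\<close> by (simp add: divide_le_eq mult.commute)
  qed
  have hn: "(\<lambda>x. \<bar>h x\<bar>) integrable_on {Y..}"
    using set_integrable_subset[OF h, of "{Y..}"] by (auto simp: Y_def absolutely_integrable_on_def)
  define I where "I = integral {Y..} (\<lambda>x. \<bar>h x\<bar>)"
  \<comment> \<open>Chosen so that the logarithmic lower bound equals |I| + 1 and exceeds the
    integral I.\<close>
  define B where "B = Y * exp ((\<bar>I\<bar> + 1) / e)"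
  have YB: "0 < Y" "Y \<le> B" using e mult_left_mono[of 1 "exp ((\<bar>I\<bar> + 1) / e)" Y] by (auto simp: Y_def B_def less_max_iff_disj)
  have "e * (ln B - ln Y) \<le> I" unfolding I_def using ge by (intro integral_ge_log hn YB) auto
  moreover have "ln B - ln Y = (\<bar>I\<bar> + 1) / e" using YB by (simp add: B_def ln_mult)
  ultimately show False using e by simp
qed

lemma integrable_small_value_at_top:
  fixes h :: "real \<Rightarrow> real"
  assumes "h absolutely_integrable_on {c..}" and e: "e > 0"
  shows "\<exists>x\<ge>X. h x < e"
proof -
  obtain x where x: "x \<ge> max 1 X" "x * h x < e" using integrable_small_weighted_value_at_top[OF assms] by blast
  with e have "h x < e" using mult_right_mono[of 1 x "h x"] by (cases "h x \<ge> 0") auto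
  with x show ?thesis by (intro exI[of _ x]) simp
qed

text \<open>The same logarithmic divergence of 1 / x, now at the left end.\<close>

lemma L2_small_value_at_0:
  assumes f: "f \<in> L2" and c: "continuous_on {0<..} f" and e: "e > 0" and d: "d > 0"
  shows "\<exists>x\<in>{0<..<d}. x * (norm (f x))^2 < e"
proof (rule ccontr)
  assume "\<not> ?thesis"
  then have ge: "e / x \<le> (norm (f x))^2" if "0 < x" "x < d" for x using that by (auto simp: not_less divide_le_eq mult.commute)
  have "(\<lambda>x. (norm (f x))^2) absolutely_integrable_on {0..d/2}" by (rule absolutely_integrable_Icc_half_line[OF L2_integrable_sq[OF f]]) simp
  then have i: "(\<lambda>x. (norm (f x))^2) integrable_on {0..d/2}" by (simp add: absolutely_integrable_on_def)
  define I where "I = integral {0..d/2} (\<lambda>x. (norm (f x))^2)"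
  have "e * (ln (d/2) - ln a) \<le> I" if a: "0 < a" "a \<le> d/2" for a unfolding I_def using a d ge by (intro integral_ge_log i) auto
  from this[of "exp (min (ln (d/2)) (ln (d/2) - (I + 1) / e))"] d
  have "e * (ln (d/2) - (ln (d/2) - (I + 1) / e)) \<le> I" using mult_left_mono[of "min (ln (d/2)) (ln (d/2) - (I + 1) / e)" "ln (d/2) - (I + 1) / e" e] e
    by (smt (verit, best) exp_gt_zero exp_le_cancel_iff exp_ln half_gt_zero ln_exp right_diff_distrib)
  with e show False by simp
qed

lemma L2_bounded_mult:
  assumes "h \<in> borel_measurable half_line" and B: "\<And>x. 0 < x \<Longrightarrow> norm (h x) \<le> B" and f: "f \<in> L2"
  shows "(\<lambda>x. h x * f x) \<in> L2"
proof -
  have m: "(\<lambda>x. h x * f x) \<in> borel_measurable half_line" using assms(1) L2_measurable[OF f] by measurable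
  have "integrable half_line (\<lambda>x. (norm (h x * f x))^2)"
  proof (rule Bochner_Integration.integrable_bound)
    show "integrable half_line (\<lambda>x. B^2 * (norm (f x))^2)" using L2_integrable_sq[OF f] by simp
    show "AE x in half_line. norm ((norm (h x * f x))^2) \<le> norm (B^2 * (norm (f x))^2)" using AE_half_line_pos
      by eventually_elim (auto simp: norm_mult power_mult_distrib intro!: mult_right_mono power_mono B)
  qed (use m in measurable)
  with m show ?thesis by (simp add: L2_def)
qed

lemma absolutely_integrable_Ici_half_line:
  fixes h :: "real \<Rightarrow> 'b::euclidean_space"
  assumes "integrable half_line h" "0 \<le> a"
  shows "h absolutely_integrable_on {a..}" using assms(1) unfolding half_line_integrable_iff by (rule set_integrable_subset) (use assms(2) in auto)

lemma Re_cnj_mult_self: "Re (cnj z * z) = (norm z)^2" unfolding cmod_power2 by (simp add: power2_eq_square)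

text \<open>If \<open>f'\<close> were not square integrable near infinity, then \<open>Re (cnj f f')\<close>, hence the derivative of
  \<open>|f|^2\<close>, would stay above a positive constant.\<close>

lemma regular_deriv_square_integrable:
  assumes reg: "regular \<alpha> f f' g"
  shows "(\<lambda>x. (norm (f' x))^2) absolutely_integrable_on {1..}"
proof -
  note R = regularD[OF reg]
  note fc = regular_continuous[OF reg] and f'c = regular_deriv_continuous[OF reg]
  \<comment> \<open>The potential frozen below 1 is bounded on the whole half-line, so that V f - g
    is square integrable; on [1, \<infinity>[ nothing has changed.\<close>
  define V where "V x = potential \<alpha> (max 1 x)" for x
  have "norm (V x) \<le> \<bar>- 1/4 + \<alpha>\<bar>" for x
  proof -
    have "1 \<le> (max 1 x)^2" by (simp add: one_le_power)
    then have "1 / (max 1 x)^2 \<le> 1" by (simp add: divide_le_eq)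
    then have "\<bar>- 1/4 + \<alpha>\<bar> * (1 / (max 1 x)^2) \<le> \<bar>- 1/4 + \<alpha>\<bar> * 1" by (intro mult_left_mono) auto
    then show ?thesis unfolding V_def potential_def by (simp only: norm_of_real abs_mult) simp
  qed
  moreover have "continuous_on {0<..} V" unfolding V_def potential_def by (intro continuous_intros) (auto simp: max_def)
  ultimately have "(\<lambda>x. V x * f x - g x) \<in> L2" using R by (intro L2_diff L2_bounded_mult[of V] continuous_on_pos_measurable) auto
  from absolutely_integrable_Ici_half_line[OF L2_integrable_inner[OF R(1) this], of 1]
  have ki: "(\<lambda>x. cnj (f x) * (potential \<alpha> x * f x - g x)) absolutely_integrable_on {1..}"
    by (subst set_integrable_cong[OF refl refl, of "{1..}" _ "\<lambda>x. cnj (f x) * (V x * f x - g x)"])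
      (auto simp: V_def max_def)
  define k where "k x = cnj (f x) * (potential \<alpha> x * f x - g x)" for x
  have ki: "k absolutely_integrable_on {1..}" using ki by (simp add: k_def[abs_def])
  then have kn: "(\<lambda>x. norm (k x)) integrable_on {1..}" "k integrable_on {1..}" by (auto simp: absolutely_integrable_on_def)
  have k1: "k integrable_on {1..b}" for b by (rule integrable_on_subinterval[OF kn(2)]) auto
  have kb: "norm (integral {1..b} k) \<le> integral {1..} (\<lambda>x. norm (k x))" for b
  proof -
    have "norm (integral {1..b} k) \<le> integral {1..b} (\<lambda>x. norm (k x))"
      by (intro integral_norm_bound_integral k1 integrable_on_subinterval[OF kn(1)]) auto
    also have "\<dots> \<le> integral {1..} (\<lambda>x. norm (k x))" by (intro integral_subset_le kn integrable_on_subinterval[OF kn(1)]) auto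
    finally show ?thesis .
  qed
  have f'i: "(\<lambda>x. (norm (f' x))^2) integrable_on {1..b}" for b
    by (intro integrable_continuous_interval continuous_intros continuous_on_subset[OF f'c]) auto
  define E where "E b = integral {1..b} (\<lambda>x. (norm (f' x))^2)" for b
  have E_eq: "E b = Re (cnj (f b) * f' b) - Re (cnj (f 1) * f' 1) - Re (integral {1..b} k)" if b: "1 \<le> b" for b
  proof -
    have "((\<lambda>x. cnj (f' x) * f' x + cnj (f x) * (potential \<alpha> x * f x - g x)) has_integral
       (cnj (f b) * f' b - cnj (f 1) * f' 1)) {1..b}" using b by (intro regular_parts reg continuous_intros f'c has_vector_derivative_cnj R(3)) auto
    from has_integral_diff[OF this integrable_integral[OF k1]]
    have "((\<lambda>x. cnj (f' x) * f' x) has_integral (cnj (f b) * f' b - cnj (f 1) * f' 1 - integral {1..b} k)) {1..b}" by (simp add: k_def)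
    from has_integral_linear[OF this bounded_linear_Re]
    have "((\<lambda>x. (norm (f' x))^2) has_integral Re (cnj (f b) * f' b - cnj (f 1) * f' 1 - integral {1..b} k)) {1..b}"
      unfolding o_def Re_cnj_mult_self .
    then show ?thesis by (simp add: E_def integral_unique)
  qed
  \<comment> \<open>As soon as \<open>E x\<close> reaches this value, \<open>E_eq\<close> leaves at
    least 1 for the boundary term at x.\<close>
  define C where "C = 1 + \<bar>Re (cnj (f 1) * f' 1)\<bar> + integral {1..} (\<lambda>x. norm (k x))"
  have bd: "E b \<le> C" if b: "1 \<le> b" for b
  proof (rule ccontr)
    assume "\<not> E b \<le> C"
    have big: "1 \<le> Re (cnj (f x) * f' x)" if "x \<ge> b" for x
    proof -
      have "E b \<le> E x" unfolding E_def by (intro integral_subset_le f'i) (use that in auto)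
      then have "C \<le> E x" using \<open>\<not> E b \<le> C\<close> by simp
      moreover have "\<bar>Re (integral {1..x} k)\<bar> \<le> integral {1..} (\<lambda>x. norm (k x))"
        using kb[of x] abs_Re_le_cmod[of "integral {1..x} k"] by linarith
      ultimately show ?thesis using E_eq[of x] b that unfolding C_def by linarith
    qed
    have grow: "2 * (x - b) \<le> (norm (f x))^2" if x: "x \<ge> b" for x
    proof -
      have "((\<lambda>x. cnj (f x) * f' x + cnj (f' x) * f x) has_integral (cnj (f x) * f x - cnj (f b) * f b)) {b..x}"
      proof (rule fundamental_theorem_of_calculus[OF x])
        fix y assume "y \<in> {b..x}"
        then have "0 < y" using b by simp
        from has_vector_derivative_mult[OF has_vector_derivative_cnj[OF R(3)[OF this]] R(3)[OF this]]
        show "((\<lambda>x. cnj (f x) * f x) has_vector_derivative cnj (f y) * f' y + cnj (f' y) * f y) (at y within {b..x})"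
          by (rule has_vector_derivative_at_within)
      qed
      from has_integral_linear[OF this bounded_linear_Re]
      have i: "((\<lambda>x. 2 * Re (cnj (f x) * f' x)) has_integral ((norm (f x))^2 - (norm (f b))^2)) {b..x}"
        unfolding o_def minus_complex.sel Re_cnj_mult_self by (simp add: algebra_simps)
      have "2 * (x - b) = integral {b..x} (\<lambda>x. 2)" using x by simp
      also have "\<dots> \<le> integral {b..x} (\<lambda>x. 2 * Re (cnj (f x) * f' x))" using i big by (intro integral_le) fastforce+
      also have "\<dots> \<le> (norm (f x))^2" using integral_unique[OF i] by simp
      finally show ?thesis .
    qed
    obtain x where "x \<ge> b + 1" "(norm (f x))^2 < 1"
      using integrable_small_value_at_top[OF absolutely_integrable_Ici_half_line[OF L2_integrable_sq[OF R(1)], of 0], of 1 "b + 1"] by auto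
    with grow[of x] show False by simp
  qed
  have "(\<lambda>x. (norm (f' x))^2) integrable_on {1..}"
  proof (rule nonneg_integrable_exhaustion(1)[where a = "\<lambda>_. 1" and b = "\<lambda>n. 1 + real n" and C = C])
    show "\<exists>n. x \<in> {1..1 + real n}" if "x \<in> {1..}" for x using that real_arch_simple[of "x - 1"] by (auto simp: algebra_simps)
    show "integral {1..1 + real n} (\<lambda>x. (norm (f' x))^2) \<le> C" for n using bd[of "1 + real n"] by (simp add: E_def)
  qed (auto intro: f'i)
  then show ?thesis by (simp add: absolutely_integrable_on_def)
qed

lemma lagrange_integrand_integrable:
  assumes f: "regular \<alpha> f f' g" and h: "regular \<alpha> h h' k"
  shows "integrable half_line (\<lambda>x. f x * k x - g x * h x)"
  using regularD[OF f] regularD[OF h] by (intro Bochner_Integration.integrable_diff L2_integrable_mult)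

text \<open>Lagrange's identity with an integrable integrand gives the existence of a limit. The
  Wronskian is dominated by an integrable function, which takes arbitrarily small values far out, so
  the limit is 0.\<close>

lemma wronskian_tendsto_0_at_top:
  assumes f: "regular \<alpha> f f' g" and h: "regular \<alpha> h h' k"
  shows "((\<lambda>x. wronskian f f' h h' x) \<longlongrightarrow> 0) at_top"
proof -
  let ?W = "wronskian f f' h h'"
  define I where "I x = f x * k x - g x * h x" for x
  have Ii: "integrable half_line I" unfolding I_def by (rule lagrange_integrand_integrable[OF f h])
  have "((\<lambda>b. ?W 1 - integral {1..b} I) \<longlongrightarrow> ?W 1 - integral {1..} I) at_top"
    by (intro tendsto_intros integral_Icc_tendsto_at_top absolutely_integrable_Ici_half_line[OF Ii]) simp
  then have lim: "(?W \<longlongrightarrow> ?W 1 - integral {1..} I) at_top"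
  proof (rule Lim_transform_eventually)
    show "\<forall>\<^sub>F b in at_top. ?W 1 - integral {1..b} I = ?W b" using eventually_ge_at_top[of 1]
      by eventually_elim (use integral_unique[OF lagrange_Icc[OF f h, of 1]] in \<open>simp add: I_def[abs_def]\<close>)
  qed
  define S where "S x = ((norm (f x))^2 + (norm (h' x))^2) + ((norm (f' x))^2 + (norm (h x))^2)" for x
  have S: "S absolutely_integrable_on {1..}" unfolding S_def
    by (intro set_integral_add(1) regular_deriv_square_integrable[OF f] regular_deriv_square_integrable[OF h]
        absolutely_integrable_Ici_half_line[OF L2_integrable_sq] regularD(1)[OF f] regularD(1)[OF h]) simp_all
  have WS: "norm (?W x) \<le> S x" for x
  proof -
    have "norm (?W x) \<le> norm (f x) * norm (h' x) + norm (f' x) * norm (h x)" by (metis norm_mult norm_triangle_ineq4)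
    also have "\<dots> \<le> S x" using sum_squares_bound[of "norm (f x)" "norm (h' x)"] sum_squares_bound[of "norm (f' x)" "norm (h x)"]
        mult_nonneg_nonneg[OF norm_ge_zero[of "f x"] norm_ge_zero[of "h' x"]]
        mult_nonneg_nonneg[OF norm_ge_zero[of "f' x"] norm_ge_zero[of "h x"]] unfolding S_def by linarith
    finally show ?thesis .
  qed
  have "?W 1 - integral {1..} I = 0"
  proof (rule ccontr)
    define L where "L = ?W 1 - integral {1..} I"
    assume "?W 1 - integral {1..} I \<noteq> 0"
    then have L: "norm L > 0" by (simp add: L_def)
    have "((\<lambda>x. norm (?W x)) \<longlongrightarrow> norm L) at_top" using lim unfolding L_def by (rule tendsto_norm)
    then have "\<forall>\<^sub>F x in at_top. norm L / 2 < norm (?W x)" using L by (intro order_tendstoD(1)) auto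
    then obtain X where X: "\<And>x. x \<ge> X \<Longrightarrow> norm L / 2 < norm (?W x)" by (auto simp: eventually_at_top_linorder)
    obtain x where "x \<ge> X" "S x < norm L / 2" using integrable_small_value_at_top[OF S, of "norm L / 2" X] L by auto
    with X[of x] WS[of x] show False by linarith
  qed
  with lim show ?thesis by simp
qed

lemma wronskian_eq_tail_integral:
  assumes f: "regular \<alpha> f f' g" and h: "regular \<alpha> h h' k" and a: "0 < a"
  shows "wronskian f f' h h' a = integral {a..} (\<lambda>x. f x * k x - g x * h x)"
proof -
  let ?I = "\<lambda>x. f x * k x - g x * h x"
  have "((\<lambda>b. wronskian f f' h h' a - wronskian f f' h h' b) \<longlongrightarrow> wronskian f f' h h' a - 0) at_top"
    by (intro tendsto_intros wronskian_tendsto_0_at_top[OF f h])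
  then have "((\<lambda>b. integral {a..b} ?I) \<longlongrightarrow> wronskian f f' h h' a - 0) at_top"
  proof (rule Lim_transform_eventually)
    show "\<forall>\<^sub>F b in at_top. wronskian f f' h h' a - wronskian f f' h h' b = integral {a..b} ?I"
      using eventually_ge_at_top[of a] by eventually_elim (use integral_unique[OF lagrange_Icc[OF f h a]] in simp)
  qed
  moreover have "((\<lambda>b. integral {a..b} ?I) \<longlongrightarrow> integral {a..} ?I) at_top"
    using a by (intro integral_Icc_tendsto_at_top absolutely_integrable_Ici_half_line[OF lagrange_integrand_integrable[OF f h]]) simp
  ultimately show ?thesis using tendsto_unique[OF trivial_limit_at_top_linorder] by fastforce
qed

lemma integral_Ici_tendsto_at_right_0:
  fixes h :: cfun
  assumes h: "integrable half_line h"
  shows "((\<lambda>a. integral {a..} h) \<longlongrightarrow> (LINT x|half_line. h x)) (at_right 0)"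
proof (rule tendsto_at_right_sequentially[of 0 1])
  fix S :: "nat \<Rightarrow> real" assume S: "\<And>n. 0 < S n" "S \<longlonglongrightarrow> 0"
  show "(\<lambda>n. integral {S n..} h) \<longlonglongrightarrow> (LINT x|half_line. h x)" unfolding half_line_integral_eq[OF h]
  proof (rule integral_tendsto_sets[where U = "{0..}"])
    show "h absolutely_integrable_on {0..}" using h by (simp add: half_line_integrable_iff)
    show "{S n..} \<subseteq> {0..}" for n using S(1)[of n] by auto
    have "\<forall>\<^sub>F n in sequentially. (x \<in> {S n..}) = (x \<in> {0..})" if "x \<noteq> 0" for x
    proof (cases "x < 0")
      case True
      then show ?thesis using S(1) by (intro always_eventually) (auto simp: not_le intro: less_trans)
    next
      case False
      with that have "\<forall>\<^sub>F n in sequentially. S n < x" using order_tendstoD(2)[OF S(2)] by auto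
      then show ?thesis by eventually_elim (use False in auto)
    qed
    with AE_lebesgue_nonzero show "AE x in lebesgue. \<forall>\<^sub>F n in sequentially. (x \<in> {S n..}) = (x \<in> {0..})" by (auto elim: AE_mp)
  qed auto
qed simp

text \<open>Nothing comes from infinity, so Lagrange's identity leaves only the boundary form at 0;
  conjugating f makes it sesquilinear. In particular the limit at 0 exists on the whole maximal
  domain.\<close>

lemma wronskian_tendsto_at_right_0:
  assumes f: "regular \<alpha> f f' g" and h: "regular \<alpha> h h' k"
  shows "((\<lambda>x. wronskian (\<lambda>x. cnj (f x)) (\<lambda>x. cnj (f' x)) h h' x) \<longlongrightarrow> L2_inner f k - L2_inner g h) (at_right 0)"
proof -
  note cf = regular_cnj[OF f]
  have "((\<lambda>a. integral {a..} (\<lambda>x. cnj (f x) * k x - cnj (g x) * h x)) \<longlongrightarrow>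
     (LINT x|half_line. cnj (f x) * k x - cnj (g x) * h x)) (at_right 0)"
    by (rule integral_Ici_tendsto_at_right_0[OF lagrange_integrand_integrable[OF cf h]])
  moreover have "(LINT x|half_line. cnj (f x) * k x - cnj (g x) * h x) = L2_inner f k - L2_inner g h"
    unfolding L2_inner_def using regularD[OF f] regularD[OF h] by (simp add: L2_integrable_inner)
  moreover have "\<forall>\<^sub>F a in at_right 0. integral {a..} (\<lambda>x. cnj (f x) * k x - cnj (g x) * h x)
      = wronskian (\<lambda>x. cnj (f x)) (\<lambda>x. cnj (f' x)) h h' a" using eventually_at_right_less[of 0]
    by eventually_elim (simp add: wronskian_eq_tail_integral[OF cf h])
  ultimately show ?thesis by (auto intro: Lim_transform_eventually)
qed

text \<open>One minus the primitive of a test function of integral 1.\<close>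

lemma exists_cutoff:
  "\<exists>\<theta> \<theta>' \<theta>'' a b. 0 < a \<and> a < b \<and> (\<forall>x>0. (\<theta> has_vector_derivative \<theta>' x) (at x)) \<and>
    (\<forall>x. (\<theta>' has_vector_derivative \<theta>'' x) (at x)) \<and> continuous_on UNIV \<theta>' \<and> continuous_on UNIV \<theta>'' \<and>
    (\<forall>x. 0 < x \<longrightarrow> x \<le> a \<longrightarrow> \<theta> x = (1::complex)) \<and> (\<forall>x\<ge>b. \<theta> x = 0) \<and>
    (\<forall>x. x \<notin> {a..b} \<longrightarrow> \<theta>' x = 0 \<and> \<theta>'' x = 0)"
proof -
  obtain \<rho> where \<rho>: "\<rho> \<in> test_functions" "(LINT x|half_line. \<rho> x) = 1" by (rule test_function_with_unit_integral)
  obtain \<rho>' \<rho>'' a b where ab: "0 < a" "a < b" and t: "\<rho>' \<in> test_functions"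
    and d: "\<And>x. (\<rho> has_vector_derivative \<rho>' x) (at x)" and o: "\<And>x. x \<notin> {a<..<b} \<Longrightarrow> \<rho> x = 0 \<and> \<rho>' x = 0 \<and> \<rho>'' x = (0::complex)"
    using test_function_derivs[OF \<rho>(1)] by blast
  define \<theta> where "\<theta> x = 1 - integral {0..x} \<rho>" for x
  have c: "continuous_on S \<rho>" for S by (rule test_function_continuous_on[OF \<rho>(1)])
  have "(\<theta> has_vector_derivative - \<rho> x) (at x)" if x: "x > 0" for x
  proof -
    have "((\<lambda>u. 1 - integral {0..u} \<rho>) has_vector_derivative 0 - \<rho> x) (at x within {0..x + 1})"
      using x by (intro has_vector_derivative_diff has_vector_derivative_const integral_has_vector_derivative c) auto
    moreover have "at x within {0..x + 1} = at x" using x by (intro at_within_interior) auto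
    ultimately show ?thesis by (simp add: \<theta>_def[abs_def])
  qed
  moreover have "((\<lambda>x. - \<rho> x) has_vector_derivative - \<rho>' x) (at x)" for x by (intro has_vector_derivative_minus d)
  moreover have "continuous_on UNIV (\<lambda>x. - \<rho> x)" "continuous_on UNIV (\<lambda>x. - \<rho>' x)"
    by (intro continuous_intros c test_function_continuous_on[OF t])+
  moreover have "\<theta> x = 1" if "0 < x" "x \<le> a" for x
  proof -
    have "integral {0..x} \<rho> = integral {0..x} (\<lambda>_. 0)"
    proof (rule Henstock_Kurzweil_Integration.integral_cong)
      fix y assume "y \<in> {0..x}"
      then show "\<rho> y = 0" using o[of y] that by auto
    qed
    then show ?thesis by (simp add: \<theta>_def)
  qed
  moreover have "\<theta> x = 0" if "x \<ge> b" for x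
  proof -
    have "y \<notin> {0..x} \<Longrightarrow> \<rho> y = 0" for y using o[of y] that ab by auto
    then have "(LINT x|half_line. \<rho> x) = integral {0..x} \<rho>" by (intro half_line_integral_support(2) absolutely_integrable_continuous_real c) auto
    with \<rho>(2) show ?thesis by (simp add: \<theta>_def)
  qed
  moreover have "x \<notin> {a..b} \<Longrightarrow> - \<rho> x = 0 \<and> - \<rho>' x = 0" for x using o[of x] by auto
  ultimately show ?thesis using ab
    by (intro exI[of _ \<theta>] exI[of _ "\<lambda>x. - \<rho> x"] exI[of _ "\<lambda>x. - \<rho>' x"] exI[of _ a] exI[of _ b]) auto
qed

text \<open>As L u = 0, applying L to \<theta> u leaves - 2 \<theta>' u' - \<theta>'' u, which is
  continuous with compact support away from 0. Square integrability of u near 0 therefore puts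
  \<theta> u into the maximal domain.\<close>

lemma exists_regular_cutoff:
  fixes u u' :: "real \<Rightarrow> real"
  assumes u: "\<And>x. 0 < x \<Longrightarrow> (u has_real_derivative u' x) (at x)"
    and u': "\<And>x. 0 < x \<Longrightarrow> (u' has_real_derivative ((- 1/4 + \<alpha>) * (1 / x^2)) * u x) (at x)"
    and i: "\<And>b. 0 < b \<Longrightarrow> (\<lambda>x. (u x)^2) integrable_on {0<..b}"
  shows "\<exists>e e' z a. regular \<alpha> e e' z \<and> 0 < a \<and>
    (\<forall>x. 0 < x \<longrightarrow> x \<le> a \<longrightarrow> e x = of_real (u x) \<and> e' x = of_real (u' x) \<and> z x = 0)"
proof -
  obtain \<theta> \<theta>' \<theta>'' a b where ab: "0 < a" "a < b" and \<theta>: "\<And>x. 0 < x \<Longrightarrow> (\<theta> has_vector_derivative \<theta>' x) (at x)"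
      "\<And>x. (\<theta>' has_vector_derivative \<theta>'' x) (at x)"
    and c: "continuous_on UNIV \<theta>'" "continuous_on UNIV \<theta>''"
    and one: "\<And>x. 0 < x \<Longrightarrow> x \<le> a \<Longrightarrow> \<theta> x = (1::complex)" and zero: "\<And>x. x \<ge> b \<Longrightarrow> \<theta> x = 0"
    and supp: "\<And>x. x \<notin> {a..b} \<Longrightarrow> \<theta>' x = 0 \<and> \<theta>'' x = 0"
    using exists_cutoff by blast
  define U U' where "U x = complex_of_real (u x)" and "U' x = complex_of_real (u' x)" for x
  have Ud: "(U has_vector_derivative U' x) (at x)" if "0 < x" for x unfolding U_def[abs_def] U'_def using u[OF that]
    by (intro has_vector_derivative_of_real) (simp add: has_real_derivative_iff_has_vector_derivative)
  have U'd: "(U' has_vector_derivative potential \<alpha> x * U x) (at x)" if "0 < x" for x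
    unfolding U'_def[abs_def] U_def potential_def of_real_mult[symmetric] using u'[OF that]
    by (intro has_vector_derivative_of_real) (simp add: has_real_derivative_iff_has_vector_derivative)
  have Uc: "continuous_on {0<..} U" and U'c: "continuous_on {0<..} U'" using continuous_on_pos_if_deriv[OF Ud] continuous_on_pos_if_deriv[OF U'd] by auto
  have \<theta>c: "continuous_on {0<..} \<theta>" using \<theta>(1) by (rule continuous_on_pos_if_deriv)
  define e e' z where "e x = \<theta> x * U x" and "e' x = \<theta> x * U' x + \<theta>' x * U x"
    and "z x = - 2 * \<theta>' x * U' x - \<theta>'' x * U x" for x
  have ed: "(e has_vector_derivative e' x) (at x)" if "0 < x" for x
    unfolding e_def[abs_def] e'_def using that by (intro has_vector_derivative_mult \<theta> Ud)
  have e'd: "(e' has_vector_derivative potential \<alpha> x * e x - z x) (at x)" if "0 < x" for x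
  proof -
    have "(e' has_vector_derivative (\<theta> x * (potential \<alpha> x * U x) + \<theta>' x * U' x) + (\<theta>' x * U' x + \<theta>'' x * U x)) (at x)"
      unfolding e'_def[abs_def] using that by (intro has_vector_derivative_add has_vector_derivative_mult \<theta> Ud U'd)
    then show ?thesis by (simp add: e_def z_def algebra_simps)
  qed
  have zL: "z \<in> L2"
  proof (rule continuous_compact_support_L2)
    show "continuous_on {a..b} z" unfolding z_def using ab by (intro continuous_intros continuous_on_subset[OF c(1)] continuous_on_subset[OF c(2)]
          continuous_on_subset[OF Uc] continuous_on_subset[OF U'c]) auto
    show "z x = 0" if "x \<notin> {a..b}" for x using supp[OF that] by (simp add: z_def)
  qed (use ab in simp)
  have eL: "e \<in> L2"
  proof -
    have em: "e \<in> borel_measurable half_line" by (rule continuous_on_pos_measurable[OF continuous_on_pos_if_deriv[OF ed]])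
    have "bounded (\<theta> ` {a..b})" using ab by (intro compact_imp_bounded compact_continuous_image continuous_on_subset[OF \<theta>c]) auto
    then obtain B where B: "\<And>x. x \<in> {a..b} \<Longrightarrow> norm (\<theta> x) \<le> B" unfolding bounded_iff by blast
    have \<theta>B: "norm (\<theta> x) \<le> max 1 B" if "x > 0" for x
    proof -
      consider "x \<le> a" | "x \<in> {a..b}" | "x \<ge> b" by fastforce
      then show ?thesis using one[OF that] zero B[of x] by cases auto
    qed
    have "(\<lambda>x. (u x)^2) absolutely_integrable_on {0<..b}" using i[of b] ab by (intro nonnegative_absolutely_integrable_1) auto
    then have "integrable lebesgue (\<lambda>x. indicator {0..} x *\<^sub>R (norm (indicator {0<..b} x *\<^sub>R U x))^2)"
      unfolding set_integrable_def by (rule Bochner_Integration.integrable_cong[THEN iffD1, OF refl, rotated])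
        (auto simp: indicator_def U_def)
    then have "integrable half_line (\<lambda>x. (norm (indicator {0<..b} x *\<^sub>R U x))^2)" by (subst integrable_restrict_space) auto
    moreover have "(\<lambda>x. indicator {0<..b} x *\<^sub>R U x) \<in> borel_measurable half_line"
      by (intro borel_measurable_scaleR borel_measurable_indicator continuous_on_pos_measurable[OF Uc]) (auto simp: sets_restrict_space_iff)
    ultimately have "(\<lambda>x. indicator {0<..b} x *\<^sub>R U x) \<in> L2" by (simp add: L2_def)
    from L2_bounded_mult[OF continuous_on_pos_measurable[OF \<theta>c] \<theta>B this] show ?thesis
    proof (rule L2_cong_AE)
      show "AE x in half_line. \<theta> x * (indicator {0<..b} x *\<^sub>R U x) = e x"
        using AE_half_line_pos by eventually_elim (use zero in \<open>auto simp: e_def indicator_def\<close>)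
    qed (simp_all add: em)
  qed
  have "regular \<alpha> e e' z" unfolding regular_def using eL zL ed by (auto intro!: fundamental_theorem_of_calculus has_vector_derivative_at_within e'd)
  \<comment> \<open>The derivatives of \<theta> are known to vanish strictly left of a only, hence
    the smaller radius a / 2.\<close>
  moreover have "e x = of_real (u x) \<and> e' x = of_real (u' x) \<and> z x = 0" if "0 < x" "x \<le> a / 2" for x
    using one[of x] supp[of x] that ab by (simp add: e_def e'_def z_def U_def U'_def)
  ultimately show ?thesis using ab by (intro exI[of _ e] exI[of _ e'] exI[of _ z] exI[of _ "a / 2"]) auto
qed

subsection \<open>Dilations\<close>

lemma half_line_integrable_stretch:
  fixes h :: "real \<Rightarrow> 'b::euclidean_space"
  assumes h: "integrable half_line h" and c: "0 < c"
  shows "integrable half_line (\<lambda>x. h (c * x))" "(LINT x|half_line. h (c * x)) = (1 / c) *\<^sub>R (LINT x|half_line. h x)"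
proof -
  define k where "k x = indicat_real {0..} x *\<^sub>R h x" for x
  have k: "integrable lebesgue k" "integral\<^sup>L half_line h = integral\<^sup>L lebesgue k"
    using h by (simp_all add: half_line_integrable_iff set_integrable_def k_def[abs_def] integral_restrict_space)
  have eq: "(\<lambda>x. indicat_real {0..} x *\<^sub>R h (c * x)) = (\<lambda>x. k (0 + c * x))"
    using c by (auto simp: k_def indicator_def zero_le_mult_iff)
  have b: "has_bochner_integral lebesgue (\<lambda>x. k (0 + c * x)) (integral\<^sup>L lebesgue k /\<^sub>R \<bar>c\<bar>)"
    by (subst has_bochner_integral_lebesgue_real_affine_iff[symmetric]) (use k c in \<open>auto simp: has_bochner_integral_iff\<close>)
  then show "integrable half_line (\<lambda>x. h (c * x))" unfolding half_line_integrable_iff set_integrable_def eq by (simp add: has_bochner_integral_iff)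
  have "(LINT x|half_line. h (c * x)) = integral\<^sup>L lebesgue (\<lambda>x. indicat_real {0..} x *\<^sub>R h (c * x))"
    by (simp add: integral_restrict_space)
  also have "\<dots> = (1 / c) *\<^sub>R (LINT x|half_line. h x)" unfolding eq using b k(2) c by (simp add: has_bochner_integral_iff inverse_eq_divide)
  finally show "(LINT x|half_line. h (c * x)) = (1 / c) *\<^sub>R (LINT x|half_line. h x)" .
qed

lemma half_line_measurable_stretch:
  assumes f: "(f :: real \<Rightarrow> complex) \<in> borel_measurable half_line" and c: "0 < c"
  shows "(\<lambda>x. f (c * x)) \<in> borel_measurable half_line"
proof -
  have "(\<lambda>x. if x \<in> {0..} then f x else 0) \<in> borel_measurable lebesgue" using f by (intro borel_measurable_if_I) auto
  from measurable_compose[OF lebesgue_measurable_scaling[of c] this]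
  have "(\<lambda>x. if c * x \<in> {0..} then f (c * x) else 0) \<in> borel_measurable lebesgue" unfolding real_scaleR_def .
  then have "(\<lambda>x. if c * x \<in> {0..} then f (c * x) else 0) \<in> borel_measurable half_line" by (rule measurable_restrict_space1)
  also have "?this \<longleftrightarrow> (\<lambda>x. f (c * x)) \<in> borel_measurable half_line" by (rule measurable_cong) (use c in auto)
  finally show ?thesis .
qed

lemma L2_dilation:
  assumes "f \<in> L2"
  shows "dilation \<tau> f \<in> L2" "L2_norm (dilation \<tau> f) = L2_norm f"
proof -
  have i: "integrable half_line (\<lambda>x. (norm (f (exp \<tau> * x)))^2)"
    "(LINT x|half_line. (norm (f (exp \<tau> * x)))^2) = (1 / exp \<tau>) * (LINT x|half_line. (norm (f x))^2)"
    using half_line_integrable_stretch[OF L2_integrable_sq[OF assms] exp_gt_zero[of \<tau>]] by auto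
  have e: "(norm (dilation \<tau> f x))^2 = exp \<tau> * (norm (f (exp \<tau> * x)))^2" for x
    by (simp add: dilation_def norm_mult power_mult_distrib power2_eq_square flip: exp_add)
  show "dilation \<tau> f \<in> L2"
  proof -
    have "dilation \<tau> f \<in> borel_measurable half_line"
      using half_line_measurable_stretch[OF L2_measurable[OF assms] exp_gt_zero[of \<tau>]] unfolding dilation_def[abs_def] by simp
    moreover have "integrable half_line (\<lambda>x. (norm (dilation \<tau> f x))^2)" unfolding e using i(1) by simp
    ultimately show ?thesis by (simp add: L2_def)
  qed
  show "L2_norm (dilation \<tau> f) = L2_norm f" unfolding L2_norm_def e using i by simp
qed

lemma AE_dilation_cong:
  assumes ae: "AE x in half_line. f x = F x" and L: "f \<in> L2" "F \<in> L2"
  shows "AE x in half_line. dilation t f x = dilation t F x"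
proof -
  note D = L2_diff[OF L]
  have "L2_norm (dilation t (\<lambda>x. f x - F x)) = 0" using ae L2_norm_eq_0_iff[OF D] L2_dilation(2)[OF D] by simp
  then have "AE x in half_line. dilation t (\<lambda>x. f x - F x) x = 0" using L2_norm_eq_0_iff[OF L2_dilation(1)[OF D]] by simp
  then show ?thesis by eventually_elim (simp add: dilation_def right_diff_distrib)
qed

lemma dilation_dilation: "dilation s (dilation t f) = dilation (s + t) f"
  by (auto simp: dilation_def fun_eq_iff exp_add add_divide_distrib mult_ac simp flip: of_real_mult)

lemma dilation_0 [simp]: "dilation 0 f = f" by (auto simp: dilation_def)

lemma dilation_scale: "dilation s (\<lambda>x. c * f x) = (\<lambda>x. c * dilation s f x)" by (auto simp: dilation_def)

lemma rg_0: "rg 0 H = H" by (auto simp: rg_def)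

lemma rg_add: "rg (s + t) H = rg s (rg t H)"
proof -
  have "(\<lambda>x. complex_of_real (exp (2 * (s + t))) * dilation (s + t) g x) =
     (\<lambda>x. complex_of_real (exp (2 * s)) * dilation s (\<lambda>x. complex_of_real (exp (2 * t)) * dilation t g x) x)" for g
    unfolding dilation_scale dilation_dilation by (simp add: distrib_left exp_add mult.assoc)
  then show ?thesis unfolding rg_def by (auto simp: dilation_dilation) (metis (no_types, lifting) dilation_dilation)+
qed

text \<open>Homogeneity of the potential: V(exp \<tau> x) = exp (- 2 \<tau>) V(x). The exponent 3
  \<tau> / 2 is \<tau> / 2 from the unitary factor plus \<tau> from the chain rule.\<close>

lemma regular_dilation:
  assumes reg: "regular \<alpha> f f' g"
  shows "regular \<alpha> (dilation \<tau> f) (\<lambda>x. complex_of_real (exp (3 * \<tau> / 2)) * f' (exp \<tau> * x)) (\<lambda>x. complex_of_real (exp (2 * \<tau>)) * dilation \<tau> g x)"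
  unfolding regular_def
proof (intro conjI allI impI)
  note R = regularD[OF reg]
  show "dilation \<tau> f \<in> L2" "(\<lambda>x. complex_of_real (exp (2 * \<tau>)) * dilation \<tau> g x) \<in> L2" by (intro L2_scale L2_dilation R)+
  have exps: "exp (3 * \<tau> / 2) = exp (\<tau> / 2) * exp \<tau>" "exp (2 * \<tau>) = exp \<tau> * exp \<tau>" by (simp_all flip: exp_add)
  show "(dilation \<tau> f has_vector_derivative complex_of_real (exp (3 * \<tau> / 2)) * f' (exp \<tau> * x)) (at x)" if "0 < x" for x
  proof -
    have "((\<lambda>x. exp \<tau> * x) has_vector_derivative exp \<tau>) (at x)"
      by (auto intro!: derivative_eq_intros simp flip: has_real_derivative_iff_has_vector_derivative)
    from vector_diff_chain_at[OF this R(3)[of "exp \<tau> * x"]] that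
    have "((\<lambda>x. f (exp \<tau> * x)) has_vector_derivative exp \<tau> *\<^sub>R f' (exp \<tau> * x)) (at x)" by (simp add: o_def)
    from has_vector_derivative_mult_right[OF this, of "complex_of_real (exp (\<tau> / 2))"]
    show ?thesis unfolding dilation_def[abs_def] exps by (simp add: scaleR_conv_of_real mult.assoc)
  qed
  fix a b :: real assume ab: "0 < a" "a \<le> b"
  have "((\<lambda>x. potential \<alpha> x * f x - g x) has_integral (f' (exp \<tau> * b) - f' (exp \<tau> * a))) {exp \<tau> * a..exp \<tau> * b}"
    using ab by (intro R(4)) auto
  from has_integral_stretch_real[OF this, of "exp \<tau>"]
  have "((\<lambda>x. potential \<alpha> (exp \<tau> * x) * f (exp \<tau> * x) - g (exp \<tau> * x)) has_integral
     (1 / exp \<tau>) *\<^sub>R (f' (exp \<tau> * b) - f' (exp \<tau> * a))) {a..b}" using ab by (simp add: image_divide_atLeastAtMost)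
  from has_integral_mult_right[OF this, of "complex_of_real (exp (2 * \<tau>) * exp (\<tau> / 2))"]
  have "((\<lambda>x. complex_of_real (exp (2 * \<tau>) * exp (\<tau> / 2)) * (potential \<alpha> (exp \<tau> * x) * f (exp \<tau> * x) - g (exp \<tau> * x))) has_integral
     complex_of_real (exp (2 * \<tau>) * exp (\<tau> / 2)) * ((1 / exp \<tau>) *\<^sub>R (f' (exp \<tau> * b) - f' (exp \<tau> * a)))) {a..b}" .
  moreover have "complex_of_real (exp (2 * \<tau>) * exp (\<tau> / 2)) * ((1 / exp \<tau>) *\<^sub>R (f' (exp \<tau> * b) - f' (exp \<tau> * a)))
     = complex_of_real (exp (3 * \<tau> / 2)) * f' (exp \<tau> * b) - complex_of_real (exp (3 * \<tau> / 2)) * f' (exp \<tau> * a)"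
    unfolding exps by (simp add: scaleR_conv_of_real field_simps)
  moreover have "complex_of_real (exp (2 * \<tau>) * exp (\<tau> / 2)) * (potential \<alpha> (exp \<tau> * x) * f (exp \<tau> * x) - g (exp \<tau> * x))
     = potential \<alpha> x * dilation \<tau> f x - complex_of_real (exp (2 * \<tau>)) * dilation \<tau> g x" for x
  proof -
    have "complex_of_real (exp (2 * \<tau>)) * potential \<alpha> (exp \<tau> * x) = potential \<alpha> x" unfolding potential_def exps
      by (cases "x = 0") (simp_all add: power2_eq_square field_simps flip: of_real_mult)
    then have "complex_of_real (exp (2 * \<tau>) * exp (\<tau> / 2)) * (potential \<alpha> (exp \<tau> * x) * f (exp \<tau> * x)) = potential \<alpha> x * dilation \<tau> f x"
      by (simp add: dilation_def)
    then show ?thesis by (simp add: right_diff_distrib dilation_def mult.assoc)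
  qed
  ultimately show "((\<lambda>x. potential \<alpha> x * dilation \<tau> f x - complex_of_real (exp (2 * \<tau>)) * dilation \<tau> g x) has_integral
     complex_of_real (exp (3 * \<tau> / 2)) * f' (exp \<tau> * b) - complex_of_real (exp (3 * \<tau> / 2)) * f' (exp \<tau> * a)) {a..b}" by simp
qed

subsection \<open>Linear structure of the maximal operator\<close>

lemma max_opE:
  assumes "(f, g) \<in> max_op \<alpha>"
  obtains F F' where "regular \<alpha> F F' g" "AE x in half_line. f x = F x" "f \<in> L2" "g \<in> L2"
  using assms by (auto simp: max_op_def regular_def)

lemma regular_max_op: "regular \<alpha> f f' g \<Longrightarrow> (f, g) \<in> max_op \<alpha>" by (auto simp: max_op_def regular_def)

lemma max_op_L2: "(f, g) \<in> max_op \<alpha> \<Longrightarrow> f \<in> L2 \<and> g \<in> L2" by (auto simp: max_op_def regular_def)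

lemma adjoint_op_add:
  assumes "(f, g) \<in> adjoint_op A" "(h, k) \<in> adjoint_op A" "\<And>p q. (p, q) \<in> A \<Longrightarrow> p \<in> L2 \<and> q \<in> L2"
  shows "(\<lambda>x. f x + h x, \<lambda>x. g x + k x) \<in> adjoint_op A"
proof (rule adjoint_opI)
  fix p q assume pq: "(p, q) \<in> A"
  note D = adjoint_opD[OF assms(1)] adjoint_opD[OF assms(2)]
  show "L2_inner q (\<lambda>x. f x + h x) = L2_inner p (\<lambda>x. g x + k x)" using assms(3)[OF pq] D pq by (simp add: inner_add_right)
qed (use adjoint_opD[OF assms(1)] adjoint_opD[OF assms(2)] in \<open>auto intro: L2_add\<close>)

lemma adjoint_op_scale:
  assumes "(f, g) \<in> adjoint_op A"
  shows "(\<lambda>x. c * f x, \<lambda>x. c * g x) \<in> adjoint_op A"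
  by (rule adjoint_opI) (use adjoint_opD[OF assms] in \<open>auto simp: inner_scale_right intro: L2_scale\<close>)

lemma op_closure_superset:
  assumes "\<And>h k. (h, k) \<in> A \<Longrightarrow> h \<in> L2 \<and> k \<in> L2"
  shows "A \<subseteq> op_closure A"
proof (rule subrelI)
  fix f g assume "(f, g) \<in> A"
  then have "f \<in> L2 \<and> g \<in> L2 \<and> (\<forall>n::nat. (f, g) \<in> A) \<and> (\<lambda>n::nat. L2_dist f f) \<longlonglongrightarrow> 0 \<and>
      (\<lambda>n::nat. L2_dist g g) \<longlonglongrightarrow> 0" using assms by simp
  then show "(f, g) \<in> op_closure A"
    unfolding op_closure_def by (intro CollectI case_prodI conjI exI[of _ "\<lambda>_. f"] exI[of _ "\<lambda>_. g"]) simp_all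
qed

lemma max_op_add:
  "(f, g) \<in> max_op \<alpha> \<Longrightarrow> (h, k) \<in> max_op \<alpha> \<Longrightarrow> (\<lambda>x. f x + h x, \<lambda>x. g x + k x) \<in> max_op \<alpha>"
  unfolding adjoint_test_op[symmetric] using adjoint_op_add test_op_L2 by blast

lemma max_op_scale: "(f, g) \<in> max_op \<alpha> \<Longrightarrow> (\<lambda>x. c * f x, \<lambda>x. c * g x) \<in> max_op \<alpha>"
  unfolding adjoint_test_op[symmetric] by (rule adjoint_op_scale)

lemma max_op_diff:
  "(f, g) \<in> max_op \<alpha> \<Longrightarrow> (h, k) \<in> max_op \<alpha> \<Longrightarrow> (\<lambda>x. f x - h x, \<lambda>x. g x - k x) \<in> max_op \<alpha>"
  using max_op_add[OF _ max_op_scale[of h k \<alpha> "-1"], of f g] by simp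

lemma max_op_dilation:
  assumes "(f, g) \<in> max_op \<alpha>"
  shows "(dilation \<tau> f, \<lambda>x. complex_of_real (exp (2 * \<tau>)) * dilation \<tau> g x) \<in> max_op \<alpha>"
proof -
  obtain F F' where F: "regular \<alpha> F F' g" "AE x in half_line. f x = F x" "f \<in> L2" "g \<in> L2" using assms by (rule max_opE)
  note FL = regularD(1)[OF F(1)]
  have "L2_dist f F = 0" using F(2) L2_norm_eq_0_iff[OF L2_diff[OF F(3) FL]] by simp
  then have "L2_norm (dilation \<tau> (\<lambda>x. f x - F x)) = 0" using L2_dilation(2)[OF L2_diff[OF F(3) FL]] by simp
  then have "AE x in half_line. dilation \<tau> (\<lambda>x. f x - F x) x = 0" using L2_norm_eq_0_iff[OF L2_dilation(1)[OF L2_diff[OF F(3) FL]]] by simp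
  then have "AE x in half_line. dilation \<tau> f x = dilation \<tau> F x" by eventually_elim (simp add: dilation_def right_diff_distrib)
  with regular_dilation[OF F(1), of \<tau>] L2_dilation(1)[OF F(3), of \<tau>] show ?thesis unfolding max_op_def by blast
qed

lemma adjoint_op_closure:
  assumes "\<And>h k. (h, k) \<in> A \<Longrightarrow> h \<in> L2 \<and> k \<in> L2"
  shows "adjoint_op (op_closure A) = adjoint_op A"
proof
  have "A \<subseteq> op_closure A" using assms by (rule op_closure_superset)
  then show "adjoint_op (op_closure A) \<subseteq> adjoint_op A" by (rule adjoint_op_antimono)
  show "adjoint_op A \<subseteq> adjoint_op (op_closure A)"
  proof (rule subrelI)
    fix f g assume fg: "(f, g) \<in> adjoint_op A"
    note D = adjoint_opD[OF fg]
    show "(f, g) \<in> adjoint_op (op_closure A)"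
    proof (rule adjoint_opI[OF D(1,2)])
      fix h k assume "(h, k) \<in> op_closure A"
      then obtain u v where uv: "\<And>n::nat. (u n, v n) \<in> A" "h \<in> L2" "k \<in> L2"
        "L2_lim u h" "L2_lim v k"
        by (auto simp: op_closure_def)
      have "(\<lambda>n. L2_inner f (v n)) \<longlonglongrightarrow> L2_inner f k" "(\<lambda>n. L2_inner g (u n)) \<longlonglongrightarrow> L2_inner g h"
        using uv assms[OF uv(1)] D by (auto intro!: inner_tendsto_right)
      moreover have "L2_inner f (v n) = L2_inner g (u n)" for n using D(3)[OF uv(1), of n] inner_commute[of f "v n"] inner_commute[of g "u n"] by simp
      ultimately have "L2_inner f k = L2_inner g h" using LIMSEQ_unique by fastforce
      then show "L2_inner k f = L2_inner h g" using inner_commute[of k f] inner_commute[of h g] by simp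
    qed
  qed
qed

lemma adjoint_L_min: "adjoint_op (L_min \<alpha>) = max_op \<alpha>" unfolding L_min_eq using adjoint_op_closure[OF test_op_L2] adjoint_test_op by simp

lemma test_op_subset_L_min: "test_op \<alpha> \<subseteq> L_min \<alpha>" unfolding L_min_eq by (rule op_closure_superset[OF test_op_L2])

lemma sa_extensions_L_min_iff: "H \<in> sa_extensions (L_min \<alpha>) \<longleftrightarrow> self_adjoint H \<and> test_op \<alpha> \<subseteq> H"
  using test_op_subset_L_min self_adjoint_op_closure_subset[of H "test_op \<alpha>"] unfolding sa_extensions_def L_min_eq by auto

lemma sa_extension_subset_max_op: "H \<in> sa_extensions (L_min \<alpha>) \<Longrightarrow> H \<subseteq> max_op \<alpha>"
  using adjoint_op_antimono[of "test_op \<alpha>" H] adjoint_test_op by (auto simp: sa_extensions_L_min_iff self_adjoint_def)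

lemma densely_defined_if_test_op: "test_op \<alpha> \<subseteq> H \<Longrightarrow> densely_defined H"
  unfolding densely_defined_def using test_functions_dense by (fastforce simp: test_op_def)

subsection \<open>The limit-circle case\<close>

text \<open>\<open>e1\<close>, \<open>e2\<close> are the solutions \<open>u1\<close>,
  \<open>u2\<close> cut off away from 0, and \<open>z1\<close>, \<open>z2\<close> their images under
  L. The powers of exp \<tau> in the scaling laws are chosen so that the matrix G is exactly the
  action of \<open>rg \<tau>\<close> on the pair of boundary values.\<close>

locale limit_circle =
  fixes \<alpha> w a :: real and u1 u1' u2 u2' :: "real \<Rightarrow> real" and e1 e1' z1 e2 e2' z2 :: cfun
    and G11 G12 G21 G22 :: "real \<Rightarrow> real"
  assumes w: "w \<noteq> 0" and a: "0 < a"
    and reg1: "regular \<alpha> e1 e1' z1" and reg2: "regular \<alpha> e2 e2' z2"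
    and near1: "\<And>x. 0 < x \<Longrightarrow> x \<le> a \<Longrightarrow> e1 x = of_real (u1 x) \<and> e1' x = of_real (u1' x) \<and> z1 x = 0"
    and near2: "\<And>x. 0 < x \<Longrightarrow> x \<le> a \<Longrightarrow> e2 x = of_real (u2 x) \<and> e2' x = of_real (u2' x) \<and> z2 x = 0"
    and wr: "\<And>x. 0 < x \<Longrightarrow> u1 x * u2' x - u1' x * u2 x = w"
    and scaling1: "\<And>\<tau> x. 0 < x \<Longrightarrow> u1 x = exp (- 3 * \<tau> / 2) * (G11 \<tau> * u1 (exp \<tau> * x) + G12 \<tau> * u2 (exp \<tau> * x))"
      "\<And>\<tau> x. 0 < x \<Longrightarrow> u1' x = exp (- \<tau> / 2) * (G11 \<tau> * u1' (exp \<tau> * x) + G12 \<tau> * u2' (exp \<tau> * x))"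
    and scaling2: "\<And>\<tau> x. 0 < x \<Longrightarrow> u2 x = exp (- 3 * \<tau> / 2) * (G21 \<tau> * u1 (exp \<tau> * x) + G22 \<tau> * u2 (exp \<tau> * x))"
      "\<And>\<tau> x. 0 < x \<Longrightarrow> u2' x = exp (- \<tau> / 2) * (G21 \<tau> * u1' (exp \<tau> * x) + G22 \<tau> * u2' (exp \<tau> * x))"
    and G_det: "\<And>\<tau>. G11 \<tau> * G22 \<tau> - G12 \<tau> * G21 \<tau> \<noteq> 0"
    and G_cont: "continuous_on UNIV G11" "continuous_on UNIV G12" "continuous_on UNIV G21" "continuous_on UNIV G22"
begin

text \<open>The limit at 0 of the Wronskian of \<open>u1\<close> and f, written as a pairing: this
  form is visibly continuous in the graph norm and blind to null sets.\<close>

definition b1 :: "cfun \<Rightarrow> cfun \<Rightarrow> complex" where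
  "b1 f g = L2_inner e1 g - L2_inner z1 f"

definition b2 :: "cfun \<Rightarrow> cfun \<Rightarrow> complex" where
  "b2 f g = L2_inner e2 g - L2_inner z2 f"

lemmas e_L2 = regularD(1,2)[OF reg1] regularD(1,2)[OF reg2]

lemma ev_near: "\<forall>\<^sub>F x in at_right 0. 0 < x \<and> x \<le> a" unfolding eventually_at_right_field using a by (intro exI[of _ a]) auto

lemma b_tendsto:
  assumes F: "regular \<alpha> F F' g"
  shows "((\<lambda>x. of_real (u1 x) * F' x - of_real (u1' x) * F x) \<longlongrightarrow> b1 F g) (at_right 0)"
    "((\<lambda>x. of_real (u2 x) * F' x - of_real (u2' x) * F x) \<longlongrightarrow> b2 F g) (at_right 0)"
proof -
  have "\<forall>\<^sub>F x in at_right 0. wronskian (\<lambda>x. cnj (e1 x)) (\<lambda>x. cnj (e1' x)) F F' x = of_real (u1 x) * F' x - of_real (u1' x) * F x"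
    using ev_near by eventually_elim (simp add: near1)
  then show "((\<lambda>x. of_real (u1 x) * F' x - of_real (u1' x) * F x) \<longlongrightarrow> b1 F g) (at_right 0)"
    using wronskian_tendsto_at_right_0[OF reg1 F] unfolding b1_def by (rule Lim_transform_eventually[rotated])
  have "\<forall>\<^sub>F x in at_right 0. wronskian (\<lambda>x. cnj (e2 x)) (\<lambda>x. cnj (e2' x)) F F' x = of_real (u2 x) * F' x - of_real (u2' x) * F x"
    using ev_near by eventually_elim (simp add: near2)
  then show "((\<lambda>x. of_real (u2 x) * F' x - of_real (u2' x) * F x) \<longlongrightarrow> b2 F g) (at_right 0)"
    using wronskian_tendsto_at_right_0[OF reg2 F] unfolding b2_def by (rule Lim_transform_eventually[rotated])
qed

lemma b_eqI:
  assumes F: "regular \<alpha> F F' g"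
  shows "((\<lambda>x. of_real (u1 x) * F' x - of_real (u1' x) * F x) \<longlongrightarrow> c) (at_right 0) \<Longrightarrow> b1 F g = c"
    "((\<lambda>x. of_real (u2 x) * F' x - of_real (u2' x) * F x) \<longlongrightarrow> c) (at_right 0) \<Longrightarrow> b2 F g = c"
  using tendsto_unique[OF trivial_limit_at_right_real b_tendsto(1)[OF F]]
    tendsto_unique[OF trivial_limit_at_right_real b_tendsto(2)[OF F]] by blast+

lemma b_add:
  assumes "f \<in> L2" "g \<in> L2" "h \<in> L2" "k \<in> L2"
  shows "b1 (\<lambda>x. f x + h x) (\<lambda>x. g x + k x) = b1 f g + b1 h k"
    "b2 (\<lambda>x. f x + h x) (\<lambda>x. g x + k x) = b2 f g + b2 h k"
  using assms by (simp_all add: b1_def b2_def inner_add_right e_L2)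

lemma b_scale:
  "b1 (\<lambda>x. c * f x) (\<lambda>x. c * g x) = c * b1 f g"
  "b2 (\<lambda>x. c * f x) (\<lambda>x. c * g x) = c * b2 f g"
  by (simp_all add: b1_def b2_def inner_scale_right right_diff_distrib)

lemma b_diff:
  assumes "f \<in> L2" "g \<in> L2" "h \<in> L2" "k \<in> L2"
  shows "b1 (\<lambda>x. f x - h x) (\<lambda>x. g x - k x) = b1 f g - b1 h k"
    "b2 (\<lambda>x. f x - h x) (\<lambda>x. g x - k x) = b2 f g - b2 h k"
  using assms by (simp_all add: b1_def b2_def inner_diff_right e_L2)

lemma b_cong_AE:
  assumes "AE x in half_line. f x = F x" "f \<in> L2" "F \<in> L2"
  shows "b1 f g = b1 F g" "b2 f g = b2 F g" using assms inner_cong_AE[of z1 z1 f F] inner_cong_AE[of z2 z2 f F] by (simp_all add: b1_def b2_def e_L2)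

definition bC :: real where "bC = L2_norm e1 + L2_norm z1 + L2_norm e2 + L2_norm z2"

lemma bC_nonneg: "0 \<le> bC" by (simp add: bC_def)

lemma b_bound:
  assumes "f \<in> L2" "g \<in> L2"
  shows "norm (b1 f g) \<le> bC * (L2_norm f + L2_norm g)" "norm (b2 f g) \<le> bC * (L2_norm f + L2_norm g)"
proof -
  have le: "norm (L2_inner e g - L2_inner z f) \<le> bC * (L2_norm f + L2_norm g)"
    if "e \<in> L2" "z \<in> L2" "L2_norm e \<le> bC" "L2_norm z \<le> bC" for e z
  proof -
    have "norm (L2_inner e g - L2_inner z f) \<le> norm (L2_inner e g) + norm (L2_inner z f)" by (rule norm_triangle_ineq4)
    also have "\<dots> \<le> L2_norm e * L2_norm g + L2_norm z * L2_norm f" by (intro add_mono L2_Cauchy_Schwarz that assms)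
    also have "\<dots> \<le> bC * L2_norm g + bC * L2_norm f" by (intro add_mono mult_right_mono that) auto
    finally show ?thesis by (simp add: algebra_simps)
  qed
  show "norm (b1 f g) \<le> bC * (L2_norm f + L2_norm g)" "norm (b2 f g) \<le> bC * (L2_norm f + L2_norm g)"
    unfolding b1_def b2_def by (intro le e_L2; simp add: bC_def)+
qed

lemma wrC: "0 < x \<Longrightarrow> complex_of_real (u1 x) * of_real (u2' x) - of_real (u1' x) * of_real (u2 x) = of_real w"
  using wr[of x] by (simp flip: of_real_mult of_real_diff)

text \<open>Green's formula: the Pluecker identity expresses \<open>w\<close> times the Wronskian of two functions by their
  Wronskians with \<open>u1\<close> and \<open>u2\<close>.\<close>

lemma green:
  assumes fg: "(f, g) \<in> max_op \<alpha>" and hk: "(h, k) \<in> max_op \<alpha>"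
  shows "of_real w * (L2_inner f k - L2_inner g h) = cnj (b1 f g) * b2 h k - cnj (b2 f g) * b1 h k"
proof -
  obtain F F' where F: "regular \<alpha> F F' g" "AE x in half_line. f x = F x" "f \<in> L2" "g \<in> L2" using fg by (rule max_opE)
  obtain H H' where H: "regular \<alpha> H H' k" "AE x in half_line. h x = H x" "h \<in> L2" "k \<in> L2" using hk by (rule max_opE)
  note L = regularD(1)[OF F(1)] regularD(1)[OF H(1)]
  have e: "L2_inner f k = L2_inner F k" "L2_inner g h = L2_inner g H" using F H L by (auto intro!: inner_cong_AE)
  let ?W = "\<lambda>x. wronskian (\<lambda>x. cnj (F x)) (\<lambda>x. cnj (F' x)) H H' x"
  let ?p = "\<lambda>x. of_real (u1 x) * F' x - of_real (u1' x) * F x" and ?q = "\<lambda>x. of_real (u2 x) * F' x - of_real (u2' x) * F x"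
  let ?r = "\<lambda>x. of_real (u1 x) * H' x - of_real (u1' x) * H x" and ?s = "\<lambda>x. of_real (u2 x) * H' x - of_real (u2' x) * H x"
  have "((\<lambda>x. cnj (?p x) * ?s x - cnj (?q x) * ?r x) \<longlongrightarrow> cnj (b1 F g) * b2 H k - cnj (b2 F g) * b1 H k) (at_right 0)"
    by (intro tendsto_intros b_tendsto F H)
  moreover have "\<forall>\<^sub>F x in at_right 0. cnj (?p x) * ?s x - cnj (?q x) * ?r x = of_real w * ?W x" using ev_near
  proof eventually_elim
    case (elim x)
    then show ?case by (simp add: wrC[of x, symmetric] algebra_simps)
  qed
  ultimately have "((\<lambda>x. of_real w * ?W x) \<longlongrightarrow> cnj (b1 F g) * b2 H k - cnj (b2 F g) * b1 H k) (at_right 0)"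
    by (rule Lim_transform_eventually)
  moreover have "((\<lambda>x. of_real w * ?W x) \<longlongrightarrow> of_real w * (L2_inner F k - L2_inner g H)) (at_right 0)"
    by (rule tendsto_mult[OF tendsto_const wronskian_tendsto_at_right_0[OF F(1) H(1)]])
  ultimately have "of_real w * (L2_inner F k - L2_inner g H) = cnj (b1 F g) * b2 H k - cnj (b2 F g) * b1 H k"
    using tendsto_unique[OF trivial_limit_at_right_real] by blast
  then show ?thesis unfolding e using b_cong_AE[OF F(2,3) L(1)] b_cong_AE[OF H(2,3) L(2)] by simp
qed

text \<open>Near 0 the cut-off solutions coincide with \<open>u1\<close> and \<open>u2\<close>, so
  the Wronskians are constant there. They form a basis of boundary vectors, which makes the boundary
  map surjective.\<close>

lemma b_e: "b1 e1 z1 = 0" "b2 e1 z1 = - of_real w" "b1 e2 z2 = of_real w" "b2 e2 z2 = 0"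
proof -
  have ev: "\<forall>\<^sub>F x in at_right 0. complex_of_real (u1 x) * e1' x - complex_of_real (u1' x) * e1 x = 0"
    "\<forall>\<^sub>F x in at_right 0. complex_of_real (u2 x) * e1' x - complex_of_real (u2' x) * e1 x = - of_real w"
    "\<forall>\<^sub>F x in at_right 0. complex_of_real (u1 x) * e2' x - complex_of_real (u1' x) * e2 x = of_real w"
    "\<forall>\<^sub>F x in at_right 0. complex_of_real (u2 x) * e2' x - complex_of_real (u2' x) * e2 x = 0"
  proof -
    have "\<forall>\<^sub>F x in at_right 0. (complex_of_real (u1 x) * e1' x - complex_of_real (u1' x) * e1 x = 0 \<and>
        complex_of_real (u2 x) * e1' x - complex_of_real (u2' x) * e1 x = - of_real w) \<and>
       (complex_of_real (u1 x) * e2' x - complex_of_real (u1' x) * e2 x = of_real w \<and>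
        complex_of_real (u2 x) * e2' x - complex_of_real (u2' x) * e2 x = 0)" using ev_near
    proof eventually_elim
      case (elim x)
      then show ?case using near1[of x] near2[of x] wrC[of x, symmetric] by (simp add: mult.commute)
    qed
    then show "\<forall>\<^sub>F x in at_right 0. complex_of_real (u1 x) * e1' x - complex_of_real (u1' x) * e1 x = 0"
      "\<forall>\<^sub>F x in at_right 0. complex_of_real (u2 x) * e1' x - complex_of_real (u2' x) * e1 x = - of_real w"
      "\<forall>\<^sub>F x in at_right 0. complex_of_real (u1 x) * e2' x - complex_of_real (u1' x) * e2 x = of_real w"
      "\<forall>\<^sub>F x in at_right 0. complex_of_real (u2 x) * e2' x - complex_of_real (u2' x) * e2 x = 0"
      by (auto elim: eventually_mono)
  qed
  show "b1 e1 z1 = 0" by (rule b_eqI(1)[OF reg1 tendsto_eventually[OF ev(1)]])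
  show "b2 e1 z1 = - of_real w" by (rule b_eqI(2)[OF reg1 tendsto_eventually[OF ev(2)]])
  show "b1 e2 z2 = of_real w" by (rule b_eqI(1)[OF reg2 tendsto_eventually[OF ev(3)]])
  show "b2 e2 z2 = 0" by (rule b_eqI(2)[OF reg2 tendsto_eventually[OF ev(4)]])
qed

lemma exists_boundary_values:
  "\<exists>f g. (f, g) \<in> max_op \<alpha> \<and> b1 f g = p \<and> b2 f g = q"
proof -
  define c d where "c = p / of_real w" and "d = - q / of_real w"
  have "(\<lambda>x. c * e2 x + d * e1 x, \<lambda>x. c * z2 x + d * z1 x) \<in> max_op \<alpha>"
    by (intro max_op_add max_op_scale regular_max_op[OF reg1] regular_max_op[OF reg2])
  moreover note b_add[of "\<lambda>x. c * e2 x" "\<lambda>x. c * z2 x" "\<lambda>x. d * e1 x" "\<lambda>x. d * z1 x",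
      OF L2_scale[OF e_L2(3)] L2_scale[OF e_L2(4)] L2_scale[OF e_L2(1)] L2_scale[OF e_L2(2)]]
  then have "b1 (\<lambda>x. c * e2 x + d * e1 x) (\<lambda>x. c * z2 x + d * z1 x) = p"
    "b2 (\<lambda>x. c * e2 x + d * e1 x) (\<lambda>x. c * z2 x + d * z1 x) = q"
    unfolding b_scale b_e using w by (simp_all add: c_def d_def)
  ultimately show ?thesis by blast
qed

lemma b_test_op:
  assumes "(f, g) \<in> test_op \<alpha>"
  shows "b1 f g = 0" "b2 f g = 0"
proof -
  have f: "f \<in> test_functions" and g: "g = L_expr \<alpha> f" using assms by (auto simp: test_op_def)
  obtain f' where f': "f' \<in> test_functions" "regular \<alpha> f f' g" using regular_test_function[OF f, of \<alpha>] g by blast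
  obtain c d where cd: "0 < c" "0 < d" "\<And>x. x < c \<Longrightarrow> f x = 0" "\<And>x. x < d \<Longrightarrow> f' x = 0"
    using f f'(1) by (auto simp: test_functions_iff)
  have "\<forall>\<^sub>F x in at_right 0. f x = 0 \<and> f' x = 0" unfolding eventually_at_right_field using cd by (intro exI[of _ "min c d"]) auto
  then have ev: "\<forall>\<^sub>F x in at_right 0. of_real (u x) * f' x - of_real (u' x) * f x = 0" for u u' :: "real \<Rightarrow> real"
    by eventually_elim simp
  show "b1 f g = 0" by (rule b_eqI(1)[OF f'(2) tendsto_eventually[OF ev]])
  show "b2 f g = 0" by (rule b_eqI(2)[OF f'(2) tendsto_eventually[OF ev]])
qed

text \<open>The boundary vector (\<open>b1\<close>, \<open>b2\<close>) is required to be a complex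
  multiple of the real vector (Re z, Im z); z therefore counts only up to a real factor.\<close>

definition ext :: "complex \<Rightarrow> operator" where
  "ext z = {(f, g) \<in> max_op \<alpha>. of_real (Re z) * b2 f g = of_real (Im z) * b1 f g}"

lemma test_op_subset_max_op: "test_op \<alpha> \<subseteq> max_op \<alpha>"
proof (rule subrelI)
  fix f g assume "(f, g) \<in> test_op \<alpha>"
  then show "(f, g) \<in> max_op \<alpha>" using regular_test_function[of f \<alpha>] regular_max_op unfolding test_op_def by blast
qed

lemma test_op_subset_ext: "test_op \<alpha> \<subseteq> ext z" using test_op_subset_max_op b_test_op by (auto simp: ext_def)

lemma ext_proportional:
  assumes "(f, g) \<in> ext z" "z \<noteq> 0"
  obtains c where "b1 f g = c * of_real (Re z)" "b2 f g = c * of_real (Im z)"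
proof (cases "Re z = 0")
  case True
  with assms have "Im z \<noteq> 0" by (auto simp: complex_eq_iff)
  with True assms show ?thesis by (intro that[of "b2 f g / of_real (Im z)"]) (auto simp: ext_def)
next
  case False
  with assms show ?thesis by (intro that[of "b1 f g / of_real (Re z)"]) (auto simp: ext_def field_simps)
qed

text \<open>The boundary form of Green's formula vanishes on the span of a real vector, which gives
  symmetry. Conversely one element with boundary vector z tests the adjoint enough to force its
  boundary vectors onto the same line.\<close>

lemma ext_sa_extension:
  assumes z: "z \<noteq> 0"
  shows "ext z \<in> sa_extensions (L_min \<alpha>)"
proof -
  have "adjoint_op (ext z) = ext z"
  proof (rule equalityI; rule subrelI)
    fix f g assume fg: "(f, g) \<in> ext z"
    then have M: "(f, g) \<in> max_op \<alpha>" by (simp add: ext_def)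
    show "(f, g) \<in> adjoint_op (ext z)"
    proof (rule adjoint_opI)
      fix h k assume hk: "(h, k) \<in> ext z"
      then have M': "(h, k) \<in> max_op \<alpha>" by (simp add: ext_def)
      obtain c where c: "b1 f g = c * of_real (Re z)" "b2 f g = c * of_real (Im z)" using fg z by (rule ext_proportional)
      obtain d where d: "b1 h k = d * of_real (Re z)" "b2 h k = d * of_real (Im z)" using hk z by (rule ext_proportional)
      have "of_real w * (L2_inner h g - L2_inner k f) = 0" unfolding green[OF M' M] c d by (simp add: mult_ac)
      with w show "L2_inner k f = L2_inner h g" by simp
    qed (use max_op_L2[OF M] in auto)
  next
    fix f g assume fg: "(f, g) \<in> adjoint_op (ext z)"
    then have M: "(f, g) \<in> max_op \<alpha>" using adjoint_op_antimono[OF test_op_subset_ext[of z]] adjoint_test_op by blast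
    obtain h k where hk: "(h, k) \<in> max_op \<alpha>" "b1 h k = of_real (Re z)" "b2 h k = of_real (Im z)" using exists_boundary_values by blast
    then have "(h, k) \<in> ext z" by (simp add: ext_def mult.commute)
    then have "L2_inner k f = L2_inner h g" by (rule adjoint_opD(3)[OF fg])
    with green[OF hk(1) M] hk have "of_real (Re z) * b2 f g = of_real (Im z) * b1 f g" by simp
    with M show "(f, g) \<in> ext z" by (simp add: ext_def)
  qed
  then show ?thesis using densely_defined_if_test_op[OF test_op_subset_ext] test_op_subset_ext by (auto simp: sa_extensions_L_min_iff self_adjoint_def)
qed

text \<open>Some boundary vector of K is nonzero, since otherwise Green's formula would put
  (\<open>e1\<close>, \<open>z1\<close>) into the adjoint and hence into K. Pairing that element
  with itself makes cnj b1 * b2 real, so its direction is real; pairing it with the others confines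
  K to one line.\<close>

lemma sa_extension_is_ext:
  assumes K: "K \<in> sa_extensions (L_min \<alpha>)"
  shows "\<exists>z. z \<noteq> 0 \<and> K = ext z"
proof -
  have sa: "self_adjoint K" and M: "K \<subseteq> max_op \<alpha>" using K sa_extension_subset_max_op by (auto simp: sa_extensions_L_min_iff)
  have sym: "cnj (b1 f g) * b2 h k = cnj (b2 f g) * b1 h k" if "(f, g) \<in> K" "(h, k) \<in> K" for f g h k
  proof -
    have "(f, g) \<in> max_op \<alpha>" "(h, k) \<in> max_op \<alpha>" using M that by auto
    from green[OF this] self_adjointD(3)[OF sa that(2,1)] show ?thesis by simp
  qed
  have "\<exists>f g. (f, g) \<in> K \<and> \<not> (b1 f g = 0 \<and> b2 f g = 0)"
  proof (rule ccontr)
    assume "\<not> ?thesis"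
    then have z: "b1 f g = 0" "b2 f g = 0" if "(f, g) \<in> K" for f g using that by auto
    have "(e1, z1) \<in> K"
    proof (rule self_adjointI[OF sa e_L2(1,2)])
      fix h k assume hk: "(h, k) \<in> K"
      then have "(h, k) \<in> max_op \<alpha>" using M by auto
      from green[OF this regular_max_op[OF reg1]] z[OF hk] w show "L2_inner k e1 = L2_inner h z1" by simp
    qed
    from z(2)[OF this] b_e(2) w show False by simp
  qed
  then obtain f g where fg: "(f, g) \<in> K" "\<not> (b1 f g = 0 \<and> b2 f g = 0)" by blast
  have "cnj (b1 f g) * b2 f g \<in> \<real>" using sym[OF fg(1) fg(1)] by (simp add: Reals_cnj_iff mult.commute)
  then obtain r where r: "cnj (b1 f g) * b2 f g = of_real r" by (auto elim: Reals_cases)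
  obtain z c where z: "z \<noteq> 0" "c \<noteq> 0" "b1 f g = c * of_real (Re z)" "b2 f g = c * of_real (Im z)"
  proof (cases "b1 f g = 0")
    case True
    with fg(2) show ?thesis by (intro that[of \<i> "b2 f g"]) auto
  next
    case False
    have "b2 f g = (b1 f g * (cnj (b1 f g) * b2 f g)) / (b1 f g * cnj (b1 f g))" using False by simp
    also have "\<dots> = b1 f g * of_real (r / (norm (b1 f g))^2)" unfolding r complex_norm_square[symmetric] by simp
    finally show ?thesis using False by (intro that[of "Complex 1 (r / (norm (b1 f g))^2)" "b1 f g"]) (auto simp: complex_eq_iff)
  qed
  have "K \<subseteq> ext z"
  proof (rule subrelI)
    fix h k assume hk: "(h, k) \<in> K"
    from sym[OF fg(1) hk] z have "of_real (Re z) * b2 h k = of_real (Im z) * b1 h k" by simp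
    with hk M show "(h, k) \<in> ext z" by (auto simp: ext_def)
  qed
  moreover have "self_adjoint (ext z)" using ext_sa_extension[OF z(1)] by (simp add: sa_extensions_def)
  ultimately have "K = ext z" by (intro self_adjoint_maximal sa)
  with z(1) show ?thesis by blast
qed

lemma ext_scale:
  assumes "c \<noteq> 0"
  shows "ext (of_real c * z) = ext z" using assms by (auto simp: ext_def mult.assoc)

lemma ext_eqD:
  assumes eq: "ext z = ext z'"
  shows "Im (cnj z * z') = 0"
proof -
  obtain h k where hk: "(h, k) \<in> max_op \<alpha>" "b1 h k = of_real (Re z)" "b2 h k = of_real (Im z)" using exists_boundary_values by blast
  then have "(h, k) \<in> ext z" by (simp add: ext_def mult.commute)
  then have "(h, k) \<in> ext z'" using eq by simp
  with hk have "complex_of_real (Re z' * Im z) = complex_of_real (Im z' * Re z)" by (simp add: ext_def)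
  then have "Re z' * Im z = Im z' * Re z" by (simp only: of_real_eq_iff)
  then show ?thesis by (simp add: mult.commute)
qed

text \<open>The difference h of the two resolvents solves L h = \<i> h, so Green's formula expresses
  |w| times its squared norm by boundary values, of which the component across the line of z is
  small. The constant is the product of the bounds 4 bC for the component along the line and 6 bC
  for the coefficient of the other extension.\<close>

lemma ext_resolvent_dist_le:
  assumes z: "norm z = 1" "norm z' = 1"
  shows "resolvent_dist (ext z) (ext z') \<le> (24 * bC^2 / \<bar>w\<bar>) * \<bar>Im (cnj z * z')\<bar>"
proof -
  have nz: "z \<noteq> 0" "z' \<noteq> 0" using z by auto
  have sa: "self_adjoint (ext z)" "self_adjoint (ext z')" using ext_sa_extension[OF nz(1)] ext_sa_extension[OF nz(2)] by (auto simp: sa_extensions_def)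
  have unit: "(Re z)^2 + (Im z)^2 = 1" "(Re z')^2 + (Im z')^2 = 1" using z by (auto simp flip: cmod_power2)
  have comp: "\<bar>Re z\<bar> \<le> 1" "\<bar>Im z\<bar> \<le> 1" "\<bar>Re z'\<bar> \<le> 1" "\<bar>Im z'\<bar> \<le> 1"
    using abs_Re_le_cmod[of z] abs_Im_le_cmod[of z] abs_Re_le_cmod[of z'] abs_Im_le_cmod[of z'] z by auto
  show ?thesis
  proof (rule resolvent_dist_le[OF sa])
    fix f1 f2 g :: cfun
    let ?g1 = "\<lambda>x. g x + \<i> * f1 x" and ?g2 = "\<lambda>x. g x + \<i> * f2 x"
    assume g: "g \<in> L2" "L2_norm g \<le> 1"
      and f1: "(f1, ?g1) \<in> ext z" and f2: "(f2, ?g2) \<in> ext z'"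
    have M: "(f1, ?g1) \<in> max_op \<alpha>" "(f2, ?g2) \<in> max_op \<alpha>" using f1 f2 by (auto simp: ext_def)
    note L = max_op_L2[OF M(1)] max_op_L2[OF M(2)]
    define h where "h x = f1 x - f2 x" for x
    have h_eq: "(\<lambda>x. f1 x - f2 x) = h" by (simp add: h_def[abs_def])
    have hL: "h \<in> L2" unfolding h_def using L by (intro L2_diff) auto
    have "(\<lambda>x. f1 x - f2 x, \<lambda>x. (g x + \<i> * f1 x) - (g x + \<i> * f2 x)) \<in> max_op \<alpha>" by (rule max_op_diff[OF M])
    moreover have "(\<lambda>x. (g x + \<i> * f1 x) - (g x + \<i> * f2 x)) = (\<lambda>x. \<i> * h x)" by (auto simp: h_def algebra_simps)
    ultimately have hM: "(h, \<lambda>x. \<i> * h x) \<in> max_op \<alpha>" by (simp add: h_def[abs_def])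
    let ?p = "b1 h (\<lambda>x. \<i> * h x)" and ?q = "b2 h (\<lambda>x. \<i> * h x)"
    \<comment> \<open>Components of the boundary vector of h across and along the line of z; as z is
      a unit vector, this is a rotation and preserves the boundary form.\<close>
    define lz n where "lz = of_real (Re z) * ?q - of_real (Im z) * ?p"
      and "n = of_real (Re z) * ?p + of_real (Im z) * ?q"
    have "of_real w * (2 * \<i> * of_real ((L2_norm h)^2)) = cnj n * lz - cnj lz * n"
    proof -
      have "cnj n * lz - cnj lz * n = of_real ((Re z)^2 + (Im z)^2) * (cnj ?p * ?q - cnj ?q * ?p)"
        by (simp add: lz_def n_def power2_eq_square algebra_simps)
      also have "\<dots> = of_real w * (L2_inner h (\<lambda>x. \<i> * h x) - L2_inner (\<lambda>x. \<i> * h x) h)" using green[OF hM hM] unit by simp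
      finally show ?thesis by (simp add: inner_scale_left inner_scale_right inner_self)
    qed
    then have "norm (of_real w * (2 * \<i> * complex_of_real ((L2_norm h)^2))) \<le> norm (cnj n * lz) + norm (cnj lz * n)" by (metis norm_triangle_ineq4)
    then have 1: "\<bar>w\<bar> * (L2_norm h)^2 \<le> norm n * norm lz" by (simp add: norm_mult norm_power mult.commute)
    have "norm n \<le> \<bar>Re z\<bar> * norm (?p) + \<bar>Im z\<bar> * norm (?q)"
      unfolding n_def by (rule order_trans[OF norm_triangle_ineq]) (simp add: norm_mult)
    also have "\<dots> \<le> 1 * (bC * (L2_norm h + L2_norm (\<lambda>x. \<i> * h x))) + 1 * (bC * (L2_norm h + L2_norm (\<lambda>x. \<i> * h x)))"
      by (intro add_mono mult_mono comp b_bound hL L2_scale) auto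
    also have "\<dots> = 4 * bC * L2_norm h" by (simp add: L2_norm_scale)
    finally have 2: "norm n \<le> 4 * bC * L2_norm h" .
    obtain c where c: "b1 f2 ?g2 = c * of_real (Re z')" "b2 f2 ?g2 = c * of_real (Im z')" using f2 nz(2) by (rule ext_proportional)
    have f2n: "L2_norm f2 \<le> 1" using self_adjoint_resolvent_norm_le[OF sa(2) g(1) f2] g(2) by simp
    have hb: "?p = b1 f1 ?g1 - c * of_real (Re z')"
      "?q = b2 f1 ?g1 - c * of_real (Im z')"
    proof -
      have e: "(\<lambda>x. (g x + \<i> * f1 x) - (g x + \<i> * f2 x)) = (\<lambda>x. \<i> * h x)" by (auto simp: h_def algebra_simps)
      show "?p = b1 f1 ?g1 - c * of_real (Re z')"
        "?q = b2 f1 ?g1 - c * of_real (Im z')"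
        using b_diff[of f1 ?g1 f2 ?g2] L unfolding c e h_eq by simp_all
    qed
    \<comment> \<open>The boundary vector of f1 lies on the line of z, so only f2 contributes across
      it.\<close>
    have "lz = - c * of_real (Im (cnj z * z'))" using f1 unfolding lz_def hb ext_def by (simp add: algebra_simps)
    then have 3: "norm lz = norm c * \<bar>Im (cnj z * z')\<bar>" by (simp only: norm_mult norm_minus_cancel norm_of_real)
    have cb: "norm c \<le> 3 * (bC * 2)"
    proof -
      have le: "norm (c * of_real (Re z')) \<le> bC * 3" "norm (c * of_real (Im z')) \<le> bC * 3"
      proof -
        have "L2_norm f2 + L2_norm ?g2 \<le> 1 + (1 + 1)"
          using L2_triangle[OF g(1) L2_scale[of f2 \<i>]] L f2n g(2) by (intro add_mono f2n) (auto simp: L2_norm_scale)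
        then have "bC * (L2_norm f2 + L2_norm ?g2) \<le> bC * 3" using bC_nonneg by (intro mult_left_mono) auto
        then show "norm (c * of_real (Re z')) \<le> bC * 3" "norm (c * of_real (Im z')) \<le> bC * 3" using b_bound[of f2 ?g2] L unfolding c by linarith+
      qed
      have "norm c * norm z' \<le> norm c * (\<bar>Re z'\<bar> + \<bar>Im z'\<bar>)" by (intro mult_left_mono cmod_le) auto
      with le z(2) show ?thesis by (simp add: norm_mult distrib_left)
    qed
    have "\<bar>w\<bar> * (L2_norm h)^2 \<le> (4 * bC * L2_norm h) * (6 * bC * \<bar>Im (cnj z * z')\<bar>)"
    proof (rule order_trans[OF 1], rule mult_mono[OF 2])
      show "norm lz \<le> 6 * bC * \<bar>Im (cnj z * z')\<bar>" unfolding 3 using cb by (intro mult_right_mono) auto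
    qed (use bC_nonneg in auto)
    then have "L2_norm h * (\<bar>w\<bar> * L2_norm h) \<le> L2_norm h * (24 * bC^2 * \<bar>Im (cnj z * z')\<bar>)" by (simp add: power2_eq_square mult_ac)
    then have "\<bar>w\<bar> * L2_norm h \<le> 24 * bC^2 * \<bar>Im (cnj z * z')\<bar>"
      by (cases "L2_norm h = 0") (auto simp: mult_le_cancel_left order.strict_iff_order)
    then show "L2_dist f1 f2 \<le> (24 * bC^2 / \<bar>w\<bar>) * \<bar>Im (cnj z * z')\<bar>" using w unfolding h_def by (simp add: field_simps)
  qed
qed

end

subsection \<open>The circle of self-adjoint extensions and the flow\<close>

lemma csqrt_power2_unit:
  assumes "norm z = 1"
  shows "csqrt (z^2) = z \<or> csqrt (z^2) = - z" by (metis power2_csqrt power2_eq_iff)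

text \<open>Factor z^2 - z'^2; the squared norms of the factors are 2 - 2 r and 2 + 2 r with r^2 +
  s^2 = 1. This turns the resolvent bound into the chordal distance of the points coding the two
  lines.\<close>

lemma norm_power2_diff_unit:
  assumes "norm z = 1" "norm z' = 1"
  shows "norm (z^2 - z'^2) = 2 * \<bar>Im (cnj z * z')\<bar>"
proof -
  define r s where "r = Re (cnj z * z')" and "s = Im (cnj z * z')"
  have u: "(Re z)^2 + (Im z)^2 = 1" "(Re z')^2 + (Im z')^2 = 1" using assms by (auto simp flip: cmod_power2)
  have rs: "r^2 + s^2 = 1" unfolding r_def s_def cmod_power2[symmetric] using assms by (simp add: norm_mult)
  have "(norm (z^2 - z'^2))^2 = (norm (z - z'))^2 * (norm (z + z'))^2" by (simp add: square_diff_square_factored power2_eq_square norm_mult mult_ac)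
  also have "(norm (z - z'))^2 = 2 - 2 * r" unfolding cmod_power2 r_def using u by (simp add: power2_eq_square algebra_simps)
  also have "(norm (z + z'))^2 = 2 + 2 * r" unfolding cmod_power2 r_def using u by (simp add: power2_eq_square algebra_simps)
  also have "(2 - 2 * r) * (2 + 2 * r) = (2 * \<bar>s\<bar>)^2" using rs by (simp add: power2_eq_square algebra_simps)
  finally show ?thesis unfolding s_def by (rule power2_eq_imp_eq) auto
qed

text \<open>Negative energies are parametrized by the dilation that carries the solution at energy
  -1 to them.\<close>

abbreviation energy :: cfun where
  "energy \<tau> \<equiv> complex_of_real (- exp (2 * \<tau>))"

context limit_circle
begin

text \<open>Opposite square roots span the same real line, so the choice made by
  \<open>csqrt\<close> does not matter.\<close>

definition circ :: "complex \<Rightarrow> operator" where "circ c = ext (csqrt c)"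

abbreviation "extensions \<equiv> sa_extensions (L_min \<alpha>)"
abbreviation "ext_top \<equiv> sa_topology (L_min \<alpha>)"

lemma topspace_ext_top [simp]: "topspace ext_top = extensions"
  unfolding sa_topology_def by (rule Metric_space.topspace_mtopology[OF Metric_space_sa_extensions])

lemma circ_power2:
  assumes "norm z = 1"
  shows "circ (z^2) = ext z"
proof -
  have "ext (- z) = ext z" using ext_scale[of "-1" z] by simp
  with csqrt_power2_unit[OF assms] show ?thesis unfolding circ_def by (elim disjE) simp_all
qed

lemma ext_eq_circ:
  assumes "z \<noteq> 0"
  shows "ext z = circ (z / cnj z)" "norm (z / cnj z) = 1"
proof -
  define u where "u = of_real (1 / norm z) * z"
  have u: "norm u = 1" using assms by (simp add: u_def norm_mult norm_divide)
  have "u^2 = z / cnj z"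
  proof -
    have "u^2 = z * z / (of_real (norm z))^2" by (simp add: u_def power2_eq_square)
    also have "(complex_of_real (norm z))^2 = z * cnj z" using complex_norm_square[of z] by simp
    also have "z * z / (z * cnj z) = z / cnj z" using assms by simp
    finally show ?thesis .
  qed
  moreover have "ext z = ext u" unfolding u_def using assms by (intro ext_scale[symmetric]) (simp add: of_real_eq_0_iff)
  ultimately show "ext z = circ (z / cnj z)" using circ_power2[OF u] by simp
  show "norm (z / cnj z) = 1" using assms by (simp add: norm_divide)
qed

lemma circ_in_extensions: "norm c = 1 \<Longrightarrow> circ c \<in> extensions" unfolding circ_def by (rule ext_sa_extension) auto

text \<open>A Lipschitz bijection from a compact space onto a Hausdorff space; compactness supplies
  the continuity of the inverse.\<close>

lemma circ_homeomorphic: "homeomorphic_map circle ext_top circ"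
proof (rule continuous_imp_homeomorphic_map)
  interpret M: Metric_space extensions resolvent_dist by (rule Metric_space_sa_extensions)
  show "Hausdorff_space ext_top" unfolding sa_topology_def by (rule M.Hausdorff_space_mtopology)
  show "compact_space circle" by (simp add: compact_space_subtopology)
  show "circ ` topspace circle = topspace ext_top"
  proof (intro equalityI subsetI)
    fix K assume "K \<in> topspace ext_top"
    then obtain z where "z \<noteq> 0" "K = ext z" using sa_extension_is_ext by auto
    then show "K \<in> circ ` topspace circle" using ext_eq_circ[of z] by (auto intro!: image_eqI[of _ _ "z / cnj z"])
  qed (use circ_in_extensions in auto)
  show "inj_on circ (topspace circle)"
  proof (rule inj_onI)
    fix c d assume cd: "c \<in> topspace circle" "d \<in> topspace circle" and eq: "circ c = circ d"
    have n: "norm (csqrt c) = 1" "norm (csqrt d) = 1" using cd by auto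
    have "Im (cnj (csqrt c) * csqrt d) = 0" using eq unfolding circ_def by (rule ext_eqD)
    then have "norm ((csqrt c)^2 - (csqrt d)^2) = 0" unfolding norm_power2_diff_unit[OF n] by simp
    then show "c = d" by simp
  qed
  define C where "C = (24 * bC^2 / \<bar>w\<bar>) / 2"
  have C: "0 \<le> C" by (simp add: C_def)
  have lip: "resolvent_dist (circ c) (circ d) \<le> C * norm (c - d)" if "norm c = 1" "norm d = 1" for c d
  proof -
    have n: "norm (csqrt c) = 1" "norm (csqrt d) = 1" using that by auto
    show ?thesis using ext_resolvent_dist_le[OF n] norm_power2_diff_unit[OF n] unfolding circ_def C_def by simp
  qed
  show "continuous_map circle ext_top circ" unfolding sa_topology_def M.continuous_map_to_metric
  proof (intro ballI allI impI)
    fix c \<epsilon> assume c: "c \<in> topspace circle" and e: "(0::real) < \<epsilon>"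
    define U where "U = sphere 0 1 \<inter> ball c (\<epsilon> / (C + 1))"
    have "openin circle U" unfolding U_def by (intro openin_open_Int) auto
    moreover have "c \<in> U" using c e C by (auto simp: U_def)
    moreover have "circ d \<in> M.mball (circ c) \<epsilon>" if "d \<in> U" for d
    proof -
      have d: "norm c = 1" "norm d = 1" "norm (c - d) < \<epsilon> / (C + 1)" using that c by (auto simp: U_def dist_norm)
      have "resolvent_dist (circ c) (circ d) \<le> C * norm (c - d)" by (rule lip[OF d(1,2)])
      also have "\<dots> \<le> C * (\<epsilon> / (C + 1))" using d(3) C by (intro mult_left_mono) auto
      also have "\<dots> < \<epsilon>" using C e by (simp add: field_simps)
      finally show ?thesis using circ_in_extensions d by simp
    qed
    ultimately show "\<exists>U. openin circle U \<and> c \<in> U \<and> (\<forall>d\<in>U. circ d \<in> M.mball (circ c) \<epsilon>)" by blast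
  qed
qed

definition angle :: "operator \<Rightarrow> complex" where
  "angle = (SOME g. homeomorphic_maps circle ext_top circ g)"

lemma angle_homeomorphic_maps: "homeomorphic_maps circle ext_top circ angle"
  unfolding angle_def using circ_homeomorphic[unfolded homeomorphic_map_maps] by (rule someI_ex)

lemma angle_homeomorphic: "homeomorphic_map ext_top circle angle" using angle_homeomorphic_maps by (simp add: homeomorphic_maps_map)

lemma angle_circ: "norm c = 1 \<Longrightarrow> angle (circ c) = c" using angle_homeomorphic_maps by (auto simp: homeomorphic_maps_def)

lemma angle_ext: "z \<noteq> 0 \<Longrightarrow> angle (ext z) = z / cnj z" using ext_eq_circ[of z] angle_circ by simp

lemma homeomorphic_circle: "ext_top homeomorphic_space circle" by (rule homeomorphic_map_imp_homeomorphic_space[OF angle_homeomorphic])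

definition G :: "real \<Rightarrow> complex \<Rightarrow> complex" where
  "G \<tau> z = Complex (G11 \<tau> * Re z + G12 \<tau> * Im z) (G21 \<tau> * Re z + G22 \<tau> * Im z)"

lemma G_nonzero:
  assumes "z \<noteq> 0"
  shows "G \<tau> z \<noteq> 0"
proof
  assume "G \<tau> z = 0"
  then have *: "G11 \<tau> * Re z + G12 \<tau> * Im z = 0" "G21 \<tau> * Re z + G22 \<tau> * Im z = 0" by (simp_all add: G_def complex_eq_iff)
  have "(G11 \<tau> * G22 \<tau> - G12 \<tau> * G21 \<tau>) * Re z = G22 \<tau> * (G11 \<tau> * Re z + G12 \<tau> * Im z) - G12 \<tau> * (G21 \<tau> * Re z + G22 \<tau> * Im z)"
    "(G11 \<tau> * G22 \<tau> - G12 \<tau> * G21 \<tau>) * Im z = G11 \<tau> * (G21 \<tau> * Re z + G22 \<tau> * Im z) - G21 \<tau> * (G11 \<tau> * Re z + G12 \<tau> * Im z)"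
    by (simp_all add: algebra_simps)
  with * G_det[of \<tau>] assms show False by (simp add: complex_eq_iff)
qed

text \<open>By the scaling laws the Wronskian of \<open>u1\<close> or \<open>u2\<close> with the
  dilated function at x is a combination of Wronskians with the original function at exp \<tau> x,
  which also tends to 0.\<close>

lemma b_dilation:
  assumes fg: "(f, g) \<in> max_op \<alpha>"
  shows "b1 (dilation \<tau> f) (\<lambda>x. complex_of_real (exp (2 * \<tau>)) * dilation \<tau> g x) = of_real (G11 \<tau>) * b1 f g + of_real (G12 \<tau>) * b2 f g"
    "b2 (dilation \<tau> f) (\<lambda>x. complex_of_real (exp (2 * \<tau>)) * dilation \<tau> g x) = of_real (G21 \<tau>) * b1 f g + of_real (G22 \<tau>) * b2 f g"
proof -
  obtain F F' where F: "regular \<alpha> F F' g" "AE x in half_line. f x = F x" "f \<in> L2" "g \<in> L2" using fg by (rule max_opE)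
  note FL = regularD(1)[OF F(1)]
  note reg = regular_dilation[OF F(1), of \<tau>]
  have scale: "filterlim (\<lambda>x. exp \<tau> * x) (at_right 0) (at_right 0)"
    using filtermap_times_pos_at_right[of "exp \<tau>" 0] by (simp add: filterlim_def)
  note lim = filterlim_compose[OF b_tendsto(1)[OF F(1)] scale] filterlim_compose[OF b_tendsto(2)[OF F(1)] scale]
  have e: "complex_of_real (exp (- 3 * \<tau> / 2)) * of_real (exp (3 * \<tau> / 2)) = 1" "complex_of_real (exp (- \<tau> / 2)) * of_real (exp (\<tau> / 2)) = 1"
    by (simp_all flip: of_real_mult exp_add)
  have key: "((\<lambda>x. of_real (u x) * (complex_of_real (exp (3 * \<tau> / 2)) * F' (exp \<tau> * x)) - of_real (u' x) * dilation \<tau> F x)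
       \<longlongrightarrow> of_real p * b1 F g + of_real q * b2 F g) (at_right 0)"
    if u: "\<And>x. 0 < x \<Longrightarrow> u x = exp (- 3 * \<tau> / 2) * (p * u1 (exp \<tau> * x) + q * u2 (exp \<tau> * x))"
      "\<And>x. 0 < x \<Longrightarrow> u' x = exp (- \<tau> / 2) * (p * u1' (exp \<tau> * x) + q * u2' (exp \<tau> * x))" for u u' p q
  proof (rule Lim_transform_eventually[OF tendsto_add[OF tendsto_mult[OF tendsto_const lim(1)] tendsto_mult[OF tendsto_const lim(2)]]])
    show "\<forall>\<^sub>F x in at_right 0. of_real p * (of_real (u1 (exp \<tau> * x)) * F' (exp \<tau> * x) - of_real (u1' (exp \<tau> * x)) * F (exp \<tau> * x)) +
        of_real q * (of_real (u2 (exp \<tau> * x)) * F' (exp \<tau> * x) - of_real (u2' (exp \<tau> * x)) * F (exp \<tau> * x)) =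
        of_real (u x) * (complex_of_real (exp (3 * \<tau> / 2)) * F' (exp \<tau> * x)) - of_real (u' x) * dilation \<tau> F x" using ev_near
    proof eventually_elim
      case (elim x)
      have "of_real (u x) * (complex_of_real (exp (3 * \<tau> / 2)) * F' (exp \<tau> * x)) =
         (complex_of_real (exp (- 3 * \<tau> / 2)) * of_real (exp (3 * \<tau> / 2))) *
         ((of_real p * of_real (u1 (exp \<tau> * x)) + of_real q * of_real (u2 (exp \<tau> * x))) * F' (exp \<tau> * x))" using u(1)[of x] elim by simp
      moreover have "of_real (u' x) * dilation \<tau> F x =
         (complex_of_real (exp (- \<tau> / 2)) * of_real (exp (\<tau> / 2))) *
         ((of_real p * of_real (u1' (exp \<tau> * x)) + of_real q * of_real (u2' (exp \<tau> * x))) * F (exp \<tau> * x))"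
        using u(2)[of x] elim by (simp add: dilation_def)
      ultimately show ?case unfolding e by (simp add: algebra_simps)
    qed
  qed
  show "b1 (dilation \<tau> f) (\<lambda>x. complex_of_real (exp (2 * \<tau>)) * dilation \<tau> g x) = of_real (G11 \<tau>) * b1 f g + of_real (G12 \<tau>) * b2 f g"
    "b2 (dilation \<tau> f) (\<lambda>x. complex_of_real (exp (2 * \<tau>)) * dilation \<tau> g x) = of_real (G21 \<tau>) * b1 f g + of_real (G22 \<tau>) * b2 f g"
    unfolding b_cong_AE[OF AE_dilation_cong[OF F(2,3) FL] L2_dilation(1)[OF F(3)] L2_dilation(1)[OF FL]] b_cong_AE[OF F(2,3) FL]
    by (rule b_eqI[OF reg], rule key, erule scaling1, erule scaling1)
      (rule b_eqI[OF reg], rule key, erule scaling2, erule scaling2)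
qed

text \<open>The transformation of boundary values gives one inclusion for every parameter. Using it
  for \<tau> and - \<tau>, maximality of self-adjoint operators turns it into equality.\<close>

lemma rg_ext:
  assumes z: "z \<noteq> 0"
  shows "rg \<tau> (ext z) = ext (G \<tau> z)"
proof -
  have sub: "rg t (ext y) \<subseteq> ext (G t y)" if y: "y \<noteq> 0" for t y
  proof (rule subrelI)
    fix f g assume "(f, g) \<in> rg t (ext y)"
    then obtain h k where hk: "(h, k) \<in> ext y" "f = dilation t h" "g = (\<lambda>x. complex_of_real (exp (2 * t)) * dilation t k x)"
      by (auto simp: rg_def)
    then have M: "(h, k) \<in> max_op \<alpha>" by (simp add: ext_def)
    obtain c where "b1 h k = c * of_real (Re y)" "b2 h k = c * of_real (Im y)" using hk(1) y by (rule ext_proportional)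
    note c = this
    have "b1 f g = c * of_real (Re (G t y))" "b2 f g = c * of_real (Im (G t y))"
      unfolding hk(2,3) b_dilation[OF M] c G_def by (simp_all add: algebra_simps)
    moreover have "(f, g) \<in> max_op \<alpha>" using max_op_dilation[OF M, of t] unfolding hk(2,3) .
    ultimately show "(f, g) \<in> ext (G t y)" by (simp add: ext_def)
  qed
  have sa: "self_adjoint (ext y)" if "y \<noteq> 0" for y using ext_sa_extension[OF that] by (simp add: sa_extensions_def)
  have inv: "rg (- \<tau>) (rg \<tau> K) = K" "rg \<tau> (rg (- \<tau>) K) = K" for K by (simp_all add: rg_0 flip: rg_add)
  have mono: "rg (- \<tau>) A \<subseteq> rg (- \<tau>) B" if "A \<subseteq> B" for A B using that by (force simp: rg_def)
  have chain: "ext z \<subseteq> rg (- \<tau>) (ext (G \<tau> z))" using mono[OF sub[OF z, of \<tau>]] inv by simp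
  also have "\<dots> \<subseteq> ext (G (- \<tau>) (G \<tau> z))" by (rule sub[OF G_nonzero[OF z]])
  finally have "ext z = ext (G (- \<tau>) (G \<tau> z))" by (intro self_adjoint_maximal sa z G_nonzero)
  with chain sub[OF G_nonzero[OF z], of "- \<tau>"] have "rg (- \<tau>) (ext (G \<tau> z)) = ext z" by auto
  then have "rg \<tau> (rg (- \<tau>) (ext (G \<tau> z))) = rg \<tau> (ext z)" by simp
  then show ?thesis using inv by simp
qed

text \<open>As a real-linear map, G sends z to p z + q cnj z with the two coefficients displayed
  here. Dividing by the conjugate and using z cnj z = 1 gives a fractional linear map of c =
  z^2.\<close>

definition moebius :: "real \<times> complex \<Rightarrow> complex" where
  "moebius = (\<lambda>(t, c). (Complex ((G11 t + G22 t) / 2) ((G21 t - G12 t) / 2) * c + Complex ((G11 t - G22 t) / 2) ((G21 t + G12 t) / 2)) /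
     (cnj (Complex ((G11 t + G22 t) / 2) ((G21 t - G12 t) / 2)) + cnj (Complex ((G11 t - G22 t) / 2) ((G21 t + G12 t) / 2)) * c))"

lemma moebius_eq:
  assumes s: "norm s = 1"
  shows "moebius (t, s^2) = G t s / cnj (G t s)"
    "cnj (Complex ((G11 t + G22 t) / 2) ((G21 t - G12 t) / 2)) + cnj (Complex ((G11 t - G22 t) / 2) ((G21 t + G12 t) / 2)) * s^2 \<noteq> 0"
proof -
  define p q where "p = Complex ((G11 t + G22 t) / 2) ((G21 t - G12 t) / 2)"
    and "q = Complex ((G11 t - G22 t) / 2) ((G21 t + G12 t) / 2)"
  have G: "G t s = p * s + q * cnj s" by (simp add: G_def p_def q_def complex_eq_iff field_simps)
  have ss: "s * cnj s = 1" using s by (simp add: complex_norm_square[symmetric])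
  have s0: "s \<noteq> 0" using s by auto
  have num: "p * s^2 + q = s * G t s" unfolding G using ss by (simp add: power2_eq_square algebra_simps)
  have den: "cnj p + cnj q * s^2 = s * cnj (G t s)" unfolding G using ss by (simp add: power2_eq_square algebra_simps)
  show "moebius (t, s^2) = G t s / cnj (G t s)" using num den s0 by (simp add: moebius_def p_def q_def)
  show "cnj (Complex ((G11 t + G22 t) / 2) ((G21 t - G12 t) / 2)) + cnj (Complex ((G11 t - G22 t) / 2) ((G21 t + G12 t) / 2)) * s^2 \<noteq> 0"
    using den s0 G_nonzero[OF s0, of t] by (simp add: p_def q_def)
qed

lemma rg_circ:
  assumes "norm c = 1"
  shows "rg t (circ c) = circ (moebius (t, c))" "norm (moebius (t, c)) = 1"
proof -
  have n: "norm (csqrt c) = 1" using assms by simp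
  then have s0: "csqrt c \<noteq> 0" by auto
  show "rg t (circ c) = circ (moebius (t, c))"
    using moebius_eq(1)[OF n, of t] ext_eq_circ(1)[OF G_nonzero[OF s0], of t] by (simp add: circ_def rg_ext[OF s0])
  show "norm (moebius (t, c)) = 1" using moebius_eq(1)[OF n, of t] ext_eq_circ(2)[OF G_nonzero[OF s0], of t] by simp
qed

lemma extension_cases:
  assumes "K \<in> extensions"
  obtains c where "norm c = 1" "K = circ c"
  using assms sa_extension_is_ext ext_eq_circ by metis

lemma rg_extensions: "K \<in> extensions \<Longrightarrow> rg t K \<in> extensions" by (erule extension_cases) (auto simp: rg_circ circ_in_extensions)

text \<open>The flow is conjugate to \<open>moebius\<close> by the homeomorphism
  \<open>circ\<close>; joint continuity holds since the denominator has no zero on the unit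
  circle.\<close>

lemma continuous_flow: "continuous_flow_on extensions ext_top rg" unfolding continuous_flow_on_def
proof (intro conjI allI ballI)
  have "continuous_on (UNIV \<times> sphere 0 1) moebius"
  proof -
    have c: "continuous_on S (\<lambda>x. g (fst x))" if "continuous_on UNIV g" for g :: "real \<Rightarrow> real" and S :: "(real \<times> complex) set"
      by (rule continuous_on_compose2[OF that]) (auto intro: continuous_intros)
    have nz: "cnj (Complex ((G11 (fst x) + G22 (fst x)) / 2) ((G21 (fst x) - G12 (fst x)) / 2)) +
       cnj (Complex ((G11 (fst x) - G22 (fst x)) / 2) ((G21 (fst x) + G12 (fst x)) / 2)) * snd x \<noteq> 0" if "x \<in> UNIV \<times> sphere 0 1" for x
      using moebius_eq(2)[of "csqrt (snd x)" "fst x"] that by auto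
    show ?thesis unfolding moebius_def case_prod_beta
    proof (rule continuous_on_divide)
      show "continuous_on (UNIV \<times> sphere 0 1) (\<lambda>p. Complex ((G11 (fst p) + G22 (fst p)) / 2) ((G21 (fst p) - G12 (fst p)) / 2) * snd p +
            Complex ((G11 (fst p) - G22 (fst p)) / 2) ((G21 (fst p) + G12 (fst p)) / 2))"
        "continuous_on (UNIV \<times> sphere 0 1) (\<lambda>p. cnj (Complex ((G11 (fst p) + G22 (fst p)) / 2) ((G21 (fst p) - G12 (fst p)) / 2)) +
            cnj (Complex ((G11 (fst p) - G22 (fst p)) / 2) ((G21 (fst p) + G12 (fst p)) / 2)) * snd p)"
        unfolding Complex_eq by (intro continuous_intros c G_cont; simp)+
    qed (use nz in blast)
  qed
  then have "continuous_map (prod_topology euclideanreal circle) circle moebius"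
  proof -
    have "prod_topology euclideanreal circle = top_of_set (UNIV \<times> sphere 0 1)"
      using prod_topology_subtopology_eu[of "UNIV :: real set" "sphere 0 1 :: complex set"] by simp
    with \<open>continuous_on (UNIV \<times> sphere 0 1) moebius\<close> show ?thesis using rg_circ(2) by (auto simp: continuous_map_in_subtopology)
  qed
  moreover have "continuous_map (prod_topology euclideanreal ext_top) (prod_topology euclideanreal circle) (\<lambda>(t, K). (t, angle K))"
    using homeomorphic_imp_continuous_map[OF angle_homeomorphic]
    using continuous_map_compose[OF continuous_map_snd[of euclideanreal ext_top], of circle angle]
    by (simp add: case_prod_beta continuous_map_pairwise o_def continuous_map_fst)
  ultimately have "continuous_map (prod_topology euclideanreal ext_top) ext_top (circ \<circ> (moebius \<circ> (\<lambda>(t, K). (t, angle K))))"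
    by (intro continuous_map_compose[OF _ homeomorphic_imp_continuous_map[OF circ_homeomorphic]] continuous_map_compose)
  then show "continuous_map (prod_topology euclideanreal ext_top) ext_top (\<lambda>(t, K). rg t K)"
  proof (rule continuous_map_eq)
    fix x assume "x \<in> topspace (prod_topology euclideanreal ext_top)"
    then have "snd x \<in> extensions" by auto
    then obtain c where "norm c = 1" "snd x = circ c" by (rule extension_cases)
    then show "(circ \<circ> (moebius \<circ> (\<lambda>(t, K). (t, angle K)))) x = (case x of (t, K) \<Rightarrow> rg t K)"
      by (simp add: case_prod_beta angle_circ rg_circ)
  qed
qed (auto intro: rg_extensions simp: rg_0 rg_add)

lemma limitin_circ:
  assumes "((\<lambda>t. moebius (t, c)) \<longlongrightarrow> d) F" "norm c = 1" "norm d = 1"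
  shows "limitin ext_top (\<lambda>t. rg t (circ c)) (circ d) F"
proof -
  have "limitin circle (\<lambda>t. moebius (t, c)) d F" using assms rg_circ(2)[OF assms(2)] by (simp add: limitin_subtopology)
  from continuous_map_limit[OF homeomorphic_imp_continuous_map[OF circ_homeomorphic] this]
  show ?thesis by (simp add: o_def rg_circ[OF assms(2)])
qed

subsection \<open>Negative eigenvalues\<close>

text \<open>A function with vanishing boundary values is orthogonal to all its dilates, because these are
  eigenfunctions for other eigenvalues; as the dilates converge pointwise to it, Fatou's lemma bounds
  the norm of \<open>2 f\<close> by \<open>sqrt 2\<close> times that of \<open>f\<close>.\<close>

lemma eigenfunction_boundary_values_zero:
  assumes f: "(f, \<lambda>x. of_real l * f x) \<in> max_op \<alpha>" and l: "l \<noteq> 0"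
    and b: "b1 f (\<lambda>x. of_real l * f x) = 0" "b2 f (\<lambda>x. of_real l * f x) = 0"
  shows "AE x in half_line. f x = 0"
proof -
  obtain F F' where F: "regular \<alpha> F F' (\<lambda>x. of_real l * f x)" "AE x in half_line. f x = F x" "f \<in> L2" using f by (rule max_opE)
  note FL = regularD(1)[OF F(1)]
  define t where "t n = 1 / real (Suc n)" for n
  have t: "t n > 0" "t \<longlonglongrightarrow> 0" for n unfolding t_def[abs_def] using LIMSEQ_inverse_real_of_nat by (auto simp: inverse_eq_divide)
  have orth: "L2_inner f (dilation (t n) f) = 0" for n
  proof -
    have M: "(dilation (t n) f, \<lambda>x. complex_of_real (exp (2 * t n)) * dilation (t n) (\<lambda>x. of_real l * f x) x) \<in> max_op \<alpha>"
      by (rule max_op_dilation[OF f])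
    from green[OF f M] b w have "L2_inner f (\<lambda>x. complex_of_real (exp (2 * t n)) * dilation (t n) (\<lambda>x. of_real l * f x) x) =
        L2_inner (\<lambda>x. of_real l * f x) (dilation (t n) f)" by simp
    then have "complex_of_real (exp (2 * t n)) * (of_real l * L2_inner f (dilation (t n) f)) = of_real l * L2_inner f (dilation (t n) f)"
      by (simp add: dilation_scale inner_scale_left inner_scale_right)
    then have "(complex_of_real (exp (2 * t n)) - 1) * (of_real l * L2_inner f (dilation (t n) f)) = 0" by (simp add: algebra_simps)
    moreover have "complex_of_real (exp (2 * t n)) \<noteq> 1" using t(1)[of n] by (simp only: of_real_eq_1_iff exp_eq_one_iff)
    ultimately show ?thesis using l by simp
  qed
  note ae_dil = AE_dilation_cong[OF F(2,3) FL]
  have nrm: "L2_norm (\<lambda>x. F x + dilation (t n) F x) = sqrt 2 * L2_norm F" for n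
  proof -
    have "L2_inner F (dilation (t n) F) = 0"
      using orth[of n] inner_cong_AE[OF F(2) ae_dil[of "t n"] F(3) FL L2_dilation(1)[OF F(3)] L2_dilation(1)[OF FL]] by simp
    then have "(L2_norm (\<lambda>x. F x + dilation (t n) F x))^2 = 2 * (L2_norm F)^2"
      using L2_norm_add_sq[OF FL L2_dilation(1)[OF FL], of "t n"] by (simp add: L2_dilation(2)[OF FL])
    then have "sqrt ((L2_norm (\<lambda>x. F x + dilation (t n) F x))^2) = sqrt (2 * (L2_norm F)^2)" by simp
    then show ?thesis by (simp add: real_sqrt_mult)
  qed
  have "(\<lambda>x. 2 * F x) \<in> L2 \<and> L2_norm (\<lambda>x. 2 * F x) \<le> sqrt 2 * L2_norm F"
  proof (rule L2_Fatou[where F = "\<lambda>n x. F x + dilation (t n) F x" and ?n0.0 = 0])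
    show "(\<lambda>x. F x + dilation (t n) F x) \<in> L2" for n by (intro L2_add FL L2_dilation)
    show "(\<lambda>x. 2 * F x) \<in> borel_measurable half_line" by (rule L2_measurable[OF L2_scale[OF FL]])
    show "AE x in half_line. (\<lambda>n. F x + dilation (t n) F x) \<longlonglongrightarrow> 2 * F x" using AE_half_line_pos
    proof eventually_elim
      case x: (elim x)
      have "isCont F x" using regular_continuous[OF F(1)] x by (simp add: continuous_on_eq_continuous_at)
      moreover have "(\<lambda>n. exp (t n) * x) \<longlonglongrightarrow> exp 0 * x" by (intro tendsto_intros t)
      ultimately have "(\<lambda>n. F (exp (t n) * x)) \<longlonglongrightarrow> F x"
        using isCont_tendsto_compose[of x F "\<lambda>n. exp (t n) * x"] by simp
      then have "(\<lambda>n. F x + complex_of_real (exp (t n / 2)) * F (exp (t n) * x)) \<longlonglongrightarrow> F x + complex_of_real (exp (0 / 2)) * F x"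
        by (intro tendsto_intros t) auto
      then show ?case by (simp add: dilation_def)
    qed
  qed (simp add: nrm)
  then have "2 * L2_norm F \<le> sqrt 2 * L2_norm F" by (simp add: L2_norm_scale)
  moreover have "sqrt 2 < (2::real)" by (rule real_less_lsqrt) auto
  ultimately have "L2_norm F = 0" using L2_norm_nonneg[of F] mult_less_cancel_right[of "sqrt 2" "L2_norm F" 2] by (cases "L2_norm F = 0") auto
  then have "AE x in half_line. F x = 0" using L2_norm_eq_0_iff[OF FL] by simp
  with F(2) show ?thesis by eventually_elim simp
qed

text \<open>The dilate of \<psi> has energy \<open>energy \<tau>\<close> and boundary vector G
  \<tau> \<beta>. If f is an eigenfunction for the same real energy, the operator side of Green's
  formula is 0, so the boundary vectors of f and of the dilate are parallel; that of f is nonzero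
  and lies on the line of z.\<close>

lemma negative_eigenvalue_iff:
  assumes \<psi>: "(\<psi>, \<lambda>x. - \<psi> x) \<in> max_op \<alpha>" "\<not> (AE x in half_line. \<psi> x = 0)"
    and \<beta>: "b1 \<psi> (\<lambda>x. - \<psi> x) = of_real (Re \<beta>)" "b2 \<psi> (\<lambda>x. - \<psi> x) = of_real (Im \<beta>)" and z: "z \<noteq> 0"
  shows "energy \<tau> \<in> eigenvalues (ext z) \<longleftrightarrow> Im (cnj z * G \<tau> \<beta>) = 0"
proof -
  define \<phi> where "\<phi> = dilation \<tau> \<psi>"
  have e: "(\<lambda>x. complex_of_real (exp (2 * \<tau>)) * dilation \<tau> (\<lambda>x. - \<psi> x) x) = (\<lambda>x. energy \<tau> * \<phi> x)"
    by (auto simp: \<phi>_def dilation_def)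
  have \<phi>M: "(\<phi>, \<lambda>x. energy \<tau> * \<phi> x) \<in> max_op \<alpha>"
    using max_op_dilation[OF \<psi>(1), of \<tau>] unfolding e by (simp add: \<phi>_def)
  have \<phi>b: "b1 \<phi> (\<lambda>x. energy \<tau> * \<phi> x) = of_real (Re (G \<tau> \<beta>))"
    "b2 \<phi> (\<lambda>x. energy \<tau> * \<phi> x) = of_real (Im (G \<tau> \<beta>))"
    using b_dilation[OF \<psi>(1), of \<tau>] unfolding e \<beta> by (simp_all add: \<phi>_def G_def)
  have \<psi>L: "\<psi> \<in> L2" using max_op_L2[OF \<psi>(1)] by simp
  have \<phi>0: "\<not> (AE x in half_line. \<phi> x = 0)"
    using \<psi>(2) L2_norm_eq_0_iff[OF \<psi>L] L2_norm_eq_0_iff[OF L2_dilation(1)[OF \<psi>L]] L2_dilation(2)[OF \<psi>L] by (simp add: \<phi>_def)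
  show ?thesis
  proof
    assume "energy \<tau> \<in> eigenvalues (ext z)"
    then obtain f where f: "(f, \<lambda>x. energy \<tau> * f x) \<in> ext z" "\<not> (AE x in half_line. f x = 0)" by (auto simp: eigenvalues_def)
    then have fM: "(f, \<lambda>x. energy \<tau> * f x) \<in> max_op \<alpha>" by (simp add: ext_def)
    obtain c where c: "b1 f (\<lambda>x. energy \<tau> * f x) = c * of_real (Re z)"
      "b2 f (\<lambda>x. energy \<tau> * f x) = c * of_real (Im z)" using f(1) z by (rule ext_proportional)
    have "c \<noteq> 0" using eigenfunction_boundary_values_zero[OF fM] f(2) c by auto
    have "of_real w * (L2_inner \<phi> (\<lambda>x. energy \<tau> * f x) - L2_inner (\<lambda>x. energy \<tau> * \<phi> x) f) = 0"
      unfolding inner_scale_left inner_scale_right by simp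
    then have "of_real (Re (G \<tau> \<beta>)) * (c * of_real (Im z)) - of_real (Im (G \<tau> \<beta>)) * (c * of_real (Re z)) = 0"
      unfolding green[OF \<phi>M fM] \<phi>b c by simp
    moreover have "c * complex_of_real (Im (cnj z * G \<tau> \<beta>)) =
        - (of_real (Re (G \<tau> \<beta>)) * (c * of_real (Im z)) - of_real (Im (G \<tau> \<beta>)) * (c * of_real (Re z)))" by (simp add: algebra_simps)
    ultimately have "c * complex_of_real (Im (cnj z * G \<tau> \<beta>)) = 0" by (simp only: neg_equal_0_iff_equal)
    with \<open>c \<noteq> 0\<close> show "Im (cnj z * G \<tau> \<beta>) = 0" by (simp only: mult_eq_0_iff of_real_eq_0_iff simp_thms)
  next
    assume "Im (cnj z * G \<tau> \<beta>) = 0"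
    then have "complex_of_real (Re z * Im (G \<tau> \<beta>)) = complex_of_real (Im z * Re (G \<tau> \<beta>))"
      by (simp only: of_real_eq_iff) (simp add: mult.commute)
    then have "(\<phi>, \<lambda>x. energy \<tau> * \<phi> x) \<in> ext z" using \<phi>M by (simp add: ext_def \<phi>b del: of_real_minus)
    with \<phi>0 show "energy \<tau> \<in> eigenvalues (ext z)" by (auto simp: eigenvalues_def)
  qed
qed

end

subsection \<open>Absence of nonnegative and nonreal eigenvalues\<close>

lemma eigenvalue_real:
  assumes H: "self_adjoint H" and z: "z \<in> eigenvalues H"
  shows "z \<in> \<real>"
proof -
  obtain f where f: "(f, \<lambda>x. z * f x) \<in> H" "\<not> (AE x in half_line. f x = 0)" using z by (auto simp: eigenvalues_def)
  have "L2_norm f \<noteq> 0" using f(2) L2_norm_eq_0_iff[OF self_adjointD(1)[OF H f(1)]] by simp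
  moreover have "z * complex_of_real ((L2_norm f)^2) \<in> \<real>" using self_adjoint_inner_real[OF H f(1)] unfolding inner_scale_right inner_self .
  ultimately show ?thesis by (auto simp: complex_is_Real_iff)
qed

text \<open>The primitive of q is locally constant, and its derivative is q by continuity.\<close>

lemma primitive_eq_zero:
  fixes q :: cfun
  assumes "continuous_on {0<..} q" "AE x in half_line. q x = 0" "0 < x"
  shows "q x = 0"
proof -
  note l = continuous_locally_integrable[OF assms(1)]
  have z: "(q has_integral 0) {a..b}" if "0 < a" for a b
    by (rule AE_half_line_has_integral[where h = "\<lambda>_. 0"]) (use assms(2) that in \<open>auto elim: AE_mp\<close>)
  have "primitive q y = primitive q (x / 2)" if "y \<in> {x/2<..}" for y
    using has_integral_unique[OF has_integral_primitive[OF l, of "x/2" y] z] that assms(3) by simp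
  then have "(primitive q has_vector_derivative 0) (at x)"
    using assms(3) by (intro has_vector_derivative_transform_within_open[OF has_vector_derivative_const[of "primitive q (x / 2)"], where S = "{x/2<..}"]) auto
  then show ?thesis using vector_derivative_unique_at[OF primitive_deriv[OF assms(1,3)]] by blast
qed

lemma regular_deriv_differentiable:
  assumes reg: "regular \<alpha> f f' g" and g: "continuous_on {0<..} g" and x: "0 < x"
  shows "(f' has_vector_derivative potential \<alpha> x * f x - g x) (at x)"
proof -
  define q where "q x = potential \<alpha> x * f x - g x" for x
  have q: "continuous_on {0<..} q" unfolding q_def by (intro continuous_intros continuous_on_potential regular_continuous[OF reg] g)
  have "((\<lambda>y. f' (x/2) - primitive q (x/2) + primitive q y) has_vector_derivative 0 + q x) (at x)"
    by (intro has_vector_derivative_add has_vector_derivative_const primitive_deriv q x)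
  then have "(f' has_vector_derivative 0 + q x) (at x)"
  proof (rule has_vector_derivative_transform_within_open[where S = "{x/2<..}"])
    show "f' (x/2) - primitive q (x/2) + primitive q y = f' y" if "y \<in> {x/2<..}" for y
    proof -
      have "f' y - f' (x/2) = primitive q y - primitive q (x/2)"
        using that x has_integral_unique[OF regularD(4)[OF reg, of "x/2" y] has_integral_primitive[OF continuous_locally_integrable[OF q], of "x/2" y, unfolded q_def]]
        by (simp add: q_def[abs_def])
      then show ?thesis by (simp add: algebra_simps)
    qed
  qed (use x in auto)
  then show ?thesis by (simp add: q_def)
qed

lemma regular_Re:
  assumes "regular \<alpha> f f' g"
  shows "regular \<alpha> (\<lambda>x. of_real (Re (f x))) (\<lambda>x. of_real (Re (f' x))) (\<lambda>x. of_real (Re (g x)))"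
proof -
  have "(\<lambda>x. (1/2) * (h x + cnj (h x))) = (\<lambda>x. complex_of_real (Re (h x)))" for h :: cfun
    by (simp add: complex_add_cnj)
  with regular_scale[OF regular_add[OF assms regular_cnj[OF assms]], of "1/2"] show ?thesis by simp
qed

lemma has_vector_derivative_of_real_imp:
  assumes "((\<lambda>x. complex_of_real (p x)) has_vector_derivative of_real d) (at x)"
  shows "(p has_real_derivative d) (at x)" using bounded_linear.has_vector_derivative[OF bounded_linear_Re assms]
  by (simp add: has_real_derivative_iff_has_vector_derivative)

lemma real_eigenfunction_derivs:
  assumes reg: "regular \<alpha> (\<lambda>x. of_real (p x)) (\<lambda>x. of_real (p' x)) (\<lambda>x. of_real (l * p x))" and x: "0 < x"
  shows "(p has_real_derivative p' x) (at x)" "(p' has_real_derivative ((\<alpha> - 1/4) / x^2 - l) * p x) (at x)"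
proof -
  show "(p has_real_derivative p' x) (at x)" by (rule has_vector_derivative_of_real_imp[OF regularD(3)[OF reg x]])
  have "continuous_on {0<..} (\<lambda>x. complex_of_real (l * p x))"
    using continuous_on_mult[OF continuous_on_const regular_continuous[OF reg], of "of_real l"] by simp
  from regular_deriv_differentiable[OF reg this x]
  have "((\<lambda>x. complex_of_real (p' x)) has_vector_derivative of_real (((\<alpha> - 1/4) / x^2 - l) * p x)) (at x)"
    by (simp add: potential_def algebra_simps diff_divide_distrib)
  then show "(p' has_real_derivative ((\<alpha> - 1/4) / x^2 - l) * p x) (at x)" by (rule has_vector_derivative_of_real_imp)
qed

text \<open>Virial identity: \<open>Q = x (p'^2 + (l - V) p^2) - p p'\<close> has derivative \<open>2 l p^2\<close>. As \<open>Q\<close> is monotone and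
  tends to \<open>0\<close> along a sequence tending to infinity, it is nonpositive, while it is nonnegative for large \<open>x\<close>.\<close>

lemma no_positive_eigenvalue_real:
  assumes reg: "regular \<alpha> (\<lambda>x. of_real (p x)) (\<lambda>x. of_real (p' x)) (\<lambda>x. of_real (l * p x))"
    and l: "l > 0" and x: "x > 0"
  shows "p x = 0"
proof -
  note d = real_eigenfunction_derivs[OF reg]
  define v where "v = \<alpha> - 1/4"
  define Q where "Q x = x * ((p' x)^2 + l * (p x)^2) - v / x * (p x)^2 - p x * p' x" for x
  have dQ: "(Q has_real_derivative 2 * l * (p x)^2) (at x)" if "x > 0" for x unfolding Q_def[abs_def] using that
    by (auto intro!: derivative_eq_intros d simp: v_def power2_eq_square field_simps)
  have mono: "Q x \<le> Q y" if "0 < x" "x \<le> y" for x y using that l by (intro DERIV_nonneg_imp_nondecreasing[OF that(2)]) (auto intro!: exI dQ)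
  \<comment> \<open>An integrable function with \<open>Q x \<le> x * S x\<close> for x >= 1:
    arbitrarily far out \<open>Q\<close> lies below any given positive number.\<close>
  define S where "S x = 2 * (p' x)^2 + (l + \<bar>v\<bar> + 1) * (p x)^2" for x
  have "(\<lambda>x. (p x)^2) absolutely_integrable_on {1..}"
    using absolutely_integrable_Ici_half_line[OF L2_integrable_sq[OF regularD(1)[OF reg]], of 1] by simp
  moreover have "(\<lambda>x. (p' x)^2) absolutely_integrable_on {1..}" using regular_deriv_square_integrable[OF reg] by simp
  ultimately have Si: "S absolutely_integrable_on {1..}" unfolding S_def by (intro set_integral_add(1)) auto
  have QS: "Q x \<le> x * S x" if "x \<ge> 1" for x
  proof -
    have "- (v / x) * (p x)^2 \<le> x * (\<bar>v\<bar> * (p x)^2)"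
    proof -
      have "- (v / x) \<le> \<bar>v\<bar> / x" using that by (simp add: field_simps)
      also have "\<dots> \<le> \<bar>v\<bar> * x"
        using that mult_mono[of 1 x 1 x] mult_left_mono[of 1 "x * x" "\<bar>v\<bar>"] by (simp add: divide_le_eq mult.assoc)
      finally have "- (v / x) * (p x)^2 \<le> (\<bar>v\<bar> * x) * (p x)^2" by (intro mult_right_mono) auto
      then show ?thesis by (simp add: mult_ac)
    qed
    moreover have "- (p x * p' x) \<le> x * ((p x)^2 + (p' x)^2)"
    proof -
      have "- (p x * p' x) \<le> (p x)^2 + (p' x)^2"
        using zero_le_power2[of "p x + p' x"] sum_power2_ge_zero[of "p x" "p' x"] unfolding power2_sum by linarith
      also have "\<dots> \<le> x * ((p x)^2 + (p' x)^2)" using that mult_right_mono[of 1 x "(p x)^2 + (p' x)^2"] by simp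
      finally show ?thesis .
    qed
    ultimately show ?thesis unfolding Q_def S_def by (simp add: algebra_simps)
  qed
  have Q_le: "Q x \<le> 0" if "x > 0" for x
  proof (rule ccontr)
    assume "\<not> Q x \<le> 0"
    then obtain y where y: "y \<ge> max 1 x" "y * S y < Q x" using integrable_small_weighted_value_at_top[OF Si, of "Q x" "max 1 x"] by auto
    with QS[of y] mono[of x y] that show False by auto
  qed
  \<comment> \<open>Beyond this point the term l x p^2 absorbs both the potential and the cross term
    p p'.\<close>
  define X where "X = max 1 ((\<bar>v\<bar> + 1) / l)"
  have Q_ge: "0 \<le> Q x" if "x \<ge> X" for x
  proof -
    have x1: "x \<ge> 1" and xl: "\<bar>v\<bar> + 1 \<le> l * x" using that l by (auto simp: X_def divide_le_eq mult.commute)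
    have "v / x * (p x)^2 \<le> \<bar>v\<bar> * (p x)^2"
      using x1 mult_left_mono[of 1 x "\<bar>v\<bar>"] by (intro mult_right_mono) (auto simp: divide_le_eq)
    moreover have "p x * p' x \<le> (p x)^2 + (p' x)^2"
      using zero_le_power2[of "p x - p' x"] sum_power2_ge_zero[of "p x" "p' x"] unfolding power2_diff by linarith
    moreover have "(p' x)^2 \<le> x * (p' x)^2" using x1 mult_right_mono[of 1 x "(p' x)^2"] by simp
    moreover have "(\<bar>v\<bar> + 1) * (p x)^2 \<le> (l * x) * (p x)^2" using xl by (intro mult_right_mono) auto
    ultimately show ?thesis unfolding Q_def by (simp add: algebra_simps)
  qed
  have X: "X > 0" by (simp add: X_def)
  have pX: "p x = 0" if "x > X" for x
  proof -
    have "Q y = 0" if "y \<in> {X<..}" for y using Q_le[of y] Q_ge[of y] that X by auto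
    then have "((\<lambda>_. 0) has_real_derivative 2 * l * (p x)^2) (at x)"
      using has_field_derivative_transform_within_open[OF dQ[of x], of "{X<..}" "\<lambda>_. 0"] that X by auto
    then have "2 * l * (p x)^2 = 0" using DERIV_unique DERIV_const by blast
    with l show ?thesis by simp
  qed
  show ?thesis
  proof (cases "x > X")
    case False
    define b where "b = X + 1"
    have "p' b = 0"
    proof -
      have "((\<lambda>_. 0) has_real_derivative p' b) (at b)"
        using has_field_derivative_transform_within_open[OF d(1)[of b], of "{X<..}" "\<lambda>_. 0"] X pX by (auto simp: b_def)
      then show ?thesis using DERIV_unique DERIV_const by blast
    qed
    define K where "K = 1 + \<bar>v\<bar> / x^2 + l"
    \<comment> \<open>A Gronwall argument run to the left: on [x, b] the growth rate of p^2 + p'^2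
      is at least - K, so \<open>M\<close> is nondecreasing and its zero at b propagates back to
      x.\<close>
    define M where "M y = ((p y)^2 + (p' y)^2) * exp (K * y)" for y
    define M' where "M' y = (2 * (p y * p' y) * (1 + v / y^2 - l) + K * ((p y)^2 + (p' y)^2)) * exp (K * y)" for y
    have "(M has_real_derivative M' y) (at y)" if "y > 0" for y unfolding M_def[abs_def] M'_def using that
      by (auto intro!: derivative_eq_intros d simp: v_def power2_eq_square field_simps)
    moreover have "0 \<le> M' y" if "y \<ge> x" for y
    proof -
      have "\<bar>1 + v / y^2 - l\<bar> \<le> 1 + \<bar>v\<bar> / y^2 + l"
        using l by (intro order_trans[OF abs_triangle_ineq4] add_mono order_trans[OF abs_triangle_ineq]) auto
      also have "\<dots> \<le> K" unfolding K_def using that x by (intro add_mono divide_left_mono power_mono) auto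
      finally have "\<bar>2 * (p y * p' y)\<bar> * \<bar>1 + v / y^2 - l\<bar> \<le> ((p y)^2 + (p' y)^2) * K"
        using sum_squares_bound[of "\<bar>p y\<bar>" "\<bar>p' y\<bar>"] by (intro mult_mono) (auto simp: abs_mult)
      then have "0 \<le> 2 * (p y * p' y) * (1 + v / y^2 - l) + K * ((p y)^2 + (p' y)^2)"
        unfolding abs_mult[symmetric] by (simp add: abs_le_iff mult.commute)
      then show ?thesis unfolding M'_def by (intro mult_nonneg_nonneg) auto
    qed
    moreover have "x \<le> b" using False by (simp add: b_def)
    ultimately have "M x \<le> M b" using x by (intro DERIV_nonneg_imp_nondecreasing[of x b M]) (meson less_le_trans)+
    also have "M b = 0" using \<open>p' b = 0\<close> pX[of b] by (simp add: M_def b_def)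
    finally have "(p x)^2 + (p' x)^2 \<le> 0" by (simp add: M_def mult_le_0_iff)
    then show ?thesis by (simp add: sum_power2_le_zero_iff)
  qed (rule pX)
qed

text \<open>At energy 0 the Wronskian \<open>c\<close> of p with x powr (1/2 - m) is constant, and
  its square is at most x times an integrable function, so it is 0. Then p is a multiple of x powr
  (1/2 - m), and the same estimate applied to the factor \<open>h\<close> finishes.\<close>

lemma no_zero_eigenvalue_real:
  assumes reg: "regular (m^2) (\<lambda>x. of_real (p x)) (\<lambda>x. of_real (p' x)) (\<lambda>x. of_real (0 * p x))"
    and m: "0 \<le> m" "m < 1" and x: "x > 0"
  shows "p x = 0"
proof -
  note d = real_eigenfunction_derivs[OF reg]
  have "(\<lambda>x. (p x)^2) absolutely_integrable_on {1..}"
    using absolutely_integrable_Ici_half_line[OF L2_integrable_sq[OF regularD(1)[OF reg]], of 1] by simp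
  moreover have "(\<lambda>x. (p' x)^2) absolutely_integrable_on {1..}" using regular_deriv_square_integrable[OF reg] by simp
  ultimately have Si: "(\<lambda>x. 2 * ((p' x)^2 + (p x)^2)) absolutely_integrable_on {1..}" by (intro set_integrable_mult_right set_integral_add(1)) auto
  have const: "h x = h 1" if "\<And>x. x > 0 \<Longrightarrow> (h has_real_derivative 0) (at x)" "x > 0" for h :: "real \<Rightarrow> real" and x
    using has_field_derivative_zero_constant[of "{0<..}" h] that has_field_derivative_at_within by (metis convex_real_interval(3) greaterThan_iff zero_less_one)
  define c where "c x = x powr (1/2 - m) * p' x - (1/2 - m) * x powr (- (1/2) - m) * p x" for x
  have e: "x powr (- (1/2) - m) = x powr (1/2 - m) / x" "x powr (- (3/2) - m) = x powr (1/2 - m) / x^2" if "x > 0" for x :: real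
  proof -
    have "- (1/2) - m = (1/2 - m) - 1" "- (3/2) - m = (1/2 - m) - 2" by simp_all
    then show "x powr (- (1/2) - m) = x powr (1/2 - m) / x" "x powr (- (3/2) - m) = x powr (1/2 - m) / x^2"
      using that by (simp_all only: powr_diff) simp_all
  qed
  have e': "x powr ((- 3 - m * 2) / 2) = x powr ((1 - m * 2) / 2) / x^2" if "x > 0" for x :: real using e(2)[OF that] by (simp add: diff_divide_distrib)
  have "(c has_real_derivative 0) (at x)" if "x > 0" for x unfolding c_def[abs_def] using that
    by (auto intro!: derivative_eq_intros d simp: e[OF that] e'[OF that] power2_eq_square field_simps)
  then have c: "c x = c 1" if "x > 0" for x using const that by blast
  have cf: "c x = x powr (1/2 - m) * (p' x - (1/2 - m) * p x / x)" if "x > 0" for x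
    using that unfolding c_def by (subst e(1)) (simp_all add: algebra_simps diff_divide_distrib)
  have "(c 1)^2 \<le> x * (2 * ((p' x)^2 + (p x)^2))" if "x \<ge> 1" for x
  proof -
    have "\<bar>c x\<bar> = x powr (1/2 - m) * \<bar>p' x - (1/2 - m) * p x / x\<bar>" using cf[of x] that by (simp add: abs_mult)
    also have "\<dots> \<le> x powr (1/2) * (\<bar>p' x\<bar> + \<bar>p x\<bar>)"
    proof (rule mult_mono)
      show "x powr (1/2 - m) \<le> x powr (1/2)" using that m by (intro powr_mono) auto
      have "\<bar>1/2 - m\<bar> * \<bar>p x\<bar> \<le> x * \<bar>p x\<bar>" using that m by (intro mult_right_mono) auto
      then have "\<bar>(1/2 - m) * p x / x\<bar> \<le> \<bar>p x\<bar>" using that by (simp add: abs_mult divide_le_eq mult.commute)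
      then show "\<bar>p' x - (1/2 - m) * p x / x\<bar> \<le> \<bar>p' x\<bar> + \<bar>p x\<bar>" by linarith
    qed auto
    finally have "(c x)^2 \<le> (x powr (1/2) * (\<bar>p' x\<bar> + \<bar>p x\<bar>))^2" by (simp add: abs_le_square_iff[symmetric])
    also have "\<dots> = x * (\<bar>p' x\<bar> + \<bar>p x\<bar>)^2" using that by (simp add: power_mult_distrib powr_half_sqrt)
    also have "\<dots> \<le> x * (2 * ((p' x)^2 + (p x)^2))"
      using that sum_squares_bound[of "\<bar>p' x\<bar>" "\<bar>p x\<bar>"] by (intro mult_left_mono) (auto simp: power2_sum)
    finally show ?thesis using c[of x] that by simp
  qed
  then have c1: "c 1 = 0" using integrable_small_weighted_value_at_top[OF Si, of "(c 1)^2" 1] by (force simp: not_less)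
  define h where "h x = x powr (m - 1/2) * p x" for x
  have "(h has_real_derivative 0) (at x)" if "x > 0" for x
  proof -
    have p': "p' x = (1/2 - m) * p x / x" using c[OF that] c1 cf[OF that] that by simp
    have "x powr (m - 1/2 - 1) = x powr (m - 1/2) / x" using that by (simp only: powr_diff) simp
    then show ?thesis unfolding h_def[abs_def] using that p' by (auto intro!: derivative_eq_intros d simp: algebra_simps simp flip: add_divide_distrib)
  qed
  then have h: "h x = h 1" if "x > 0" for x using const that by blast
  have "(h 1)^2 \<le> x * (2 * ((p' x)^2 + (p x)^2))" if "x \<ge> 1" for x
  proof -
    have "\<bar>h x\<bar> \<le> x powr (1/2) * \<bar>p x\<bar>" unfolding h_def abs_mult using that m by (intro mult_mono) (auto intro!: powr_mono)
    then have "(h x)^2 \<le> (x powr (1/2) * \<bar>p x\<bar>)^2" by (simp add: abs_le_square_iff[symmetric] abs_mult)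
    also have "\<dots> = x * (p x)^2" using that by (simp add: power_mult_distrib powr_half_sqrt)
    also have "\<dots> \<le> x * (2 * ((p' x)^2 + (p x)^2))" using that by (intro mult_left_mono) auto
    finally show ?thesis using h[of x] that by simp
  qed
  then have "h 1 = 0" using integrable_small_weighted_value_at_top[OF Si, of "(h 1)^2" 1] by (force simp: not_less)
  with h[OF x] x show ?thesis by (simp add: h_def)
qed

lemma eigenvalue_negative:
  assumes H: "self_adjoint H" "H \<subseteq> max_op (m^2)" and m: "0 \<le> m" "m < 1" and z: "z \<in> eigenvalues H"
  shows "\<exists>\<tau>. z = energy \<tau>"
proof -
  obtain l where l: "z = of_real l" using eigenvalue_real[OF H(1) z] by (auto elim: Reals_cases)
  obtain f where f: "(f, \<lambda>x. z * f x) \<in> H" "\<not> (AE x in half_line. f x = 0)" using z by (auto simp: eigenvalues_def)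
  have "l < 0"
  proof (rule ccontr)
    assume "\<not> l < 0"
    have zero: "p x = 0" if "regular (m^2) (\<lambda>x. of_real (p x)) (\<lambda>x. of_real (p' x)) (\<lambda>x. of_real (l * p x))" "0 < x" for p p' x
    proof (cases "l = 0")
      case True
      with that m show ?thesis using no_zero_eigenvalue_real[of m p p' x] by simp
    next
      case False
      with that \<open>\<not> l < 0\<close> show ?thesis using no_positive_eigenvalue_real[of "m^2" p p' l x] by simp
    qed
    have "(f, \<lambda>x. z * f x) \<in> max_op (m^2)" using f H by auto
    then obtain F F' where F: "regular (m^2) F F' (\<lambda>x. z * f x)" "AE x in half_line. f x = F x" "f \<in> L2" by (rule max_opE)
    note FL = regularD(1)[OF F(1)]
    have rF: "regular (m^2) F F' (\<lambda>x. z * F x)" unfolding regular_def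
    proof (intro conjI allI impI)
      fix a b :: real assume ab: "0 < a" "a \<le> b"
      show "((\<lambda>x. potential (m^2) x * F x - z * F x) has_integral F' b - F' a) {a..b}"
        by (rule AE_half_line_has_integral[OF _ _ regularD(4)[OF F(1) ab]]) (use F(2) ab in \<open>auto elim: AE_mp\<close>)
    qed (use regularD[OF F(1)] L2_scale[OF FL] in auto)
    have "Re (F x) = 0" if "0 < x" for x using zero[OF _ that, of "\<lambda>x. Re (F x)" "\<lambda>x. Re (F' x)"] regular_Re[OF rF] by (simp add: l)
    moreover have "Im (F x) = 0" if "0 < x" for x
    proof -
      \<comment> \<open>The real part of - \<i> F is the imaginary part of F; since the eigenvalue
        is real, both parts solve the same real equation.\<close>
      have "regular (m^2) (\<lambda>x. - \<i> * F x) (\<lambda>x. - \<i> * F' x) (\<lambda>x. - \<i> * (z * F x))" by (rule regular_scale[OF rF])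
      from zero[OF _ that, of "\<lambda>x. Re (- \<i> * F x)" "\<lambda>x. Re (- \<i> * F' x)"] regular_Re[OF this]
      show ?thesis by (simp add: l)
    qed
    ultimately have F0: "F x = 0" if "0 < x" for x using that by (simp add: complex_eq_iff)
    have "AE x in half_line. f x = 0" using F(2) AE_half_line_pos by eventually_elim (use F0 in auto)
    with f(2) show False by simp
  qed
  then show ?thesis unfolding l by (intro exI[of _ "ln (- l) / 2"]) simp
qed

subsection \<open>The decaying solution at energy \<open>-1\<close>\<close>

text \<open>For \<open>c'' = \<alpha> c\<close>, integration by parts shows that \<open>\<integral>\<^sub>0\<^sup>\<infinity> exp (-x cosh t) c t dt\<close> satisfies the modified Bessel equation
  (it is the Macdonald function of order \<open>\<surd>\<alpha>\<close>).\<close>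

locale macdonald =
  fixes \<alpha> s C :: real and c c' :: "real \<Rightarrow> real"
  assumes s: "0 \<le> s" "s < 1" and C: "0 \<le> C"
    and dc: "\<And>t. (c has_real_derivative c' t) (at t)"
    and dc': "\<And>t. (c' has_real_derivative \<alpha> * c t) (at t)"
    and c_le: "\<And>t. 0 \<le> t \<Longrightarrow> \<bar>c t\<bar> \<le> exp (s * t)"
    and c'_le: "\<And>t. 0 \<le> t \<Longrightarrow> \<bar>c' t\<bar> \<le> C * exp (s * t)"
    and c0: "c 0 = 1" "c' 0 = 0"
begin

text \<open>Each derivative in x brings down a factor - cosh t, so \<open>Y k\<close> is (-1)^k
  times the k-th derivative of \<open>Y 0\<close>.\<close>

definition kern :: "nat \<Rightarrow> real \<Rightarrow> real \<Rightarrow> real" where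
  "kern k x t = cosh t ^ k * exp (- x * cosh t) * c t"

definition Y :: "nat \<Rightarrow> real \<Rightarrow> real" where
  "Y k x = integral {0..} (kern k x)"

text \<open>With n = k + 1, the n-th power of x cosh t / n is at most exp (x cosh t). This leaves
  one spare factor 1 / cosh t, at most 2 exp (- t), for the decay in t.\<close>

definition A :: "nat \<Rightarrow> real \<Rightarrow> real" where
  "A k x = 2 * (real (Suc k) / x) ^ Suc k"

lemma weight_le:
  assumes "0 < x" "0 \<le> t"
  shows "cosh t ^ k * exp (- x * cosh t) \<le> A k x * exp (- t)"
proof -
  let ?n = "Suc k"
  have u: "cosh t > 0" by (rule cosh_real_pos)
  have "(x * cosh t / real ?n) ^ ?n \<le> (1 + x * cosh t / real ?n) ^ ?n" using assms u by (intro power_mono) auto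
  also have "\<dots> \<le> exp (x * cosh t)"
    using assms(1) u by (intro exp_ge_one_plus_x_over_n_power_n) (auto intro!: order_trans[OF _ mult_nonneg_nonneg])
  finally have le: "(x / real ?n) ^ ?n * (cosh t ^ k * cosh t) \<le> exp (x * cosh t)" by (simp add: power_divide power_mult_distrib mult_ac)
  have "exp t \<le> 2 * cosh t" by (simp add: cosh_def)
  then have "(x / real ?n) ^ ?n * (cosh t ^ k * exp t) \<le> (x / real ?n) ^ ?n * (cosh t ^ k * (2 * cosh t))" using assms u by (intro mult_left_mono) auto
  with le have "(x / real ?n) ^ ?n * (cosh t ^ k * exp t) \<le> 2 * exp (x * cosh t)" by linarith
  then show ?thesis using assms by (simp add: A_def exp_minus field_simps power_divide del: of_nat_Suc power_Suc)
qed

lemma exp_s: "exp (- t) * exp (s * t) = exp (- (1 - s) * t)" by (simp add: exp_add[symmetric] algebra_simps)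

lemma kern_le:
  assumes "0 < x" "0 \<le> t"
  shows "\<bar>kern k x t\<bar> \<le> A k x * exp (- (1 - s) * t)"
proof -
  have "\<bar>kern k x t\<bar> = (cosh t ^ k * exp (- x * cosh t)) * \<bar>c t\<bar>" by (simp add: kern_def abs_mult)
  also have "\<dots> \<le> (A k x * exp (- t)) * exp (s * t)" using assms by (intro mult_mono weight_le c_le) (auto simp: A_def)
  finally show ?thesis by (simp add: exp_s mult.assoc)
qed

lemma c_continuous: "continuous_on X c" using dc by (intro DERIV_continuous_on) (auto intro: has_field_derivative_at_within)

lemma exp_integrable: "(0::real) < a \<Longrightarrow> (\<lambda>t. B * exp (- a * t) :: real) integrable_on {0..}"
  by (intro integrable_on_mult_right integrable_on_exp_minus_to_infinity)

lemma kern_integrable: "0 < x \<Longrightarrow> kern k x absolutely_integrable_on {0..}"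
  by (rule measurable_bounded_by_integrable_imp_absolutely_integrable[OF _ _ exp_integrable[of "1 - s" "A k x"]])
    (use s kern_le in \<open>auto simp: kern_def[abs_def] intro!: continuous_imp_measurable_on_sets_lebesgue continuous_intros c_continuous\<close>)

lemma kern_abs_integrable: "0 < x \<Longrightarrow> (\<lambda>t. \<bar>kern k x t\<bar>) integrable_on {0..}"
  using kern_integrable[of x k] by (simp add: absolutely_integrable_on_def)

lemma kern_hk: "0 < x \<Longrightarrow> kern k x integrable_on {0..}" using kern_integrable set_lebesgue_integral_eq_integral(1) by blast

lemma exp_quadratic: "\<bar>exp v - 1 - v\<bar> \<le> v^2 * exp \<bar>v\<bar>" for v :: real
proof -
  obtain t where t: "\<bar>t\<bar> \<le> \<bar>v\<bar>" "exp v = (\<Sum>m<2. v ^ m / fact m) + exp t / fact 2 * v ^ 2"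
    using Maclaurin_exp_le[of v 2] by blast
  then have eq: "exp v - 1 - v = exp t / 2 * v^2" by (simp add: numeral_2_eq_2)
  have "0 \<le> exp v - 1 - v" unfolding eq by simp
  moreover have "exp t / 2 * v^2 \<le> exp \<bar>v\<bar> * v^2" 
  proof (rule mult_right_mono)
    have "exp t \<le> exp \<bar>v\<bar>" using t(1) by simp
    then show "exp t / 2 \<le> exp \<bar>v\<bar>" using exp_gt_zero[of t] by linarith
  qed simp
  ultimately show ?thesis unfolding eq by (simp only: abs_of_nonneg mult.commute)
qed

text \<open>The second-order remainder of exp (- h cosh t) is bounded, for |h| < x / 2, by h^2 times
  the kernel of order k + 2 at x / 2, whose integral does not depend on h.\<close>

lemma Y_deriv:
  assumes x: "0 < x"
  shows "(Y k has_real_derivative - Y (Suc k) x) (at x)"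
proof -
  define D where "D = integral {0..} (\<lambda>t. \<bar>kern (k + 2) (x/2) t\<bar>)"
  have le: "\<bar>Y k (x + h) - Y k x + h * Y (Suc k) x\<bar> \<le> D * h^2" if h: "\<bar>h\<bar> < x/2" for h :: real
  proof -
    have xh: "0 < x + h" using h by linarith
    have i: "((\<lambda>t. kern k (x + h) t - kern k x t + h * kern (Suc k) x t) has_integral Y k (x + h) - Y k x + h * Y (Suc k) x) {0..}"
      unfolding Y_def by (intro has_integral_add has_integral_diff has_integral_mult_right integrable_integral kern_hk x xh)
    have "\<bar>Y k (x + h) - Y k x + h * Y (Suc k) x\<bar> = norm (integral {0..} (\<lambda>t. kern k (x + h) t - kern k x t + h * kern (Suc k) x t))"
      using integral_unique[OF i] by simp
    also have "\<dots> \<le> integral {0..} (\<lambda>t. h^2 * \<bar>kern (k + 2) (x/2) t\<bar>)"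
    proof (rule Henstock_Kurzweil_Integration.integral_norm_bound_integral[OF has_integral_integrable[OF i]])
      show "(\<lambda>t. h^2 * \<bar>kern (k + 2) (x/2) t\<bar>) integrable_on {0..}" using x by (intro integrable_on_mult_right kern_abs_integrable) auto
      fix t :: real
      let ?u = "cosh t"
      have u: "?u > 0" by (rule cosh_real_pos)
      have "kern k (x + h) t - kern k x t + h * kern (Suc k) x t = ?u ^ k * exp (- x * ?u) * c t * (exp (- h * ?u) - 1 - (- h * ?u))"
        by (simp add: kern_def algebra_simps exp_diff exp_minus exp_add field_simps)
      also have "\<bar>\<dots>\<bar> = ?u ^ k * exp (- x * ?u) * \<bar>c t\<bar> * \<bar>exp (- h * ?u) - 1 - (- h * ?u)\<bar>"
        using u by (simp add: abs_mult)
      also have "\<dots> \<le> ?u ^ k * exp (- x * ?u) * \<bar>c t\<bar> * ((- h * ?u)^2 * exp \<bar>- h * ?u\<bar>)"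
        using u by (intro mult_left_mono exp_quadratic) auto
      also have "\<dots> \<le> ?u ^ k * exp (- x * ?u) * \<bar>c t\<bar> * ((- h * ?u)^2 * exp (x / 2 * ?u))"
        using u h by (intro mult_left_mono) (auto simp: abs_mult)
      also have "\<dots> = h^2 * (?u ^ (k + 2) * exp (- (x/2) * ?u) * \<bar>c t\<bar>)"
      proof -
        have "exp (- x * ?u) * exp (x / 2 * ?u) = exp (- (x/2) * ?u)" by (simp add: exp_add[symmetric] algebra_simps)
        then show ?thesis by (simp add: power_mult_distrib power2_eq_square mult_ac)
      qed
      finally show "norm (kern k (x + h) t - kern k x t + h * kern (Suc k) x t) \<le> h^2 * \<bar>kern (k + 2) (x/2) t\<bar>"
        using u by (simp add: kern_def abs_mult)
    qed
    finally show ?thesis by (simp add: D_def mult.commute)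
  qed
  have D0: "D * h^2 \<le> \<bar>D\<bar> * \<bar>h\<bar> * \<bar>h\<bar>" for h by (simp add: power2_eq_square mult.assoc abs_mult mult_right_mono)
  show ?thesis unfolding DERIV_def
  proof (rule LIM_zero_cancel, rule tendsto_rabs_zero_cancel, rule tendsto_sandwich[OF _ _ tendsto_const])
    show "((\<lambda>h. \<bar>D\<bar> * \<bar>h\<bar>) \<longlongrightarrow> 0) (at 0)" by (auto intro!: tendsto_eq_intros)
    show "\<forall>\<^sub>F h in at 0. \<bar>(Y k (x + h) - Y k x) / h - - Y (Suc k) x\<bar> \<le> \<bar>D\<bar> * \<bar>h\<bar>" unfolding eventually_at
    proof (intro exI[of _ "x/2"] conjI ballI impI)
      fix h :: real assume h: "h \<noteq> 0 \<and> dist h 0 < x/2"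
      have "\<bar>(Y k (x + h) - Y k x) / h - - Y (Suc k) x\<bar> = \<bar>Y k (x + h) - Y k x + h * Y (Suc k) x\<bar> / \<bar>h\<bar>"
        using h by (simp add: field_simps abs_divide[symmetric] del: abs_divide)
      also have "\<dots> \<le> (\<bar>D\<bar> * \<bar>h\<bar> * \<bar>h\<bar>) / \<bar>h\<bar>"
        using le[of h] D0[of h] h by (intro divide_right_mono) (auto simp: dist_real_def)
      finally show "\<bar>(Y k (x + h) - Y k x) / h - - Y (Suc k) x\<bar> \<le> \<bar>D\<bar> * \<bar>h\<bar>" using h by simp
    qed (use x in auto)
  qed auto
qed

lemma bessel_equation:
  assumes x: "0 < x"
  shows "x^2 * Y 2 x - x * Y 1 x - x^2 * Y 0 x = \<alpha> * Y 0 x"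
proof -
  \<comment> \<open>An explicit antiderivative of the integrand of the Bessel equation. It vanishes
    at 0 because sinh and c' do, and at infinity by the growth bounds on c and c'.\<close>
  define \<Phi> where "\<Phi> t = - (x * sinh t * c t + c' t) * exp (- x * cosh t)" for t
  define h where "h t = x^2 * kern 2 x t - x * kern 1 x t - x^2 * kern 0 x t - \<alpha> * kern 0 x t" for t
  have d: "(\<Phi> has_real_derivative h t) (at t)" for t unfolding \<Phi>_def[abs_def] h_def kern_def
    by (auto intro!: derivative_eq_intros dc dc' simp: cosh_square_eq power2_eq_square algebra_simps simp flip: power2_eq_square)
  have ai: "h absolutely_integrable_on {0..}"
    unfolding h_def[abs_def] using kern_integrable[OF x] by (intro set_integral_diff(1) set_integrable_mult_right) auto
  have "integral {0..} h = 0"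
  proof (rule tendsto_unique[OF _ integral_Icc_tendsto_at_top[OF ai]])
    define E where "E = x * A 1 x + C * A 0 x"
    have \<Phi>_le: "\<bar>\<Phi> t\<bar> \<le> E * exp (- (1 - s) * t)" if t: "0 \<le> t" for t
    proof -
      have "\<bar>\<Phi> t\<bar> \<le> (x * cosh t * exp (s * t) + C * exp (s * t)) * exp (- x * cosh t)"
        unfolding \<Phi>_def abs_mult abs_exp_cancel abs_minus_cancel
      proof (intro mult_right_mono order_trans[OF abs_triangle_ineq] add_mono c'_le t)
        have "\<bar>sinh t\<bar> \<le> cosh t" using t sinh_less_cosh_real[of t] by simp
        then show "\<bar>x * sinh t * c t\<bar> \<le> x * cosh t * exp (s * t)" unfolding abs_mult using x t by (intro mult_mono c_le) auto
      qed auto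
      also have "\<dots> = exp (s * t) * (x * (cosh t ^ 1 * exp (- x * cosh t)) + C * (cosh t ^ 0 * exp (- x * cosh t)))" by (simp add: algebra_simps)
      also have "\<dots> \<le> exp (s * t) * (x * (A 1 x * exp (- t)) + C * (A 0 x * exp (- t)))"
        using x t C by (intro mult_left_mono add_mono weight_le) auto
      also have "\<dots> = E * exp (- (1 - s) * t)" unfolding exp_s[symmetric] E_def by (simp add: algebra_simps)
      finally show ?thesis .
    qed
    have "\<Phi> 0 = 0" by (simp add: \<Phi>_def c0)
    then have "integral {0..t} h = \<Phi> t" if "0 \<le> t" for t using integral_unique[OF fundamental_theorem_of_calculus[OF that, of \<Phi> h]] d
      by (simp add: has_real_derivative_iff_has_vector_derivative has_vector_derivative_at_within)
    then have "\<forall>\<^sub>F t in at_top. \<bar>integral {0..t} h\<bar> \<le> E * exp (- (1 - s) * t)"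
      using \<Phi>_le by (intro eventually_mono[OF eventually_ge_at_top[of 0]]) metis
    moreover have "((\<lambda>t. E * exp (- (1 - s) * t)) \<longlongrightarrow> 0) at_top" using s by real_asymp
    ultimately show "((\<lambda>t. integral {0..t} h) \<longlongrightarrow> 0) at_top"
      by (rule tendsto_rabs_zero_cancel[OF tendsto_sandwich[OF always_eventually _ tendsto_const], rotated]) simp
  qed auto
  moreover have "integral {0..} h = x^2 * Y 2 x - x * Y 1 x - x^2 * Y 0 x - \<alpha> * Y 0 x" unfolding h_def[abs_def] Y_def
    by (intro integral_unique has_integral_diff has_integral_mult_right integrable_integral kern_hk x)
  ultimately show ?thesis by simp
qed

text \<open>The factor sqrt x removes the first-order term of the modified Bessel equation and
  leaves L psi = - psi.\<close>

definition psi :: "real \<Rightarrow> real" where "psi x = sqrt x * Y 0 x"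

definition psi' :: "real \<Rightarrow> real" where "psi' x = Y 0 x / (2 * sqrt x) - sqrt x * Y 1 x"

lemma psi_deriv: "0 < x \<Longrightarrow> (psi has_real_derivative psi' x) (at x)" unfolding psi_def[abs_def] psi'_def
  by (auto intro!: derivative_eq_intros Y_deriv simp: field_simps)

lemma psi'_deriv:
  assumes x: "0 < x"
  shows "(psi' has_real_derivative ((- 1/4 + \<alpha>) * (1 / x^2) + 1) * psi x) (at x)"
proof -
  \<comment> \<open>Substituting a square for x turns the identity with sqrt x into a rational
    one.\<close>
  obtain r where r: "x = r * r" "0 < r" using x by (intro that[of "sqrt x"]) auto
  have Y2: "Y (Suc (Suc 0)) (r * r) = (r^2 * Y (Suc 0) (r * r) + (r^4 + \<alpha>) * Y 0 (r * r)) / r^4"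
    using bessel_equation[OF x] r(2) by (simp add: numeral_eq_Suc r(1) field_simps)
  show ?thesis unfolding psi'_def[abs_def] psi_def r(1) using r(2)
    by (auto intro!: derivative_eq_intros Y_deriv simp: Y2 field_simps power2_eq_square power4_eq_xxxx)
qed

text \<open>Averaging cosh t >= 1 and cosh t >= exp t / 2 gives x cosh t >= x / 2 + v with v = x exp
  t / 4, and exp (- v) is at most v powr - r. Any r between s and 1 gives decay in t; for r = (1 +
  s) / 2 the power left in psi^2 is x powr - s, integrable at 0.\<close>

lemma psi_sq_le:
  shows "\<exists>B. \<forall>x\<ge>0. (psi x)^2 \<le> B * (x powr (- s) / exp x)"
proof -
  define r where "r = (1 + s) / 2"
  have r: "0 < r" "r \<le> 1" "r - s > 0" using s by (auto simp: r_def)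
  define D where "D = integral {0..} (\<lambda>t. exp (- (r - s) * t))"
  have "(psi x)^2 \<le> (4 * D)^2 * (x powr (- s) / exp x)" if "0 \<le> x" for x
  proof (cases "x = 0")
    case False
    with that have x: "0 < x" by simp
    define E where "E = 4 * exp (- x / 2) * x powr (- r)"
    have w: "exp (- x * cosh t) \<le> E * exp (- r * t)" if t: "0 \<le> t" for t
    proof -
      define v where "v = x * exp t / 4"
      have v: "0 < v" using x by (simp add: v_def)
      have "r * ln v \<le> v"
      proof (cases "0 \<le> ln v")
        case True
        then show ?thesis using mult_right_mono[OF r(2) True] ln_le_minus_one[OF v] by linarith
      next
        case False
        then show ?thesis using mult_nonneg_nonpos[of r "ln v"] r v by linarith
      qed
      moreover have "- r * ln v \<le> - r * ln x - r * t + ln 4"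
      proof -
        have "r * ln 4 \<le> ln 4" using r mult_right_mono[of r 1 "ln 4"] by simp
        then show ?thesis using x by (simp add: v_def ln_mult ln_div algebra_simps)
      qed
      moreover have "x / 2 + v \<le> x * cosh t"
      proof -
        have "x * 1 \<le> x * cosh t" using x by (intro mult_left_mono cosh_real_ge_1) auto
        moreover have "x * exp t \<le> x * (2 * cosh t)" using x by (intro mult_left_mono) (auto simp: cosh_def)
        ultimately show ?thesis unfolding v_def by linarith
      qed
      ultimately have "- x * cosh t \<le> ln 4 + - x / 2 + - r * ln x + - r * t" by linarith
      then have "exp (- x * cosh t) \<le> exp (ln 4 + - x / 2 + - r * ln x + - r * t)" by simp
      also have "\<dots> = E * exp (- r * t)" unfolding exp_add E_def using x by (simp add: powr_def)
      finally show ?thesis .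
    qed
    have "\<bar>Y 0 x\<bar> \<le> integral {0..} (\<lambda>t. E * exp (- (r - s) * t))" unfolding Y_def real_norm_def[symmetric]
    proof (rule Henstock_Kurzweil_Integration.integral_norm_bound_integral[OF kern_hk[OF x] exp_integrable[OF r(3)]])
      fix t :: real assume "t \<in> {0..}"
      then have "\<bar>kern 0 x t\<bar> \<le> (E * exp (- r * t)) * exp (s * t)" using mult_mono[OF w c_le, of t t] by (simp add: kern_def abs_mult E_def)
      then show "norm (kern 0 x t) \<le> E * exp (- (r - s) * t)" by (simp add: exp_add[symmetric] mult.assoc algebra_simps)
    qed
    also have "\<dots> = E * D" by (simp add: D_def)
    finally have "(Y 0 x)^2 \<le> (E * D)^2" by (simp add: abs_le_square_iff[symmetric])
    then have "(psi x)^2 \<le> x * (E * D)^2" using x by (simp add: psi_def power_mult_distrib mult_left_mono)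
    also have "\<dots> = (4 * D)^2 * (x * (x powr (- r))^2 * (exp (- x / 2))^2)" by (simp add: E_def power_mult_distrib mult_ac)
    also have "x * (x powr (- r))^2 = x powr (- s)"
    proof -
      have "x * (x powr (- r))^2 = x powr 1 * (x powr (- r) * x powr (- r))" using x by (simp add: power2_eq_square)
      also have "\<dots> = x powr (1 + (- r + - r))" by (simp only: powr_add)
      finally show ?thesis by (simp add: r_def field_simps)
    qed
    also have "(exp (- x / 2))^2 = inverse (exp x)" by (simp add: exp_minus[symmetric] power2_eq_square mult_exp_exp)
    finally show ?thesis by (simp add: divide_inverse)
  qed (simp add: psi_def)
  then show ?thesis by blast
qed

lemma psi_L2: "(\<lambda>x. complex_of_real (psi x)) \<in> L2"
proof -
  have cont: "continuous_on {0<..} (\<lambda>x. complex_of_real (psi x))"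
    using psi_deriv by (intro continuous_on_of_real DERIV_continuous_on[of "{0<..}" psi psi']) (auto intro: has_field_derivative_at_within)
  obtain B where B: "\<And>x. 0 \<le> x \<Longrightarrow> (psi x)^2 \<le> B * (x powr (- s) / exp x)" using psi_sq_le by blast
  have m: "(\<lambda>x. complex_of_real (psi x)) \<in> borel_measurable half_line" by (rule continuous_on_pos_measurable[OF cont])
  have "(\<lambda>x. (cmod (complex_of_real (psi x)))^2) absolutely_integrable_on {0..}"
  proof (rule measurable_bounded_by_integrable_imp_absolutely_integrable)
    show "(\<lambda>x. B * (x powr (- s) / exp x)) integrable_on {0..}"
      using Gamma_integral_real[of "1 - s"] s by (intro integrable_on_mult_right) (auto simp: integrable_on_def)
    show "(\<lambda>x. (cmod (complex_of_real (psi x)))^2) \<in> borel_measurable half_line"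
      by (rule borel_measurable_power[OF measurable_compose[OF m borel_measurable_norm]])
  qed (use B in auto)
  with m show ?thesis unfolding L2_def half_line_integrable_iff by simp
qed

lemma psi_regular: "regular \<alpha> (\<lambda>x. of_real (psi x)) (\<lambda>x. of_real (psi' x)) (\<lambda>x. - of_real (psi x))" unfolding regular_def
proof (intro conjI allI impI)
  show "(\<lambda>x. - complex_of_real (psi x)) \<in> L2" using L2_scale[OF psi_L2, of "-1"] by simp
  show "((\<lambda>x. complex_of_real (psi x)) has_vector_derivative of_real (psi' x)) (at x)" if "0 < x" for x
    by (rule has_vector_derivative_of_real[OF psi_deriv[OF that]])
  fix a b :: real assume ab: "0 < a" "a \<le> b"
  have d: "((\<lambda>x. complex_of_real (psi' x)) has_vector_derivative potential \<alpha> x * of_real (psi x) - - of_real (psi x)) (at x)" if "0 < x" for x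
  proof -
    have "potential \<alpha> x * of_real (psi x) - - of_real (psi x) = of_real (((- 1/4 + \<alpha>) * (1 / x^2) + 1) * psi x)"
      by (simp add: potential_def distrib_right)
    with has_vector_derivative_of_real[OF psi'_deriv[OF that]] show ?thesis by (simp only:)
  qed
  show "((\<lambda>x. potential \<alpha> x * of_real (psi x) - - of_real (psi x)) has_integral of_real (psi' b) - complex_of_real (psi' a)) {a..b}"
  proof (rule fundamental_theorem_of_calculus[OF ab(2)], rule has_vector_derivative_at_within, rule d)
    fix x assume "x \<in> {a..b}"
    with ab show "0 < x" by simp
  qed
qed (rule psi_L2)

text \<open>Laplace's method: for large x the part of the integral over [0, e/2], where c >= 1/2, is
  at least (e/4) exp (- x cosh (e/2)), while the part beyond e is of order exp (- x cosh e). So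
  \<open>Y 0\<close> cannot vanish identically.\<close>

lemma psi_nonzero: "\<not> (AE x in half_line. complex_of_real (psi x) = 0)"
proof
  assume z: "AE x in half_line. complex_of_real (psi x) = 0"
  have Y0: "Y 0 x = 0" if "0 < x" for x using primitive_eq_zero[OF regular_continuous[OF psi_regular] z that] that by (simp add: psi_def)
  have "isCont c 0" using dc by (rule DERIV_isCont)
  then have "\<forall>\<^sub>F t in at 0. c t > 1/2" unfolding isCont_def using c0 by (intro order_tendstoD(1)[of c "c 0"]) auto
  then obtain d where d: "d > 0" and c_gt: "\<And>t. t \<noteq> 0 \<Longrightarrow> \<bar>t\<bar> < d \<Longrightarrow> c t > 1/2"
    unfolding eventually_at by (auto simp: dist_real_def)
  define e where "e = d / 2"
  have e: "e > 0" using d by (simp add: e_def)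
  have c_ge: "c t \<ge> 1/2" if "0 \<le> t" "t \<le> e" for t using c_gt[of t] c0 that d by (cases "t = 0") (auto simp: e_def)
  define B where "B = integral {0..} (\<lambda>t. \<bar>kern 0 1 t\<bar>)"
  have le: "e / 4 \<le> B * exp (cosh e) * exp (- x * (cosh e - cosh (e/2)))" if x: "1 \<le> x" for x
  proof -
    \<comment> \<open>On [0, e/2] the kernel is at least its value at the right end with c replaced
      by 1/2.\<close>
    have ind: "((\<lambda>t. if t \<in> {0..e/2} then exp (- x * cosh (e/2)) / 2 else 0) has_integral e/2 * (exp (- x * cosh (e/2)) / 2)) {0..}"
      using has_integral_const_real[of "exp (- x * cosh (e/2)) / 2" 0 "e/2"] e by (subst has_integral_restrict) (auto simp: mult.commute)
    have "((\<lambda>t. exp (- (x - 1) * cosh e) * \<bar>kern 0 1 t\<bar>) has_integral exp (- (x - 1) * cosh e) * B) {0..}"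
      unfolding B_def by (intro has_integral_mult_right integrable_integral kern_abs_integrable) simp
    from has_integral_diff[OF ind this]
    have "e/2 * (exp (- x * cosh (e/2)) / 2) - exp (- (x - 1) * cosh e) * B \<le> Y 0 x"
    proof (rule has_integral_le)
      show "(kern 0 x has_integral Y 0 x) {0..}" unfolding Y_def using x by (intro integrable_integral kern_hk) simp
      fix t :: real assume "t \<in> {0..}"
      then have t: "0 \<le> t" by simp
      show "(if t \<in> {0..e/2} then exp (- x * cosh (e/2)) / 2 else 0) - exp (- (x - 1) * cosh e) * \<bar>kern 0 1 t\<bar> \<le> kern 0 x t"
      proof (cases "t \<le> e")
        case True
        have c: "1/2 \<le> c t" by (rule c_ge[OF t True])
        have "(if t \<in> {0..e/2} then exp (- x * cosh (e/2)) / 2 else 0) \<le> kern 0 x t"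
        proof (cases "t \<le> e/2")
          case True
          then have "cosh t \<le> cosh (e/2)" using t e by (simp add: cosh_real_nonneg_le_iff)
          then have "exp (- x * cosh (e/2)) * (1/2) \<le> exp (- x * cosh t) * c t" using x c by (intro mult_mono) auto
          then show ?thesis using True t by (simp add: kern_def)
        qed (use c in \<open>simp add: kern_def\<close>)
        moreover have "0 \<le> exp (- (x - 1) * cosh e) * \<bar>kern 0 1 t\<bar>" by simp
        ultimately show ?thesis by linarith
      next
        case False
        then have "cosh e \<le> cosh t" using e by (simp add: cosh_real_nonneg_le_iff)
        then have "(x - 1) * cosh e \<le> (x - 1) * cosh t" using x by (intro mult_left_mono) auto
        then have "exp (- (x - 1) * cosh t) \<le> exp (- (x - 1) * cosh e)" by (simp only: exp_le_cancel_iff mult_minus_left neg_le_iff_le)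
        then have "exp (- (x - 1) * cosh t) * \<bar>kern 0 1 t\<bar> \<le> exp (- (x - 1) * cosh e) * \<bar>kern 0 1 t\<bar>" by (intro mult_right_mono) auto
        moreover have "exp (- (x - 1) * cosh t) * \<bar>kern 0 1 t\<bar> = \<bar>kern 0 x t\<bar>"
          by (simp add: kern_def abs_mult exp_add[symmetric] algebra_simps flip: mult.assoc)
        ultimately show ?thesis using False e by auto
      qed
    qed
    then have "e / 4 * exp (- x * cosh (e/2)) \<le> B * exp (- (x - 1) * cosh e)" using Y0[of x] x by (simp add: mult.commute)
    then have "e / 4 * exp (- x * cosh (e/2)) * exp (x * cosh (e/2)) \<le> B * exp (- (x - 1) * cosh e) * exp (x * cosh (e/2))"
      by (intro mult_right_mono) auto
    also have "e / 4 * exp (- x * cosh (e/2)) * exp (x * cosh (e/2)) = e / 4" by (simp add: exp_minus)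
    also have "B * exp (- (x - 1) * cosh e) * exp (x * cosh (e/2)) = B * exp (cosh e) * exp (- x * (cosh e - cosh (e/2)))"
      by (simp add: exp_add[symmetric] mult.assoc algebra_simps)
    finally show ?thesis .
  qed
  define D k where "D = B * exp (cosh e)" "k = cosh e - cosh (e/2)"
  have "k > 0" using e by (simp add: D_k_def cosh_real_nonneg_less_iff)
  then have "((\<lambda>x. D * exp (- x * k)) \<longlongrightarrow> 0) at_top" by real_asymp
  from tendsto_lowerbound[OF this[unfolded D_k_def] eventually_mono[OF eventually_ge_at_top[of 1] le]] have "e / 4 \<le> 0" by simp
  with e show False by simp
qed

end

text \<open>For \<alpha> = m^2 the weight is cosh (m t), of growth rate m < 1; for \<alpha> = - m^2
  it is the bounded weight cos (m t).\<close>

lemma exists_negative_energy_solution: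
  assumes "\<alpha> < 1"
  shows "\<exists>p p'. regular \<alpha> (\<lambda>x. of_real (p x)) (\<lambda>x. of_real (p' x)) (\<lambda>x. - of_real (p x)) \<and>
    \<not> (AE x in half_line. complex_of_real (p x) = 0)"
proof (cases "0 \<le> \<alpha>")
  case True
  define m where "m = sqrt \<alpha>"
  have m: "0 \<le> m" "m < 1" "m * m = \<alpha>" using True assms by (simp_all add: m_def)
  interpret macdonald \<alpha> m m "\<lambda>t. cosh (m * t)" "\<lambda>t. m * sinh (m * t)"
  proof
    fix t :: real
    show "((\<lambda>t. cosh (m * t)) has_real_derivative m * sinh (m * t)) (at t)" by (auto intro!: derivative_eq_intros)
    show "((\<lambda>t. m * sinh (m * t)) has_real_derivative \<alpha> * cosh (m * t)) (at t)" by (auto intro!: derivative_eq_intros simp flip: m(3))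
    assume "0 \<le> t"
    then have 1: "0 \<le> sinh (m * t)" using m by (simp add: sinh_real_nonneg_iff)
    have "cosh (m * t) + sinh (m * t) = exp (m * t)" by (rule cosh_plus_sinh)
    moreover have "cosh (m * t) > 0" by (rule cosh_real_pos)
    ultimately have "cosh (m * t) \<le> exp (m * t)" "sinh (m * t) \<le> exp (m * t)" using 1 by linarith+
    then show "\<bar>cosh (m * t)\<bar> \<le> exp (m * t)" "\<bar>m * sinh (m * t)\<bar> \<le> m * exp (m * t)"
      using 1 m(1) by (auto simp: abs_mult intro!: mult_left_mono)
  qed (use m in auto)
  show ?thesis using psi_regular psi_nonzero by blast
next
  case False
  define m where "m = sqrt (- \<alpha>)"
  have m: "0 \<le> m" "- (m * m) = \<alpha>" using False by (simp_all add: m_def)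
  interpret macdonald \<alpha> 0 m "\<lambda>t. cos (m * t)" "\<lambda>t. - m * sin (m * t)"
  proof
    fix t :: real
    show "((\<lambda>t. cos (m * t)) has_real_derivative - m * sin (m * t)) (at t)" by (auto intro!: derivative_eq_intros)
    show "((\<lambda>t. - m * sin (m * t)) has_real_derivative \<alpha> * cos (m * t)) (at t)" by (auto intro!: derivative_eq_intros simp flip: m(2))
    show "\<bar>- m * sin (m * t)\<bar> \<le> m * exp (0 * t)" using m mult_left_mono[OF abs_sin_le_one m(1)] by (simp add: abs_mult)
  qed (use m in auto)
  show ?thesis using psi_regular psi_nonzero by blast
qed

subsection \<open>Factorization of the Bessel operator\<close>

text \<open>\<open>L\<^bsub>s^2\<^esub> = A\<^sup>* A\<close> with \<open>A f = f' - (1/2 + s) f / x = u (f / u)'\<close> for the solution \<open>u = x powr (1/2 + s)\<close> of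
  \<open>L u = 0\<close>; \<open>u A f\<close> is the Wronskian of \<open>u\<close> and \<open>f\<close>.\<close>

definition hardy :: "real \<Rightarrow> cfun \<Rightarrow> cfun \<Rightarrow> real \<Rightarrow> complex" where
  "hardy s f f' x = f' x - of_real ((1/2 + s) / x) * f x"

lemma hardy_add: "hardy s (\<lambda>x. f x + h x) (\<lambda>x. f' x + h' x) = (\<lambda>x. hardy s f f' x + hardy s h h' x)"
  unfolding hardy_def by (rule ext) algebra

lemma hardy_diff: "hardy s (\<lambda>x. f x - h x) (\<lambda>x. f' x - h' x) = (\<lambda>x. hardy s f f' x - hardy s h h' x)"
  unfolding hardy_def by (rule ext) algebra

lemma hardy_scale: "hardy s (\<lambda>x. c * f x) (\<lambda>x. c * f' x) = (\<lambda>x. c * hardy s f f' x)" unfolding hardy_def by (rule ext) algebra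

lemma continuous_on_hardy:
  assumes "regular \<alpha> f f' g"
  shows "continuous_on {0<..} (hardy s f f')" unfolding hardy_def[abs_def]
  by (intro continuous_intros regular_continuous[OF assms] regular_deriv_continuous[OF assms]) auto

text \<open>Completing the square with q = (1/2 + s) / x: the Riccati identity q' + q^2 = (s^2 -
  1/4) / x^2 produces the potential, and the derivative of q |f|^2 becomes the boundary
  term.\<close>

lemma hardy_Icc:
  assumes reg: "regular (s^2) f f' g" and ab: "0 < a" "a \<le> b"
  shows "((\<lambda>x. of_real ((norm (hardy s f f' x))^2) - cnj (f x) * g x) has_integral
    cnj (f b) * hardy s f f' b - cnj (f a) * hardy s f f' a) {a..b}"
proof -
  note c = regular_cnj[OF reg]
  define P where "P x = of_real ((1/2 + s) / x) * (cnj (f x) * f x)" for x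
  define P' where "P' x = of_real ((1/2 + s) / x) * (cnj (f' x) * f x + cnj (f x) * f' x) - of_real ((1/2 + s) / x^2) * (cnj (f x) * f x)" for x
  have 1: "((\<lambda>x. cnj (f' x) * f' x + cnj (f x) * (potential (s^2) x * f x - g x)) has_integral cnj (f b) * f' b - cnj (f a) * f' a) {a..b}"
    by (rule regular_parts[OF regularD(3)[OF c] regular_deriv_continuous[OF c] reg ab])
  have 2: "(P' has_integral P b - P a) {a..b}"
  proof (rule fundamental_theorem_of_calculus[OF ab(2)], rule has_vector_derivative_at_within)
    fix x assume "x \<in> {a..b}"
    then have x: "0 < x" using ab by simp
    have "((\<lambda>x. (1/2 + s) / x) has_real_derivative - ((1/2 + s) / x^2)) (at x)"
      using x by (auto intro!: derivative_eq_intros simp: power2_eq_square divide_simps)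
    from has_vector_derivative_mult[OF has_vector_derivative_of_real[OF this]
        has_vector_derivative_mult[OF regularD(3)[OF c x] regularD(3)[OF reg x]]]
    show "(P has_vector_derivative P' x) (at x)" unfolding P_def[abs_def] P'_def by (simp add: algebra_simps)
  qed
  show ?thesis
  proof (rule has_integral_eq_rhs[OF has_integral_eq[OF _ has_integral_diff[OF 1 2]]])
    fix x assume "x \<in> {a..b}"
    then have x: "x \<noteq> 0" using ab by simp
    show "cnj (f' x) * f' x + cnj (f x) * (potential (s^2) x * f x - g x) - P' x = of_real ((norm (hardy s f f' x))^2) - cnj (f x) * g x"
      unfolding complex_norm_square hardy_def P'_def potential_def using x by (simp add: field_simps power2_eq_square)
  qed (simp add: hardy_def P_def algebra_simps)
qed

text \<open>The boundary term at infinity vanishes along a suitable sequence, since \<open>f\<close> and \<open>f'\<close> are square integrable there.\<close>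

lemma hardy_form:
  assumes reg: "regular (s^2) f f' g" and a: "\<And>n. 0 < a n" "a \<longlonglongrightarrow> 0"
    and l: "(\<lambda>n. cnj (f (a n)) * hardy s f f' (a n)) \<longlonglongrightarrow> l"
  shows "hardy s f f' \<in> L2" "L2_inner f g = of_real ((L2_norm (hardy s f f'))^2) + l"
proof -
  let ?h = "hardy s f f'"
  \<comment> \<open>For b >= 1 the boundary term is at most K times the sum of the squared norms of
    f and f', an integrable function; this yields the points b n where it is small.\<close>
  define K where "K = 1 + \<bar>1/2 + s\<bar>"
  have small: "\<exists>b. b \<ge> real n + 1 \<and> norm (cnj (f b) * ?h b) \<le> inverse (real (Suc n)) \<and> a n \<le> b" for n
  proof -
    have i: "(\<lambda>x. (norm (f x))^2) absolutely_integrable_on {1..}"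
      using absolutely_integrable_Ici_half_line[OF L2_integrable_sq[OF regularD(1)[OF reg]], of 1] by simp
    have "(\<lambda>x. K * ((norm (f x))^2 + (norm (f' x))^2)) absolutely_integrable_on {1..}"
      by (rule set_integrable_mult_right, rule set_integral_add(1)[OF i regular_deriv_square_integrable[OF reg]])
    from integrable_small_value_at_top[OF this, of "inverse (real (Suc n))" "max (real n + 1) (a n)"]
    obtain b where b: "b \<ge> real n + 1" "b \<ge> a n" and lt: "K * ((norm (f b))^2 + (norm (f' b))^2) < inverse (real (Suc n))" by auto
    have b1: "b \<ge> 1" using b(1) by linarith
    have "\<bar>(1/2 + s) / b\<bar> \<le> \<bar>1/2 + s\<bar>" using b1 divide_left_mono[of 1 b "\<bar>1/2 + s\<bar>"] by (simp add: abs_divide)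
    then have "norm (?h b) \<le> norm (f' b) + \<bar>1/2 + s\<bar> * norm (f b)"
      unfolding hardy_def by (intro order_trans[OF norm_triangle_ineq4] add_mono) (auto simp only: norm_mult norm_of_real norm_ge_zero intro!: mult_right_mono)
    then have "norm (cnj (f b) * ?h b) \<le> norm (f b) * (norm (f' b) + \<bar>1/2 + s\<bar> * norm (f b))"
      unfolding norm_mult complex_mod_cnj by (intro mult_left_mono) auto
    also have "\<dots> \<le> K * ((norm (f b))^2 + (norm (f' b))^2)"
    proof -
      have "norm (f b) * norm (f' b) \<le> (norm (f b))^2 + (norm (f' b))^2"
        using sum_squares_bound[of "norm (f b)" "norm (f' b)"] mult_nonneg_nonneg[OF norm_ge_zero norm_ge_zero, of "f b" "f' b"] by linarith
      moreover have "\<bar>1/2 + s\<bar> * (norm (f b))^2 \<le> \<bar>1/2 + s\<bar> * ((norm (f b))^2 + (norm (f' b))^2)" by (intro mult_left_mono) auto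
      moreover have eq: "norm (f b) * (norm (f' b) + \<bar>1/2 + s\<bar> * norm (f b)) = norm (f b) * norm (f' b) + \<bar>1/2 + s\<bar> * (norm (f b))^2"
        by (simp add: algebra_simps power2_eq_square)
      ultimately show ?thesis unfolding K_def distrib_right[of 1] mult_1 eq by (intro add_mono)
    qed
    finally show ?thesis using b lt by (intro exI[of _ b]) auto
  qed
  then obtain b where b: "\<And>n. b n \<ge> real n + 1" "\<And>n. norm (cnj (f (b n)) * ?h (b n)) \<le> inverse (real (Suc n))" "\<And>n. a n \<le> b n"
    by metis
  have b_top: "filterlim b at_top sequentially"
    by (rule filterlim_at_top_mono[OF filterlim_real_sequentially]) (use b(1) in \<open>auto intro!: always_eventually order_trans[OF _ b(1)]\<close>)
  have b0: "(\<lambda>n. cnj (f (b n)) * ?h (b n)) \<longlonglongrightarrow> 0"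
    by (rule Lim_null_comparison[OF always_eventually LIMSEQ_inverse_real_of_nat]) (use b(2) in auto)
  define I where "I n = integral {a n..b n} (\<lambda>x. complex_of_real ((norm (?h x))^2))" for n
  note gL = L2_integrable_inner[OF regularD(1,2)[OF reg]]
  have gi: "(\<lambda>n. integral {a n..b n} (\<lambda>x. cnj (f x) * g x)) \<longlonglongrightarrow> L2_inner f g"
    unfolding L2_inner_def by (rule half_line_integral_tendsto[OF gL a b_top])
  have I_eq: "I n = integral {a n..b n} (\<lambda>x. cnj (f x) * g x) + (cnj (f (b n)) * ?h (b n) - cnj (f (a n)) * ?h (a n))" for n
  proof -
    have "(\<lambda>x. cnj (f x) * g x) integrable_on {a n..b n}"
      using absolutely_integrable_Icc_half_line[OF gL, of "a n" "b n"] a(1)[of n] by (auto dest: set_lebesgue_integral_eq_integral(1))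
    from has_integral_add[OF hardy_Icc[OF reg a(1) b(3)] integrable_integral[OF this]]
    show ?thesis unfolding I_def by (simp add: integral_unique algebra_simps)
  qed
  have I_lim: "I \<longlonglongrightarrow> L2_inner f g + (0 - l)" unfolding I_eq by (intro tendsto_add tendsto_diff gi b0 l)
  \<comment> \<open>Truncations of A f: their squared norms are the convergent integrals I n, so
    Fatou's lemma puts A f itself into L2.\<close>
  define F where "F n x = (if x \<in> {a n..b n} then ?h x else 0)" for n x
  have FL: "F n \<in> L2" for n
  proof (rule continuous_compact_support_L2)
    show "continuous_on {a n..b n} (F n)"
    proof (subst continuous_on_cong[OF refl])
      show "continuous_on {a n..b n} ?h" by (rule continuous_on_subset[OF continuous_on_hardy[OF reg]]) (use a(1)[of n] in auto)
    qed (simp add: F_def)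
  qed (use a(1)[of n] in \<open>auto simp: F_def\<close>)
  have F_norm: "of_real ((L2_norm (F n))^2) = I n" for n
  proof -
    have "(L2_norm (F n))^2 = integral {a n..b n} (\<lambda>x. (norm (F n x))^2)" unfolding L2_norm_sq using a(1)[of n]
      by (intro half_line_integral_support(2)[OF absolutely_integrable_Icc_half_line[OF L2_integrable_sq[OF FL]]]) (auto simp: F_def)
    also have "\<dots> = integral {a n..b n} (\<lambda>x. (norm (?h x))^2)" by (rule integral_cong) (simp add: F_def)
    also have "of_real \<dots> = I n"
    proof -
      have "(\<lambda>x. (norm (?h x))^2) integrable_on {a n..b n}"
        by (intro integrable_continuous_interval continuous_on_power continuous_on_norm continuous_on_subset[OF continuous_on_hardy[OF reg]])
          (use a(1)[of n] in auto)
      then show ?thesis unfolding I_def by (intro sym[OF integral_unique[OF has_integral_of_real]] integrable_integral)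
    qed
    finally show ?thesis .
  qed
  obtain C where C: "\<And>n. norm (I n) \<le> C" using convergent_imp_Bseq[OF convergentI[OF I_lim]] by (auto simp: Bseq_def)
  have "?h \<in> L2 \<and> L2_norm ?h \<le> sqrt C"
  proof (rule L2_Fatou[OF FL, where ?n0.0 = 0])
    show "?h \<in> borel_measurable half_line" by (rule continuous_on_pos_measurable[OF continuous_on_hardy[OF reg]])
    show "L2_norm (F n) \<le> sqrt C" for n using C[of n] unfolding F_norm[symmetric] by (auto intro!: real_le_rsqrt simp: norm_mult power2_eq_square)
    show "AE x in half_line. (\<lambda>n. F n x) \<longlonglongrightarrow> ?h x" using AE_half_line_pos
    proof eventually_elim
      case x: (elim x)
      have "\<forall>\<^sub>F n in sequentially. a n < x \<and> x \<le> b n"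
        using order_tendstoD(2)[OF a(2) x] b_top[unfolded filterlim_at_top, rule_format, of x] by eventually_elim auto
      then have "\<forall>\<^sub>F n in sequentially. F n x = ?h x" by eventually_elim (auto simp: F_def)
      then show ?case by (rule tendsto_eventually)
    qed
  qed
  then show hL: "?h \<in> L2" by blast
  have "integrable half_line (\<lambda>x. complex_of_real ((norm (?h x))^2))" by (rule integrable_of_real[OF L2_integrable_sq[OF hL]])
  from half_line_integral_tendsto[OF this a b_top]
  have "I \<longlonglongrightarrow> of_real ((L2_norm ?h)^2)" unfolding I_def[abs_def] L2_norm_sq by (simp only: integral_complex_of_real)
  from LIMSEQ_unique[OF this I_lim] show "L2_inner f g = of_real ((L2_norm ?h)^2) + l" by (simp add: algebra_simps)
qed

lemma powr_solution_deriv: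
  assumes "0 < x"
  shows "((\<lambda>x. x powr (1/2 + s)) has_real_derivative (1/2 + s) * x powr (s - 1/2)) (at x)"
    "((\<lambda>x. (1/2 + s) * x powr (s - 1/2)) has_real_derivative ((- 1/4 + s^2) * (1 / x^2)) * x powr (1/2 + s)) (at x)"
proof -
  have e: "1/2 + s - 1 = s - 1/2" "s - 1/2 - 1 = (1/2 + s) - 2" by simp_all
  show "((\<lambda>x. x powr (1/2 + s)) has_real_derivative (1/2 + s) * x powr (s - 1/2)) (at x)"
    using has_real_derivative_powr[OF assms, of "1/2 + s"] unfolding e .
  have "x powr (s - 1/2 - 1) = x powr (1/2 + s) / x^2" unfolding e powr_diff using assms by simp
  then have "(1/2 + s) * ((s - 1/2) * x powr (s - 1/2 - 1)) = ((- 1/4 + s^2) * (1 / x^2)) * x powr (1/2 + s)" by (simp add: field_simps power2_eq_square)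
  from DERIV_cong[OF DERIV_cmult[OF has_real_derivative_powr[OF assms, of "s - 1/2"], of "1/2 + s"] this]
  show "((\<lambda>x. (1/2 + s) * x powr (s - 1/2)) has_real_derivative ((- 1/4 + s^2) * (1 / x^2)) * x powr (1/2 + s)) (at x)" .
qed

lemma powr_times_hardy:
  assumes "0 < x"
  shows "complex_of_real (x powr (1/2 + s)) * hardy s f f' x = of_real (x powr (1/2 + s)) * f' x - of_real ((1/2 + s) * x powr (s - 1/2)) * f x"
proof -
  have "1/2 + s = (s - 1/2) + 1" by simp
  then have "x powr (1/2 + s) = x powr (s - 1/2) * x powr 1" by (metis powr_add)
  then have "x powr (1/2 + s) * ((1/2 + s) / x) = (1/2 + s) * x powr (s - 1/2)" using assms by simp
  then have "complex_of_real (x powr (1/2 + s)) * of_real ((1/2 + s) / x) = of_real ((1/2 + s) * x powr (s - 1/2))"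
    unfolding of_real_mult[symmetric] by (rule arg_cong)
  then show ?thesis unfolding hardy_def right_diff_distrib mult.assoc[symmetric] by (simp only:)
qed

lemma powr_times_hardy_Icc:
  assumes reg: "regular (s^2) f f' g" and ab: "0 < a" "a \<le> b"
  shows "((\<lambda>x. - (of_real (x powr (1/2 + s)) * g x)) has_integral
    of_real (b powr (1/2 + s)) * hardy s f f' b - of_real (a powr (1/2 + s)) * hardy s f f' a) {a..b}"
proof -
  define u u' where "u x = complex_of_real (x powr (1/2 + s))" "u' x = complex_of_real ((1/2 + s) * x powr (s - 1/2))" for x
  have d: "(u has_vector_derivative u' x) (at x)" "(u' has_vector_derivative potential (s^2) x * u x) (at x)" if "0 < x" for x
    using powr_solution_deriv[OF that, of s, THEN has_vector_derivative_of_real] unfolding u_u'_def[abs_def] potential_def of_real_mult[symmetric] .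
  have 1: "((\<lambda>x. u' x * f' x + u x * (potential (s^2) x * f x - g x)) has_integral u b * f' b - u a * f' a) {a..b}"
    by (rule regular_parts[OF d(1) continuous_on_pos_if_deriv[OF d(2)] reg ab])
  have 2: "((\<lambda>x. u' x * f' x + potential (s^2) x * u x * f x) has_integral u' b * f b - u' a * f a) {a..b}"
  proof (rule fundamental_theorem_of_calculus[OF ab(2)], rule has_vector_derivative_at_within)
    fix x assume "x \<in> {a..b}"
    then have x: "0 < x" using ab by simp
    show "((\<lambda>x. u' x * f x) has_vector_derivative u' x * f' x + potential (s^2) x * u x * f x) (at x)"
      by (rule has_vector_derivative_mult[OF d(2)[OF x] regularD(3)[OF reg x]])
  qed
  show ?thesis
  proof (rule has_integral_eq_rhs[OF has_integral_eq[OF _ has_integral_diff[OF 1 2]]])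
    show "of_real (b powr (1/2 + s)) * hardy s f f' b - of_real (a powr (1/2 + s)) * hardy s f f' a =
        u b * f' b - u a * f' a - (u' b * f b - u' a * f a)" using ab by (simp only: powr_times_hardy u_u'_def) simp
  qed (simp add: u_u'_def algebra_simps)
qed

text \<open>For s >= 0 the solution is continuous up to 0, so its product with g is integrable
  there, and the Wronskian is a primitive of that product up to sign.\<close>

lemma powr_times_hardy_convergent:
  assumes reg: "regular (s^2) f f' g" and s: "0 \<le> s"
  shows "\<exists>b. ((\<lambda>x. of_real (x powr (1/2 + s)) * hardy s f f' x) \<longlongrightarrow> b) (at_right 0)"
proof -
  define h where "h x = - (complex_of_real (x powr (1/2 + s)) * g x)" for x
  let ?W = "\<lambda>x. of_real (x powr (1/2 + s)) * hardy s f f' x"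
  have "continuous_on {0..1::real} (\<lambda>x. x powr (1/2 + s))" using s by (intro continuous_on_powr' continuous_intros) auto
  then have "continuous_on {0..1} (\<lambda>x. complex_of_real (x powr (1/2 + s)))" by (rule continuous_on_of_real)
  from absolutely_integrable_mult_continuous[OF this L2_absolutely_integrable_Icc[OF regularD(2)[OF reg] order_refl]]
  have "(\<lambda>x. of_real (x powr (1/2 + s)) * g x) integrable_on {0..1}" by (rule set_lebesgue_integral_eq_integral(1))
  then have "h integrable_on {0..1}" unfolding h_def[abs_def] by (rule integrable_neg)
  then have "((\<lambda>a. ?W 1 - integral {a..1} h) \<longlongrightarrow> ?W 1 - integral {0..1} h) (at_right 0)"
    by (intro tendsto_diff tendsto_const integral_Icc_tendsto_at_right_0) auto
  moreover have "\<forall>\<^sub>F a in at_right 0. ?W 1 - integral {a..1} h = ?W a"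
  proof (rule eventually_at_rightI[of 0 1])
    show "?W 1 - integral {a..1} h = ?W a" if "a \<in> {0<..<1}" for a
    proof -
      have a: "0 < a" "a \<le> 1" using that by simp_all
      have "integral {a..1} h = ?W 1 - ?W a" unfolding h_def[abs_def] by (rule integral_unique[OF powr_times_hardy_Icc[OF reg a]])
      then show ?thesis by simp
    qed
  qed simp
  ultimately show ?thesis by (intro exI[of _ "?W 1 - integral {0..1} h"]) (rule Lim_transform_eventually)
qed

text \<open>A Wronskian starting from 0 is minus the integral of u g over [0, x]. Cauchy-Schwarz and
  the monotonicity of u for s >= 0 bound it by u(x) sqrt x times the norm of g, and u(x)
  cancels.\<close>

lemma hardy_pointwise_bound:
  assumes reg: "regular (s^2) f f' g" and s: "0 \<le> s"
    and lim: "((\<lambda>x. of_real (x powr (1/2 + s)) * hardy s f f' x) \<longlongrightarrow> 0) (at_right 0)" and x: "0 < x"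
  shows "norm (hardy s f f' x) \<le> sqrt x * L2_norm g"
proof -
  let ?u = "\<lambda>x. x powr (1/2 + s)" and ?W = "\<lambda>x. of_real (x powr (1/2 + s)) * hardy s f f' x"
  have le: "norm (?W x - ?W a) \<le> ?u x * sqrt x * L2_norm g" if a: "0 < a" "a \<le> x" for a
  proof -
    define v where "v y = (if y \<in> {a..x} then complex_of_real (?u y) else 0)" for y
    have "continuous_on {a..x} (\<lambda>y. complex_of_real (?u y))" using a by (intro continuous_intros) auto
    then have "continuous_on {a..x} v" by (rule continuous_on_cong[THEN iffD1, rotated 2]) (auto simp: v_def)
    then have vL: "v \<in> L2" by (rule continuous_compact_support_L2) (use a in \<open>auto simp: v_def\<close>)
    have "(L2_norm v)^2 = integral {a..x} (\<lambda>y. (norm (v y))^2)" unfolding L2_norm_sq using a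
      by (intro half_line_integral_support(2)[OF absolutely_integrable_Icc_half_line[OF L2_integrable_sq[OF vL]]]) (auto simp: v_def)
    also have "\<dots> \<le> integral {a..x} (\<lambda>y. (?u x)^2)"
    proof (rule integral_le)
      show "(\<lambda>y. (norm (v y))^2) integrable_on {a..x}"
        using absolutely_integrable_Icc_half_line[OF L2_integrable_sq[OF vL], of a x] a by (auto dest: set_lebesgue_integral_eq_integral(1))
      show "(norm (v y))^2 \<le> (?u x)^2" if "y \<in> {a..x}" for y using that a s by (auto simp: v_def intro!: power_mono powr_mono2)
    qed auto
    also have "\<dots> \<le> (?u x)^2 * x" using a by (simp add: mult_left_mono mult.commute)
    also have "\<dots> = (?u x * sqrt x)^2" using x by (simp add: power_mult_distrib)
    finally have nv: "L2_norm v \<le> ?u x * sqrt x" by (rule power2_le_imp_le) (use x in simp)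
    have i: "integrable half_line (\<lambda>y. cnj (v y) * g y)" by (rule L2_integrable_inner[OF vL regularD(2)[OF reg]])
    have "L2_inner v g = integral {a..x} (\<lambda>y. cnj (v y) * g y)"
      unfolding L2_inner_def using a by (intro half_line_integral_support(2)[OF absolutely_integrable_Icc_half_line[OF i]]) (auto simp: v_def)
    also have "\<dots> = integral {a..x} (\<lambda>y. of_real (?u y) * g y)" by (rule integral_cong) (simp add: v_def)
    also have "\<dots> = - (?W x - ?W a)"
    proof -
      have aux: "- I = X \<Longrightarrow> I = - X" for I X :: complex by auto
      show ?thesis by (rule aux, unfold integral_neg[symmetric], rule integral_unique[OF powr_times_hardy_Icc[OF reg a]])
    qed
    finally have "norm (?W x - ?W a) = norm (L2_inner v g)" by (simp add: norm_minus_commute)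
    also have "\<dots> \<le> L2_norm v * L2_norm g" by (rule L2_Cauchy_Schwarz[OF vL regularD(2)[OF reg]])
    also have "\<dots> \<le> ?u x * sqrt x * L2_norm g" by (rule mult_right_mono[OF nv L2_norm_nonneg])
    finally show ?thesis .
  qed
  have "((\<lambda>a. norm (?W x - ?W a)) \<longlongrightarrow> norm (?W x - 0)) (at_right 0)" by (intro tendsto_intros lim)
  moreover have "\<forall>\<^sub>F a in at_right 0. norm (?W x - ?W a) \<le> ?u x * sqrt x * L2_norm g"
    using eventually_at_rightI[of 0 x "\<lambda>a. norm (?W x - ?W a) \<le> ?u x * sqrt x * L2_norm g"] le x by auto
  ultimately have "norm (?W x - 0) \<le> ?u x * sqrt x * L2_norm g" by (intro tendsto_upperbound[of _ _ "at_right 0"]) auto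
  then have "?u x * norm (hardy s f f' x) \<le> ?u x * (sqrt x * L2_norm g)" using x by (simp add: norm_mult mult.assoc)
  then show ?thesis using x by simp
qed

text \<open>The boundary term f A f is at most |f| sqrt x times a constant, and sqrt x |f| is small
  along a sequence tending to 0 because f is square integrable.\<close>

lemma hardy_form_zero:
  assumes reg: "regular (s^2) f f' g" and s: "0 \<le> s"
    and lim: "((\<lambda>x. of_real (x powr (1/2 + s)) * hardy s f f' x) \<longlongrightarrow> 0) (at_right 0)"
  shows "hardy s f f' \<in> L2" "L2_inner f g = of_real ((L2_norm (hardy s f f'))^2)"
proof -
  have "\<exists>x. 0 < x \<and> x < inverse (real (Suc n)) \<and> norm (cnj (f x) * hardy s f f' x) \<le> L2_norm g * inverse (real (Suc n))" for n
  proof -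
    let ?e = "inverse (real (Suc n))"
    obtain x where x: "0 < x" "x < ?e" and lt: "x * (norm (f x))^2 < ?e^2"
      using L2_small_value_at_0[OF regularD(1)[OF reg] regular_continuous[OF reg], of "?e^2" ?e] by auto
    have "(sqrt x * norm (f x))^2 \<le> ?e^2" using lt x by (simp add: power_mult_distrib)
    then have le: "sqrt x * norm (f x) \<le> ?e" by (rule power2_le_imp_le) simp
    have "norm (cnj (f x) * hardy s f f' x) \<le> norm (f x) * (sqrt x * L2_norm g)"
      unfolding norm_mult complex_mod_cnj by (intro mult_left_mono hardy_pointwise_bound[OF reg s lim x(1)]) auto
    also have "\<dots> \<le> L2_norm g * ?e" using mult_left_mono[OF le L2_norm_nonneg[of g]] by (simp add: mult_ac)
    finally show ?thesis using x by blast
  qed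
  then obtain a where a: "\<And>n. 0 < a n" "\<And>n. a n < inverse (real (Suc n))"
      "\<And>n. norm (cnj (f (a n)) * hardy s f f' (a n)) \<le> L2_norm g * inverse (real (Suc n))" by metis
  have 1: "a \<longlonglongrightarrow> 0"
    by (rule tendsto_sandwich[OF _ _ tendsto_const LIMSEQ_inverse_real_of_nat]) (use a in \<open>auto intro!: always_eventually less_imp_le\<close>)
  have 2: "(\<lambda>n. cnj (f (a n)) * hardy s f f' (a n)) \<longlonglongrightarrow> 0"
  proof (rule Lim_null_comparison)
    show "(\<lambda>n. L2_norm g * inverse (real (Suc n))) \<longlonglongrightarrow> 0" by (rule tendsto_mult_right_zero[OF LIMSEQ_inverse_real_of_nat])
  qed (use a(3) in \<open>auto intro!: always_eventually\<close>)
  show "hardy s f f' \<in> L2" "L2_inner f g = of_real ((L2_norm (hardy s f f'))^2)" using hardy_form[OF reg a(1) 1 2] by simp_all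
qed

text \<open>A nonzero limit would keep x |h|^2 above a positive constant near 0, as p >=
  1/2.\<close>

lemma L2_weighted_limit_zero:
  assumes h: "h \<in> L2" "continuous_on {0<..} h" and p: "1/2 \<le> p"
    and lim: "((\<lambda>x. of_real (x powr p) * h x) \<longlongrightarrow> b) (at_right 0)"
  shows "b = 0"
proof (rule ccontr)
  assume "b \<noteq> 0"
  define e where "e = (norm b / 2)^2"
  have e: "0 < e" using \<open>b \<noteq> 0\<close> by (simp add: e_def)
  have "\<forall>\<^sub>F x in at_right 0. norm b / 2 < norm (of_real (x powr p) * h x)"
    using \<open>b \<noteq> 0\<close> by (intro order_tendstoD(1)[OF tendsto_norm[OF lim]]) auto
  then obtain d where d: "0 < d" and gt: "\<And>x. 0 < x \<Longrightarrow> x < d \<Longrightarrow> norm b / 2 < norm (of_real (x powr p) * h x)"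
    unfolding eventually_at_right_field by auto
  obtain x where x: "0 < x" "x < min d 1" and lt: "x * (norm (h x))^2 < e" using L2_small_value_at_0[OF h e, of "min d 1"] d by auto
  have "x powr p \<le> x powr (1/2)" using x p by (intro powr_mono') auto
  then have "norm (of_real (x powr p) * h x) \<le> sqrt x * norm (h x)" using x by (simp add: norm_mult powr_half_sqrt mult_right_mono)
  with gt[of x] x have "norm b / 2 < sqrt x * norm (h x)" by linarith
  then have "e < (sqrt x * norm (h x))^2" unfolding e_def by (intro power_strict_mono) auto
  with lt x show False by (simp add: power_mult_distrib)
qed

subsection \<open>The Friedrichs extension\<close>

text \<open>The Friedrichs extension consists of the functions whose Wronskian with the less singular solution
  \<open>x powr (1/2 + m)\<close> vanishes at \<open>0\<close>.\<close>

definition zero_trace :: "real \<Rightarrow> cfun \<Rightarrow> cfun \<Rightarrow> bool" where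
  "zero_trace m f f' \<longleftrightarrow> ((\<lambda>x. of_real (x powr (1/2 + m)) * hardy m f f' x) \<longlongrightarrow> 0) (at_right 0)"

text \<open>The explicit candidate, stated for general m so that it serves the phases 0 < \<alpha> <
  1, \<alpha> = 0 and \<alpha> >= 1 alike.\<close>

definition friedrichs_op :: "real \<Rightarrow> operator" where
  "friedrichs_op m = {(f, g). f \<in> L2 \<and> (\<exists>F F'. regular (m^2) F F' g \<and> (AE x in half_line. f x = F x) \<and> zero_trace m F F')}"

lemma friedrichs_opE:
  assumes "(f, g) \<in> friedrichs_op m"
  obtains F F' where "regular (m^2) F F' g" "AE x in half_line. f x = F x" "zero_trace m F F'" "f \<in> L2" "g \<in> L2"
  using assms by (auto simp: friedrichs_op_def regular_def)

lemma friedrichs_opI: "regular (m^2) f f' g \<Longrightarrow> zero_trace m f f' \<Longrightarrow> (f, g) \<in> friedrichs_op m"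
  by (auto simp: friedrichs_op_def regular_def)

lemma friedrichs_op_subset_max_op: "friedrichs_op m \<subseteq> max_op (m^2)" by (auto simp: friedrichs_op_def max_op_def)

lemma zero_trace_add: "zero_trace m f f' \<Longrightarrow> zero_trace m h h' \<Longrightarrow> zero_trace m (\<lambda>x. f x + h x) (\<lambda>x. f' x + h' x)"
  unfolding zero_trace_def hardy_add distrib_left by (rule tendsto_add_zero)

lemma zero_trace_diff: "zero_trace m f f' \<Longrightarrow> zero_trace m h h' \<Longrightarrow> zero_trace m (\<lambda>x. f x - h x) (\<lambda>x. f' x - h' x)"
  unfolding zero_trace_def hardy_diff right_diff_distrib using tendsto_diff[of _ 0 _ _ 0] by simp

lemma zero_trace_scale:
  assumes "zero_trace m f f'"
  shows "zero_trace m (\<lambda>x. c * f x) (\<lambda>x. c * f' x)"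
  using tendsto_mult_right_zero[OF assms[unfolded zero_trace_def], of c] unfolding zero_trace_def hardy_scale by (simp add: mult.left_commute)

lemma test_function_zero_trace:
  assumes "f \<in> test_functions" "f' \<in> test_functions"
  shows "zero_trace m f f'"
proof -
  obtain a b where a: "0 < a" "\<And>x. x \<notin> {a..b} \<Longrightarrow> f x = 0" using assms(1) by (auto simp: test_functions_def)
  obtain a' b' where a': "0 < a'" "\<And>x. x \<notin> {a'..b'} \<Longrightarrow> f' x = 0" using assms(2) by (auto simp: test_functions_def)
  have "\<forall>\<^sub>F x in at_right 0. of_real (x powr (1/2 + m)) * hardy m f f' x = 0"
    using a(1) a'(1) by (intro eventually_at_rightI[of 0 "min a a'"]) (auto simp: hardy_def a(2) a'(2))
  then show ?thesis unfolding zero_trace_def by (rule tendsto_eventually)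
qed

text \<open>Polarization of the quadratic identity: a sesquilinear defect that vanishes on f + t h
  for t = 1 and t = \<i> is 0.\<close>

lemma hardy_inner:
  assumes f: "regular (s^2) f f' g" "zero_trace s f f'" and h: "regular (s^2) h h' k" "zero_trace s h h'" and s: "0 \<le> s"
  shows "L2_inner f k = L2_inner (hardy s f f') (hardy s h h')"
proof -
  note fL = regularD(1,2)[OF f(1)] hardy_form_zero(1)[OF f(1) s f(2)[unfolded zero_trace_def]]
  note hL = regularD(1,2)[OF h(1)] hardy_form_zero(1)[OF h(1) s h(2)[unfolded zero_trace_def]]
  note q = hardy_form_zero(2)[OF _ s, folded zero_trace_def inner_self]
  define P where "P = L2_inner f k - L2_inner (hardy s f f') (hardy s h h')"
  define R where "R = L2_inner h g - L2_inner (hardy s h h') (hardy s f f')"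
  have "t * P + cnj t * R = 0" for t
  proof -
    have "L2_inner (\<lambda>x. f x + t * h x) (\<lambda>x. g x + t * k x) =
        L2_inner (\<lambda>x. hardy s f f' x + t * hardy s h h' x) (\<lambda>x. hardy s f f' x + t * hardy s h h' x)"
      using q[OF regular_add[OF f(1) regular_scale[OF h(1), of t]] zero_trace_add[OF f(2) zero_trace_scale[OF h(2)]]] unfolding hardy_add hardy_scale .
    then show ?thesis using q[OF f] q[OF h] fL hL
      by (simp add: P_def R_def inner_add_left inner_add_right inner_scale_left inner_scale_right L2_add L2_scale algebra_simps)
  qed
  from this[of 1] this[of \<i>] have "P + R = 0" "\<i> * (P - R) = 0" by (simp_all add: algebra_simps)
  then show ?thesis by (simp add: P_def)
qed

lemma friedrichs_op_nonneg:
  assumes "0 \<le> m" "(f, g) \<in> friedrichs_op m"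
  shows "L2_inner f g \<in> \<real>" "0 \<le> Re (L2_inner f g)"
proof -
  obtain F F' where F: "regular (m^2) F F' g" "AE x in half_line. f x = F x" "zero_trace m F F'" "f \<in> L2" "g \<in> L2"
    using assms(2) by (rule friedrichs_opE)
  have "L2_inner f g = of_real ((L2_norm (hardy m F F'))^2)"
    using inner_cong_AE[OF F(2) _ F(4) regularD(1)[OF F(1)] F(5,5)] hardy_form_zero(2)[OF F(1) assms(1) F(3)[unfolded zero_trace_def]] by simp
  then show "L2_inner f g \<in> \<real>" "0 \<le> Re (L2_inner f g)" by simp_all
qed

text \<open>The operator \<open>A\<close> is closed: testing against \<open>\<phi>\<close> moves \<open>A\<close> to its formal transpose.\<close>

lemma hardy_closed:
  assumes U: "\<And>n::nat. regular \<alpha> (U n) (U' n) (v n)" "\<And>n. hardy s (U n) (U' n) \<in> L2" and F: "regular \<alpha> F F' g"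
    and lim: "L2_lim U F" "L2_lim (\<lambda>n. hardy s (U n) (U' n)) e" and e: "e \<in> L2"
  shows "AE x in half_line. hardy s F F' x = e x"
proof -
  have loc: "locally_integrable (\<lambda>x. hardy s F F' x - e x)"
    by (intro locally_integrable_diff continuous_locally_integrable[OF continuous_on_hardy[OF F]] L2_locally_integrable e)
  have "AE x in half_line. hardy s F F' x - e x = 0"
  proof (rule fundamental_lemma[OF loc])
    fix p assume p: "p \<in> test_functions"
    obtain p' p'' a b where p': "0 < a" "p' \<in> test_functions" "\<And>x. (p has_vector_derivative p' x) (at x)"
      and z: "\<And>x. x \<notin> {a<..<b} \<Longrightarrow> p x = 0 \<and> p' x = 0"
      using test_function_derivs[OF p] by metis
    define T where "T x = - p' x - of_real ((1/2 + s) / x) * p x" for x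
    have TL: "T \<in> L2"
    proof (rule continuous_compact_support_L2)
      show "continuous_on {a..b} T"
        unfolding T_def[abs_def] using p'(1) by (intro continuous_on_diff continuous_on_minus continuous_on_mult continuous_on_of_real continuous_on_divide continuous_on_const continuous_on_id test_function_continuous_on p p') auto
    qed (use p'(1) z in \<open>auto simp: T_def\<close>)
    have parts: "(LINT x|half_line. p x * hardy s G G' x) = (LINT x|half_line. T x * G x)" if G: "regular \<alpha> G G' k" for G G' k
    proof -
      note lG = continuous_locally_integrable[OF regular_continuous[OF G]] and lG' = continuous_locally_integrable[OF regular_deriv_continuous[OF G]]
      have lq: "locally_integrable (\<lambda>x. of_real ((1/2 + s) / x) * G x)" by (intro locally_integrable_mult lG continuous_intros) auto
      have "p x * hardy s G G' x = p x * G' x - p x * (of_real ((1/2 + s) / x) * G x)" for x by (simp add: hardy_def right_diff_distrib)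
      then have "(LINT x|half_line. p x * hardy s G G' x) = (LINT x|half_line. p x * G' x) - (LINT x|half_line. p x * (of_real ((1/2 + s) / x) * G x))"
        using Bochner_Integration.integral_diff[OF test_function_mult_integral(1)[OF p lG'] test_function_mult_integral(1)[OF p lq]] by simp
      also have "(LINT x|half_line. p x * G' x) = - (LINT x|half_line. p' x * G x)"
        using test_function_parts[OF p p'(2,3) lG' C1_locally[OF regularD(3)[OF G] regular_deriv_continuous[OF G]] lG] by simp
      also have "- (LINT x|half_line. p' x * G x) - (LINT x|half_line. p x * (of_real ((1/2 + s) / x) * G x)) = (LINT x|half_line. T x * G x)"
        using Bochner_Integration.integral_diff[OF Bochner_Integration.integrable_minus[OF test_function_mult_integral(1)[OF p'(2) lG]] test_function_mult_integral(1)[OF p lq]]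
        by (simp add: T_def algebra_simps)
      finally show ?thesis .
    qed
    have inner: "(LINT x|half_line. q x * r x) = L2_inner (\<lambda>x. cnj (q x)) r" for q r :: cfun by (simp add: L2_inner_def)
    have 1: "(\<lambda>n. L2_inner (\<lambda>x. cnj (T x)) (U n)) \<longlonglongrightarrow> L2_inner (\<lambda>x. cnj (T x)) F"
      by (rule inner_tendsto_right[OF L2_cnj[OF TL] _ regularD(1)[OF F] lim(1)]) (rule regularD(1)[OF U(1)])
    have 2: "(\<lambda>n. L2_inner (\<lambda>x. cnj (p x)) (hardy s (U n) (U' n))) \<longlonglongrightarrow> L2_inner (\<lambda>x. cnj (p x)) e"
      by (rule inner_tendsto_right[OF L2_cnj[OF test_function_L2[OF p]] U(2) e lim(2)])
    have "L2_inner (\<lambda>x. cnj (T x)) F = L2_inner (\<lambda>x. cnj (p x)) e"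
      using LIMSEQ_unique[OF 1[folded inner, folded parts[OF U(1)], unfolded inner] 2] .
    then have "(LINT x|half_line. p x * hardy s F F' x) = (LINT x|half_line. p x * e x)" unfolding parts[OF F] inner .
    then show "(LINT x|half_line. p x * (hardy s F F' x - e x)) = 0"
      using Bochner_Integration.integral_diff[OF test_function_mult_integral(1)[OF p continuous_locally_integrable[OF continuous_on_hardy[OF F]]]
          test_function_mult_integral(1)[OF p L2_locally_integrable[OF e]], of s] by (simp add: right_diff_distrib)
  qed
  then show ?thesis by simp
qed

text \<open>Form-Cauchy means that the images under A converge, and closedness identifies the limit
  with A F. Hence A F is square integrable, and a nonzero limit of its product with x powr (1/2 + m)
  is then impossible.\<close>

lemma closed_form_friedrichs_op:
  assumes m: "0 \<le> m" and fg: "(f, g) \<in> max_op (m^2)" and q: "closed_form (friedrichs_op m) f q"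
  shows "(f, g) \<in> friedrichs_op m"
proof -
  obtain u v where uv: "\<And>n::nat. (u n, v n) \<in> friedrichs_op m" and lim: "L2_lim u f"
    and cau: "\<And>e. e > 0 \<Longrightarrow> \<exists>N. \<forall>i\<ge>N. \<forall>j\<ge>N. norm (L2_inner (\<lambda>x. u i x - u j x) (\<lambda>x. v i x - v j x)) < e"
    using q unfolding closed_form_def by blast
  have "\<forall>n. \<exists>U U'. regular (m^2) U U' (v n) \<and> (AE x in half_line. u n x = U x) \<and> zero_trace m U U'"
    using uv by (auto simp: friedrichs_op_def)
  then obtain U U' where U: "\<And>n. regular (m^2) (U n) (U' n) (v n)" "\<And>n. AE x in half_line. u n x = U n x" "\<And>n. zero_trace m (U n) (U' n)"
    by metis
  have uL: "u n \<in> L2" for n using uv by (auto simp: friedrichs_op_def)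
  note UL = regularD(1,2)[OF U(1)]
  let ?h = "\<lambda>n. hardy m (U n) (U' n)"
  have hL: "?h n \<in> L2" for n by (rule hardy_form_zero(1)[OF U(1) m U(3)[unfolded zero_trace_def]])
  have diff: "of_real ((L2_dist (?h i) (?h j))^2) = L2_inner (\<lambda>x. u i x - u j x) (\<lambda>x. v i x - v j x)" for i j
  proof -
    have "AE x in half_line. u i x - u j x = U i x - U j x" using U(2)[of i] U(2)[of j] by eventually_elim simp
    then have "L2_inner (\<lambda>x. u i x - u j x) (\<lambda>x. v i x - v j x) = L2_inner (\<lambda>x. U i x - U j x) (\<lambda>x. v i x - v j x)"
      by (intro inner_cong_AE L2_diff[OF uL uL] L2_diff[OF UL(1) UL(1)] L2_diff[OF UL(2) UL(2)]) auto
    then show ?thesis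
      using hardy_form_zero(2)[OF regular_diff[OF U(1) U(1)] m zero_trace_diff[OF U(3) U(3), unfolded zero_trace_def], of i j] by (simp add: hardy_diff)
  qed
  have "\<exists>e\<in>L2. L2_lim ?h e" by (rule L2_complete_sq[OF hL _ cau]) (simp only: diff[symmetric] norm_of_real abs_ge_self)
  then obtain e where e: "e \<in> L2" "L2_lim ?h e" by blast
  obtain F F' where F: "regular (m^2) F F' g" "AE x in half_line. f x = F x" "f \<in> L2" using fg by (rule max_opE)
  note FL = regularD(1)[OF F(1)]
  have "L2_dist (U n) F = L2_dist (u n) f" for n
  proof (rule L2_norm_cong_AE)
    show "AE x in half_line. U n x - F x = u n x - f x" using U(2)[of n] F(2) by eventually_elim simp
  qed (intro L2_measurable L2_diff uL UL FL F(3))+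
  with lim have limU: "L2_lim U F" by simp
  have ae: "AE x in half_line. e x = hardy m F F' x" using hardy_closed[OF U(1) hL F(1) limU e(2,1)] by eventually_elim simp
  have FhL: "hardy m F F' \<in> L2" by (rule L2_cong_AE[OF e(1) ae continuous_on_pos_measurable[OF continuous_on_hardy[OF F(1)]]])
  obtain b where b: "((\<lambda>x. of_real (x powr (1/2 + m)) * hardy m F F' x) \<longlongrightarrow> b) (at_right 0)"
    using powr_times_hardy_convergent[OF F(1) m] by blast
  have "b = 0" by (rule L2_weighted_limit_zero[OF FhL continuous_on_hardy[OF F(1)] _ b]) (use m in simp)
  with b F show ?thesis by (auto simp: friedrichs_op_def zero_trace_def)
qed

lemma closed_form_mono: "A \<subseteq> B \<Longrightarrow> closed_form A f q \<Longrightarrow> closed_form B f q" unfolding closed_form_def by blast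

text \<open>When the form is the squared norm of a factor, convergence in the form is norm
  convergence of the images under the factor.\<close>

lemma closed_formI_factor:
  assumes uv: "\<And>n::nat. (u n, v n) \<in> A" and f: "f \<in> L2" and h: "\<And>n. h n \<in> L2" and e: "e \<in> L2"
    and lim: "L2_lim u f" "L2_lim h e"
    and q: "\<And>n. L2_inner (u n) (v n) = of_real ((L2_norm (h n))^2)"
    and diff: "\<And>i j. L2_inner (\<lambda>x. u i x - u j x) (\<lambda>x. v i x - v j x) = of_real ((L2_dist (h i) (h j))^2)"
  shows "closed_form A f ((L2_norm e)^2)" unfolding closed_form_def
proof (rule conjI[OF f], rule exI[of _ u], rule exI[of _ v], intro conjI allI impI uv lim(1))
  fix r :: real assume r: "r > 0"
  then have "0 < sqrt r / 2" by simp
  from order_tendstoD(2)[OF lim(2) this]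
  obtain N where N: "\<And>n. n \<ge> N \<Longrightarrow> L2_dist (h n) e < sqrt r / 2" by (auto simp: eventually_sequentially)
  have "norm (L2_inner (\<lambda>x. u i x - u j x) (\<lambda>x. v i x - v j x)) < r" if "i \<ge> N" "j \<ge> N" for i j
  proof -
    have "L2_dist (h i) (h j) < sqrt r" using L2_triangle_dist[OF h[of i] e h[of j]] L2_norm_minus_commute[of e "h j"] N[OF that(1)] N[OF that(2)] by simp
    then have "(L2_dist (h i) (h j))^2 < (sqrt r)^2" by (intro power_strict_mono) auto
    then show ?thesis using r unfolding diff norm_of_real by simp
  qed
  then show "\<exists>N. \<forall>i\<ge>N. \<forall>j\<ge>N. norm (L2_inner (\<lambda>x. u i x - u j x) (\<lambda>x. v i x - v j x)) < r" by blast
next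
  show "(\<lambda>n. Re (L2_inner (u n) (v n))) \<longlonglongrightarrow> (L2_norm e)^2"
    unfolding q Re_complex_of_real by (intro tendsto_power L2_norm_tendsto h e lim)
qed

lemma L_expr_linear:
  assumes "f \<in> test_functions" "h \<in> test_functions"
  shows "L_expr \<alpha> (\<lambda>x. c * f x + d * h x) = (\<lambda>x. c * L_expr \<alpha> f x + d * L_expr \<alpha> h x)"
proof -
  obtain f' f'' where f: "\<And>x. (f has_vector_derivative f' x) (at x)" "\<And>x. (f' has_vector_derivative f'' x) (at x)"
    using test_function_derivs[OF assms(1)] by metis
  obtain h' h'' where h: "\<And>x. (h has_vector_derivative h' x) (at x)" "\<And>x. (h' has_vector_derivative h'' x) (at x)"
    using test_function_derivs[OF assms(2)] by metis
  note sc = bounded_linear.has_vector_derivative[OF bounded_linear_mult_right]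
  show ?thesis unfolding L_expr_test_function[OF f] L_expr_test_function[OF h]
      L_expr_test_function[OF has_vector_derivative_add[OF sc[OF f(1)] sc[OF h(1)]] has_vector_derivative_add[OF sc[OF f(2)] sc[OF h(2)]], of \<alpha> c d]
    by (simp add: fun_eq_iff algebra_simps)
qed

text \<open>The substantial inclusion says that test functions are a form core. Project (F, A F)
  onto the pairs (p, A p) of test functions: the first component r of the residual solves L r = - r
  weakly and lies in the form domain, hence in the domain of the nonnegative operator, so r =
  0.\<close>

lemma friedrichs_extension_L_min:
  assumes m: "0 \<le> m" and sa: "self_adjoint (friedrichs_op m)" "L_min (m^2) \<subseteq> friedrichs_op m"
  shows "friedrichs_extension (L_min (m^2)) = friedrichs_op m"
proof (intro equalityI subrelI)
  fix f g assume "(f, g) \<in> friedrichs_extension (L_min (m^2))"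
  then obtain q where "(f, g) \<in> max_op (m^2)" "closed_form (L_min (m^2)) f q" unfolding friedrichs_extension_def adjoint_L_min by blast
  then show "(f, g) \<in> friedrichs_op m" using closed_form_friedrichs_op[OF m] closed_form_mono[OF sa(2)] by blast
next
  fix f g assume fg: "(f, g) \<in> friedrichs_op m"
  then obtain F F' where F: "regular (m^2) F F' g" "AE x in half_line. f x = F x" "zero_trace m F F'" and fL: "f \<in> L2" "g \<in> L2"
    by (rule friedrichs_opE)
  note FL = regularD(1)[OF F(1)] and FhL = hardy_form_zero(1)[OF F(1) m F(3)[unfolded zero_trace_def]]
  define S where "S = {(p, hardy m p p') | p p'. p \<in> test_functions \<and> p' \<in> test_functions \<and> regular (m^2) p p' (L_expr (m^2) p)}"
  have lin: "(\<lambda>x. c * u x + d * v x, \<lambda>x. c * u' x + d * v' x) \<in> S" if u: "(u, u') \<in> S" and v: "(v, v') \<in> S" for u u' v v' c d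
  proof -
    obtain p where p: "u' = hardy m u p" "u \<in> test_functions" "p \<in> test_functions" "regular (m^2) u p (L_expr (m^2) u)" using u by (auto simp: S_def)
    obtain q where q: "v' = hardy m v q" "v \<in> test_functions" "q \<in> test_functions" "regular (m^2) v q (L_expr (m^2) v)" using v by (auto simp: S_def)
    have "regular (m^2) (\<lambda>x. c * u x + d * v x) (\<lambda>x. c * p x + d * q x) (L_expr (m^2) (\<lambda>x. c * u x + d * v x))"
      unfolding L_expr_linear[OF p(2) q(2)] by (rule regular_add[OF regular_scale[OF p(4)] regular_scale[OF q(4)]])
    moreover have "(\<lambda>x. c * u' x + d * v' x) = hardy m (\<lambda>x. c * u x + d * v x) (\<lambda>x. c * p x + d * q x)"
      unfolding hardy_add hardy_scale p(1) q(1) ..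
    moreover have "(\<lambda>x. c * u x + d * v x) \<in> test_functions" "(\<lambda>x. c * p x + d * q x) \<in> test_functions"
      by (intro test_function_add test_function_scale p q)+
    ultimately show ?thesis unfolding S_def by blast
  qed
  have S0: "(p, hardy m p p') \<in> S" if "p \<in> test_functions" "p' \<in> test_functions" "regular (m^2) p p' (L_expr (m^2) p)" for p p'
    using that by (auto simp: S_def)
  obtain p0 where p0: "(\<lambda>x. 0, p0) \<in> S" using regular_test_function[OF test_function_zero] test_function_zero S0 by blast
  have SL: "S \<subseteq> L2 \<times> L2"
    using hardy_form_zero(1)[OF _ m test_function_zero_trace[unfolded zero_trace_def]] by (auto simp: S_def test_function_L2)
  obtain s s' r r' where s: "\<And>n. (s n, s' n) \<in> S" and r: "r \<in> L2" "r' \<in> L2"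
    and lim: "L2_lim (\<lambda>n x. F x - s n x) r" "L2_lim (\<lambda>n x. hardy m F F' x - s' n x) r'"
    and orth: "\<And>y y'. (y, y') \<in> S \<Longrightarrow> L2_inner r y + L2_inner r' y' = 0"
  proof (atomize_elim, goal_cases)
    case 1
    from L2_pair_orthogonal_residual[OF SL _ _ _ FL FhL] show ?case
      using lin[OF p0 p0, of 0 0] lin[of _ _ _ _ 1 1] lin[of _ _ _ _ _ 0] by (simp add: case_prod_beta' Ball_def)
  qed
  have "\<forall>n. \<exists>p. s' n = hardy m (s n) p \<and> s n \<in> test_functions \<and> p \<in> test_functions \<and> regular (m^2) (s n) p (L_expr (m^2) (s n))"
    using s by (auto simp: S_def)
  then obtain p where p: "\<And>n. s' n = hardy m (s n) (p n)" "\<And>n. s n \<in> test_functions" "\<And>n. p n \<in> test_functions"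
    "\<And>n. regular (m^2) (s n) (p n) (L_expr (m^2) (s n))" by metis
  have z: "zero_trace m (s n) (p n)" for n by (rule test_function_zero_trace[OF p(2,3)])
  note form = hardy_form_zero(2)[OF _ m, folded zero_trace_def]
  have d: "regular (m^2) (\<lambda>x. F x - s n x) (\<lambda>x. F' x - p n x) (\<lambda>x. g x - L_expr (m^2) (s n) x)"
    "zero_trace m (\<lambda>x. F x - s n x) (\<lambda>x. F' x - p n x)" for n
    by (rule regular_diff[OF F(1) p(4)], rule zero_trace_diff[OF F(3) z])
  have s'L: "s' n \<in> L2" "s n \<in> L2" for n using s[of n] SL by auto
  note dL = L2_diff[OF FL s'L(2)] L2_diff[OF FhL s'L(1)]
  \<comment> \<open>Orthogonality reads (r, h) + (r', A h) = 0, and (A h, r') equals (L h, r) in the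
    limit; together this is the weak form of L r = - r.\<close>
  have "(r, \<lambda>x. - r x) \<in> adjoint_op (test_op (m^2))"
  proof (rule adjoint_opI[OF r(1) L2_uminus[OF r(1)]])
    fix h k assume hk: "(h, k) \<in> test_op (m^2)"
    then have h: "h \<in> test_functions" "k = L_expr (m^2) h" by (auto simp: test_op_def)
    obtain h' where h': "h' \<in> test_functions" "regular (m^2) h h' k" using regular_test_function[OF h(1)] h(2) by blast
    have hS: "(h, hardy m h h') \<in> S" using S0 h h' by simp
    then have hhL: "hardy m h h' \<in> L2" using SL by auto
    note kL = regularD(2)[OF h'(2)]
    have "L2_inner k (\<lambda>x. F x - s n x) = L2_inner (hardy m h h') (\<lambda>x. hardy m F F' x - s' n x)" for n
      using hardy_inner[OF d h'(2) test_function_zero_trace[OF h(1) h'(1)] m, of n] unfolding hardy_diff p(1) by (metis inner_commute)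
    moreover have "(\<lambda>n. L2_inner k (\<lambda>x. F x - s n x)) \<longlonglongrightarrow> L2_inner k r" by (rule inner_tendsto_right[OF kL dL(1) r(1) lim(1)])
    moreover have "(\<lambda>n. L2_inner (hardy m h h') (\<lambda>x. hardy m F F' x - s' n x)) \<longlonglongrightarrow> L2_inner (hardy m h h') r'"
      by (rule inner_tendsto_right[OF hhL dL(2) r(2) lim(2)])
    ultimately have "L2_inner k r = L2_inner (hardy m h h') r'" using LIMSEQ_unique by simp
    moreover have "L2_inner h r + L2_inner (hardy m h h') r' = 0"
      using arg_cong[OF orth[OF hS], of cnj] by (simp add: inner_commute[of r] inner_commute[of r'])
    ultimately show "L2_inner k r = L2_inner h (\<lambda>x. - r x)" by (simp add: inner_uminus_right eq_neg_iff_add_eq_0 add.commute)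
  qed
  then have "(r, \<lambda>x. - r x) \<in> max_op (m^2)" unfolding adjoint_test_op .
  moreover have "closed_form (friedrichs_op m) r ((L2_norm r')^2)"
  proof (rule closed_formI_factor[where u = "\<lambda>n x. F x - s n x" and h = "\<lambda>n x. hardy m F F' x - s' n x", OF friedrichs_opI[OF d] r(1) dL(2) r(2) lim])
    show "L2_inner (\<lambda>x. F x - s n x) (\<lambda>x. g x - L_expr (m^2) (s n) x) = of_real ((L2_norm (\<lambda>x. hardy m F F' x - s' n x))^2)" for n
      using form[OF d] unfolding hardy_diff p(1) .
    show "L2_inner (\<lambda>x. F x - s i x - (F x - s j x)) (\<lambda>x. g x - L_expr (m^2) (s i) x - (g x - L_expr (m^2) (s j) x)) =
        of_real ((L2_norm (\<lambda>x. hardy m F F' x - s' i x - (hardy m F F' x - s' j x)))^2)" for i j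
      using form[OF regular_diff[OF d(1) d(1)] zero_trace_diff[OF d(2) d(2)]] unfolding hardy_diff p(1) .
  qed
  ultimately have "(r, \<lambda>x. - r x) \<in> friedrichs_op m" by (rule closed_form_friedrichs_op[OF m])
  from friedrichs_op_nonneg(2)[OF m this] have r0: "L2_norm r = 0" by (simp add: inner_uminus_right inner_self)
  have "closed_form (L_min (m^2)) f ((L2_norm (\<lambda>x. hardy m F F' x - r' x))^2)"
  proof (rule closed_formI_factor[where u = s and h = s' and v = "\<lambda>n. L_expr (m^2) (s n)"])
    show "(s n, L_expr (m^2) (s n)) \<in> L_min (m^2)" for n using p(2) test_op_subset_L_min by (auto simp: test_op_def)
    have "L2_dist (s n) f = L2_dist F (s n)" for n unfolding L2_norm_minus_commute[of F "s n"]
    proof (rule L2_norm_cong_AE)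
      show "AE x in half_line. s n x - f x = s n x - F x" using F(2) by eventually_elim simp
    qed (intro L2_measurable L2_diff s'L fL FL)+
    then show "L2_lim s f" using L2_norm_tendsto[OF dL(1) r(1) lim(1)] r0 by simp
    have "(\<lambda>x. s' n x - (hardy m F F' x - r' x)) = (\<lambda>x. - ((hardy m F F' x - s' n x) - r' x))" for n by auto
    then show "(\<lambda>n. L2_norm (\<lambda>x. s' n x - (hardy m F F' x - r' x))) \<longlonglongrightarrow> 0" using lim(2) by (simp only: L2_norm_uminus)
    show "L2_inner (s n) (L_expr (m^2) (s n)) = of_real ((L2_norm (s' n))^2)" for n using form[OF p(4) z] unfolding p(1) .
    show "L2_inner (\<lambda>x. s i x - s j x) (\<lambda>x. L_expr (m^2) (s i) x - L_expr (m^2) (s j) x) = of_real ((L2_dist (s' i) (s' j))^2)" for i j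
      using form[OF regular_diff[OF p(4) p(4)] zero_trace_diff[OF z z]] unfolding hardy_diff p(1) .
  qed (intro fL s'L L2_diff FhL r)+
  then show "(f, g) \<in> friedrichs_extension (L_min (m^2))"
    unfolding friedrichs_extension_def adjoint_L_min using fg friedrichs_op_subset_max_op by blast
qed

lemma friedrichs_op_symmetric:
  assumes m: "0 \<le> m" and fg: "(f, g) \<in> friedrichs_op m" and hk: "(h, k) \<in> friedrichs_op m"
  shows "L2_inner k f = L2_inner h g"
proof -
  obtain F F' where F: "regular (m^2) F F' g" "AE x in half_line. f x = F x" "zero_trace m F F'" "f \<in> L2" "g \<in> L2"
    using fg by (rule friedrichs_opE)
  obtain H H' where H: "regular (m^2) H H' k" "AE x in half_line. h x = H x" "zero_trace m H H'" "h \<in> L2" "k \<in> L2"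
    using hk by (rule friedrichs_opE)
  have "L2_inner k f = L2_inner k F" by (rule inner_cong_AE[OF _ F(2) H(5,5) F(4) regularD(1)[OF F(1)]]) simp
  also have "\<dots> = L2_inner (hardy m H H') (hardy m F F')" using hardy_inner[OF F(1,3) H(1,3) m] by (metis inner_commute)
  also have "\<dots> = L2_inner H g" by (rule hardy_inner[OF H(1,3) F(1,3) m, symmetric])
  also have "\<dots> = L2_inner h g" by (rule inner_cong_AE[OF _ _ regularD(1)[OF H(1)] H(4) F(5,5)]) (use H(2) in \<open>auto elim: AE_mp\<close>)
  finally show ?thesis .
qed

lemma test_op_subset_friedrichs_op: "test_op (m^2) \<subseteq> friedrichs_op m"
proof (rule subrelI)
  fix f g assume fg: "(f, g) \<in> test_op (m^2)"
  then obtain f' where "f \<in> test_functions" "f' \<in> test_functions" "regular (m^2) f f' g" using regular_test_function by (auto simp: test_op_def)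
  then show "(f, g) \<in> friedrichs_op m" using friedrichs_opI test_function_zero_trace by blast
qed

text \<open>For \<open>m \<ge> 1\<close> a nonzero limit \<open>b\<close> of the Wronskian would force \<open>f\<close> to behave like \<open>- b x powr (1/2 - m) / (2 m)\<close>,
  which is not square integrable at \<open>0\<close>.\<close>

lemma regular_zero_trace_ge_1:
  assumes m: "1 \<le> m" and reg: "regular (m^2) f f' g"
  shows "zero_trace m f f'"
proof -
  have Re_zero: "Re b = 0" if reg: "regular (m^2) f f' g" and b: "((\<lambda>x. of_real (x powr (1/2 + m)) * hardy m f f' x) \<longlongrightarrow> b) (at_right 0)" for f f' g b
  proof -
    \<comment> \<open>N is the real part of f / u for u = x powr (1/2 + m), so N' is Re (A f) / u,
      and D is the quotient of the two solutions. l'Hopital's rule then gives the limit of N / D,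
      the real part of f over x powr (1/2 - m).\<close>
    define N D where "N x = x powr - (1/2 + m) * Re (f x)" "D x = x powr (- (2 * m))" for x
    define N' D' where "N' x = x powr - (1/2 + m) * Re (hardy m f f' x)" "D' x = - (2 * m) * x powr (- (2 * m) - 1)" for x
    have dN: "(N has_real_derivative N' x) (at x)" if x: "0 < x" for x
    proof -
      have "((\<lambda>x. Re (f x)) has_real_derivative Re (f' x)) (at x)"
        using bounded_linear.has_vector_derivative[OF bounded_linear_Re regularD(3)[OF reg x]] by (simp add: has_real_derivative_iff_has_vector_derivative)
      from DERIV_mult[OF has_real_derivative_powr[OF x, of "- (1/2 + m)"] this]
      have "(N has_real_derivative (- (1/2 + m)) * x powr (- (1/2 + m) - 1) * Re (f x) + Re (f' x) * x powr - (1/2 + m)) (at x)"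
        unfolding N_D_def[abs_def] .
      moreover have "(- (1/2 + m)) * x powr (- (1/2 + m) - 1) * Re (f x) + Re (f' x) * x powr - (1/2 + m) = N' x"
        using x unfolding powr_diff[of x _ 1] by (simp add: N'_D'_def hardy_def field_simps)
      ultimately show ?thesis by simp
    qed
    have dD: "(D has_real_derivative D' x) (at x)" if x: "0 < x" for x
      using has_real_derivative_powr[OF x, of "- (2 * m)"] unfolding N_D_def[abs_def] N'_D'_def .
    have "((\<lambda>x. N x / D x) \<longlongrightarrow> Re b / (- (2 * m))) (at_right 0)"
    proof (rule lhopital_right_0_at_top)
      show "LIM x (at_right 0). D x :> at_top" unfolding N_D_def using m by real_asymp
      show "\<forall>\<^sub>F x in at_right 0. D' x \<noteq> 0" using m by (intro eventually_at_rightI[of 0 1]) (auto simp: N'_D'_def)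
      show "\<forall>\<^sub>F x in at_right 0. (N has_real_derivative N' x) (at x)" "\<forall>\<^sub>F x in at_right 0. (D has_real_derivative D' x) (at x)"
        using dN dD by (auto intro!: eventually_at_rightI[of 0 1])
      have "\<forall>\<^sub>F x in at_right 0. Re (of_real (x powr (1/2 + m)) * hardy m f f' x) / (- (2 * m)) = N' x / D' x"
      proof (rule eventually_at_rightI[of 0 1])
        fix x :: real assume "x \<in> {0<..<1}"
        then have x: "0 < x" by simp
        have "x powr - (1/2 + m) = x powr ((1/2 + m) + (- (2 * m) - 1))" by (rule arg_cong[of _ _ "\<lambda>t. x powr t"]) simp
        also have "\<dots> = x powr (1/2 + m) * x powr (- (2 * m) - 1)" by (rule powr_add)
        finally show "Re (of_real (x powr (1/2 + m)) * hardy m f f' x) / (- (2 * m)) = N' x / D' x" using x m by (simp add: N'_D'_def)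
      qed simp
      moreover have "((\<lambda>x. Re (of_real (x powr (1/2 + m)) * hardy m f f' x) / (- (2 * m))) \<longlongrightarrow> Re b / (- (2 * m))) (at_right 0)"
        using m by (intro tendsto_divide tendsto_Re b tendsto_const) auto
      ultimately show "((\<lambda>x. N' x / D' x) \<longlongrightarrow> Re b / (- (2 * m))) (at_right 0)" by (rule Lim_transform_eventually[rotated])
    qed
    then have "((\<lambda>x. complex_of_real (N x / D x)) \<longlongrightarrow> complex_of_real (Re b / (- (2 * m)))) (at_right 0)" by (rule tendsto_of_real)
    moreover have "\<forall>\<^sub>F x in at_right 0. complex_of_real (N x / D x) = of_real (x powr (m - 1/2)) * of_real (Re (f x))"
    proof (rule eventually_at_rightI[of 0 1])
      fix x :: real assume "x \<in> {0<..<1}"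
      then have x: "0 < x" by simp
      have "x powr (m - 1/2) = x powr (- (1/2 + m) - (- (2 * m)))" by simp
      also have "\<dots> = x powr - (1/2 + m) / x powr (- (2 * m))" by (rule powr_diff)
      finally show "complex_of_real (N x / D x) = of_real (x powr (m - 1/2)) * of_real (Re (f x))" by (simp add: N_D_def)
    qed simp
    ultimately have lim: "((\<lambda>x. of_real (x powr (m - 1/2)) * of_real (Re (f x))) \<longlongrightarrow> complex_of_real (Re b / (- (2 * m)))) (at_right 0)"
      by (rule Lim_transform_eventually)
    have "complex_of_real (Re b / (- (2 * m))) = 0"
      by (rule L2_weighted_limit_zero[OF regularD(1)[OF regular_Re[OF reg]] regular_continuous[OF regular_Re[OF reg]] _ lim]) (use m in simp)
    then show ?thesis using m by simp
  qed
  obtain b where b: "((\<lambda>x. of_real (x powr (1/2 + m)) * hardy m f f' x) \<longlongrightarrow> b) (at_right 0)"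
    using powr_times_hardy_convergent[OF reg] m by auto
  have "((\<lambda>x. of_real (x powr (1/2 + m)) * hardy m (\<lambda>x. - \<i> * f x) (\<lambda>x. - \<i> * f' x) x) \<longlongrightarrow> - \<i> * b) (at_right 0)"
    using tendsto_mult_left[OF b, of "- \<i>"] unfolding hardy_scale by (simp add: mult_ac)
  from Re_zero[OF regular_scale[OF reg] this] Re_zero[OF reg b] have "b = 0" by (simp add: complex_eq_iff)
  with b show ?thesis by (simp add: zero_trace_def)
qed

text \<open>The boundary condition holds automatically, so the maximal operator is symmetric, and
  its adjoint cannot exceed the maximal operator.\<close>

lemma friedrichs_op_ge_1:
  assumes "1 \<le> m"
  shows "friedrichs_op m = max_op (m^2)" "self_adjoint (friedrichs_op m)"
proof -
  show eq: "friedrichs_op m = max_op (m^2)" using regular_zero_trace_ge_1[OF assms] unfolding friedrichs_op_def max_op_def by blast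
  have "adjoint_op (friedrichs_op m) \<subseteq> friedrichs_op m"
    using adjoint_op_antimono[OF test_op_subset_friedrichs_op[of m]] unfolding adjoint_test_op eq .
  moreover have "friedrichs_op m \<subseteq> adjoint_op (friedrichs_op m)"
  proof (rule subrelI, rule adjoint_opI)
    fix f g assume fg: "(f, g) \<in> friedrichs_op m"
    then show "f \<in> L2" "g \<in> L2" by (auto elim: friedrichs_opE)
    show "L2_inner k f = L2_inner h g" if "(h, k) \<in> friedrichs_op m" for h k using friedrichs_op_symmetric[OF _ fg that] assms by simp
  qed
  ultimately show "self_adjoint (friedrichs_op m)" unfolding self_adjoint_def using densely_defined_if_test_op[OF test_op_subset_friedrichs_op] by blast
qed

text \<open>Near \<open>0\<close> one has \<open>f / u\<^sub>- = (x powr (2 m) W\<^sub>- - W\<^sub>+) / (2 m)\<close> for \<open>u\<^sub>\<plusminus> = x powr (1/2 \<plusminus> m)\<close> and the Wronskians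
  \<open>W\<^sub>\<plusminus>\<close> of \<open>u\<^sub>\<plusminus>\<close> and \<open>f\<close>.\<close>

lemma hardy_form_singular:
  assumes reg: "regular (m^2) f f' g" and m: "0 < m"
    and bp: "((\<lambda>x. of_real (x powr (1/2 + m)) * hardy m f f' x) \<longlongrightarrow> bp) (at_right 0)"
    and bm: "((\<lambda>x. of_real (x powr (1/2 + - m)) * hardy (- m) f f' x) \<longlongrightarrow> bm) (at_right 0)"
  shows "hardy (- m) f f' \<in> L2"
    "L2_inner f g = of_real ((L2_norm (hardy (- m) f f'))^2) - cnj bp * bm / of_real (2 * m)"
proof -
  let ?Wp = "\<lambda>x. of_real (x powr (1/2 + m)) * hardy m f f' x" and ?Wm = "\<lambda>x. of_real (x powr (1/2 + - m)) * hardy (- m) f f' x"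
  let ?B = "\<lambda>x. cnj ((of_real (x powr (2 * m)) * ?Wm x - ?Wp x) / of_real (2 * m)) * ?Wm x"
  have "((\<lambda>x. x powr (2 * m)) \<longlongrightarrow> 0) (at_right 0)" using m by real_asymp
  then have p0: "((\<lambda>x. complex_of_real (x powr (2 * m))) \<longlongrightarrow> 0) (at_right 0)" using tendsto_of_real by fastforce
  have "(?B \<longlongrightarrow> cnj ((0 * bm - bp) / of_real (2 * m)) * bm) (at_right 0)"
    using m by (intro tendsto_mult tendsto_cnj tendsto_divide tendsto_diff tendsto_const p0 bp bm) auto
  moreover have "\<forall>\<^sub>F x in at_right 0. ?B x = cnj (f x) * hardy (- m) f f' x"
  proof (rule eventually_at_rightI[of 0 1])
    fix x :: real assume "x \<in> {0<..<1}"
    then have x: "0 < x" by simp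
    have "x powr (2 * m) * x powr (1/2 + - m) = x powr (1/2 + m)" unfolding powr_add[symmetric] by (rule arg_cong[of _ _ "\<lambda>t. x powr t"]) simp
    then have "complex_of_real (x powr (2 * m)) * ?Wm x - ?Wp x = of_real (x powr (1/2 + m)) * (hardy (- m) f f' x - hardy m f f' x)"
      unfolding right_diff_distrib mult.assoc[symmetric] of_real_mult[symmetric] by simp
    also have "hardy (- m) f f' x - hardy m f f' x = of_real (2 * m / x) * f x" using x by (simp add: hardy_def field_simps)
    finally have eq: "(of_real (x powr (2 * m)) * ?Wm x - ?Wp x) / of_real (2 * m) = of_real (x powr (1/2 + m) / x) * f x" using m by simp
    have "x powr (1/2 + m) / x * x powr (1/2 + - m) = 1" using x powr_add[of x "1/2 + m" "1/2 + - m"] by simp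
    then have "complex_of_real (x powr (1/2 + m) / x) * of_real (x powr (1/2 + - m)) = 1" unfolding of_real_mult[symmetric] by simp
    then show "?B x = cnj (f x) * hardy (- m) f f' x" unfolding eq complex_cnj_mult complex_cnj_complex_of_real by (simp add: mult_ac)
  qed simp
  ultimately have l: "((\<lambda>x. cnj (f x) * hardy (- m) f f' x) \<longlongrightarrow> - (cnj bp * bm / of_real (2 * m))) (at_right 0)"
    using Lim_transform_eventually by fastforce
  have "filterlim (\<lambda>n. inverse (real (Suc n))) (at_right 0) sequentially" unfolding filterlim_at using LIMSEQ_inverse_real_of_nat by auto
  from filterlim_compose[OF l this] have "(\<lambda>n. cnj (f (inverse (real (Suc n)))) * hardy (- m) f f' (inverse (real (Suc n))))
      \<longlonglongrightarrow> - (cnj bp * bm / of_real (2 * m))" .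
  with hardy_form[of "- m" f f' g "\<lambda>n. inverse (real (Suc n))"] reg LIMSEQ_inverse_real_of_nat
  show "hardy (- m) f f' \<in> L2" "L2_inner f g = of_real ((L2_norm (hardy (- m) f f'))^2) - cnj bp * bm / of_real (2 * m)" by auto
qed

subsection \<open>The four phases\<close>

lemma solution_square_integrable:
  fixes u u' :: "real \<Rightarrow> real"
  assumes u: "\<And>x. 0 < x \<Longrightarrow> (u has_real_derivative u' x) (at x)" and r: "- 1 < r" and b: "0 < b"
    and le: "\<And>x. 0 < x \<Longrightarrow> x \<le> b \<Longrightarrow> (u x)^2 \<le> C * x powr r"
  shows "(\<lambda>x. (u x)^2) integrable_on {0<..b}"
proof -
  have "(\<lambda>x. C * x powr r) integrable_on {0..b}"
    using has_integral_powr_from_0[OF r, of b] b by (intro integrable_on_mult_right) (auto simp: integrable_on_def)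
  then have i: "(\<lambda>x. C * x powr r) integrable_on {0<..b}" by (rule integrable_spike_set) (auto intro: negligible_subset[OF negligible_sing[of 0]])
  have "continuous_on {0<..b} (\<lambda>x. (u x)^2)"
    using u by (intro continuous_on_power DERIV_continuous_on[of _ u u']) (auto intro: has_field_derivative_at_within)
  then have "(\<lambda>x. (u x)^2) \<in> borel_measurable (lebesgue_on {0<..b})" by (rule continuous_imp_measurable_on_sets_lebesgue) simp
  from measurable_bounded_by_integrable_imp_absolutely_integrable[OF this _ i] show ?thesis using le by (auto dest: set_lebesgue_integral_eq_integral(1))
qed

lemma exists_regular_cutoffs:
  fixes u1 u1' u2 u2' :: "real \<Rightarrow> real"
  assumes "\<And>x. 0 < x \<Longrightarrow> (u1 has_real_derivative u1' x) (at x)" "\<And>x. 0 < x \<Longrightarrow> (u2 has_real_derivative u2' x) (at x)"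
    and "\<And>x. 0 < x \<Longrightarrow> (u1' has_real_derivative ((- 1/4 + \<alpha>) * (1 / x^2)) * u1 x) (at x)"
    and "\<And>x. 0 < x \<Longrightarrow> (u2' has_real_derivative ((- 1/4 + \<alpha>) * (1 / x^2)) * u2 x) (at x)"
    and "\<And>b. 0 < b \<Longrightarrow> (\<lambda>x. (u1 x)^2) integrable_on {0<..b}" "\<And>b. 0 < b \<Longrightarrow> (\<lambda>x. (u2 x)^2) integrable_on {0<..b}"
  obtains a e1 e1' z1 e2 e2' z2 where "0 < a" "regular \<alpha> e1 e1' z1" "regular \<alpha> e2 e2' z2"
    "\<And>x. 0 < x \<Longrightarrow> x \<le> a \<Longrightarrow> e1 x = of_real (u1 x) \<and> e1' x = of_real (u1' x) \<and> z1 x = 0"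
    "\<And>x. 0 < x \<Longrightarrow> x \<le> a \<Longrightarrow> e2 x = of_real (u2 x) \<and> e2' x = of_real (u2' x) \<and> z2 x = 0"
proof -
  let ?N = "\<lambda>u u' e e' z a. regular \<alpha> e e' z \<and> 0 < a \<and> (\<forall>x. 0 < x \<longrightarrow> x \<le> a \<longrightarrow> e x = of_real (u x) \<and> e' x = of_real (u' x) \<and> z x = 0)"
  have "\<exists>e e' z a. ?N u1 u1' e e' z a" "\<exists>e e' z a. ?N u2 u2' e e' z a" by (rule exists_regular_cutoff; rule assms; assumption)+
  then obtain e1 e1' z1 a1 e2 e2' z2 a2 where 1: "?N u1 u1' e1 e1' z1 a1" "?N u2 u2' e2 e2' z2 a2" by (elim exE)
  show thesis by (rule that[of "min a1 a2" e1 e1' z1 e2 e2' z2]) (use 1 in auto)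
qed

context limit_circle
begin

lemma real_boundary_values:
  assumes reg: "regular \<alpha> (\<lambda>x. of_real (p x)) (\<lambda>x. of_real (p' x)) g"
  shows "b1 (\<lambda>x. of_real (p x)) g \<in> \<real>" "b2 (\<lambda>x. of_real (p x)) g \<in> \<real>"
proof -
  show "b1 (\<lambda>x. of_real (p x)) g \<in> \<real>" "b2 (\<lambda>x. of_real (p x)) g \<in> \<real>"
    by (rule Lim_in_closed_set[OF closed_complex_Reals _ _ b_tendsto(1)[OF reg]] Lim_in_closed_set[OF closed_complex_Reals _ _ b_tendsto(2)[OF reg]];
        simp add: Reals_diff Reals_mult)+
qed

lemma exists_negative_eigenvector:
  assumes "\<alpha> < 1"
  obtains \<psi> \<psi>' \<beta> where "regular \<alpha> \<psi> \<psi>' (\<lambda>x. - \<psi> x)"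
    "0 < L2_norm \<psi>" "\<beta> \<noteq> 0"
    "b1 \<psi> (\<lambda>x. - \<psi> x) = of_real (Re \<beta>)" "b2 \<psi> (\<lambda>x. - \<psi> x) = of_real (Im \<beta>)"
    "\<forall>\<tau> z. z \<noteq> 0 \<longrightarrow> (energy \<tau> \<in> eigenvalues (ext z) \<longleftrightarrow> Im (cnj z * G \<tau> \<beta>) = 0)"
proof -
  obtain p p' where reg: "regular \<alpha> (\<lambda>x. of_real (p x)) (\<lambda>x. of_real (p' x)) (\<lambda>x. - of_real (p x))"
    and nz: "\<not> (AE x in half_line. complex_of_real (p x) = 0)"
    using exists_negative_energy_solution[OF assms] by blast
  define \<beta> where "\<beta> = Complex (Re (b1 (\<lambda>x. of_real (p x)) (\<lambda>x. - of_real (p x)))) (Re (b2 (\<lambda>x. of_real (p x)) (\<lambda>x. - of_real (p x))))"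
  have \<beta>: "b1 (\<lambda>x. of_real (p x)) (\<lambda>x. - of_real (p x)) = of_real (Re \<beta>)" "b2 (\<lambda>x. of_real (p x)) (\<lambda>x. - of_real (p x)) = of_real (Im \<beta>)"
    using real_boundary_values[OF reg] by (simp_all add: \<beta>_def)
  note M = regular_max_op[OF reg]
  have "\<beta> \<noteq> 0" using eigenfunction_boundary_values_zero[of "\<lambda>x. of_real (p x)" "-1"] M \<beta> nz by auto
  moreover have "0 < L2_norm (\<lambda>x. complex_of_real (p x))"
    using L2_norm_eq_0_iff[OF regularD(1)[OF reg]] nz L2_norm_nonneg[of "\<lambda>x. complex_of_real (p x)"] by linarith
  ultimately show thesis using that[OF reg _ _ \<beta>] negative_eigenvalue_iff[OF M nz \<beta>] by blast
qed

lemma extension_ext: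
  assumes "H \<in> extensions"
  obtains z where "z \<noteq> 0" "H = ext z"
  using sa_extension_is_ext[OF assms] by blast

lemma ext_self_adjoint: "z \<noteq> 0 \<Longrightarrow> self_adjoint (ext z)" using ext_sa_extension sa_extensions_L_min_iff by blast

lemma ext_fixed_iff:
  assumes z: "z \<noteq> 0"
  shows "ext z \<in> rg_fixed_points \<alpha> \<longleftrightarrow> (\<forall>\<tau>. ext (G \<tau> z) = ext z)"
  using ext_sa_extension[OF z] by (simp add: rg_fixed_points_def rg_ext[OF z])

lemma negative_eigenvalue_not_nonneg:
  assumes "self_adjoint H" "energy \<tau> \<in> eigenvalues H"
  shows "\<not> nonneg_op H"
proof
  assume nn: "nonneg_op H"
  obtain f where f: "(f, \<lambda>x. of_real (- exp (2 * \<tau>)) * f x) \<in> H" "\<not> (AE x in half_line. f x = 0)"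
    using assms(2) by (auto simp: eigenvalues_def)
  have "0 \<le> Re (L2_inner f (\<lambda>x. of_real (- exp (2 * \<tau>)) * f x))" using nn f(1) by (auto simp: nonneg_op_def)
  then have "exp (2 * \<tau>) * (L2_norm f)^2 \<le> 0" unfolding inner_scale_right inner_self of_real_mult[symmetric] Re_complex_of_real by simp
  then have "L2_norm f = 0" by (simp add: mult_le_0_iff)
  then show False using f(2) L2_norm_eq_0_iff[OF self_adjointD(1)[OF assms(1) f(1)]] by simp
qed

end

text \<open>\<open>B\<close> stands for a boundary pairing. The sign of s is left open so that s = -
  m yields the trace belonging to the more singular solution.\<close>

lemma friedrichs_op_eq:
  assumes lim: "\<And>F F' g. regular (s^2) F F' g \<Longrightarrow>
      ((\<lambda>x. of_real (x powr (1/2 + s)) * F' x - of_real ((1/2 + s) * x powr (s - 1/2)) * F x) \<longlongrightarrow> B F g) (at_right 0)"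
    and cong: "\<And>f F g. AE x in half_line. f x = F x \<Longrightarrow> f \<in> L2 \<Longrightarrow> F \<in> L2 \<Longrightarrow> B f g = B F g"
  shows "regular (s^2) F F' g \<Longrightarrow> ((\<lambda>x. of_real (x powr (1/2 + s)) * hardy s F F' x) \<longlongrightarrow> B F g) (at_right 0)"
    and "friedrichs_op s = {(f, g) \<in> max_op (s^2). B f g = 0}"
proof -
  have tr: "((\<lambda>x. of_real (x powr (1/2 + s)) * hardy s F F' x) \<longlongrightarrow> B F g) (at_right 0)" if "regular (s^2) F F' g" for F F' g
    by (rule Lim_transform_eventually[OF lim[OF that] eventually_at_rightI[of 0 1]]) (simp_all add: powr_times_hardy del: of_real_mult of_real_add of_real_divide)
  then show "regular (s^2) F F' g \<Longrightarrow> ((\<lambda>x. of_real (x powr (1/2 + s)) * hardy s F F' x) \<longlongrightarrow> B F g) (at_right 0)" .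
  have z: "zero_trace s F F' \<longleftrightarrow> B F g = 0" if "regular (s^2) F F' g" for F F' g
    unfolding zero_trace_def using tr[OF that] tendsto_unique[OF trivial_limit_at_right_real tr[OF that]] by metis
  show "friedrichs_op s = {(f, g) \<in> max_op (s^2). B f g = 0}" unfolding friedrichs_op_def max_op_def using z cong regularD(1) by fastforce
qed

section \<open>The phase 0 < \<alpha> < 1\<close>

lemma Im_divide_cnj: "0 < Im (z / cnj z) \<longleftrightarrow> 0 < Re z * Im z" "Im (z / cnj z) < 0 \<longleftrightarrow> Re z * Im z < 0"
proof -
  have "Im (z / cnj z) = 2 * (Re z * Im z) / ((Re z)^2 + (Im z)^2)" by (simp add: Im_divide)
  moreover have "0 < (Re z)^2 + (Im z)^2 \<or> z = 0" by (simp add: sum_power2_gt_zero_iff complex_eq_iff)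
  ultimately show "0 < Im (z / cnj z) \<longleftrightarrow> 0 < Re z * Im z" "Im (z / cnj z) < 0 \<longleftrightarrow> Re z * Im z < 0"
    by (auto simp: zero_less_divide_iff divide_less_0_iff mult.commute[of "Im z"])
qed

text \<open>The solutions are x powr (1/2 - m) and x powr (1/2 + m), on which dilations act
  diagonally. \<open>ext 1\<close> is the condition b2 = 0 (Friedrichs), \<open>ext \<i>\<close> the
  condition b1 = 0 (Krein).\<close>

locale liquid =
  limit_circle "m^2" "2 * m" a "\<lambda>x. x powr (1/2 + - m)" "\<lambda>x. (1/2 + - m) * x powr (- m - 1/2)"
    "\<lambda>x. x powr (1/2 + m)" "\<lambda>x. (1/2 + m) * x powr (m - 1/2)" e1 e1' z1 e2 e2' z2
    "\<lambda>\<tau>. exp (\<tau> * (1 + m))" "\<lambda>_. 0" "\<lambda>_. 0" "\<lambda>\<tau>. exp (\<tau> * (1 - m))"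
  for m a :: real and e1 e1' z1 e2 e2' z2 +
  assumes m: "0 < m" "m < 1"

lemma liquid_exists:
  assumes m: "0 < m" "m < 1"
  shows "\<exists>a e1 e1' z1 e2 e2' z2. liquid m a e1 e1' z1 e2 e2' z2"
proof -
  note d1 = powr_solution_deriv[of _ "- m", unfolded power2_minus] and d2 = powr_solution_deriv[of _ m]
  have sq: "(x powr r)^2 \<le> 1 * x powr (2 * r)" for x r :: real by (simp add: power2_eq_square powr_add[symmetric])
  have i: "(\<lambda>x. (x powr (1/2 + - m))^2) integrable_on {0<..b}" "(\<lambda>x. (x powr (1/2 + m))^2) integrable_on {0<..b}" if "0 < b" for b
    by (rule solution_square_integrable[OF d1(1) _ that sq], use m in simp_all, rule solution_square_integrable[OF d2(1) _ that sq], use m in simp_all)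
  have dil: "(exp \<tau> * x) powr r = exp (\<tau> * r) * x powr r" if "0 < x" for \<tau> x r :: real using that by (simp add: powr_mult exp_powr_real)
  have dil': "exp A * (exp B * (exp \<tau> * x) powr r) = x powr r" if "0 < x" "A + B + \<tau> * r = 0" for A B \<tau> x r :: real
  proof -
    have "exp (A + B + \<tau> * r) = 1" using that(2) by simp
    then show ?thesis using that(1) unfolding exp_add by (simp add: dil mult.assoc[symmetric])
  qed
  show ?thesis
  proof (rule exists_regular_cutoffs[OF d1(1) d2(1) d1(2) d2(2) i])
    fix a e1 e1' z1 e2 e2' z2 assume e: "0 < a" "regular (m^2) e1 e1' z1" "regular (m^2) e2 e2' z2"
    "\<And>x. 0 < x \<Longrightarrow> x \<le> a \<Longrightarrow> e1 x = of_real (x powr (1/2 + - m)) \<and> e1' x = of_real ((1/2 + - m) * x powr (- m - 1/2)) \<and> z1 x = 0"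
    "\<And>x. 0 < x \<Longrightarrow> x \<le> a \<Longrightarrow> e2 x = of_real (x powr (1/2 + m)) \<and> e2' x = of_real ((1/2 + m) * x powr (m - 1/2)) \<and> z2 x = 0"
  have "liquid m a e1 e1' z1 e2 e2' z2"
  proof (unfold_locales, goal_cases)
    case (7 x)
    have "x powr (1/2 + - m) * x powr (m - 1/2) = 1" "x powr (- m - 1/2) * x powr (1/2 + m) = 1" using 7 by (simp_all add: powr_add[symmetric])
    then have "(1/2 + m) * (x powr (1/2 + - m) * x powr (m - 1/2)) - (1/2 + - m) * (x powr (- m - 1/2) * x powr (1/2 + m)) = 2 * m" by simp
    then show ?case by (simp only: mult_ac)
  next
    case (8 \<tau> x)
    then show ?case using dil'[of x "- 3 * \<tau> / 2" "\<tau> * (1 + m)" \<tau> "1/2 + - m"] by (simp add: field_simps)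
  next
    case (9 \<tau> x)
    then show ?case using dil'[of x "- \<tau> / 2" "\<tau> * (1 + m)" \<tau> "- m - 1/2"] by (simp add: field_simps)
  next
    case (10 \<tau> x)
    then show ?case using dil'[of x "- 3 * \<tau> / 2" "\<tau> * (1 - m)" \<tau> "1/2 + m"] by (simp add: field_simps)
  next
    case (11 \<tau> x)
    then show ?case using dil'[of x "- \<tau> / 2" "\<tau> * (1 - m)" \<tau> "m - 1/2"] by (simp add: field_simps)
  qed (use e m in \<open>auto intro!: continuous_intros\<close>)
    then show ?thesis by blast
  qed
qed

context liquid
begin

lemma traces:
  assumes "regular (m^2) F F' g"
  shows "((\<lambda>x. of_real (x powr (1/2 + - m)) * hardy (- m) F F' x) \<longlongrightarrow> b1 F g) (at_right 0)"
    "((\<lambda>x. of_real (x powr (1/2 + m)) * hardy m F F' x) \<longlongrightarrow> b2 F g) (at_right 0)"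
  using friedrichs_op_eq(1)[of "- m" b1, OF _ b_cong_AE(1)] friedrichs_op_eq(1)[of m b2, OF _ b_cong_AE(2)] b_tendsto assms by simp_all

lemma ext_friedrichs: "ext 1 = friedrichs_op m" using friedrichs_op_eq(2)[of m b2, OF b_tendsto(2) b_cong_AE(2)] by (auto simp: ext_def)

lemma ext_krein: "(f, g) \<in> ext \<i> \<longleftrightarrow> (f, g) \<in> max_op (m^2) \<and> b1 f g = 0" by (auto simp: ext_def)

lemma form:
  assumes "regular (m^2) F F' g"
  shows "hardy (- m) F F' \<in> L2" "L2_inner F g = of_real ((L2_norm (hardy (- m) F F'))^2) - cnj (b2 F g) * b1 F g / of_real (2 * m)"
  using hardy_form_singular[OF assms m(1) traces(2,1)[OF assms]] by auto

text \<open>The form identity for the solution at energy -1 has a negative left side, so its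
  boundary term forces Re \<beta> Im \<beta> > 0. The diagonal flow only changes the slope of
  \<beta>, by the factor exp (2 m \<tau>), so k is Re \<beta> / Im \<beta>.\<close>

lemma eigenvalue_criterion:
  obtains k where "0 < k" "\<forall>\<tau> z. z \<noteq> 0 \<longrightarrow>
    (energy \<tau> \<in> eigenvalues (ext z) \<longleftrightarrow> Re z = k * exp (2 * m * \<tau>) * Im z)"
proof -
  have "m^2 < 1" using m by (simp add: power_less_one_iff)
  then obtain \<psi> \<psi>' \<beta> where reg: "regular (m^2) \<psi> \<psi>' (\<lambda>x. - \<psi> x)"
    and n: "0 < L2_norm \<psi>" "\<beta> \<noteq> 0"
    and \<beta>: "b1 \<psi> (\<lambda>x. - \<psi> x) = of_real (Re \<beta>)" "b2 \<psi> (\<lambda>x. - \<psi> x) = of_real (Im \<beta>)"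
    and ev: "\<forall>\<tau> z. z \<noteq> 0 \<longrightarrow> (energy \<tau> \<in> eigenvalues (ext z) \<longleftrightarrow> Im (cnj z * G \<tau> \<beta>) = 0)"
    by (rule exists_negative_eigenvector)
  define h where "h = hardy (- m) \<psi> \<psi>'"
  have "- ((L2_norm \<psi>)^2) = (L2_norm h)^2 - Im \<beta> * Re \<beta> / (2 * m)"
    using arg_cong[OF form(2)[OF reg], of Re] unfolding \<beta> inner_uminus_right inner_self h_def[symmetric]
    by (simp flip: of_real_mult of_real_divide of_real_diff of_real_power)
  then have "Im \<beta> * Re \<beta> / (2 * m) > 0" using zero_le_power2[of "L2_norm h"] zero_less_power[OF n(1), of 2] by linarith
  then have pos: "Re \<beta> * Im \<beta> > 0" using m by (auto simp add: zero_less_divide_iff zero_less_mult_iff)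
  show thesis
  proof (rule that[of "Re \<beta> / Im \<beta>"])
    show "0 < Re \<beta> / Im \<beta>" using pos by (auto simp: zero_less_mult_iff zero_less_divide_iff)
    show "\<forall>\<tau> z. z \<noteq> 0 \<longrightarrow>
      (energy \<tau> \<in> eigenvalues (ext z) \<longleftrightarrow> Re z = Re \<beta> / Im \<beta> * exp (2 * m * \<tau>) * Im z)"
    proof (intro allI impI)
    fix \<tau> z assume z: "(z :: complex) \<noteq> 0"
    have "Im (cnj z * G \<tau> \<beta>) = exp (\<tau> * (1 - m)) * (Re z * Im \<beta> - exp (2 * m * \<tau>) * (Im z * Re \<beta>))"
    proof -
      have "exp (\<tau> * (1 + m)) = exp (\<tau> * (1 - m)) * exp (2 * m * \<tau>)" by (simp add: exp_add[symmetric] algebra_simps)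
      then show ?thesis unfolding G_def by (simp add: algebra_simps)
    qed
    have \<beta>0: "Im \<beta> \<noteq> 0" using pos by auto
    from \<open>Im (cnj z * G \<tau> \<beta>) = _\<close> have eq: "Im (cnj z * G \<tau> \<beta>) = 0 \<longleftrightarrow> Re z * Im \<beta> = exp (2 * m * \<tau>) * (Im z * Re \<beta>)" by simp
    then show "energy \<tau> \<in> eigenvalues (ext z) \<longleftrightarrow> Re z = Re \<beta> / Im \<beta> * exp (2 * m * \<tau>) * Im z"
      unfolding ev[rule_format, OF z] eq using \<beta>0 by (auto simp: field_simps)
    qed
  qed
qed

lemma eigenvalues_negative:
  assumes "z \<noteq> 0" "l \<in> eigenvalues (ext z)"
  shows "\<exists>\<tau>. l = energy \<tau>"
  by (rule eigenvalue_negative[OF ext_self_adjoint[OF assms(1)] sa_extension_subset_max_op[OF ext_sa_extension[OF assms(1)]] _ _ assms(2)])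
    (use m in auto)

lemma one_eigenvalue:
  assumes z: "0 < Re z * Im z"
  shows "\<exists>\<tau>. eigenvalues (ext z) = {energy \<tau>}"
proof -
  obtain k where k: "0 < k" "\<forall>\<tau> z. z \<noteq> 0 \<longrightarrow>
    (energy \<tau> \<in> eigenvalues (ext z) \<longleftrightarrow> Re z = k * exp (2 * m * \<tau>) * Im z)" by (rule eigenvalue_criterion)
  have z0: "z \<noteq> 0" "Im z \<noteq> 0" using z by auto
  define t where "t = ln (Re z / (k * Im z)) / (2 * m)"
  have pos: "0 < Re z / (k * Im z)" using z k(1) by (auto simp: zero_less_mult_iff zero_less_divide_iff mult_less_0_iff)
  have aux: "0 < X \<Longrightarrow> exp y = X \<longleftrightarrow> y = ln X" for X y :: real by auto
  have iff: "energy \<tau> \<in> eigenvalues (ext z) \<longleftrightarrow> \<tau> = t" for \<tau>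
  proof -
    have "Re z = k * exp (2 * m * \<tau>) * Im z \<longleftrightarrow> exp (2 * m * \<tau>) = Re z / (k * Im z)" using k(1) z0 by (auto simp: field_simps)
    also have "\<dots> \<longleftrightarrow> 2 * m * \<tau> = ln (Re z / (k * Im z))" by (rule aux[OF pos])
    also have "\<dots> \<longleftrightarrow> \<tau> = t" using m by (auto simp: t_def field_simps)
    finally show ?thesis unfolding k(2)[rule_format, OF z0(1)] .
  qed
  have "l \<in> eigenvalues (ext z) \<longleftrightarrow> l = energy t" for l using eigenvalues_negative[OF z0(1), of l] iff by metis
  then show ?thesis by (intro exI[of _ t]) auto
qed

lemma no_eigenvalue:
  assumes z: "Re z * Im z < 0"
  shows "eigenvalues (ext z) = {}"
proof -
  obtain k where k: "0 < k" "\<forall>\<tau> z. z \<noteq> 0 \<longrightarrow>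
    (energy \<tau> \<in> eigenvalues (ext z) \<longleftrightarrow> Re z = k * exp (2 * m * \<tau>) * Im z)" by (rule eigenvalue_criterion)
  have z0: "z \<noteq> 0" using z by auto
  have "Re z \<noteq> k * exp (2 * m * \<tau>) * Im z" for \<tau>
  proof
    assume "Re z = k * exp (2 * m * \<tau>) * Im z"
    then have "Re z * Im z = k * exp (2 * m * \<tau>) * (Im z)^2" by (simp add: power2_eq_square)
    then show False using z k(1) by (simp add: mult_less_0_iff)
  qed
  then show ?thesis using k(2) z0 eigenvalues_negative[OF z0] by blast
qed

text \<open>A nonnegative extension has no negative eigenvalue, hence Re z Im z <= 0, and the
  boundary term it adds to the form is nonnegative. This is why the form without boundary term is
  the least one.\<close>

lemma nonneg_form_bound:
  assumes "nonneg_op (ext z)" "(F, g) \<in> ext z" "regular (m^2) F F' g" and z: "z \<noteq> 0"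
  shows "(L2_norm (hardy (- m) F F'))^2 \<le> Re (L2_inner F g)"
proof -
  have "Re z * Im z \<le> 0"
    using one_eigenvalue[of z] negative_eigenvalue_not_nonneg[OF ext_self_adjoint[OF z]] assms(1) by (auto simp: not_le[symmetric])
  obtain c where c: "b1 F g = c * of_real (Re z)" "b2 F g = c * of_real (Im z)" by (rule ext_proportional[OF assms(2) z])
  have "cnj (b2 F g) * b1 F g = of_real ((norm c)^2 * (Re z * Im z))" unfolding c of_real_mult complex_norm_square by (simp add: mult_ac)
  then have "Re (L2_inner F g) = (L2_norm (hardy (- m) F F'))^2 - (norm c)^2 * (Re z * Im z) / (2 * m)"
    unfolding form(2)[OF assms(3)] by (simp flip: of_real_mult of_real_divide of_real_diff of_real_power)
  moreover have "(norm c)^2 * (Re z * Im z) / (2 * m) \<le> 0"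
    using m by (intro divide_nonpos_pos[OF mult_nonneg_nonpos[OF _ \<open>Re z * Im z \<le> 0\<close>]]) auto
  ultimately show ?thesis by linarith
qed

text \<open>Dilations make the norm and the form of the cut-off \<open>x powr (1/2 + m)\<close> small compared with its boundary value,
  so elements of other extensions can be moved into the Krein extension.\<close>

lemma small_correction:
  assumes r: "0 < r"
  shows "\<exists>D D' k. regular (m^2) D D' k \<and> b1 D k = c \<and> L2_norm D < r \<and> L2_norm (hardy (- m) D D') < r"
proof -
  define N where "N = L2_norm e2 * L2_norm z2"
  define Q where "Q = norm c / (2 * m)"
  have N: "0 \<le> N" and Q: "0 \<le> Q" using m by (simp_all add: N_def Q_def)
  have "((\<lambda>t. exp (- t * (1 + m))) \<longlongrightarrow> 0) at_top" using m by real_asymp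
  from tendsto_mult_left_zero[OF tendsto_mult_right_zero[OF this]]
  have "((\<lambda>t. Q * exp (- t * (1 + m)) * L2_norm e2) \<longlongrightarrow> 0) at_top" .
  moreover have "((\<lambda>t. exp (- t * m)) \<longlongrightarrow> 0) at_top" using m by real_asymp
  from tendsto_mult_left_zero[OF tendsto_mult_right_zero[OF this]]
  have "((\<lambda>t. Q * exp (- t * m) * sqrt N) \<longlongrightarrow> 0) at_top" .
  ultimately have "\<forall>\<^sub>F t in at_top. Q * exp (- t * (1 + m)) * L2_norm e2 < r" "\<forall>\<^sub>F t in at_top. Q * exp (- t * m) * sqrt N < r"
    using r by (auto dest: order_tendstoD(2))
  then have "\<forall>\<^sub>F t in at_top. Q * exp (- t * (1 + m)) * L2_norm e2 < r \<and> Q * exp (- t * m) * sqrt N < r" by eventually_elim simp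
  then obtain t where t: "Q * exp (- t * (1 + m)) * L2_norm e2 < r" "Q * exp (- t * m) * sqrt N < r" by (auto simp: eventually_at_top_linorder)
  define E E' k where "E = dilation t e2" "E' = (\<lambda>x. complex_of_real (exp (3 * t / 2)) * e2' (exp t * x))"
    "k = (\<lambda>x. complex_of_real (exp (2 * t)) * dilation t z2 x)"
  have reg: "regular (m^2) E E' k" unfolding E_E'_k_def by (rule regular_dilation[OF reg2])
  have b: "b1 E k = of_real (exp (t * (1 + m)) * (2 * m))" "b2 E k = 0"
    using b_dilation[OF regular_max_op[OF reg2], of t] b_e by (simp_all add: E_E'_k_def)
  have "(L2_norm (hardy (- m) E E'))^2 = norm (L2_inner E k)" using form(2)[OF reg] b(2) by (simp add: norm_power)
  also have "\<dots> \<le> L2_norm E * L2_norm k" by (rule L2_Cauchy_Schwarz[OF regularD(1,2)[OF reg]])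
  also have "L2_norm E = L2_norm e2" unfolding E_E'_k_def by (rule L2_dilation(2)[OF e_L2(3)])
  also have "L2_norm k = (exp t)^2 * L2_norm z2" unfolding E_E'_k_def L2_norm_scale L2_dilation(2)[OF e_L2(4)] by (simp add: exp_double norm_power)
  also have "L2_norm e2 * ((exp t)^2 * L2_norm z2) = (exp t * sqrt N)^2" using N by (simp add: power_mult_distrib N_def)
  finally have hE: "L2_norm (hardy (- m) E E') \<le> exp t * sqrt N" by (rule power2_le_imp_le) (use N in simp)
  \<comment> \<open>Normalizes the boundary value to c. The coefficient decays like exp (- t (1 +
    m)), while the image of E under the factor grows at most like exp t, so the product still decays
    like exp (- t m).\<close>
  define d where "d = c / of_real (exp (t * (1 + m)) * (2 * m))"
  have nd: "norm d = Q * exp (- t * (1 + m))"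
  proof -
    have "exp (- t * (1 + m)) = 1 / exp (t * (1 + m))" using exp_minus[of "t * (1 + m)"] by (simp add: divide_inverse)
    then show ?thesis using m by (simp add: d_def Q_def norm_divide norm_mult)
  qed
  have "L2_norm (\<lambda>x. d * E x) < r" using t(1) by (simp add: L2_norm_scale nd E_E'_k_def L2_dilation(2) e_L2)
  moreover have "L2_norm (hardy (- m) (\<lambda>x. d * E x) (\<lambda>x. d * E' x)) < r"
  proof -
    have "norm d * L2_norm (hardy (- m) E E') \<le> (Q * exp (- t * (1 + m))) * (exp t * sqrt N)" unfolding nd using hE Q by (intro mult_left_mono) auto
    also have "\<dots> = Q * exp (- t * m) * sqrt N"
    proof -
      have "exp (- t * (1 + m)) * exp t = exp (- t * m)" by (simp add: exp_add[symmetric] algebra_simps)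
      then show ?thesis by (simp add: mult_ac)
    qed
    finally show ?thesis using t(2) unfolding hardy_scale L2_norm_scale by linarith
  qed
  moreover have "b1 (\<lambda>x. d * E x) (\<lambda>x. d * k x) = c" unfolding b_scale b using m by (simp add: d_def)
  ultimately show ?thesis using regular_scale[OF reg] by blast
qed

lemma regular_in_ext:
  assumes "z \<noteq> 0" "(f, g) \<in> ext z" "regular (m^2) F F' g" "AE x in half_line. f x = F x"
  shows "(F, g) \<in> ext z" using self_adjoint_cong_AE[OF ext_self_adjoint[OF assms(1)] assms(2) regularD(1,2)[OF assms(3)] assms(4)] by simp

lemma krein_nonneg: "nonneg_op (ext \<i>)" unfolding nonneg_op_def
proof (intro ballI, clarify)
  fix f g assume fg: "(f, g) \<in> ext \<i>"
  then obtain F F' where F: "regular (m^2) F F' g" "AE x in half_line. f x = F x" "f \<in> L2" "g \<in> L2" unfolding ext_krein using max_opE by metis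
  have "b1 F g = 0" using regular_in_ext[OF _ fg F(1,2)] by (simp add: ext_krein)
  then have "L2_inner f g = of_real ((L2_norm (hardy (- m) F F'))^2)"
    using inner_cong_AE[OF F(2) _ F(3) regularD(1)[OF F(1)] F(4,4)] form(2)[OF F(1)] by simp
  then show "L2_inner f g \<in> \<real> \<and> 0 \<le> Re (L2_inner f g)" by simp
qed

text \<open>Along a form-Cauchy sequence of \<open>ext z\<close> the images under the factor
  converge, with limiting squared norm at most q. Subtracting corrections with the same
  \<open>b1\<close> and vanishing norms moves the sequence into \<open>ext \<i>\<close> without
  changing either limit.\<close>

lemma krein_form_le:
  assumes z: "z \<noteq> 0" and nn: "nonneg_op (ext z)"
  shows "form_le (ext \<i>) (ext z)" unfolding form_le_def
proof (intro allI impI)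
  fix f q assume "closed_form (ext z) f q"
  then obtain u v where f: "f \<in> L2" and uv: "\<And>n::nat. (u n, v n) \<in> ext z" and lim: "L2_lim u f"
    and cau: "\<And>e. e > 0 \<Longrightarrow> \<exists>N. \<forall>i\<ge>N. \<forall>j\<ge>N. norm (L2_inner (\<lambda>x. u i x - u j x) (\<lambda>x. v i x - v j x)) < e"
    and q: "(\<lambda>n. Re (L2_inner (u n) (v n))) \<longlonglongrightarrow> q"
    unfolding closed_form_def by blast
  note sa = ext_self_adjoint[OF z]
  have uL: "u n \<in> L2" "v n \<in> L2" for n using self_adjointD(1,2)[OF sa uv] by auto
  have "\<forall>n. \<exists>U U'. regular (m^2) U U' (v n) \<and> (AE x in half_line. u n x = U x)" using uv by (auto simp: ext_def max_op_def)
  then obtain U U' where U: "\<And>n. regular (m^2) (U n) (U' n) (v n)" "\<And>n. AE x in half_line. u n x = U n x" by metis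
  note UL = regularD(1)[OF U(1)]
  have Uz: "(U n, v n) \<in> ext z" for n by (rule regular_in_ext[OF z uv U])
  let ?h = "\<lambda>n. hardy (- m) (U n) (U' n)"
  note hL = form(1)[OF U(1)]
  have bound: "(L2_dist (?h i) (?h j))^2 \<le> norm (L2_inner (\<lambda>x. u i x - u j x) (\<lambda>x. v i x - v j x))" for i j
  proof -
    have ae: "AE x in half_line. u i x - u j x = U i x - U j x" using U(2)[of i] U(2)[of j] by eventually_elim simp
    have "(L2_dist (?h i) (?h j))^2 \<le> Re (L2_inner (\<lambda>x. U i x - U j x) (\<lambda>x. v i x - v j x))"
      using nonneg_form_bound[OF nn self_adjoint_diff[OF sa Uz Uz] regular_diff[OF U(1) U(1)] z] unfolding hardy_diff .
    also have "L2_inner (\<lambda>x. U i x - U j x) (\<lambda>x. v i x - v j x) = L2_inner (\<lambda>x. u i x - u j x) (\<lambda>x. v i x - v j x)"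
      by (rule inner_cong_AE[OF ae _ L2_diff[OF uL(1) uL(1)] L2_diff[OF UL UL] L2_diff[OF uL(2) uL(2)] L2_diff[OF uL(2) uL(2)], symmetric]) simp
    also have "Re \<dots> \<le> norm \<dots>" by (rule complex_Re_le_cmod)
    finally show ?thesis .
  qed
  have "\<exists>e\<in>L2. L2_lim ?h e" by (rule L2_complete_sq[OF hL bound cau])
  then obtain e where e: "e \<in> L2" "L2_lim ?h e" by blast
  have "(L2_norm (?h n))^2 \<le> Re (L2_inner (u n) (v n))" for n
  proof -
    have "L2_inner (u n) (v n) = L2_inner (U n) (v n)" by (rule inner_cong_AE[OF U(2) _ uL(1) UL uL(2) uL(2)]) simp
    with nonneg_form_bound[OF nn Uz U(1) z] show ?thesis by simp
  qed
  then have le: "(L2_norm e)^2 \<le> q" by (intro LIMSEQ_le[OF tendsto_power[OF L2_norm_tendsto[OF hL e]] q]) auto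
  have "\<forall>n. \<exists>D D' k. regular (m^2) D D' k \<and> b1 D k = b1 (U n) (v n) \<and> L2_norm D < inverse (real (Suc n)) \<and>
      L2_norm (hardy (- m) D D') < inverse (real (Suc n))" using small_correction by simp
  then obtain D D' k where D: "\<And>n. regular (m^2) (D n) (D' n) (k n)" "\<And>n. b1 (D n) (k n) = b1 (U n) (v n)"
    "\<And>n. L2_norm (D n) < inverse (real (Suc n))" "\<And>n. L2_norm (hardy (- m) (D n) (D' n)) < inverse (real (Suc n))"
    by metis
  let ?k = "\<lambda>n. hardy (- m) (D n) (D' n)"
  note DL = regularD(1,2)[OF D(1)] and kL = form(1)[OF D(1)]
  have D0: "(\<lambda>n. L2_norm (D n)) \<longlonglongrightarrow> 0" "(\<lambda>n. L2_norm (?k n)) \<longlonglongrightarrow> 0"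
    by (rule tendsto_sandwich[OF _ _ tendsto_const LIMSEQ_inverse_real_of_nat]; use D(3,4) in \<open>auto intro!: always_eventually less_imp_le\<close>)+
  have null: "L2_lim (\<lambda>n x. a n x - d n x) c"
    if "\<And>n. a n \<in> L2" "\<And>n. d n \<in> L2" "c \<in> L2" "L2_lim a c" "(\<lambda>n. L2_norm (d n)) \<longlonglongrightarrow> 0" for a d :: "nat \<Rightarrow> cfun" and c
  proof (rule tendsto_sandwich[OF _ _ tendsto_const])
    show "(\<lambda>n. L2_dist (a n) c + L2_norm (d n)) \<longlonglongrightarrow> 0" using tendsto_add[OF that(4,5)] by simp
    have "(\<lambda>x. a n x - d n x - c x) = (\<lambda>x. (a n x - c x) - d n x)" for n by auto
    then show "\<forall>\<^sub>F n in sequentially. L2_norm (\<lambda>x. a n x - d n x - c x) \<le> L2_dist (a n) c + L2_norm (d n)"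
      using L2_triangle_diff[OF L2_diff[OF that(1,3)] that(2)] by simp
  qed simp
  have W: "regular (m^2) (\<lambda>x. U n x - D n x) (\<lambda>x. U' n x - D' n x) (\<lambda>x. v n x - k n x)" for n by (rule regular_diff[OF U(1) D(1)])
  have W0: "b1 (\<lambda>x. U n x - D n x) (\<lambda>x. v n x - k n x) = 0" for n using b_diff(1)[OF UL uL(2) DL] D(2) by simp
  have "closed_form (ext \<i>) f ((L2_norm e)^2)"
  proof (rule closed_formI_factor[where u = "\<lambda>n x. U n x - D n x" and v = "\<lambda>n x. v n x - k n x" and h = "\<lambda>n x. ?h n x - ?k n x"])
    show "((\<lambda>x. U n x - D n x), (\<lambda>x. v n x - k n x)) \<in> ext \<i>" for n unfolding ext_krein using regular_max_op[OF W] W0 by blast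
    have "L2_dist (U n) f = L2_dist (u n) f" for n
    proof (rule L2_norm_cong_AE)
      show "AE x in half_line. U n x - f x = u n x - f x" using U(2)[of n] by eventually_elim simp
    qed (intro L2_measurable L2_diff UL uL f)+
    with lim have "L2_lim U f" by simp
    then show "L2_lim (\<lambda>n x. U n x - D n x) f" by (rule null[OF UL DL(1) f _ D0(1)])
    show "L2_lim (\<lambda>n x. ?h n x - ?k n x) e" by (rule null[OF hL kL e D0(2)])
    show "L2_inner (\<lambda>x. U n x - D n x) (\<lambda>x. v n x - k n x) = of_real ((L2_dist (?h n) (?k n))^2)" for n
      using form(2)[OF W] unfolding W0 hardy_diff by simp
    have "b1 (\<lambda>x. U i x - D i x - (U j x - D j x)) (\<lambda>x. v i x - k i x - (v j x - k j x)) = 0" for i j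
      using b_diff(1)[OF regularD(1,2)[OF W] regularD(1,2)[OF W], of i j] W0 by simp
    then show "L2_inner (\<lambda>x. U i x - D i x - (U j x - D j x)) (\<lambda>x. v i x - k i x - (v j x - k j x)) =
        of_real ((L2_norm (\<lambda>x. ?h i x - ?k i x - (?h j x - ?k j x)))^2)" for i j
      using form(2)[OF regular_diff[OF W W], of i j] unfolding hardy_diff by simp
  qed (intro f e L2_diff hL kL)+
  with le show "\<exists>p\<le>q. closed_form (ext \<i>) f p" by blast
qed

lemma krein: "is_krein_extension (L_min (m^2)) (ext \<i>)" unfolding is_krein_extension_def
proof (intro conjI ballI impI krein_nonneg)
  show "ext \<i> \<in> extensions" by (rule ext_sa_extension) simp
  fix B assume "B \<in> extensions" "nonneg_op B"
  then show "form_le (ext \<i>) B" using extension_ext krein_form_le by metis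
qed

lemma friedrichs: "friedrichs_extension (L_min (m^2)) = ext 1"
proof -
  have "ext 1 \<in> extensions" by (rule ext_sa_extension) simp
  then have "self_adjoint (friedrichs_op m)" "L_min (m^2) \<subseteq> friedrichs_op m" unfolding ext_friedrichs by (simp_all add: sa_extensions_def)
  then show ?thesis unfolding ext_friedrichs using m by (intro friedrichs_extension_L_min) auto
qed

lemma fixed_points: "rg_fixed_points (m^2) = {ext 1, ext \<i>}"
proof (intro equalityI subsetI)
  fix H assume H: "H \<in> rg_fixed_points (m^2)"
  then have "H \<in> extensions" by (simp add: rg_fixed_points_def)
  then obtain z where z: "z \<noteq> 0" "H = ext z" by (rule extension_ext)
  \<comment> \<open>One dilation suffices: a diagonal matrix with distinct entries leaves only the
    coordinate axes invariant.\<close>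
  have "ext (G 1 z) = ext z" using H ext_fixed_iff[OF z(1)] z(2) by simp
  from ext_eqD[OF this] have "Re z * Im z * (exp (1 + m) - exp (1 - m)) = 0" unfolding G_def by (simp add: algebra_simps)
  then have "Im z = 0 \<or> Re z = 0" using m by auto
  then have "z = of_real (Re z) * 1 \<or> z = of_real (Im z) * \<i>" by (auto simp: complex_eq_iff)
  then show "H \<in> {ext 1, ext \<i>}" using ext_scale z by (metis insertCI mult_zero_left of_real_0)
next
  have "G \<tau> 1 = of_real (exp (\<tau> * (1 + m))) * 1" "G \<tau> \<i> = of_real (exp (\<tau> * (1 - m))) * \<i>" for \<tau>
    unfolding G_def by (simp_all add: complex_eq_iff)
  then have "ext (G \<tau> 1) = ext 1" "ext (G \<tau> \<i>) = ext \<i>" for \<tau> by (simp_all only: ext_scale of_real_eq_0_iff exp_not_eq_zero not_False_eq_True)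
  then show "H \<in> rg_fixed_points (m^2)" if "H \<in> {ext 1, ext \<i>}" for H using that ext_fixed_iff[of 1] ext_fixed_iff[of \<i>] by auto
qed

lemma flows: "rg_flows_from_to (m^2) (ext \<i>) (ext 1)" unfolding rg_flows_from_to_def
proof
  fix H assume H: "H \<in> extensions - rg_fixed_points (m^2)"
  then obtain c where c: "norm c = 1" "H = circ c" using extension_cases by blast
  have e: "ext 1 = circ 1" "ext \<i> = circ (- 1)" using circ_power2[of 1] circ_power2[of \<i>] by simp_all
  have c1: "1 + c \<noteq> 0" "1 - c \<noteq> 0" using H c unfolding fixed_points e by (auto simp: add_eq_0_iff)
  \<comment> \<open>Coefficients of the Moebius map of a diagonal matrix. The limits are found after
    dividing by the dominant exponential, exp (t (1 + m)) at plus and exp (t (1 - m)) at minus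
    infinity.\<close>
  define p q where "p t = (exp (t * (1 + m)) + exp (t * (1 - m))) / 2" "q t = (exp (t * (1 + m)) - exp (t * (1 - m))) / 2" for t
  have M: "moebius (t, c) = (of_real (p t) * c + of_real (q t)) / (of_real (p t) + of_real (q t) * c)" for t
    unfolding moebius_def by (simp add: p_q_def Complex_eq)
  have scale: "moebius (t, c) = (of_real (p t / r) * c + of_real (q t / r)) / (of_real (p t / r) + of_real (q t / r) * c)" if "r \<noteq> 0" for t r
    unfolding M using that by (simp add: divide_simps)
  have lim: "((\<lambda>t. moebius (t, c)) \<longlongrightarrow> (of_real P * c + of_real Q) / (of_real P + of_real Q * c)) T"
    if "\<And>t. r t \<noteq> 0" "((\<lambda>t. p t / r t) \<longlongrightarrow> P) T" "((\<lambda>t. q t / r t) \<longlongrightarrow> Q) T" "of_real P + of_real Q * c \<noteq> 0" for r P Q T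
    unfolding scale[of "r t" t for t, OF that(1)] by (intro tendsto_divide tendsto_add tendsto_mult tendsto_of_real tendsto_const that)
  have "((\<lambda>t. p t / exp (t * (1 + m))) \<longlongrightarrow> 1/2) at_top" "((\<lambda>t. q t / exp (t * (1 + m))) \<longlongrightarrow> 1/2) at_top"
    unfolding p_q_def using m by real_asymp+
  from lim[OF _ this] have top: "((\<lambda>t. moebius (t, c)) \<longlongrightarrow> 1) at_top" using c1 by (simp add: field_simps)
  have "((\<lambda>t. p t / exp (t * (1 - m))) \<longlongrightarrow> 1/2) at_bot" "((\<lambda>t. q t / exp (t * (1 - m))) \<longlongrightarrow> - 1/2) at_bot"
  proof -
    have E: "exp (t * (1 + m)) = exp (t * (1 - m)) * exp (2 * m * t)" for t by (simp add: exp_add[symmetric] algebra_simps)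
    have "p t / exp (t * (1 - m)) = (exp (2 * m * t) + 1) / 2" "q t / exp (t * (1 - m)) = (exp (2 * m * t) - 1) / 2" for t
      unfolding p_q_def E by (simp_all add: field_simps)
    moreover have "((\<lambda>t. exp (2 * m * t)) \<longlongrightarrow> 0) at_bot" using m by real_asymp
    from tendsto_divide[OF tendsto_add[OF this tendsto_const[of 1]] tendsto_const[of 2]]
      tendsto_divide[OF tendsto_diff[OF this tendsto_const[of 1]] tendsto_const[of 2]]
    have "((\<lambda>t. (exp (2 * m * t) + 1) / 2) \<longlongrightarrow> 1/2) at_bot" "((\<lambda>t. (exp (2 * m * t) - 1) / 2) \<longlongrightarrow> - 1/2) at_bot" by simp_all
    ultimately show "((\<lambda>t. p t / exp (t * (1 - m))) \<longlongrightarrow> 1/2) at_bot" "((\<lambda>t. q t / exp (t * (1 - m))) \<longlongrightarrow> - 1/2) at_bot"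
      by (simp_all only:)
  qed
  note this = lim[OF _ this]
  moreover have "complex_of_real (1/2) + of_real (- 1/2) * c = (1 - c) / 2" "complex_of_real (1/2) * c + of_real (- 1/2) = - ((1 - c) / 2)"
    by (simp_all add: diff_divide_distrib)
  ultimately have "((\<lambda>t. moebius (t, c)) \<longlongrightarrow> - 1) at_bot" using c1(2) by simp
  with top show "limitin ext_top (\<lambda>\<tau>. rg \<tau> H) (ext \<i>) at_bot \<and> limitin ext_top (\<lambda>\<tau>. rg \<tau> H) (ext 1) at_top"
    unfolding c(2) e using c(1) by (auto intro!: limitin_circ)
qed

lemma phase:
  "\<exists>F K. F = friedrichs_extension (L_min (m^2)) \<and> is_krein_extension (L_min (m^2)) K \<and> F \<noteq> K \<and>
     rg_fixed_points (m^2) = {F, K} \<and> rg_flows_from_to (m^2) K F \<and>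
     (\<exists>\<phi>. homeomorphic_map (sa_topology (L_min (m^2))) circle \<phi> \<and> \<phi> F = 1 \<and> \<phi> K = - 1 \<and>
       (\<forall>H \<in> sa_extensions (L_min (m^2)).
         (Im (\<phi> H) > 0 \<longrightarrow> card (eigenvalues H) = 1) \<and> (Im (\<phi> H) < 0 \<longrightarrow> eigenvalues H = {})))"
proof (rule exI[of _ "ext 1"], rule exI[of _ "ext \<i>"], intro exI[of _ angle] conjI ballI)
  have a: "angle (ext 1) = 1" "angle (ext \<i>) = - 1" by (simp_all add: angle_ext)
  then show "angle (ext 1) = 1" "angle (ext \<i>) = - 1" "ext 1 \<noteq> ext \<i>" by auto
  fix H assume "H \<in> extensions"
  then obtain z where z: "z \<noteq> 0" "H = ext z" by (rule extension_ext)
  \<comment> \<open>The imaginary part of z / cnj z has the sign of Re z Im z, so the upper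
    semicircle consists of the lines through the first and third quadrants.\<close>
  show "Im (angle H) > 0 \<longrightarrow> card (eigenvalues H) = 1"
    unfolding z(2) angle_ext[OF z(1)] Im_divide_cnj using one_eigenvalue[of z] by (auto simp: is_singleton_altdef[symmetric] is_singleton_def)
  show "Im (angle H) < 0 \<longrightarrow> eigenvalues H = {}" unfolding z(2) angle_ext[OF z(1)] Im_divide_cnj using no_eigenvalue[of z] by blast
qed (simp_all add: friedrichs krein fixed_points flows angle_homeomorphic)

end

lemma sqrt_exp: "sqrt (exp t) = exp (t / 2)" by (rule real_sqrt_unique) (simp_all add: power2_eq_square exp_add[symmetric])

lemmas power_simps = field_simps power2_eq_square power3_eq_cube

lemma sqrt_dilation: "sqrt (exp \<tau> * x) = exp (\<tau> / 2) * sqrt x" by (simp add: real_sqrt_mult sqrt_exp)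

text \<open>Writing every exponential as a power of exp (\<tau> / 2) turns the scaling laws into
  rational identities.\<close>

lemma exp_half_powers: "exp \<tau> = (exp (\<tau> / 2))^2" "exp (- 3 * \<tau> / 2) = 1 / (exp (\<tau> / 2)) ^ 3" "exp (- \<tau> / 2) = 1 / exp (\<tau> / 2)" for \<tau> :: real
  by (simp_all add: power2_eq_square power3_eq_cube exp_add[symmetric] exp_minus field_simps)

section \<open>The phase \<alpha> = 0\<close>

locale critical =
  limit_circle 0 "-1" a "\<lambda>x. sqrt x * ln x" "\<lambda>x. ln x / (2 * sqrt x) + 1 / sqrt x"
    "\<lambda>x. x powr (1/2 + 0)" "\<lambda>x. (1/2 + 0) * x powr (0 - 1/2)" e1 e1' z1 e2 e2' z2
    exp "\<lambda>\<tau>. - \<tau> * exp \<tau>" "\<lambda>_. 0" exp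
  for a :: real and e1 e1' z1 e2 e2' z2

lemma critical_exists: "\<exists>a e1 e1' z1 e2 e2' z2. critical a e1 e1' z1 e2 e2' z2"
proof -
  have r: "\<exists>r>0. x = r * r" if "0 < x" for x :: real using that by (intro exI[of _ "sqrt x"]) auto
  note d2 = powr_solution_deriv[of _ 0, unfolded power_zero_numeral]
  have d1: "((\<lambda>x. sqrt x * ln x) has_real_derivative ln x / (2 * sqrt x) + 1 / sqrt x) (at x)"
    "((\<lambda>x. ln x / (2 * sqrt x) + 1 / sqrt x) has_real_derivative ((- 1/4 + 0) * (1 / x^2)) * (sqrt x * ln x)) (at x)" if x: "0 < x" for x
    using x r[OF x] by (auto intro!: derivative_eq_intros simp: field_simps power2_eq_square)
  have i1: "(\<lambda>x. (sqrt x * ln x)^2) integrable_on {0<..b}" if b: "0 < b" for b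
  proof (rule solution_square_integrable[OF d1(1) _ b])
    fix x assume x: "0 < x" "x \<le> b"
    have "ln x \<le> x" using ln_le_minus_one[OF x(1)] by simp
    then have "sqrt x * ln x \<le> sqrt x * x" using x by (intro mult_left_mono) auto
    also have "\<dots> \<le> sqrt b * b" using x by (intro mult_mono) auto
    finally have 1: "sqrt x * ln x \<le> sqrt b * b + 2" by simp
    \<comment> \<open>Applying ln y <= y - 1 to 1 / sqrt x bounds - sqrt x ln x by 2 near 0.\<close>
    have "ln (1 / sqrt x) \<le> 1 / sqrt x" using ln_le_minus_one[of "1 / sqrt x"] x by simp
    then have "- ln x \<le> 2 / sqrt x" using x by (simp add: ln_div ln_sqrt)
    then have "sqrt x * (- ln x) \<le> sqrt x * (2 / sqrt x)" using x by (intro mult_left_mono) auto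
    then have "- (sqrt x * ln x) \<le> 2" using x by simp
    moreover have "0 \<le> sqrt b * b" using b by simp
    ultimately have "- (sqrt x * ln x) \<le> sqrt b * b + 2" by linarith
    with 1 have "\<bar>sqrt x * ln x\<bar> \<le> \<bar>sqrt b * b + 2\<bar>" by linarith
    then have "(sqrt x * ln x)^2 \<le> (sqrt b * b + 2)^2" by (simp only: abs_le_square_iff)
    then show "(sqrt x * ln x)^2 \<le> (sqrt b * b + 2)^2 * x powr 0" using x by simp
  qed simp_all
  have i2: "(\<lambda>x. (x powr (1/2 + 0))^2) integrable_on {0<..b}" if b: "0 < b" for b :: real
    by (rule solution_square_integrable[OF d2(1) _ b, of 1 1]) (auto simp: powr_half_sqrt)
  show ?thesis
  proof (rule exists_regular_cutoffs[OF d1(1) d2(1) d1(2) d2(2) i1 i2])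
    fix a e1 e1' z1 e2 e2' z2 assume e: "0 < a" "regular 0 e1 e1' z1" "regular 0 e2 e2' z2"
    "\<And>x. 0 < x \<Longrightarrow> x \<le> a \<Longrightarrow> e1 x = of_real (sqrt x * ln x) \<and> e1' x = of_real (ln x / (2 * sqrt x) + 1 / sqrt x) \<and> z1 x = 0"
    "\<And>x. 0 < x \<Longrightarrow> x \<le> a \<Longrightarrow> e2 x = of_real (x powr (1/2 + 0)) \<and> e2' x = of_real ((1/2 + 0) * x powr (0 - 1/2)) \<and> z2 x = 0"
    have p: "x powr (1/2) = sqrt x" "x powr - (1/2) = 1 / sqrt x" if "0 < x" for x :: real using that by (simp_all add: powr_half_sqrt powr_minus_divide)
    have p': "x powr (1/2 + 0) = sqrt x" "x powr (0 - 1/2) = 1 / sqrt x" "ln (exp \<tau> * x) = \<tau> + ln x"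
      "(exp \<tau> * x) powr (1/2 + 0) = exp (\<tau> / 2) * sqrt x" "(exp \<tau> * x) powr (0 - 1/2) = 1 / (exp (\<tau> / 2) * sqrt x)" if "0 < x" for x \<tau> :: real
      using that p[of "exp \<tau> * x"] by (simp_all add: p ln_mult sqrt_dilation)
    have "critical a e1 e1' z1 e2 e2' z2"
    proof (unfold_locales, goal_cases)
      case (7 x)
      then show ?case by (simp add: p field_simps)
    next
      case (8 \<tau> x)
      show ?case using 8 by (simp only: p'[OF 8] sqrt_dilation) (simp only: exp_half_powers[of \<tau>], simp add: power_simps)
    next
      case (9 \<tau> x)
      show ?case using 9 by (simp only: p'[OF 9] sqrt_dilation) (simp only: exp_half_powers[of \<tau>], simp add: power_simps)
    next
      case (10 \<tau> x)
      show ?case using 10 by (simp only: p'[OF 10] sqrt_dilation) (simp only: exp_half_powers[of \<tau>], simp add: power_simps)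
    next
      case (11 \<tau> x)
      show ?case using 11 by (simp only: p'[OF 11] sqrt_dilation) (simp only: exp_half_powers[of \<tau>], simp add: power_simps)
    qed (use e in \<open>auto intro!: continuous_intros\<close>)
    then show ?thesis by blast
  qed
qed

context critical
begin

text \<open>The locale writes sqrt x as \<open>x powr (1/2 + 0)\<close> so that its Wronskian
  matches the trace of \<open>friedrichs_op_eq\<close> at s = 0.\<close>

lemma ext_friedrichs: "ext 1 = friedrichs_op 0" using friedrichs_op_eq(2)[of 0 b2, OF _ b_cong_AE(2)] b_tendsto(2) by (auto simp: ext_def)

lemma ext_nonneg: "nonneg_op (ext 1)" unfolding nonneg_op_def ext_friedrichs using friedrichs_op_nonneg[of 0] by auto

text \<open>If \<beta> were real, the solution at energy -1 would lie in the nonnegative extension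
  \<open>ext 1\<close>. So Im \<beta> is nonzero, and G, which is exp \<tau> times a shear, moves
  the line of \<beta> onto that of z for exactly one \<tau>.\<close>

lemma one_eigenvalue:
  assumes z: "Im z \<noteq> 0"
  shows "\<exists>\<tau>. eigenvalues (ext z) = {energy \<tau>}"
proof -
  have "(0::real) < 1" by simp
  then obtain \<psi> \<psi>' \<beta> where reg: "regular 0 \<psi> \<psi>' (\<lambda>x. - \<psi> x)"
    and n: "0 < L2_norm \<psi>" "\<beta> \<noteq> 0"
    and \<beta>: "b1 \<psi> (\<lambda>x. - \<psi> x) = of_real (Re \<beta>)" "b2 \<psi> (\<lambda>x. - \<psi> x) = of_real (Im \<beta>)"
    and ev: "\<forall>\<tau> z. z \<noteq> 0 \<longrightarrow> (energy \<tau> \<in> eigenvalues (ext z) \<longleftrightarrow> Im (cnj z * G \<tau> \<beta>) = 0)"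
    by (rule exists_negative_eigenvector)
  have \<beta>0: "Im \<beta> \<noteq> 0"
  proof
    assume "Im \<beta> = 0"
    then have "(\<psi>, \<lambda>x. - \<psi> x) \<in> ext 1" using regular_max_op[OF reg] \<beta> by (simp add: ext_def)
    then have "0 \<le> Re (L2_inner \<psi> (\<lambda>x. - \<psi> x))" using ext_nonneg by (auto simp: nonneg_op_def)
    then show False using n(1) by (simp add: inner_uminus_right inner_self)
  qed
  have z0: "z \<noteq> 0" using z by auto
  define t where "t = Re \<beta> / Im \<beta> - Re z / Im z"
  have iff: "energy \<tau> \<in> eigenvalues (ext z) \<longleftrightarrow> \<tau> = t" for \<tau>
  proof -
    have "Im (cnj z * G \<tau> \<beta>) = exp \<tau> * (Re z * Im \<beta> - Im z * (Re \<beta> - \<tau> * Im \<beta>))" unfolding G_def by (simp add: algebra_simps)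
    then have "Im (cnj z * G \<tau> \<beta>) = 0 \<longleftrightarrow> Re z * Im \<beta> = Im z * (Re \<beta> - \<tau> * Im \<beta>)" by simp
    also have "\<dots> \<longleftrightarrow> \<tau> = t" using z \<beta>0 by (auto simp: t_def field_simps)
    finally show ?thesis unfolding ev[rule_format, OF z0] .
  qed
  note sa = ext_self_adjoint[OF z0] and sub = sa_extension_subset_max_op[OF ext_sa_extension[OF z0]]
  have "l \<in> eigenvalues (ext z) \<longleftrightarrow> l = energy t" for l using eigenvalue_negative[OF sa, of 0 l] sub iff by auto
  then show ?thesis by (intro exI[of _ t]) auto
qed

lemma ext_one_if_real:
  assumes "z \<noteq> 0" "Im z = 0"
  shows "ext z = ext 1"
proof -
  have "z = of_real (Re z) * 1" "Re z \<noteq> 0" using assms by (simp_all add: complex_eq_iff)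
  then show ?thesis using ext_scale by metis
qed

lemma fixed_points: "rg_fixed_points 0 = {ext 1}"
proof (intro equalityI subsetI)
  fix H assume H: "H \<in> rg_fixed_points 0"
  then have "H \<in> extensions" by (simp add: rg_fixed_points_def)
  then obtain z where z: "z \<noteq> 0" "H = ext z" by (rule extension_ext)
  have "ext (G 1 z) = ext z" using H ext_fixed_iff[OF z(1)] z(2) by simp
  from ext_eqD[OF this] have "exp 1 * (Im z)^2 = 0" unfolding G_def by (simp add: algebra_simps power2_eq_square)
  then show "H \<in> {ext 1}" using ext_one_if_real[OF z(1)] z(2) by simp
next
  have "G \<tau> 1 = of_real (exp \<tau>) * 1" for \<tau> unfolding G_def by (simp add: complex_eq_iff)
  then have "ext (G \<tau> 1) = ext 1" for \<tau> by (simp_all only: ext_scale of_real_eq_0_iff exp_not_eq_zero not_False_eq_True)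
  then show "H \<in> rg_fixed_points 0" if "H \<in> {ext 1}" for H using that ext_fixed_iff[of 1] by auto
qed

text \<open>The Moebius maps are parabolic: \<open>moebius (t, c) = 1 + (c - 1) / d t\<close> with
  \<open>d\<close> growing at least linearly in |t|, so both ends of every orbit tend to the fixed
  point 1.\<close>

lemma flows: "rg_flows_from_to 0 (ext 1) (ext 1)" unfolding rg_flows_from_to_def
proof
  fix H assume H: "H \<in> extensions - rg_fixed_points 0"
  then obtain c where c: "norm c = 1" "H = circ c" using extension_cases by blast
  have e: "ext 1 = circ 1" using circ_power2[of 1] by simp
  define k where "k = norm (c - 1) / 2"
  have k: "0 < k" using H c unfolding fixed_points e by (auto simp: k_def)
  define d where "d t = 1 + of_real (t / 2) * (\<i> * (c - 1))" for t
  have "norm (of_real (t / 2) * (\<i> * (c - 1))) = \<bar>t\<bar> * k" for t by (simp add: norm_mult k_def)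
  then have d: "\<bar>t\<bar> * k - 1 \<le> norm (d t)" for t
    using norm_diff_ineq[of "of_real (t / 2) * (\<i> * (c - 1))" 1] by (simp add: d_def add.commute)
  have M: "moebius (t, c) = 1 + (c - 1) / d t" if "d t \<noteq> 0" for t
  proof -
    have "moebius (t, c) = (of_real (exp t) * (d t + (c - 1))) / (of_real (exp t) * d t)"
      unfolding moebius_def by (simp add: d_def Complex_eq algebra_simps diff_divide_distrib)
    then show ?thesis using that by (simp add: add_divide_distrib)
  qed
  have lim: "((\<lambda>t. moebius (t, c)) \<longlongrightarrow> 1) T" if T: "LIM t T. \<bar>t\<bar> * k - 1 :> at_top" for T
  proof -
    have n: "LIM t T. norm (d t) :> at_top" by (rule filterlim_at_top_mono[OF T]) (simp add: d)
    then have "((\<lambda>t. 1 + (c - 1) / d t) \<longlongrightarrow> 1 + 0) T"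
      by (intro tendsto_add[OF tendsto_const tendsto_divide_0[OF tendsto_const]] filterlim_norm_at_top_imp_at_infinity)
    moreover have "\<forall>\<^sub>F t in T. 1 + (c - 1) / d t = moebius (t, c)"
      using n[unfolded filterlim_at_top, rule_format, of 1] by (rule eventually_mono) (rule M[symmetric], auto)
    ultimately show ?thesis using Lim_transform_eventually by fastforce
  qed
  have "((\<lambda>t. moebius (t, c)) \<longlongrightarrow> 1) at_top" by (rule lim) (use k in real_asymp)
  moreover have "((\<lambda>t. moebius (t, c)) \<longlongrightarrow> 1) at_bot" by (rule lim) (use k in real_asymp)
  ultimately show "limitin ext_top (\<lambda>\<tau>. rg \<tau> H) (ext 1) at_bot \<and> limitin ext_top (\<lambda>\<tau>. rg \<tau> H) (ext 1) at_top"
    unfolding c(2) e using c(1) by (auto intro!: limitin_circ)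
qed

lemma phase:
  "\<exists>F. F = friedrichs_extension (L_min 0) \<and> is_krein_extension (L_min 0) F \<and> rg_fixed_points 0 = {F} \<and>
    rg_flows_from_to 0 F F \<and> (\<forall>H \<in> sa_extensions (L_min 0) - {F}. card (eigenvalues H) = 1)"
proof (intro exI[of _ "ext 1"] conjI ballI fixed_points flows)
  have e: "ext 1 \<in> extensions" by (rule ext_sa_extension) simp
  then have "self_adjoint (friedrichs_op 0)" "L_min 0 \<subseteq> friedrichs_op 0" unfolding ext_friedrichs by (simp_all add: sa_extensions_def)
  then show "ext 1 = friedrichs_extension (L_min 0)" using friedrichs_extension_L_min[of 0] by (simp add: ext_friedrichs)
  \<comment> \<open>All other extensions have a negative eigenvalue, so minimality among the
    nonnegative ones reduces to reflexivity.\<close>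
  have "B = ext 1" if B: "B \<in> extensions" "nonneg_op B" for B
  proof -
    obtain z where z: "z \<noteq> 0" "B = ext z" using B(1) by (rule extension_ext)
    then have "Im z = 0" using one_eigenvalue[of z] negative_eigenvalue_not_nonneg[OF ext_self_adjoint[OF z(1)]] B(2) by blast
    then show ?thesis using ext_one_if_real[OF z(1)] z(2) by simp
  qed
  then show "is_krein_extension (L_min 0) (ext 1)" unfolding is_krein_extension_def form_le_def using e ext_nonneg by blast
  fix H assume H: "H \<in> extensions - {ext 1}"
  then obtain z where z: "z \<noteq> 0" "H = ext z" using extension_ext by blast
  then have "Im z \<noteq> 0" using H ext_one_if_real[OF z(1)] by auto
  then show "card (eigenvalues H) = 1" unfolding z(2) using one_eigenvalue[of z] by auto
qed

end

section \<open>The phase \<alpha> < 0\<close>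

locale solid =
  limit_circle "- \<mu>\<^sup>2" "- \<mu>" a "\<lambda>x. sqrt x * cos (\<mu> * ln x)" "\<lambda>x. (cos (\<mu> * ln x) / 2 - \<mu> * sin (\<mu> * ln x)) / sqrt x"
    "\<lambda>x. - (sqrt x * sin (\<mu> * ln x))" "\<lambda>x. - ((sin (\<mu> * ln x) / 2 + \<mu> * cos (\<mu> * ln x)) / sqrt x)" e1 e1' z1 e2 e2' z2
    "\<lambda>\<tau>. exp \<tau> * cos (\<mu> * \<tau>)" "\<lambda>\<tau>. - (exp \<tau> * sin (\<mu> * \<tau>))" "\<lambda>\<tau>. exp \<tau> * sin (\<mu> * \<tau>)" "\<lambda>\<tau>. exp \<tau> * cos (\<mu> * \<tau>)"
  for \<mu> a :: real and e1 e1' z1 e2 e2' z2 +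
  assumes mu: "0 < \<mu>"

lemma solid_exists:
  assumes mu: "0 < \<mu>"
  shows "\<exists>a e1 e1' z1 e2 e2' z2. solid \<mu> a e1 e1' z1 e2 e2' z2"
proof -
  let ?u1 = "\<lambda>x. sqrt x * cos (\<mu> * ln x)" and ?u1' = "\<lambda>x. (cos (\<mu> * ln x) / 2 - \<mu> * sin (\<mu> * ln x)) / sqrt x"
  let ?u2 = "\<lambda>x. - (sqrt x * sin (\<mu> * ln x))" and ?u2' = "\<lambda>x. - ((sin (\<mu> * ln x) / 2 + \<mu> * cos (\<mu> * ln x)) / sqrt x)"
  have r: "\<exists>r>0. x = r * r" if "0 < x" for x :: real using that by (intro exI[of _ "sqrt x"]) auto
  have d: "(?u1 has_real_derivative ?u1' x) (at x)" "(?u2 has_real_derivative ?u2' x) (at x)"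
    "(?u1' has_real_derivative ((- 1/4 + - \<mu>\<^sup>2) * (1 / x^2)) * ?u1 x) (at x)"
    "(?u2' has_real_derivative ((- 1/4 + - \<mu>\<^sup>2) * (1 / x^2)) * ?u2 x) (at x)" if x: "0 < x" for x
    using x r[OF x] by (auto intro!: derivative_eq_intros simp: field_simps power2_eq_square)
  have sq: "(sqrt x * y)^2 \<le> 1 * x powr 1" if "0 < x" "\<bar>y\<bar> \<le> 1" for x y :: real
    using that abs_le_square_iff[of y 1] by (simp add: power_mult_distrib)
  have i1: "(\<lambda>x. (?u1 x)^2) integrable_on {0<..b}" if b: "0 < b" for b by (rule solution_square_integrable[OF d(1) _ b]) (auto intro: sq)
  have i2: "(\<lambda>x. (?u2 x)^2) integrable_on {0<..b}" if b: "0 < b" for b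
    by (rule solution_square_integrable[OF d(2) _ b, of 1 1]) (use sq[of _ "sin _"] in auto)
  show ?thesis
  proof (rule exists_regular_cutoffs[OF d i1 i2])
    fix a e1 e1' z1 e2 e2' z2 assume e: "0 < a" "regular (- \<mu>\<^sup>2) e1 e1' z1" "regular (- \<mu>\<^sup>2) e2 e2' z2"
    "\<And>x. 0 < x \<Longrightarrow> x \<le> a \<Longrightarrow> e1 x = of_real (?u1 x) \<and> e1' x = of_real (?u1' x) \<and> z1 x = 0"
    "\<And>x. 0 < x \<Longrightarrow> x \<le> a \<Longrightarrow> e2 x = of_real (?u2 x) \<and> e2' x = of_real (?u2' x) \<and> z2 x = 0"
    have sc: "sin A * sin A + cos A * cos A = 1" for A :: real using sin_cos_squared_add[of A] by (simp add: power2_eq_square)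
    have tr: "cos (\<mu> * ln x) = cos (\<mu> * \<tau>) * cos (\<mu> * ln (exp \<tau> * x)) + sin (\<mu> * \<tau>) * sin (\<mu> * ln (exp \<tau> * x))"
      "sin (\<mu> * ln x) = cos (\<mu> * \<tau>) * sin (\<mu> * ln (exp \<tau> * x)) - sin (\<mu> * \<tau>) * cos (\<mu> * ln (exp \<tau> * x))" if "0 < x" for x \<tau>
    proof -
      have "\<mu> * ln x = \<mu> * ln (exp \<tau> * x) - \<mu> * \<tau>" using that by (simp add: ln_mult algebra_simps)
      then show "cos (\<mu> * ln x) = cos (\<mu> * \<tau>) * cos (\<mu> * ln (exp \<tau> * x)) + sin (\<mu> * \<tau>) * sin (\<mu> * ln (exp \<tau> * x))"
        "sin (\<mu> * ln x) = cos (\<mu> * \<tau>) * sin (\<mu> * ln (exp \<tau> * x)) - sin (\<mu> * \<tau>) * cos (\<mu> * ln (exp \<tau> * x))"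
        by (simp_all only: cos_diff sin_diff) (simp_all add: algebra_simps)
    qed
    have "solid \<mu> a e1 e1' z1 e2 e2' z2"
    proof (unfold_locales, goal_cases)
      case (7 x)
      define S D where "S = sin (\<mu> * ln x)" "D = cos (\<mu> * ln x)"
      have "sqrt x * D * - ((S / 2 + \<mu> * D) / sqrt x) - (D / 2 - \<mu> * S) / sqrt x * - (sqrt x * S) = - \<mu> * (S * S + D * D)"
        using 7 by (simp add: field_simps)
      then show ?case using sc[of "\<mu> * ln x"] by (simp add: S_D_def)
    next
      case (8 \<tau> x)
      show ?case using 8 by (simp only: tr[OF 8, of \<tau>] sqrt_dilation) (simp only: exp_half_powers[of \<tau>], simp add: power_simps)
    next
      case (9 \<tau> x)
      show ?case using 9 by (simp only: tr[OF 9, of \<tau>] sqrt_dilation) (simp only: exp_half_powers[of \<tau>], simp add: power_simps)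
    next
      case (10 \<tau> x)
      show ?case using 10 by (simp only: tr[OF 10, of \<tau>] sqrt_dilation) (simp only: exp_half_powers[of \<tau>], simp add: power_simps)
    next
      case (11 \<tau> x)
      show ?case using 11 by (simp only: tr[OF 11, of \<tau>] sqrt_dilation) (simp only: exp_half_powers[of \<tau>], simp add: power_simps)
    next
      case (12 \<tau>)
      have "exp \<tau> * cos (\<mu> * \<tau>) * (exp \<tau> * cos (\<mu> * \<tau>)) - - (exp \<tau> * sin (\<mu> * \<tau>)) * (exp \<tau> * sin (\<mu> * \<tau>)) =
          exp \<tau> * exp \<tau> * (sin (\<mu> * \<tau>) * sin (\<mu> * \<tau>) + cos (\<mu> * \<tau>) * cos (\<mu> * \<tau>))" by algebra
      then show ?case unfolding sc by simp
    qed (use e mu in \<open>auto intro!: continuous_intros\<close>)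
    then show ?thesis by blast
  qed
qed

context solid
begin

text \<open>\<open>u1\<close> and \<open>u2\<close> are the real and imaginary parts of the solution
  with exponent 1/2 - \<i> \<mu>; the sign is chosen so that dilations rotate the boundary plane in
  the positive direction.\<close>

lemma G_eq: "G \<tau> z = of_real (exp \<tau>) * (cis (\<mu> * \<tau>) * z)" unfolding G_def by (simp add: complex_eq_iff algebra_simps)

lemma angle_rg:
  assumes "H \<in> extensions"
  shows "angle (rg \<tau> H) = cis (2 * \<mu> * \<tau>) * angle H"
proof -
  obtain z where z: "z \<noteq> 0" "H = ext z" using assms by (rule extension_ext)
  have "angle (rg \<tau> H) = G \<tau> z / cnj (G \<tau> z)" unfolding z(2) rg_ext[OF z(1)] by (rule angle_ext[OF G_nonzero[OF z(1)]])
  also have "\<dots> = (cis (\<mu> * \<tau>) / cis (- (\<mu> * \<tau>))) * (z / cnj z)" unfolding G_eq by (simp add: cis_cnj)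
  also have "cis (\<mu> * \<tau>) / cis (- (\<mu> * \<tau>)) = cis (2 * \<mu> * \<tau>)" unfolding cis_divide by (simp add: mult.assoc)
  finally show ?thesis unfolding z(2) angle_ext[OF z(1)] .
qed

lemma no_fixed_points: "rg_fixed_points (- \<mu>\<^sup>2) = {}"
proof (intro equals0I)
  fix H assume H: "H \<in> rg_fixed_points (- \<mu>\<^sup>2)"
  \<comment> \<open>This dilation rotates the circle by pi, so a fixed point would equal its
    antipode.\<close>
  then have He: "H \<in> extensions" and "rg (pi / (2 * \<mu>)) H = H" by (auto simp: rg_fixed_points_def)
  with angle_rg[OF He, of "pi / (2 * \<mu>)"] mu have "angle H = - angle H" by simp
  then have "angle H = 0" by simp
  moreover obtain z where "z \<noteq> 0" "H = ext z" using He by (rule extension_ext)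
  ultimately show False by (simp add: angle_ext)
qed

lemma infinite_eigenvalues:
  assumes "H \<in> extensions"
  shows "infinite (eigenvalues H)"
proof -
  obtain z where z: "z \<noteq> 0" "H = ext z" using assms by (rule extension_ext)
  have "- \<mu>\<^sup>2 < 1" using zero_le_power2[of \<mu>] by linarith
  then obtain \<psi> \<psi>' \<beta> where "regular (- \<mu>\<^sup>2) \<psi> \<psi>' (\<lambda>x. - \<psi> x)"
    "0 < L2_norm \<psi>" and \<beta>: "\<beta> \<noteq> 0"
    and "b1 \<psi> (\<lambda>x. - \<psi> x) = of_real (Re \<beta>)" "b2 \<psi> (\<lambda>x. - \<psi> x) = of_real (Im \<beta>)"
    and ev: "\<forall>\<tau> z. z \<noteq> 0 \<longrightarrow> (energy \<tau> \<in> eigenvalues (ext z) \<longleftrightarrow> Im (cnj z * G \<tau> \<beta>) = 0)"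
    by (rule exists_negative_eigenvector)
  define W where "W = cnj z * \<beta>"
  \<comment> \<open>Solves Im (cis (\<mu> t) W) = 0: the rotation first undoes the argument of W,
    then adds a multiple of pi.\<close>
  define t where "t k = (real k * pi - Arg W) / \<mu>" for k :: nat
  have "energy (t k) \<in> eigenvalues H" for k
  proof -
    have "cis (\<mu> * t k) * W = cis (\<mu> * t k) * (of_real (norm W) * cis (Arg W))" using rcis_cmod_Arg[of W] by (simp add: rcis_def)
    also have "\<dots> = of_real (norm W) * cis (real k * pi)" using mu by (simp add: mult.left_commute cis_mult t_def)
    finally have "cnj z * G (t k) \<beta> = of_real (exp (t k) * norm W) * cis (real k * pi)" unfolding G_eq W_def by (simp add: mult_ac)
    then have "Im (cnj z * G (t k) \<beta>) = 0" by (simp add: sin_npi)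
    then show ?thesis using ev z by simp
  qed
  then have "range (\<lambda>k. energy (t k)) \<subseteq> eigenvalues H" by blast
  moreover have "inj (\<lambda>k. energy (t k))" using mu by (auto simp: inj_def t_def)
  ultimately show ?thesis using range_inj_infinite infinite_super by blast
qed

end

section \<open>The phase \<alpha> >= 1\<close>

lemma gas_phase:
  assumes "1 \<le> \<alpha>"
  shows "\<exists>F. sa_extensions (L_min \<alpha>) = {F} \<and> rg_fixed_points \<alpha> = {F} \<and> F = friedrichs_extension (L_min \<alpha>) \<and>
      is_krein_extension (L_min \<alpha>) F"
    and "continuous_flow_on (sa_extensions (L_min \<alpha>)) (sa_topology (L_min \<alpha>)) rg"
proof -
  define m where "m = sqrt \<alpha>"
  have m: "1 \<le> m" "m^2 = \<alpha>" using assms by (simp_all add: m_def)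
  let ?F = "friedrichs_op m"
  note F = friedrichs_op_ge_1[OF m(1), unfolded m(2)]
  have Fe: "?F \<in> sa_extensions (L_min \<alpha>)" unfolding sa_extensions_L_min_iff using F(2) test_op_subset_friedrichs_op[of m] by (simp add: m(2))
  then have S: "sa_extensions (L_min \<alpha>) = {?F}"
  proof -
    have "H = ?F" if H: "H \<in> sa_extensions (L_min \<alpha>)" for H
      by (rule self_adjoint_maximal[OF _ F(2)]) (use H sa_extension_subset_max_op[OF H] in \<open>simp_all add: sa_extensions_L_min_iff F(1)\<close>)
    with Fe show ?thesis by blast
  qed
  \<comment> \<open>The maximal operator is mapped into itself by every dilation; monotonicity and
    the inverse dilation give equality.\<close>
  have "rg \<tau> ?F \<subseteq> ?F" for \<tau> unfolding F(1) rg_def using max_op_dilation by auto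
  moreover have "rg \<tau> (rg (- \<tau>) ?F) = ?F" for \<tau> using rg_add[of \<tau> "- \<tau>" ?F] rg_0[of ?F] by simp
  moreover have "A \<subseteq> B \<Longrightarrow> rg \<tau> A \<subseteq> rg \<tau> B" for A B \<tau> by (auto simp: rg_def)
  ultimately have rg: "rg \<tau> ?F = ?F" for \<tau> by (metis subset_antisym)
  have fp: "rg_fixed_points \<alpha> = {?F}" unfolding rg_fixed_points_def S using rg by auto
  have fr: "friedrichs_extension (L_min \<alpha>) = ?F" using friedrichs_extension_L_min[of m] F(2) Fe m by (simp add: sa_extensions_def)
  have "is_krein_extension (L_min \<alpha>) ?F" unfolding is_krein_extension_def S form_le_def nonneg_op_def using friedrichs_op_nonneg[of m] m(1) by auto
  with S fp fr show "\<exists>F. sa_extensions (L_min \<alpha>) = {F} \<and> rg_fixed_points \<alpha> = {F} \<and> F = friedrichs_extension (L_min \<alpha>) \<and>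
      is_krein_extension (L_min \<alpha>) F" by blast
  interpret M: Metric_space "sa_extensions (L_min \<alpha>)" resolvent_dist by (rule Metric_space_sa_extensions)
  have T: "topspace (sa_topology (L_min \<alpha>)) = {?F}" unfolding sa_topology_def M.topspace_mtopology by (rule S)
  have "continuous_map (prod_topology euclideanreal (sa_topology (L_min \<alpha>))) (sa_topology (L_min \<alpha>)) (\<lambda>_. ?F)" by (simp add: T)
  then have "continuous_map (prod_topology euclideanreal (sa_topology (L_min \<alpha>))) (sa_topology (L_min \<alpha>)) (\<lambda>(t, x). rg t x)"
    by (rule continuous_map_eq) (auto simp: T rg)
  then show "continuous_flow_on (sa_extensions (L_min \<alpha>)) (sa_topology (L_min \<alpha>)) rg" unfolding continuous_flow_on_def S by (simp add: rg)
qed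

theorem mainTheorem1:
  fixes \<alpha> :: real
  shows
    "((\<exists>H. sa_extensions (L_min \<alpha>) = {H}) \<or> sa_topology (L_min \<alpha>) homeomorphic_space circle) \<and>
     continuous_flow_on (sa_extensions (L_min \<alpha>)) (sa_topology (L_min \<alpha>)) rg \<and>
     (1 \<le> \<alpha> \<longrightarrow>
        (\<exists>F. sa_extensions (L_min \<alpha>) = {F} \<and>
             rg_fixed_points \<alpha> = {F} \<and>
             F = friedrichs_extension (L_min \<alpha>) \<and>
             is_krein_extension (L_min \<alpha>) F)) \<and>
     (0 < \<alpha> \<and> \<alpha> < 1 \<longrightarrow>
        (\<exists>F K. F = friedrichs_extension (L_min \<alpha>) \<and>
               is_krein_extension (L_min \<alpha>) K \<and>
               F \<noteq> K \<and>
               rg_fixed_points \<alpha> = {F, K} \<and>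
               rg_flows_from_to \<alpha> K F \<and>
               (\<exists>\<phi>. homeomorphic_map (sa_topology (L_min \<alpha>)) circle \<phi> \<and>
                    \<phi> F = 1 \<and> \<phi> K = - 1 \<and>
                    (\<forall>H \<in> sa_extensions (L_min \<alpha>).
                       (Im (\<phi> H) > 0 \<longrightarrow> card (eigenvalues H) = 1) \<and>
                       (Im (\<phi> H) < 0 \<longrightarrow> eigenvalues H = {}))))) \<and>
     (\<alpha> = 0 \<longrightarrow>
        sa_topology (L_min \<alpha>) homeomorphic_space circle \<and>
        (\<exists>F. F = friedrichs_extension (L_min \<alpha>) \<and>
             is_krein_extension (L_min \<alpha>) F \<and>
             rg_fixed_points \<alpha> = {F} \<and>
             rg_flows_from_to \<alpha> F F \<and>
             (\<forall>H \<in> sa_extensions (L_min \<alpha>) - {F}. card (eigenvalues H) = 1))) \<and>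
     (\<alpha> < 0 \<longrightarrow>
        (\<exists>\<phi>. homeomorphic_map (sa_topology (L_min \<alpha>)) circle \<phi> \<and>
             (\<forall>H \<in> sa_extensions (L_min \<alpha>). \<forall>\<tau>.
                \<phi> (rg \<tau> H) = cis (2 * sqrt (- \<alpha>) * \<tau>) * \<phi> H)) \<and>
        rg_fixed_points \<alpha> = {} \<and>
        (\<forall>H \<in> sa_extensions (L_min \<alpha>). infinite (eigenvalues H)))"
proof -
  consider "1 \<le> \<alpha>" | "0 < \<alpha>" "\<alpha> < 1" | "\<alpha> = 0" | "\<alpha> < 0" by linarith
  then show ?thesis
  proof cases
    case 1
    with gas_phase[OF 1] show ?thesis by auto
  next
    case 2
    define m where "m = sqrt \<alpha>"
    have M: "0 < m" "m < 1" "m^2 = \<alpha>" using 2 by (simp_all add: m_def)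
    obtain a e1 e1' z1 e2 e2' z2 where "liquid m a e1 e1' z1 e2 e2' z2" using liquid_exists[OF M(1,2)] by (elim exE)
    then interpret liquid m a e1 e1' z1 e2 e2' z2 .
    show ?thesis using 2 phase homeomorphic_circle continuous_flow unfolding M(3) by auto
  next
    case 3
    obtain a e1 e1' z1 e2 e2' z2 where "critical a e1 e1' z1 e2 e2' z2" using critical_exists by (elim exE)
    then interpret critical a e1 e1' z1 e2 e2' z2 .
    show ?thesis using phase homeomorphic_circle continuous_flow unfolding 3 by auto
  next
    case 4
    define \<mu> where "\<mu> = sqrt (- \<alpha>)"
    have \<mu>: "0 < \<mu>" "- \<mu>\<^sup>2 = \<alpha>" using 4 by (simp_all add: \<mu>_def)
    obtain a e1 e1' z1 e2 e2' z2 where "solid \<mu> a e1 e1' z1 e2 e2' z2" using solid_exists[OF \<mu>(1)] by (elim exE)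
    then interpret solid \<mu> a e1 e1' z1 e2 e2' z2 .
    show ?thesis using 4 angle_homeomorphic angle_rg no_fixed_points infinite_eigenvalues homeomorphic_circle continuous_flow
      unfolding \<mu>(2) \<mu>_def[symmetric] by auto
  qed
qed

end
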